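(* Let $\Omega\subseteq\mathbb{R}^2$ be convex, open and bounded with $C^{1,1}$ boundary, let $a_1,\dots,a_N\in\Omega$ be pairwise distinct points, $\sigma_1,\dots,\sigma_N>0$, and $\overline\mu:=\sum_{i=1}^N\sigma_i\delta_{a_i}$. Let $v_0$ be the unique convex solution of $\mu_{v_0}=\overline\mu$ in $\Omega$, $v_0=0$ on $\partial\Omega$, and let $$E_h(\mathbf{u},v)=\int_\Omega \left|\nabla \mathbf{u}+\nabla \mathbf{u}^T+\nabla v\otimes\nabla v-\nabla v_0\otimes\nabla v_0\right|^2+h^2|\nabla^2 v|^2\,dx .$$ Then there exist constants $C,h_0>0$ that only depend on $\Omega$ and $\overline\mu$ such that for every $0<h<h_0$ there exists $(\mathbf{u}_h,v_h)\in W^{1,2}(\Omega;\mathbb{R}^2)\times W^{2,2}(\Omega)$ (no boundary condition being imposed on $v_h$) with $$E_h(\mathbf{u}_h,v_h)\leq C h^2\log \frac{1}{h}.$$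
   Context: For a convex function $u:\Omega\to\mathbb{R}$, the subdifferential is $\partial^-u(x):=\{p\in\mathbb{R}^2: p\cdot(y-x)+u(x)\le u(y)\text{ for all }y\in\Omega\}$, and the Monge-Ampère measure of $u$ is $\mu_u(E):=\mathcal L^2(\bigcup_{x\in E}\partial^-u(x))$ for Borel sets $E\subseteq\Omega$. It is known that the problem $\mu_{v_0}=\overline\mu$ in $\Omega$, $v_0=0$ on $\partial\Omega$ has a unique convex solution $v_0\in C^0(\overline\Omega)$. *)

theory Defs
  imports "HOL-Analysis.Analysis"
begin

section \<open>Domains with boundary of class C11\<close>

text \<open>Near every boundary point the domain is, in a suitable orthonormal frame
  (of either orientation), the strict epigraph of a function with Lipschitz derivative.
  Taking this function to be defined on all of the real line is no restriction: a local one
  extends affinely.\<close>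

definition C11_boundary :: "(real^2) set \<Rightarrow> bool" where
  "C11_boundary \<Omega> \<longleftrightarrow>
    (\<forall>x \<in> frontier \<Omega>. \<exists>r > 0. \<exists>(e1 :: real^2) (e2 :: real^2) (\<gamma> :: real \<Rightarrow> real) \<gamma>' L.
       norm e1 = 1 \<and> norm e2 = 1 \<and> e1 \<bullet> e2 = 0 \<and>
       (\<forall>t. (\<gamma> has_real_derivative \<gamma>' t) (at t)) \<and> L-lipschitz_on UNIV \<gamma>' \<and>
       \<Omega> \<inter> ball x r = {y \<in> ball x r. \<gamma> (y \<bullet> e1) < y \<bullet> e2})"

section \<open>The Monge-Ampere measure\<close>

definition subdiff :: "(real^2) set \<Rightarrow> (real^2 \<Rightarrow> real) \<Rightarrow> real^2 \<Rightarrow> (real^2) set" where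
  "subdiff \<Omega> u x = {p. \<forall>y\<in>\<Omega>. p \<bullet> (y - x) + u x \<le> u y}"

text \<open>For Borel sets the union is Lebesgue measurable, but it need not be Borel; hence the
  completed measure.\<close>

definition monge_ampere :: "(real^2) set \<Rightarrow> (real^2 \<Rightarrow> real) \<Rightarrow> (real^2) set \<Rightarrow> ennreal" where
  "monge_ampere \<Omega> u E = emeasure lebesgue (\<Union>x\<in>E. subdiff \<Omega> u x)"

definition sum_dirac :: "nat \<Rightarrow> (nat \<Rightarrow> real^2) \<Rightarrow> (nat \<Rightarrow> real) \<Rightarrow> (real^2) set \<Rightarrow> ennreal" where
  "sum_dirac N a \<sigma> E = (\<Sum>i=1..N. ennreal (\<sigma> i) * indicator E (a i))"

text \<open>Convex solutions, continuous up to the boundary, of the Dirichlet problem with zero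
  boundary values. Only the values on the closure of the domain matter.\<close>

definition MA_solution ::
  "(real^2) set \<Rightarrow> ((real^2) set \<Rightarrow> ennreal) \<Rightarrow> (real^2 \<Rightarrow> real) \<Rightarrow> bool" where
  "MA_solution \<Omega> \<mu> v \<longleftrightarrow>
    convex_on \<Omega> v \<and> continuous_on (closure \<Omega>) v \<and> (\<forall>x \<in> frontier \<Omega>. v x = 0) \<and>
    (\<forall>E. E \<in> sets borel \<and> E \<subseteq> \<Omega> \<longrightarrow> monge_ampere \<Omega> v E = \<mu> E)"

section \<open>Weak derivatives and Sobolev spaces\<close>

definition partial :: "'n \<Rightarrow> (real^'n::finite \<Rightarrow> real) \<Rightarrow> real^'n \<Rightarrow> real" where
  "partial i f x = frechet_derivative f (at x) (axis i 1)"

primrec Ck :: "nat \<Rightarrow> (real^'n::finite \<Rightarrow> real) \<Rightarrow> bool" where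
  "Ck 0 f \<longleftrightarrow> continuous_on UNIV f"
| "Ck (Suc k) f \<longleftrightarrow> (\<forall>x. f differentiable (at x)) \<and> (\<forall>i. Ck k (partial i f))"

definition test_fun :: "(real^'n::finite) set \<Rightarrow> (real^'n \<Rightarrow> real) \<Rightarrow> bool" where
  "test_fun \<Omega> \<phi> \<longleftrightarrow>
    (\<forall>k. Ck k \<phi>) \<and> compact (closure {x. \<phi> x \<noteq> 0}) \<and> closure {x. \<phi> x \<noteq> 0} \<subseteq> \<Omega>"

definition loc_integrable :: "(real^'n::finite) set \<Rightarrow> (real^'n \<Rightarrow> real) \<Rightarrow> bool" where
  "loc_integrable \<Omega> f \<longleftrightarrow> (\<forall>K. compact K \<and> K \<subseteq> \<Omega> \<longrightarrow> integrable (lebesgue_on K) f)"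

definition has_weak_partial ::
  "(real^'n::finite) set \<Rightarrow> 'n \<Rightarrow> (real^'n \<Rightarrow> real) \<Rightarrow> (real^'n \<Rightarrow> real) \<Rightarrow> bool" where
  "has_weak_partial \<Omega> i f g \<longleftrightarrow>
    loc_integrable \<Omega> f \<and> loc_integrable \<Omega> g \<and>
    (\<forall>\<phi>. test_fun \<Omega> \<phi> \<longrightarrow>
      (LINT x|lebesgue_on \<Omega>. f x * partial i \<phi> x) = - (LINT x|lebesgue_on \<Omega>. g x * \<phi> x))"

text \<open>A representative of the weak derivative, which is unique almost everywhere in an open set;
  unspecified if there is none.\<close>

definition weak_partial ::
  "(real^'n::finite) set \<Rightarrow> 'n \<Rightarrow> (real^'n \<Rightarrow> real) \<Rightarrow> real^'n \<Rightarrow> real" where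
  "weak_partial \<Omega> i f = (SOME g. has_weak_partial \<Omega> i f g)"

definition L2_fun :: "(real^'n::finite) set \<Rightarrow> (real^'n \<Rightarrow> real) \<Rightarrow> bool" where
  "L2_fun \<Omega> f \<longleftrightarrow>
    f \<in> borel_measurable (lebesgue_on \<Omega>) \<and> integrable (lebesgue_on \<Omega>) (\<lambda>x. (f x)\<^sup>2)"

text \<open>The space of functions with square integrable weak derivatives up to order k.\<close>

primrec sobolev2 :: "nat \<Rightarrow> (real^'n::finite) set \<Rightarrow> (real^'n \<Rightarrow> real) \<Rightarrow> bool" where
  "sobolev2 0 \<Omega> f \<longleftrightarrow> L2_fun \<Omega> f"
| "sobolev2 (Suc k) \<Omega> f \<longleftrightarrow>
    L2_fun \<Omega> f \<and> (\<forall>i. \<exists>g. has_weak_partial \<Omega> i f g \<and> sobolev2 k \<Omega> g)"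

definition weak_grad :: "(real^'n::finite) set \<Rightarrow> (real^'n \<Rightarrow> real) \<Rightarrow> real^'n \<Rightarrow> real^'n" where
  "weak_grad \<Omega> f x = (\<chi> i. weak_partial \<Omega> i f x)"

definition weak_jacobian ::
  "(real^'n::finite) set \<Rightarrow> (real^'n \<Rightarrow> real^'n) \<Rightarrow> real^'n \<Rightarrow> real^'n^'n" where
  "weak_jacobian \<Omega> u x = (\<chi> i j. weak_partial \<Omega> j (\<lambda>y. u y $ i) x)"

definition weak_hessian ::
  "(real^'n::finite) set \<Rightarrow> (real^'n \<Rightarrow> real) \<Rightarrow> real^'n \<Rightarrow> real^'n^'n" where
  "weak_hessian \<Omega> f x = (\<chi> i j. weak_partial \<Omega> j (weak_partial \<Omega> i f) x)"

section \<open>The energy\<close>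

definition tensor :: "real^'n \<Rightarrow> real^'n \<Rightarrow> real^'n^'n" where
  "tensor p q = (\<chi> i j. p $ i * q $ j)"

text \<open>The norm of type \<^typ>\<open>real^2^2\<close> is the Frobenius norm. The energy is an extended
  nonnegative integral, so that a bound on it includes its finiteness.\<close>

definition energy ::
  "(real^2) set \<Rightarrow> (real^2 \<Rightarrow> real) \<Rightarrow> real \<Rightarrow> (real^2 \<Rightarrow> real^2) \<Rightarrow> (real^2 \<Rightarrow> real) \<Rightarrow> ennreal" where
  "energy \<Omega> v0 h u v =
    (\<integral>\<^sup>+ x. ennreal (
        (norm (weak_jacobian \<Omega> u x + transpose (weak_jacobian \<Omega> u x)
               + tensor (weak_grad \<Omega> v x) (weak_grad \<Omega> v x)
               - tensor (weak_grad \<Omega> v0 x) (weak_grad \<Omega> v0 x)))\<^sup>2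
        + h\<^sup>2 * (norm (weak_hessian \<Omega> v x))\<^sup>2) \<partial>lebesgue_on \<Omega>)"

end

(* The energy sees v0 only through its Monge-Ampere measure: the curl-curl of
   grad w (x) grad w is -2 det D^2 w, so if two convex functions have the same Monge-Ampere
   measure, the difference of these tensors is, up to an arbitrarily small error in L^2, a
   symmetrised gradient. Hence v0 may be replaced by any convex function v having the same atoms.
   Take v as a sum of cones, one per atom, each the support function of a thin lens: off its atom
   it is C^{1,1} with Hessian of rank one and of size 1/|x - a|, supported in a thin double cone.
   The double cones are disjoint from one another inside the domain, so the sum creates no further
   curvature. Mollifying v at scale h changes its gradient by O(h / max h |x - a|), and
   h times its Hessian has the same bound; the square of this weight integrates to
   O(h^2 log (1/h)). *)
theory Submission
  imports Defs
begin

section \<open>Smooth functions of one variable\<close>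

text \<open>The obstacle is that neither \<open>v0\<close> nor the sum of cones need be smooth, so
  the curl-curl identity cannot be integrated directly. Both functions are replaced by smooth
  strictly convex approximations, for which the two diagonal strain equations are solved exactly;
  the off-diagonal equation then fails by the integral of the Hessian determinant against a bounded
  signed kernel. By the area formula that determinant measures a set of slopes, and supporting
  planes pass to the limit, so the two residuals converge at almost every x to the same sum over the
  atoms and cancel in the difference. The approximation requires a Lipschitz function on the whole
  plane, hence the barrier estimate for \<open>v0\<close> and its extension.

  The mass of a cone is c^2 \<delta> |lens|: the thinness \<delta> is fixed by the geometry of the
  domain and the atoms, and the weight c then adjusts the mass. The Lipschitz constant of
  \<open>v0\<close> governs only how fine the approximation must be and does not enter the energy
  bound, so \<open>C\<close> can be chosen before \<open>v0\<close> and \<open>h\<close>.\<close>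

primrec Cr :: "nat \<Rightarrow> (real \<Rightarrow> real) \<Rightarrow> bool" where
  "Cr 0 f \<longleftrightarrow> continuous_on UNIV f"
| "Cr (Suc k) f \<longleftrightarrow> (\<exists>f'. (\<forall>x. (f has_real_derivative f' x) (at x)) \<and> Cr k f')"

lemma Cr_continuous: "Cr k f \<Longrightarrow> continuous_on UNIV f"
  by (cases k) (auto intro: DERIV_isCont simp: continuous_on_eq_continuous_at)

lemma Cr_Suc_imp: "Cr (Suc k) f \<Longrightarrow> Cr k f"
proof (induction k arbitrary: f)
  case 0
  then show ?case using Cr_continuous[of "Suc 0" f] by simp
next
  case (Suc k)
  then obtain f' where "\<forall>x. (f has_real_derivative f' x) (at x)" "Cr (Suc k) f'"
    using Cr.simps(2)[of "Suc k" f] by blast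
  then show ?case using Suc.IH Cr.simps(2)[of k f] by blast
qed

lemma Cr_add: "Cr k f \<Longrightarrow> Cr k g \<Longrightarrow> Cr k (\<lambda>x. f x + g x)"
proof (induction k arbitrary: f g)
  case 0
  then show ?case by (auto intro: continuous_intros)
next
  case (Suc k)
  then obtain f' g' where "\<forall>x. (f has_real_derivative f' x) (at x)" "Cr k f'"
    "\<forall>x. (g has_real_derivative g' x) (at x)" "Cr k g'" by auto
  then show ?case using Suc.IH[of f' g']
    by (auto intro!: exI[of _ "\<lambda>x. f' x + g' x"] derivative_intros)
qed

lemma Cr_mult: "Cr k f \<Longrightarrow> Cr k g \<Longrightarrow> Cr k (\<lambda>x. f x * g x)"
proof (induction k arbitrary: f g)
  case 0
  then show ?case by (auto intro: continuous_intros)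
next
  case (Suc k)
  then obtain f' g' where d: "\<forall>x. (f has_real_derivative f' x) (at x)" "Cr k f'"
    "\<forall>x. (g has_real_derivative g' x) (at x)" "Cr k g'" by auto
  have "Cr k (\<lambda>x. f' x * g x + g' x * f x)"
    by (rule Cr_add[OF Suc.IH[OF d(2) Cr_Suc_imp[OF Suc.prems(2)]] Suc.IH[OF d(4) Cr_Suc_imp[OF Suc.prems(1)]]])
  moreover have "((\<lambda>x. f x * g x) has_real_derivative (f' x * g x + g' x * f x)) (at x)" for x
    using d by (intro DERIV_mult) auto
  ultimately show ?case by (auto intro!: exI[of _ "\<lambda>x. f' x * g x + g' x * f x"])
qed

lemma Cr_affine: "Cr k f \<Longrightarrow> Cr k (\<lambda>x. f (c * x + b))"
proof (induction k arbitrary: f)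
  case 0
  then show ?case
    by (auto intro!: continuous_on_compose2[of UNIV f] continuous_intros)
next
  case (Suc k)
  then obtain f' where d: "\<forall>x. (f has_real_derivative f' x) (at x)" "Cr k f'" by auto
  have "Cr k (\<lambda>x. c * f' (c * x + b))"
  proof -
    have "Cr k (\<lambda>x. c)"
      by (induction k arbitrary: c) (auto intro!: exI[of _ "\<lambda>x. 0"] derivative_eq_intros)
    from Cr_mult[OF this Suc.IH[OF d(2)]] show ?thesis .
  qed
  moreover have "((\<lambda>x. f (c * x + b)) has_real_derivative c * f' (c * x + b)) (at x)" for x
  proof -
    have "((\<lambda>x. c * x + b) has_real_derivative c) (at x)"
      by (auto intro!: derivative_eq_intros)
    from DERIV_chain2[OF _ this, of f "f' (c * x + b)"] d
    show ?thesis by (simp add: mult.commute)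
  qed
  ultimately show ?case by (auto intro!: exI[of _ "\<lambda>x. c * f' (c * x + b)"])
qed

text \<open>This family is closed under differentiation, so one induction over all polynomials shows
  that exp (-1/t), extended by 0, is smooth.\<close>

definition flat_exp :: "real poly \<Rightarrow> real \<Rightarrow> real" where
  "flat_exp p t = (if t \<le> 0 then 0 else poly p (1 / t) * exp (- (1 / t)))"

lemma poly_exp_tendsto_0: "((\<lambda>s. poly p s * exp (- s)) \<longlongrightarrow> (0::real)) at_top"
proof -
  have "((\<lambda>s::real. coeff p i * (s ^ i / exp s)) \<longlongrightarrow> coeff p i * 0) at_top" for i
    by (intro tendsto_mult tendsto_const tendsto_power_div_exp_0)
  then have "((\<lambda>s. \<Sum>i\<le>degree p. coeff p i * (s ^ i / exp s)) \<longlongrightarrow> (\<Sum>i\<le>degree p. 0)) at_top"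
    by (intro tendsto_sum) simp
  moreover have "(\<lambda>s. \<Sum>i\<le>degree p. coeff p i * (s ^ i / exp s)) = (\<lambda>s. poly p s * exp (- s))"
    by (simp add: fun_eq_iff poly_altdef sum_distrib_right exp_minus divide_inverse mult.assoc)
  ultimately show ?thesis by simp
qed

text \<open>With s = 1/t, the chain rule multiplies the s-derivative of p(s) exp (-s) by -s^2, which
  turns the polynomial p into X^2 (p - p').\<close>

lemma flat_exp_deriv:
  "(flat_exp p has_real_derivative flat_exp ([:0, 0, 1:] * (p - pderiv p)) t) (at t)"
proof -
  consider "t < 0" | "t > 0" | "t = 0" by linarith
  then show ?thesis
  proof cases
    case 1
    have "((\<lambda>t. 0) has_real_derivative 0) (at t)" by simp
    then have "(flat_exp p has_real_derivative 0) (at t)"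
      by (rule DERIV_cong_ev[THEN iffD1, rotated 3])
        (use 1 in \<open>auto simp: flat_exp_def eventually_nhds intro!: exI[of _ "{..<0}"]\<close>)
    then show ?thesis using 1 by (simp add: flat_exp_def)
  next
    case 2
    have "((\<lambda>t. poly p (1 / t) * exp (- (1 / t))) has_real_derivative
       (poly (pderiv p) (1/t) * (- (1 / t^2))) * exp (- (1/t)) + (exp (- (1/t)) * (1 / t^2)) * poly p (1/t)) (at t)"
      using 2 by (intro DERIV_mult DERIV_chain2[OF poly_DERIV] DERIV_chain2[OF DERIV_exp])
        (auto intro!: derivative_eq_intros simp: power2_eq_square)
    then have "((\<lambda>t. poly p (1 / t) * exp (- (1 / t))) has_real_derivative
        flat_exp ([:0, 0, 1:] * (p - pderiv p)) t) (at t)"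
      by (rule DERIV_cong) (use 2 in \<open>simp add: flat_exp_def field_simps power2_eq_square\<close>)
    then show ?thesis
      by (rule DERIV_cong_ev[THEN iffD1, rotated 3])
        (use 2 in \<open>auto simp: flat_exp_def eventually_nhds intro!: exI[of _ "{0<..}"]\<close>)
  next
    case 3
    \<comment> \<open>The right-hand difference quotient at 0 is s p(s) exp (-s) with s = 1/t, which
      explains the factor \<open>[:0,1:]\<close>.\<close>
    have lim: "((\<lambda>x. poly ([:0,1:] * p) (1 / x) * exp (- (1 / x))) \<longlongrightarrow> 0) (at_right 0)"
      using poly_exp_tendsto_0[of "[:0,1:] * p"]
      by (rule filterlim_compose) (simp add: filterlim_inverse_at_top_right divide_inverse)
    have "((\<lambda>x. (flat_exp p x - flat_exp p 0) / (x - 0)) \<longlongrightarrow> 0) (at_right 0)"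
      by (rule Lim_transform_eventually[OF lim])
        (auto simp: flat_exp_def eventually_at_filter)
    moreover have "((\<lambda>x. (flat_exp p x - flat_exp p 0) / (x - 0)) \<longlongrightarrow> 0) (at_left 0)"
      by (rule Lim_transform_eventually[OF tendsto_const])
        (auto simp: flat_exp_def eventually_at_filter)
    ultimately have "((\<lambda>x. (flat_exp p x - flat_exp p 0) / (x - 0)) \<longlongrightarrow> 0) (at 0)"
      using filterlim_split_at_real by blast
    then show ?thesis using 3 by (simp add: has_field_derivative_iff flat_exp_def)
  qed
qed

lemma Cr_flat_exp: "Cr k (flat_exp p)"
proof (induction k arbitrary: p)
  case 0
  show ?case using flat_exp_deriv
    by (auto intro: DERIV_isCont simp: continuous_on_eq_continuous_at)
next
  case (Suc k)
  then show ?case using flat_exp_deriv[of p] by auto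
qed

lemma Cr_deriv:
  assumes "\<And>k. Cr k f"
  shows "(f has_real_derivative deriv f x) (at x)" "Cr k (deriv f)"
proof -
  have *: "\<exists>f'. (\<forall>x. (f has_real_derivative f' x) (at x)) \<and> Cr k f'" for k
    using assms[of "Suc k"] by simp
  then show "Cr k (deriv f)" by (metis DERIV_imp_deriv ext)
  show "(f has_real_derivative deriv f x) (at x)" using * by (metis DERIV_imp_deriv)
qed

section \<open>Test functions in the plane\<close>

lemma has_derivative_nth:
  fixes F :: "real \<Rightarrow> real"
  assumes "(F has_real_derivative F') (at (x $ i))"
  shows "((\<lambda>x::real^'n::finite. F (x $ i)) has_derivative (\<lambda>d. F' * d $ i)) (at x)"
proof -
  have "((\<lambda>x::real^'n. x $ i) has_derivative (\<lambda>d. d $ i)) (at x)"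
    by (rule bounded_linear_imp_has_derivative) (rule bounded_linear_vec_nth)
  from has_derivative_compose[OF this, of F "\<lambda>d. F' * d"] assms
  show ?thesis by (simp add: has_field_derivative_def)
qed

text \<open>Each partial derivative of a product of one function per coordinate is again such a
  product, so the induction closes once both factors are generalised.\<close>

lemma Ck_prod2:
  fixes f g :: "real \<Rightarrow> real"
  assumes "\<And>k. Cr k f" "\<And>k. Cr k g"
  shows "Ck k (\<lambda>x::real^2. f (x $ 1) * g (x $ 2))"
  using assms
proof (induction k arbitrary: f g)
  case 0
  then have "continuous_on UNIV f" "continuous_on UNIV g" using Cr.simps(1) by blast+
  then show ?case
    by (auto intro!: continuous_intros continuous_on_compose2[of UNIV f] continuous_on_compose2[of UNIV g])
next
  case (Suc k)
  have d: "((\<lambda>x::real^2. f (x $ 1) * g (x $ 2)) has_derivative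
     (\<lambda>d. f (x $ 1) * (deriv g (x $ 2) * d $ 2) + deriv f (x $ 1) * d $ 1 * g (x $ 2))) (at x)" for x
    using Suc.prems by (intro has_derivative_mult has_derivative_nth Cr_deriv)
  have fd: "partial i (\<lambda>x::real^2. f (x $ 1) * g (x $ 2)) =
     (\<lambda>x. if i = 1 then deriv f (x $ 1) * g (x $ 2) else f (x $ 1) * deriv g (x $ 2))" for i
    using exhaust_2[of i] by (auto simp: partial_def fun_eq_iff frechet_derivative_at[OF d, symmetric] axis_def)
  have "Ck k (\<lambda>x::real^2. deriv f (x $ 1) * g (x $ 2))" "Ck k (\<lambda>x::real^2. f (x $ 1) * deriv g (x $ 2))"
    using Suc.prems by (auto intro!: Suc.IH Cr_deriv)
  then have "Ck k (partial i (\<lambda>x::real^2. f (x $ 1) * g (x $ 2)))" for i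
    unfolding fd by (cases "i = 1") auto
  then show ?case using d by (auto simp: differentiable_def)
qed

text \<open>Nonzero exactly in the open box for every c > 0; increasing c steepens the flanks, so
  that the values tend to the indicator of the open box.\<close>

definition box_bump :: "real^2 \<Rightarrow> real^2 \<Rightarrow> real \<Rightarrow> real^2 \<Rightarrow> real" where
  "box_bump a b c x =
    (flat_exp 1 (c * (x $ 1 - a $ 1)) * flat_exp 1 (c * (b $ 1 - x $ 1))) *
    (flat_exp 1 (c * (x $ 2 - a $ 2)) * flat_exp 1 (c * (b $ 2 - x $ 2)))"

lemma Ck_box_bump: "Ck k (box_bump a b c)"
proof -
  have "Cr k (\<lambda>t. flat_exp 1 (c * (t - r)) * flat_exp 1 (c * (s - t)))" for r s k
  proof -
    have "Cr k (\<lambda>t. flat_exp 1 (c * t + (- c * r)) * flat_exp 1 ((- c) * t + c * s))"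
      by (intro Cr_mult Cr_affine Cr_flat_exp)
    then show ?thesis by (simp add: algebra_simps)
  qed
  from Ck_prod2[OF this this] show ?thesis unfolding box_bump_def[abs_def] .
qed

lemma box2: "x \<in> box a b \<longleftrightarrow> a $ 1 < x $ 1 \<and> x $ 1 < b $ 1 \<and> a $ 2 < x $ 2 \<and> x $ 2 < (b::real^2) $ 2"
  by (auto simp: mem_box_cart forall_2)

lemma box_bump_nz: "c > 0 \<Longrightarrow> box_bump a b c x \<noteq> 0 \<longleftrightarrow> x \<in> box a b"
  by (auto simp: box_bump_def flat_exp_def box2 not_le zero_less_mult_iff mult_le_0_iff)

lemma test_fun_box_bump:
  assumes "c > 0" "cbox a b \<subseteq> \<Omega>"
  shows "test_fun \<Omega> (box_bump a b c)"
proof -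
  have "closure {x. box_bump a b c x \<noteq> 0} \<subseteq> cbox a b"
    using assms box_subset_cbox by (intro closure_minimal) (auto simp: box_bump_nz closed_cbox)
  then show ?thesis using assms Ck_box_bump
    by (auto simp: test_fun_def compact_eq_bounded_closed intro: bounded_subset[OF bounded_cbox])
qed

lemma flat_exp_bounds: "0 \<le> flat_exp 1 t" "flat_exp 1 t \<le> 1"
  by (auto simp: flat_exp_def)

lemma box_bump_bounds: "0 \<le> box_bump a b c x" "box_bump a b c x \<le> 1"
  unfolding box_bump_def by (intro mult_nonneg_nonneg mult_le_one flat_exp_bounds)+

lemma box_bump_tendsto: "(\<lambda>n. box_bump a b (real (Suc n)) x) \<longlonglongrightarrow> indicator (box a b) x"
proof (cases "x \<in> box a b")
  case True
  have 1: "(\<lambda>n. flat_exp 1 (real (Suc n) * t)) \<longlonglongrightarrow> 1" if "t > 0" for t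
  proof -
    have "(\<lambda>n. exp (- ((1 / t) * inverse (real (Suc n))))) \<longlonglongrightarrow> exp (- ((1 / t) * 0))"
      by (intro tendsto_intros LIMSEQ_inverse_real_of_nat)
    moreover have "flat_exp 1 (real (Suc n) * t) = exp (- ((1 / t) * inverse (real (Suc n))))" for n
      using that mult_pos_pos[of "real (Suc n)" t] by (simp add: flat_exp_def divide_simps not_le del: of_nat_Suc)
    ultimately show ?thesis by simp
  qed
  have "(\<lambda>n. box_bump a b (real (Suc n)) x) \<longlonglongrightarrow> (1 * 1) * (1 * 1)"
    unfolding box_bump_def using True by (intro tendsto_mult 1) (auto simp: box2)
  then show ?thesis using True by simp
next
  case False
  then have "box_bump a b (real (Suc n)) x = 0" for n using box_bump_nz[of "real (Suc n)"] by force
  then show ?thesis using False by simp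
qed

section \<open>Weak derivatives: uniqueness and existence\<close>

text \<open>The Borel sets over which F integrates to 0 form a Dynkin system containing the boxes,
  which are stable under intersection and generate the Borel sets; \<open>F0\<close> serves the step
  to complements. The sets where F > 0 and where F < 0 are then admissible.\<close>

lemma AE_zero_if_box_integrals_zero:
  fixes F :: "'a::euclidean_space \<Rightarrow> real"
  assumes F: "integrable lborel F" and F0: "(LINT x|lborel. F x) = 0"
    and box0: "\<And>a b. (LINT x:box a b|lborel. F x) = 0"
  shows "AE x in lborel. F x = 0"
proof -
  let ?G = "range (\<lambda>(a, b). box a b :: 'a set)"
  have [measurable]: "F \<in> borel_measurable borel"
    using borel_measurable_integrable[OF F] by simp
  have si: "set_integrable lborel A F" if "A \<in> sets borel" for A
    using F that integrable_mult_indicator[of A lborel F] by (simp add: set_integrable_def)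
  have 0: "(LINT x:A|lborel. F x) = 0" if "A \<in> sets borel" for A
  proof -
    have G: "Int_stable ?G" "?G \<subseteq> Pow UNIV"
      by (auto simp: Int_stable_def box_Int_box)
    have "A \<in> sigma_sets UNIV ?G"
      using that unfolding borel_eq_box by simp
    with G show ?thesis
    proof (induction rule: sigma_sets_induct_disjoint)
      case (basic A)
      then show ?case using box0 by auto
    next
      case empty
      then show ?case by (simp add: set_lebesgue_integral_def)
    next
      case (compl A)
      then have A: "A \<in> sets borel" unfolding borel_eq_box by simp
      have "(LINT x:(UNIV - A) \<union> A|lborel. F x) = (LINT x:UNIV - A|lborel. F x) + (LINT x:A|lborel. F x)"
        using A by (intro set_integral_Un si) auto
      then show ?case using compl F0 by (simp add: set_lebesgue_integral_def)
    next
      case (union A)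
      then have A: "A i \<in> sets borel" for i unfolding borel_eq_box by auto
      have "(LINT x:(\<Union>i. A i)|lborel. F x) = (\<Sum>i. (LINT x:A i|lborel. F x))"
        using A union by (intro lebesgue_integral_countable_add si)
          (auto simp: disjoint_family_on_def)
      then show ?case using union by simp
    qed
  qed
  have "AE x in lborel. indicator {x. F x > 0} x * F x = 0"
    using 0[of "{x. F x > 0}"] si[of "{x. F x > 0}"]
    by (subst integral_nonneg_eq_0_iff_AE[symmetric])
      (auto simp: set_lebesgue_integral_def set_integrable_def indicator_def)
  moreover have "AE x in lborel. - (indicator {x. F x < 0} x * F x) = 0"
    using 0[of "{x. F x < 0}"] si[of "{x. F x < 0}"]
    by (subst integral_nonneg_eq_0_iff_AE[symmetric])
      (auto simp: set_lebesgue_integral_def set_integrable_def indicator_def)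
  ultimately show ?thesis
    by eventually_elim (auto simp: indicator_def split: if_splits)
qed

lemma LINT_lebesgue_on:
  fixes f :: "'a::euclidean_space \<Rightarrow> real"
  assumes "S \<in> sets lebesgue"
  shows "(LINT x|lebesgue_on S. f x) = (LINT x|lebesgue. indicator S x * f x)"
  using assms by (simp add: integral_restrict_space)

lemma integrable_lebesgue_on:
  fixes f :: "'a::euclidean_space \<Rightarrow> real"
  assumes "S \<in> sets lebesgue"
  shows "integrable (lebesgue_on S) f \<longleftrightarrow> integrable lebesgue (\<lambda>x. indicator S x * f x)"
  using assms by (simp add: integrable_restrict_space)

text \<open>The bumps stay below 1 and converge to the indicator of a box, so testing yields zero
  integrals over all boxes whose closure lies in the domain; countably many closed boxes exhaust the
  domain.\<close>

lemma AE_zero_if_test_zero: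
  fixes f :: "real^2 \<Rightarrow> real"
  assumes "open \<Omega>" and f: "loc_integrable \<Omega> f"
    and test: "\<And>\<phi>. test_fun \<Omega> \<phi> \<Longrightarrow> (LINT x|lebesgue_on \<Omega>. f x * \<phi> x) = 0"
  shows "AE x in lebesgue_on \<Omega>. f x = 0"
proof -
  have Om: "\<Omega> \<in> sets lebesgue" using \<open>open \<Omega>\<close> by auto
  have box0: "(LINT x|lebesgue. indicator (box a b) x * f x) = 0" if ab: "cbox a b \<subseteq> \<Omega>" for a b
  proof -
    have int: "integrable lebesgue (\<lambda>x. indicator (cbox a b) x * f x)"
      using f ab by (auto simp: loc_integrable_def integrable_lebesgue_on[symmetric])
    have eq: "indicator (cbox a b) x * f x * box_bump a b (real (Suc n)) x
        = indicator \<Omega> x * (f x * box_bump a b (real (Suc n)) x)" for n x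
      using ab box_subset_cbox[of a b] box_bump_nz[of "real (Suc n)" a b x] by (auto simp: indicator_def)
    have "(\<lambda>n. LINT x|lebesgue. indicator (cbox a b) x * f x * box_bump a b (real (Suc n)) x)
       \<longlonglongrightarrow> (LINT x|lebesgue. indicator (cbox a b) x * f x * indicator (box a b) x)"
    proof (rule integral_dominated_convergence[where w="\<lambda>x. \<bar>indicator (cbox a b) x * f x\<bar>"])
      show "(\<lambda>x. indicator (cbox a b) x * f x * indicat_real (box a b) x) \<in> borel_measurable lebesgue"
        using borel_measurable_integrable[OF int]
        by (rule borel_measurable_times) (auto intro: borel_measurable_indicator)
      show "(\<lambda>x. indicator (cbox a b) x * f x * box_bump a b (real (Suc i)) x) \<in> borel_measurable lebesgue" for i
      proof -
        have "continuous_on UNIV (box_bump a b (real (Suc i)))"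
          using Ck_box_bump[of 0] by simp
        then have "box_bump a b (real (Suc i)) \<in> borel_measurable lborel"
          by (simp add: borel_measurable_continuous_onI del: of_nat_Suc)
        then have "box_bump a b (real (Suc i)) \<in> borel_measurable lebesgue"
          by (rule measurable_completion)
        then show ?thesis by (rule borel_measurable_times[OF borel_measurable_integrable[OF int]])
      qed
      show "integrable lebesgue (\<lambda>x. \<bar>indicat_real (cbox a b) x * f x\<bar>)" using int by simp
      show "AE x in lebesgue. (\<lambda>i. indicator (cbox a b) x * f x * box_bump a b (real (Suc i)) x)
          \<longlonglongrightarrow> indicator (cbox a b) x * f x * indicator (box a b) x"
        by (intro AE_I2 tendsto_mult tendsto_const box_bump_tendsto)
      show "AE x in lebesgue. norm (indicator (cbox a b) x * f x * box_bump a b (real (Suc i)) x)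
          \<le> \<bar>indicator (cbox a b) x * f x\<bar>" for i
        using box_bump_bounds[of a b "real (Suc i)"] by (intro AE_I2) (auto simp: abs_mult mult_left_le)
    qed
    moreover have "(LINT x|lebesgue. indicator (cbox a b) x * f x * box_bump a b (real (Suc n)) x) = 0" for n
      using test[OF test_fun_box_bump[OF _ ab, of "real (Suc n)"]] unfolding eq
      by (simp add: LINT_lebesgue_on[OF Om])
    moreover have "indicator (cbox a b) x * f x * indicator (box a b) x = indicator (box a b) x * f x" for x
      using box_subset_cbox[of a b] by (auto simp: indicator_def)
    ultimately show ?thesis by (simp add: LIMSEQ_const_iff)
  qed
  have boxAE: "AE x in lebesgue. x \<in> cbox a b \<longrightarrow> f x = 0" if ab: "cbox a b \<subseteq> \<Omega>" for a b
  proof -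
    define F where "F x = indicator (box a b) x * f x" for x
    have "integrable lebesgue (\<lambda>x. indicator (box a b) x * (indicator (cbox a b) x * f x))"
      using f ab integrable_mult_indicator[of "box a b" lebesgue "\<lambda>x. indicator (cbox a b) x * f x"]
      by (auto simp: loc_integrable_def integrable_lebesgue_on[symmetric])
    moreover have "(\<lambda>x. indicator (box a b) x * (indicator (cbox a b) x * f x)) = F"
      using box_subset_cbox[of a b] by (auto simp: F_def indicator_def fun_eq_iff)
    ultimately have F: "integrable lebesgue F" by simp
    \<comment> \<open>The Dynkin argument runs on Borel sets and \<open>lborel\<close>, hence the
      passage to a Borel version of \<open>F\<close>.\<close>
    then obtain F' where F': "F' \<in> borel_measurable lborel" and FF: "AE x in lborel. F x = F' x"
      using completion_ex_borel_measurable_real[OF borel_measurable_integrable[OF F]] by auto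
    have FF': "AE x in lebesgue. F x = F' x" using FF by (rule AE_completion)
    have F'l: "F' \<in> borel_measurable lebesgue" using F' by (auto intro: measurable_completion)
    have iF': "integrable lborel F'"
      using integrable_cong_AE[OF borel_measurable_integrable[OF F] F'l FF'] F F'
      by (simp add: integrable_completion)
    have L: "(LINT x|lborel. indicator A x * F' x) = (LINT x|lebesgue. indicator A x * F x)" if [measurable]: "A \<in> sets borel" for A
    proof -
      have m: "(\<lambda>x. indicator A x * F' x) \<in> borel_measurable lborel" using F' by measurable
      have "(LINT x|lborel. indicator A x * F' x) = (LINT x|lebesgue. indicator A x * F' x)"
        by (rule integral_completion[OF m, symmetric])
      also have "\<dots> = (LINT x|lebesgue. indicator A x * F x)"
      proof (rule integral_cong_AE)
        have "indicat_real A \<in> borel_measurable lebesgue" using that by (intro borel_measurable_indicator) auto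
        then show "(\<lambda>x. indicator A x * F' x) \<in> borel_measurable lebesgue"
          "(\<lambda>x. indicator A x * F x) \<in> borel_measurable lebesgue"
          using F'l borel_measurable_integrable[OF F] by (auto intro: borel_measurable_times)
        show "AE x in lebesgue. indicator A x * F' x = indicator A x * F x"
          using FF' by (rule eventually_mono) simp
      qed
      finally show ?thesis .
    qed
    have "AE x in lborel. F' x = 0"
    proof (rule AE_zero_if_box_integrals_zero[OF iF'])
      show "(LINT x|lborel. F' x) = 0"
        using L[of UNIV] box0[OF ab] by (simp add: F_def)
      fix c d :: "real^2"
      obtain c' d' where cd: "box c d \<inter> box a b = box c' d'" using box_Int_box by blast
      \<comment> \<open>If the open box is empty, \<open>cbox c' d'\<close> may be a degenerate box
        outside the domain; this case is settled by an integral over the empty set.\<close>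
      have "cbox c' d' \<subseteq> \<Omega> \<or> box c' d' = {}"
      proof (cases "box c' d' = {}")
        case False
        then have "cbox c' d' = closure (box c' d')" by (simp add: closure_box)
        also have "\<dots> \<subseteq> cbox a b" using cd box_subset_cbox[of a b] by (intro closure_minimal) auto
        finally show ?thesis using ab by auto
      qed auto
      then have "(LINT x|lebesgue. indicator (box c' d') x * f x) = 0" using box0 by auto
      moreover have "indicator (box c d) x * F x = indicator (box c' d') x * f x" for x
        unfolding cd[symmetric] by (auto simp: F_def indicator_def)
      ultimately show "(LINT x:box c d|lborel. F' x) = 0"
        using L[of "box c d"] by (simp add: set_lebesgue_integral_def)
    qed
    then have "AE x in lebesgue. F' x = 0" by (rule AE_completion)
    moreover have "AE x in lebesgue. x \<notin> cbox a b - box a b"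
      using negligible_frontier_interval[of a b] unfolding negligible_iff_null_sets by (rule AE_not_in)
    ultimately show ?thesis using FF' by eventually_elim (auto simp: F_def indicator_def split: if_splits)
  qed
  obtain D where D: "countable D" "\<And>X. X \<in> D \<Longrightarrow> X \<subseteq> \<Omega>" "\<And>X. X \<in> D \<Longrightarrow> \<exists>a b. X = cbox a b" "\<Union>D = \<Omega>"
    by (rule open_countable_Union_open_cbox[OF \<open>open \<Omega>\<close>]) blast
  have "AE x in lebesgue. \<forall>X\<in>D. x \<in> X \<longrightarrow> f x = 0"
    unfolding AE_ball_countable[OF D(1)]
  proof
    fix X assume "X \<in> D"
    then show "AE x in lebesgue. x \<in> X \<longrightarrow> f x = 0" using D(2,3)[of X] boxAE by blast
  qed
  then show ?thesis using D(4) Om by (auto simp: AE_restrict_space_iff elim: eventually_mono)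
qed

lemma loc_integrable_diff:
  "loc_integrable \<Omega> f \<Longrightarrow> loc_integrable \<Omega> g \<Longrightarrow> loc_integrable \<Omega> (\<lambda>x. f x - g x)"
  by (simp add: loc_integrable_def)

lemma test_fun_continuous: "test_fun \<Omega> \<phi> \<Longrightarrow> continuous_on UNIV \<phi>"
  unfolding test_fun_def by (metis Ck.simps(1))

lemma loc_integrable_mult_test:
  fixes f :: "real^'n::finite \<Rightarrow> real"
  assumes "open \<Omega>" "loc_integrable \<Omega> f" "test_fun \<Omega> \<phi>"
  shows "integrable (lebesgue_on \<Omega>) (\<lambda>x. f x * \<phi> x)"
proof -
  define K where "K = closure {x. \<phi> x \<noteq> 0}"
  have K: "compact K" "K \<subseteq> \<Omega>" and nz: "\<And>x. x \<notin> K \<Longrightarrow> \<phi> x = 0"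
    using assms(3) closure_subset[of "{x. \<phi> x \<noteq> 0}"] by (auto simp: test_fun_def K_def)
  have Ks: "K \<in> sets lebesgue" "\<Omega> \<in> sets lebesgue" using K assms(1) by (auto simp: compact_imp_closed)
  have c: "continuous_on K \<phi>" using test_fun_continuous[OF assms(3)] continuous_on_subset by blast
  then have "bounded (\<phi> ` K)" using K compact_continuous_image compact_imp_bounded by blast
  then obtain B where B: "\<And>x. x \<in> K \<Longrightarrow> \<bar>\<phi> x\<bar> \<le> B" by (auto simp: bounded_iff)
  have i: "integrable (lebesgue_on K) f" using assms(2) K by (simp add: loc_integrable_def)
  have "integrable (lebesgue_on K) (\<lambda>x. f x * \<phi> x)"
  proof (rule Bochner_Integration.integrable_bound[where f="\<lambda>x. B * f x"])
    show "integrable (lebesgue_on K) (\<lambda>x. B * f x)" using i by simp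
    show "(\<lambda>x. f x * \<phi> x) \<in> borel_measurable (lebesgue_on K)"
      using i c Ks continuous_imp_measurable_on_sets_lebesgue by (intro borel_measurable_times) auto
    show "AE x in lebesgue_on K. norm (f x * \<phi> x) \<le> norm (B * f x)"
    proof (rule AE_I2)
      fix x assume "x \<in> space (lebesgue_on K)"
      then have "\<bar>\<phi> x\<bar> \<le> \<bar>B\<bar>" using B[of x] by auto
      then show "norm (f x * \<phi> x) \<le> norm (B * f x)"
        by (simp add: abs_mult mult.commute mult_right_mono)
    qed
  qed
  moreover have "indicator K x * (f x * \<phi> x) = indicator \<Omega> x * (f x * \<phi> x)" for x
    using nz[of x] K by (auto simp: indicator_def)
  ultimately show ?thesis using Ks by (simp add: integrable_lebesgue_on)
qed

lemma has_weak_partial_unique: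
  fixes f :: "real^2 \<Rightarrow> real"
  assumes "open \<Omega>" "has_weak_partial \<Omega> i f g" "has_weak_partial \<Omega> i f g'"
  shows "AE x in lebesgue_on \<Omega>. g x = g' x"
proof -
  have l: "loc_integrable \<Omega> g" "loc_integrable \<Omega> g'" using assms by (auto simp: has_weak_partial_def)
  have "AE x in lebesgue_on \<Omega>. g x - g' x = 0"
  proof (rule AE_zero_if_test_zero[OF assms(1) loc_integrable_diff[OF l]])
    fix \<phi> assume p: "test_fun \<Omega> \<phi>"
    then have "(LINT x|lebesgue_on \<Omega>. f x * partial i \<phi> x) = - (LINT x|lebesgue_on \<Omega>. g x * \<phi> x)"
      "(LINT x|lebesgue_on \<Omega>. f x * partial i \<phi> x) = - (LINT x|lebesgue_on \<Omega>. g' x * \<phi> x)"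
      using assms(2,3) unfolding has_weak_partial_def by blast+
    then have "(LINT x|lebesgue_on \<Omega>. g x * \<phi> x) = (LINT x|lebesgue_on \<Omega>. g' x * \<phi> x)"
      by simp
    then show "(LINT x|lebesgue_on \<Omega>. (g x - g' x) * \<phi> x) = 0"
      using loc_integrable_mult_test[OF assms(1) _ p] l by (simp add: left_diff_distrib)
  qed
  then show ?thesis by simp
qed

lemma test_fun_partial:
  assumes t: "test_fun \<Omega> \<phi>"
  shows "test_fun \<Omega> (partial i \<phi>)"
proof -
  have z: "partial i \<phi> x = 0" if "x \<notin> closure {x. \<phi> x \<noteq> 0}" for x
  proof -
    have "((\<lambda>x. 0) has_derivative (\<lambda>h. 0)) (at x)" by simp
    then have "(\<phi> has_derivative (\<lambda>h. 0)) (at x)"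
      by (rule has_derivative_transform_within_open[of _ _ _ _ "- closure {x. \<phi> x \<noteq> 0}"])
        (use that closure_subset[of "{x. \<phi> x \<noteq> 0}"] in \<open>auto simp: open_Compl\<close>)
    then show ?thesis by (simp add: partial_def frechet_derivative_at[symmetric])
  qed
  then have "closure {x. partial i \<phi> x \<noteq> 0} \<subseteq> closure {x. \<phi> x \<noteq> 0}"
    by (intro closure_minimal) auto
  moreover have "Ck k (partial i \<phi>)" for k
  proof -
    have "Ck (Suc k) \<phi>" using t by (simp only: test_fun_def)
    then show ?thesis by simp
  qed
  ultimately show ?thesis using t
    by (auto simp: test_fun_def compact_eq_bounded_closed intro: bounded_subset)
qed

text \<open>\<open>weak_partial\<close> chooses some representative, so a second weak derivative is
  taken of a function known only almost everywhere; this transports a derivative to that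
  representative.\<close>

lemma has_weak_partial_cong_AE:
  fixes f :: "real^'n::finite \<Rightarrow> real"
  assumes Om: "open \<Omega>" and f: "loc_integrable \<Omega> f'"
    and ae: "AE x in lebesgue_on \<Omega>. f x = f' x" and w: "has_weak_partial \<Omega> i f g"
  shows "has_weak_partial \<Omega> i f' g"
proof -
  have "(LINT x|lebesgue_on \<Omega>. f' x * partial i p x) = (LINT x|lebesgue_on \<Omega>. f x * partial i p x)"
    if "test_fun \<Omega> p" for p
    using loc_integrable_mult_test[OF Om _ test_fun_partial[OF that, of i]] f w ae
    by (intro integral_cong_AE borel_measurable_integrable) (auto simp: has_weak_partial_def elim: eventually_mono)
  then show ?thesis using w f by (simp add: has_weak_partial_def)
qed

lemma test_fun_bounds:
  assumes "test_fun \<Omega> \<phi>"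
  obtains R B where "R > 0" "B > 0" "\<And>x. norm x > R \<Longrightarrow> \<phi> x = 0" "\<And>x. \<bar>\<phi> x\<bar> \<le> B"
proof -
  define K where "K = closure {x. \<phi> x \<noteq> 0}"
  have K: "compact K" and nz: "\<And>x. x \<notin> K \<Longrightarrow> \<phi> x = 0"
    using assms closure_subset[of "{x. \<phi> x \<noteq> 0}"] by (auto simp: test_fun_def K_def)
  obtain R where R: "R > 0" "\<And>x. x \<in> K \<Longrightarrow> norm x \<le> R"
    using compact_imp_bounded[OF K] by (auto simp: bounded_pos)
  have "continuous_on K \<phi>" using test_fun_continuous[OF assms] by (rule continuous_on_subset) simp
  then have "bounded (\<phi> ` K)" using K by (intro compact_imp_bounded compact_continuous_image)
  then obtain B where B: "B > 0" "\<And>x. x \<in> K \<Longrightarrow> \<bar>\<phi> x\<bar> \<le> B" by (auto simp: bounded_pos)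
  show ?thesis
  proof (rule that[OF R(1) B(1)])
    fix x show "norm x > R \<Longrightarrow> \<phi> x = 0" using R(2)[of x] nz[of x] by force
    show "\<bar>\<phi> x\<bar> \<le> B" using B nz[of x] by (cases "x \<in> K") auto
  qed
qed

lemma partial_line_deriv:
  assumes "\<phi> differentiable (at (x + t *\<^sub>R axis i 1))"
  shows "((\<lambda>t. \<phi> (x + t *\<^sub>R axis i 1)) has_real_derivative partial i \<phi> (x + t *\<^sub>R axis i 1)) (at t)"
proof -
  let ?D = "frechet_derivative \<phi> (at (x + t *\<^sub>R axis i 1))"
  have D: "(\<phi> has_derivative ?D) (at (x + t *\<^sub>R axis i 1))"
    using assms frechet_derivative_works by blast
  have "((\<lambda>t. x + t *\<^sub>R axis i 1) has_derivative (\<lambda>h. h *\<^sub>R axis i 1)) (at t)"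
    by (auto intro!: derivative_eq_intros)
  from has_derivative_compose[OF this D] have "((\<lambda>t. \<phi> (x + t *\<^sub>R axis i 1)) has_derivative (\<lambda>h. ?D (h *\<^sub>R axis i 1))) (at t)" .
  moreover have "?D (h *\<^sub>R axis i 1) = partial i \<phi> (x + t *\<^sub>R axis i 1) * h" for h
    using linear_cmul[OF has_derivative_linear[OF D], of h "axis i 1"] by (simp add: partial_def)
  ultimately show ?thesis by (simp add: has_field_derivative_def)
qed

lemma integrable_continuous_vanishing:
  fixes h :: "real^'n::finite \<Rightarrow> real"
  assumes "continuous_on UNIV h" "\<And>x. norm x > R \<Longrightarrow> h x = 0"
  shows "integrable lborel h"
proof -
  have "integrable lborel (\<lambda>x. indicator (cball 0 R) x *\<^sub>R h x)"
    by (intro borel_integrable_compact) (auto intro: continuous_on_subset[OF assms(1)])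
  moreover have "(\<lambda>x. indicator (cball 0 R) x *\<^sub>R h x) = h"
    using assms(2) by (fastforce simp: indicator_def)
  ultimately show ?thesis by simp
qed

lemma LINT_test:
  fixes h :: "real^'n::finite \<Rightarrow> real"
  assumes "open \<Omega>" "test_fun \<Omega> \<phi>" "h \<in> borel_measurable borel"
  shows "(LINT x|lebesgue_on \<Omega>. h x * \<phi> x) = (LINT x|lborel. h x * \<phi> x)"
proof -
  have "(\<lambda>x. indicator \<Omega> x * (h x * \<phi> x)) = (\<lambda>x. h x * \<phi> x)"
    using assms(2) closure_subset[of "{x. \<phi> x \<noteq> 0}"] by (fastforce simp: test_fun_def indicator_def)
  moreover have "\<phi> \<in> borel_measurable borel"
    by (rule borel_measurable_continuous_onI[OF test_fun_continuous[OF assms(2)]])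
  ultimately show ?thesis using assms
    by (simp add: LINT_lebesgue_on integral_completion)
qed

text \<open>Discrete integration by parts: the translation invariance of Lebesgue measure moves the
  difference quotient from one factor to the other.\<close>

lemma has_weak_partialI:
  fixes f g :: "real^'n::finite \<Rightarrow> real"
  assumes Om: "open \<Omega>" and f: "continuous_on UNIV f" and g: "g \<in> borel_measurable borel"
    and t0: "\<And>n. t n \<noteq> 0" and t: "t \<longlonglongrightarrow> 0"
    and lim: "\<And>x. (\<lambda>n. (f (x + t n *\<^sub>R axis i 1) - f x) / t n) \<longlonglongrightarrow> g x"
    and lip: "\<And>R. \<exists>L. \<forall>x n. norm x \<le> R \<longrightarrow> \<bar>f (x + t n *\<^sub>R axis i 1) - f x\<bar> \<le> L * \<bar>t n\<bar>"
  shows "has_weak_partial \<Omega> i f g"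
proof -
  let ?e = "axis i 1 :: real^'n"
  have bq: "\<exists>L. \<forall>x n. norm x \<le> R \<longrightarrow> \<bar>(f (x + t n *\<^sub>R ?e) - f x) / t n\<bar> \<le> L" for R
    using lip[of R] t0 by (simp add: abs_divide divide_le_eq)
  have bg: "\<exists>L. \<forall>x. norm x \<le> R \<longrightarrow> \<bar>g x\<bar> \<le> L" for R
  proof -
    obtain L where L: "\<forall>x n. norm x \<le> R \<longrightarrow> \<bar>(f (x + t n *\<^sub>R ?e) - f x) / t n\<bar> \<le> L" using bq by blast
    have "\<bar>g x\<bar> \<le> L" if "norm x \<le> R" for x
      using L that by (intro LIMSEQ_le_const2[OF tendsto_rabs[OF lim[of x]]]) auto
    then show ?thesis by blast
  qed
  have fb [measurable]: "f \<in> borel_measurable borel" using f by (rule borel_measurable_continuous_onI)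
  have "loc_integrable \<Omega> f"
    unfolding loc_integrable_def
  proof (intro allI impI, elim conjE)
    fix K :: "(real^'n) set" assume K: "compact K" "K \<subseteq> \<Omega>"
    have "integrable lborel (\<lambda>x. indicator K x *\<^sub>R f x)"
      using K by (intro borel_integrable_compact) (auto intro: continuous_on_subset[OF f])
    then show "integrable (lebesgue_on K) f"
      using K fb by (subst integrable_lebesgue_on) (auto simp: compact_imp_closed integrable_completion)
  qed
  moreover have "loc_integrable \<Omega> g"
    unfolding loc_integrable_def
  proof (intro allI impI, elim conjE)
    fix K :: "(real^'n) set" assume K: "compact K" "K \<subseteq> \<Omega>"
    obtain R where R: "\<And>x. x \<in> K \<Longrightarrow> norm x \<le> R"
      using compact_imp_bounded[OF K(1)] by (auto simp: bounded_iff)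
    obtain L where L: "\<And>x. norm x \<le> R \<Longrightarrow> \<bar>g x\<bar> \<le> L" using bg[of R] by blast
    have Kb: "K \<in> sets borel" using K by (simp add: compact_imp_closed)
    have "integrable lborel (\<lambda>x. indicator K x *\<^sub>R g x)"
    proof (rule Bochner_Integration.integrable_bound)
      show "integrable lborel (\<lambda>x. indicator K x *\<^sub>R L)"
        using K by (intro borel_integrable_compact) auto
      show "(\<lambda>x. indicat_real K x *\<^sub>R g x) \<in> borel_measurable lborel"
        using Kb g by measurable
      show "AE x in lborel. norm (indicat_real K x *\<^sub>R g x) \<le> norm (indicat_real K x *\<^sub>R L)"
      proof (rule AE_I2)
        fix x show "norm (indicat_real K x *\<^sub>R g x) \<le> norm (indicat_real K x *\<^sub>R L)"
          using L[of x] R[of x] by (auto simp: indicator_def)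
      qed
    qed
    then show "integrable (lebesgue_on K) g"
      using Kb g by (subst integrable_lebesgue_on) (auto simp: integrable_completion)
  qed
  moreover have "(LINT x|lebesgue_on \<Omega>. f x * partial i \<phi> x) = - (LINT x|lebesgue_on \<Omega>. g x * \<phi> x)"
    if p: "test_fun \<Omega> \<phi>" for \<phi>
  proof -
    obtain R B where R: "R > 0" "\<And>x. norm x > R \<Longrightarrow> \<phi> x = 0" and B: "\<And>x. \<bar>\<phi> x\<bar> \<le> B"
      using test_fun_bounds[OF p] by metis
    obtain R' B' where B': "B' > 0" "\<And>x. \<bar>partial i \<phi> x\<bar> \<le> B'"
      using test_fun_bounds[OF test_fun_partial[OF p, of i]] by metis
    have pc: "continuous_on UNIV \<phi>" using p by (rule test_fun_continuous)
    have pb [measurable]: "\<phi> \<in> borel_measurable borel" using pc by (rule borel_measurable_continuous_onI)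
    have dp: "\<phi> differentiable (at x)" for x
    proof -
      have "Ck (Suc 0) \<phi>" using p by (simp only: test_fun_def)
      then show ?thesis by simp
    qed
    have ld: "((\<lambda>s. \<phi> (x + s *\<^sub>R ?e)) has_real_derivative partial i \<phi> (x + s *\<^sub>R ?e)) (at s)" for x s
      by (rule partial_line_deriv[OF dp])
    obtain T where T: "T > 0" "\<And>n. \<bar>t n\<bar> \<le> T"
      using convergent_imp_Bseq[OF convergentI[OF t]] by (auto simp: Bseq_def)
    have sh: "(LINT x|lborel. f (x + t n *\<^sub>R ?e) * \<phi> x) = (LINT x|lborel. f x * \<phi> (x - t n *\<^sub>R ?e))" for n
    proof -
      have "(LINT x|lborel. f x * \<phi> (x - t n *\<^sub>R ?e)) = (LINT x|distr lborel borel ((+) (t n *\<^sub>R ?e)). f x * \<phi> (x - t n *\<^sub>R ?e))"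
        by (simp add: lborel_distr_plus)
      also have "\<dots> = (LINT x|lborel. f (t n *\<^sub>R ?e + x) * \<phi> (t n *\<^sub>R ?e + x - t n *\<^sub>R ?e))"
        using fb pb by (intro integral_distr) measurable
      finally show ?thesis by (simp add: add.commute)
    qed
    have i1: "integrable lborel (\<lambda>x. f (x + t n *\<^sub>R ?e) * \<phi> x)" for n
      using R(2) pc by (intro integrable_continuous_vanishing[where R=R])
        (auto intro!: continuous_intros continuous_on_compose2[OF f])
    have i0: "integrable lborel (\<lambda>x. f x * \<phi> x)"
      using R(2) pc f by (intro integrable_continuous_vanishing[where R=R]) (auto intro!: continuous_intros)
    \<comment> \<open>\<open>T\<close> bounds all the shifts, so the ball of radius
      \<open>R + T\<close> contains the supports of all translated test functions and provides one
      dominating function.\<close>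
    have far: "\<phi> (x - t n *\<^sub>R ?e) = 0" if "norm x > R + T" for x n
    proof (rule R(2))
      have "norm x - norm (t n *\<^sub>R ?e) \<le> norm (x - t n *\<^sub>R ?e)" by (rule norm_triangle_ineq2)
      then show "R < norm (x - t n *\<^sub>R ?e)" using that T(2)[of n] by simp
    qed
    have i2: "integrable lborel (\<lambda>x. f x * \<phi> (x - t n *\<^sub>R ?e))" for n
      using far pc by (intro integrable_continuous_vanishing[where R="R+T"])
        (auto intro!: continuous_intros continuous_on_compose2[OF pc] f)
    have eq: "(LINT x|lborel. (f (x + t n *\<^sub>R ?e) - f x) / t n * \<phi> x)
        = (LINT x|lborel. f x * ((\<phi> (x - t n *\<^sub>R ?e) - \<phi> x) / t n))" for n
    proof -
      have "(LINT x|lborel. (f (x + t n *\<^sub>R ?e) - f x) / t n * \<phi> x)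
        = (LINT x|lborel. (f (x + t n *\<^sub>R ?e) * \<phi> x - f x * \<phi> x) / t n)"
        by (simp add: left_diff_distrib)
      also have "\<dots> = ((LINT x|lborel. f x * \<phi> (x - t n *\<^sub>R ?e)) - (LINT x|lborel. f x * \<phi> x)) / t n"
        using i1 i0 by (simp add: sh)
      also have "\<dots> = (LINT x|lborel. (f x * \<phi> (x - t n *\<^sub>R ?e) - f x * \<phi> x) / t n)"
        using i2 i0 by simp
      finally show ?thesis by (simp add: right_diff_distrib)
    qed
    have "(\<lambda>n. LINT x|lborel. (f (x + t n *\<^sub>R ?e) - f x) / t n * \<phi> x) \<longlonglongrightarrow> (LINT x|lborel. g x * \<phi> x)"
    proof -
      obtain L where L: "\<And>x n. norm x \<le> R \<Longrightarrow> \<bar>(f (x + t n *\<^sub>R ?e) - f x) / t n\<bar> \<le> L" using bq by blast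
      show ?thesis
      proof (rule integral_dominated_convergence[where w="\<lambda>x. L * \<bar>\<phi> x\<bar>"])
        show "integrable lborel (\<lambda>x. L * \<bar>\<phi> x\<bar>)"
          using R(2) pc by (intro integrable_continuous_vanishing[where R=R]) (auto intro!: continuous_intros)
        show "AE x in lborel. (\<lambda>n. (f (x + t n *\<^sub>R ?e) - f x) / t n * \<phi> x) \<longlonglongrightarrow> g x * \<phi> x"
          by (intro AE_I2 tendsto_mult lim tendsto_const)
        show "AE x in lborel. norm ((f (x + t n *\<^sub>R ?e) - f x) / t n * \<phi> x) \<le> L * \<bar>\<phi> x\<bar>" for n
        proof (rule AE_I2)
          fix x show "norm ((f (x + t n *\<^sub>R ?e) - f x) / t n * \<phi> x) \<le> L * \<bar>\<phi> x\<bar>"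
            using mult_right_mono[OF L[of x n] abs_ge_zero[of "\<phi> x"]] R(2)[of x]
            by (cases "norm x \<le> R") (auto simp: abs_mult)
        qed
      qed (use fb pb g in measurable)
    qed
    moreover have "(\<lambda>n. LINT x|lborel. f x * ((\<phi> (x - t n *\<^sub>R ?e) - \<phi> x) / t n)) \<longlonglongrightarrow> (LINT x|lborel. f x * (- partial i \<phi> x))"
    proof (rule integral_dominated_convergence[where w="\<lambda>x. indicator (cball 0 (R + T)) x *\<^sub>R (\<bar>f x\<bar> * B')"])
      show "integrable lborel (\<lambda>x. indicator (cball 0 (R + T)) x *\<^sub>R (\<bar>f x\<bar> * B'))"
        by (intro borel_integrable_compact) (auto intro!: continuous_intros continuous_on_subset[OF f])
      show "AE x in lborel. (\<lambda>n. f x * ((\<phi> (x - t n *\<^sub>R ?e) - \<phi> x) / t n)) \<longlonglongrightarrow> f x * - partial i \<phi> x"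
      proof (intro AE_I2 tendsto_mult tendsto_const)
        fix x
        have "((\<lambda>s. (\<phi> (x + s *\<^sub>R ?e) - \<phi> (x + 0 *\<^sub>R ?e)) / (s - 0)) \<longlongrightarrow> partial i \<phi> (x + 0 *\<^sub>R ?e)) (at 0)"
          using ld[of x 0] unfolding has_field_derivative_iff .
        moreover have "filterlim (\<lambda>n. - t n) (at 0) sequentially"
          using tendsto_minus[OF t] t0 by (auto simp: filterlim_at)
        ultimately have "(\<lambda>n. (\<phi> (x + (- t n) *\<^sub>R ?e) - \<phi> (x + 0 *\<^sub>R ?e)) / (- t n - 0)) \<longlonglongrightarrow> partial i \<phi> (x + 0 *\<^sub>R ?e)"
          by (rule filterlim_compose)
        from tendsto_minus[OF this]
        show "(\<lambda>n. (\<phi> (x - t n *\<^sub>R ?e) - \<phi> x) / t n) \<longlonglongrightarrow> - partial i \<phi> x" by simp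
      qed
      show "AE x in lborel. norm (f x * ((\<phi> (x - t n *\<^sub>R ?e) - \<phi> x) / t n)) \<le> indicator (cball 0 (R + T)) x *\<^sub>R (\<bar>f x\<bar> * B')" for n
      proof (rule AE_I2)
        fix x
        show "norm (f x * ((\<phi> (x - t n *\<^sub>R ?e) - \<phi> x) / t n)) \<le> indicator (cball 0 (R + T)) x *\<^sub>R (\<bar>f x\<bar> * B')"
        proof (cases "norm x \<le> R + T")
          case True
          have "norm (\<phi> (x + (- t n) *\<^sub>R ?e) - \<phi> (x + 0 *\<^sub>R ?e)) \<le> B' * norm (- t n - 0)"
            using ld B'(2) by (intro field_differentiable_bound[where S=UNIV and f'="\<lambda>s. partial i \<phi> (x + s *\<^sub>R ?e)"]) auto
          then have "\<bar>(\<phi> (x - t n *\<^sub>R ?e) - \<phi> x) / t n\<bar> \<le> B'"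
            using t0[of n] by (simp add: abs_divide divide_le_eq)
          from mult_left_mono[OF this abs_ge_zero[of "f x"]] True show ?thesis by (simp add: abs_mult)
        next
          case False
          then show ?thesis using far[of x n] R(2)[of x] T(1) by auto
        qed
      qed
      have "partial i \<phi> \<in> borel_measurable borel"
        by (rule borel_measurable_continuous_onI[OF test_fun_continuous[OF test_fun_partial[OF p]]])
      then show "(\<lambda>x. f x * - partial i \<phi> x) \<in> borel_measurable lborel" using fb by measurable
    qed (use fb pb in measurable)
    ultimately have "(LINT x|lborel. g x * \<phi> x) = (LINT x|lborel. f x * (- partial i \<phi> x))"
      unfolding eq using LIMSEQ_unique by blast
    then show ?thesis
      using LINT_test[OF Om p g] LINT_test[OF Om test_fun_partial[OF p] fb] by simp
  qed
  ultimately show ?thesis by (simp add: has_weak_partial_def)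
qed

lemma has_weak_partial_cong:
  fixes f :: "real^'n::finite \<Rightarrow> real"
  assumes Om: "open \<Omega>" and eq: "\<And>x. x \<in> \<Omega> \<Longrightarrow> f x = f' x" and w: "has_weak_partial \<Omega> i f g"
  shows "has_weak_partial \<Omega> i f' g"
proof (rule has_weak_partial_cong_AE[OF Om _ _ w])
  show "AE x in lebesgue_on \<Omega>. f x = f' x" using eq by (intro AE_I2) auto
  have "integrable (lebesgue_on K) f'" if "compact K" "K \<subseteq> \<Omega>" for K
  proof -
    have "integrable (lebesgue_on K) f" using w that by (simp add: has_weak_partial_def loc_integrable_def)
    then show ?thesis by (rule Bochner_Integration.integrable_cong[THEN iffD1, rotated 2]) (use eq that in auto)
  qed
  then show "loc_integrable \<Omega> f'" by (simp add: loc_integrable_def)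
qed

section \<open>Directional derivatives of convex functions\<close>

text \<open>A limit along one sequence and not over all small steps: it is measurable as a pointwise
  limit and, as slopes of a convex function are monotone in the step, it is the one-sided
  directional derivative of a convex Lipschitz function.\<close>

definition ddir :: "'a::real_normed_vector \<Rightarrow> ('a \<Rightarrow> real) \<Rightarrow> 'a \<Rightarrow> real" where
  "ddir v w x = lim (\<lambda>n. (w (x + (1 / real (Suc n)) *\<^sub>R v) - w x) / (1 / real (Suc n)))"

lemma convex_slope_mono:
  fixes w :: "'a::real_vector \<Rightarrow> real"
  assumes w: "convex_on UNIV w" and "0 < s" "s \<le> t"
  shows "(w (x + s *\<^sub>R v) - w x) / s \<le> (w (x + t *\<^sub>R v) - w x) / t"
proof -
  have t: "t \<noteq> 0" using assms by simp
  have "x + s *\<^sub>R v = (1 - s / t) *\<^sub>R x + (s / t) *\<^sub>R (x + t *\<^sub>R v)"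
    using t by (simp add: scaleR_add_right scaleR_left_diff_distrib)
  moreover have "w ((1 - s / t) *\<^sub>R x + (s / t) *\<^sub>R (x + t *\<^sub>R v)) \<le> (1 - s / t) * w x + (s / t) * w (x + t *\<^sub>R v)"
    using assms by (intro convex_onD[OF w]) auto
  ultimately have "w (x + s *\<^sub>R v) \<le> (1 - s / t) * w x + (s / t) * w (x + t *\<^sub>R v)"
    by (simp only:)
  then have "w (x + s *\<^sub>R v) - w x \<le> (s / t) * (w (x + t *\<^sub>R v) - w x)"
    by (simp add: left_diff_distrib right_diff_distrib)
  then have "(w (x + s *\<^sub>R v) - w x) / s \<le> (s / t) * (w (x + t *\<^sub>R v) - w x) / s"
    using \<open>0 < s\<close> by (intro divide_right_mono) auto
  then show ?thesis using assms by simp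
qed

lemma convex_lipschitz_ddir:
  fixes w :: "'a::real_normed_vector \<Rightarrow> real"
  assumes w: "convex_on UNIV w" and K: "K-lipschitz_on UNIV w"
  shows ddir_tendsto: "(\<lambda>n. (w (x + (1 / real (Suc n)) *\<^sub>R v) - w x) / (1 / real (Suc n))) \<longlonglongrightarrow> ddir v w x"
    and ddir_le: "t > 0 \<Longrightarrow> ddir v w x \<le> (w (x + t *\<^sub>R v) - w x) / t"
    and ddir_bound: "\<bar>ddir v w x\<bar> \<le> K * norm v"
proof -
  let ?q = "\<lambda>n. (w (x + (1 / real (Suc n)) *\<^sub>R v) - w x) / (1 / real (Suc n))"
  have b: "\<bar>?q n\<bar> \<le> K * norm v" for n
    using lipschitz_onD[OF K, of "x + (1 / real (Suc n)) *\<^sub>R v" x]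
    by (simp add: dist_norm abs_mult divide_simps mult_ac)
  have dec: "decseq ?q"
    unfolding decseq_Suc_iff by (intro allI convex_slope_mono[OF w]) (auto simp: field_simps)
  have "convergent ?q"
    by (rule Bseq_monoseq_convergent[OF BseqI']) (use b dec in \<open>auto simp: decseq_imp_monoseq\<close>)
  then show lim: "?q \<longlonglongrightarrow> ddir v w x"
    unfolding ddir_def by (simp only: convergent_LIMSEQ_iff)
  show "\<bar>ddir v w x\<bar> \<le> K * norm v"
    using b by (intro LIMSEQ_le_const2[OF tendsto_rabs[OF lim]]) auto
  show "ddir v w x \<le> (w (x + t *\<^sub>R v) - w x) / t" if "t > 0"
  proof (rule LIMSEQ_le_const2[OF lim])
    obtain N where N: "1 / real (Suc N) < t" using \<open>t > 0\<close> nat_approx_posE by blast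
    have "?q n \<le> (w (x + t *\<^sub>R v) - w x) / t" if "n \<ge> N" for n
    proof (rule convex_slope_mono[OF w])
      have "1 / real (Suc n) \<le> 1 / real (Suc N)" using that by (intro divide_left_mono) auto
      then show "1 / real (Suc n) \<le> t" using N by linarith
    qed auto
    then show "\<exists>N. \<forall>n\<ge>N. ?q n \<le> (w (x + t *\<^sub>R v) - w x) / t" by blast
  qed
qed

lemma ddir_borel_measurable:
  fixes w :: "'a::euclidean_space \<Rightarrow> real"
  assumes w: "convex_on UNIV w" and K: "K-lipschitz_on UNIV w"
  shows "ddir v w \<in> borel_measurable borel"
proof (rule borel_measurable_LIMSEQ_real)
  have c: "continuous_on UNIV w" using K by (rule lipschitz_on_continuous_on)
  show "(\<lambda>x. (w (x + (1 / real (Suc n)) *\<^sub>R v) - w x) / (1 / real (Suc n))) \<in> borel_measurable borel" for n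
    by (intro borel_measurable_continuous_onI continuous_intros continuous_on_compose2[OF c]) (auto intro: c)
qed (rule ddir_tendsto[OF assms])

lemma lipschitz_dq:
  fixes w :: "'a::real_normed_vector \<Rightarrow> real"
  assumes "K-lipschitz_on UNIV w"
  shows "\<bar>w (x + t *\<^sub>R v) - w x\<bar> \<le> (K * norm v) * \<bar>t\<bar>"
  using lipschitz_onD[OF assms, of "x + t *\<^sub>R v" x] by (simp add: dist_norm mult_ac)

text \<open>Difference quotients along positive and along negative steps converge to the right and
  to the left derivative. Since each limit represents the weak derivative, the two agree almost
  everywhere.\<close>

lemma convex_has_weak_partial:
  fixes w :: "real^'n::finite \<Rightarrow> real"
  assumes w: "convex_on UNIV w" and K: "K-lipschitz_on UNIV w" and Om: "open \<Omega>"
  shows "has_weak_partial \<Omega> i w (ddir (axis i 1) w)"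
    and "has_weak_partial \<Omega> i w (\<lambda>x. - ddir (- axis i 1) w x)"
proof -
  have c: "continuous_on UNIV w" using K by (rule lipschitz_on_continuous_on)
  have t: "(\<lambda>n. 1 / real (Suc n)) \<longlonglongrightarrow> 0"
    using LIMSEQ_inverse_real_of_nat by (simp add: inverse_eq_divide)
  show "has_weak_partial \<Omega> i w (ddir (axis i 1) w)"
  proof (rule has_weak_partialI[OF Om c ddir_borel_measurable[OF w K] _ t ddir_tendsto[OF w K]])
    show "\<exists>L. \<forall>x n. norm x \<le> R \<longrightarrow> \<bar>w (x + (1 / real (Suc n)) *\<^sub>R axis i 1) - w x\<bar> \<le> L * \<bar>1 / real (Suc n)\<bar>" for R
      using lipschitz_dq[OF K] by blast
  qed simp
  show "has_weak_partial \<Omega> i w (\<lambda>x. - ddir (- axis i 1) w x)"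
  proof (rule has_weak_partialI[OF Om c])
    show "(\<lambda>x. - ddir (- axis i 1) w x) \<in> borel_measurable borel"
      using ddir_borel_measurable[OF w K] by measurable
    show "(\<lambda>n. - (1 / real (Suc n))) \<longlonglongrightarrow> 0" using tendsto_minus[OF t] by simp
    show "(\<lambda>n. (w (x + (- (1 / real (Suc n))) *\<^sub>R axis i 1) - w x) / - (1 / real (Suc n))) \<longlonglongrightarrow> - ddir (- axis i 1) w x" for x
      using tendsto_minus[OF ddir_tendsto[OF w K, of x "- axis i 1"]] by simp
    show "\<exists>L. \<forall>x n. norm x \<le> R \<longrightarrow> \<bar>w (x + - (1 / real (Suc n)) *\<^sub>R axis i 1) - w x\<bar> \<le> L * \<bar>- (1 / real (Suc n))\<bar>" for R
      using lipschitz_dq[OF K] by blast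
  qed simp
qed

lemma AE_ddir_two_sided:
  fixes w :: "real^2 \<Rightarrow> real"
  assumes w: "convex_on UNIV w" and K: "K-lipschitz_on UNIV w"
  shows "AE x in lebesgue. ddir (axis i 1) w x = - ddir (- axis i 1) w x"
  using has_weak_partial_unique[OF open_UNIV convex_has_weak_partial[OF w K open_UNIV]]
  by (simp add: AE_restrict_space_iff)

text \<open>A subgradient is at most a difference quotient of \<open>W n\<close> with fixed step,
  which converges to that of w; shrinking the step bounds \<open>g n \<bullet> v\<close>
  asymptotically from above by \<open>ddir v w x\<close>. The same bound for \<open>- v\<close>,
  combined with \<open>two\<close>, is the lower bound.\<close>

lemma subgradients_tendsto_ddir:
  fixes w :: "'a::euclidean_space \<Rightarrow> real"
  assumes w: "convex_on UNIV w" and K: "K-lipschitz_on UNIV w"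
    and two: "ddir v w x = - ddir (- v) w x"
    and sub: "\<And>n y. W n y \<ge> W n x + g n \<bullet> (y - x)"
    and lim: "\<And>y. (\<lambda>n. W n y) \<longlonglongrightarrow> w y"
  shows "(\<lambda>n. g n \<bullet> v) \<longlonglongrightarrow> ddir v w x"
proof -
  have up: "eventually (\<lambda>n. g n \<bullet> v < ddir v w x + e) sequentially" if "e > 0" for e v
  proof -
    have "eventually (\<lambda>m. (w (x + (1 / real (Suc m)) *\<^sub>R v) - w x) / (1 / real (Suc m)) < ddir v w x + e) sequentially"
      using that by (intro order_tendstoD(2)[OF ddir_tendsto[OF w K]]) auto
    then obtain m where m: "(w (x + (1 / real (Suc m)) *\<^sub>R v) - w x) / (1 / real (Suc m)) < ddir v w x + e"
      by (auto simp: eventually_sequentially)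
    have "(\<lambda>n. (W n (x + (1 / real (Suc m)) *\<^sub>R v) - W n x) / (1 / real (Suc m))) \<longlonglongrightarrow> (w (x + (1 / real (Suc m)) *\<^sub>R v) - w x) / (1 / real (Suc m))"
      by (intro tendsto_intros lim) auto
    from order_tendstoD(2)[OF this m] show ?thesis
    proof (rule eventually_mono)
      fix n assume *: "(W n (x + (1 / real (Suc m)) *\<^sub>R v) - W n x) / (1 / real (Suc m)) < ddir v w x + e"
      have "(1 / real (Suc m)) * (g n \<bullet> v) \<le> W n (x + (1 / real (Suc m)) *\<^sub>R v) - W n x"
        using sub[of n "x + (1 / real (Suc m)) *\<^sub>R v"] by simp
      then have "g n \<bullet> v \<le> (W n (x + (1 / real (Suc m)) *\<^sub>R v) - W n x) / (1 / real (Suc m))"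
        by (simp add: field_simps)
      with * show "g n \<bullet> v < ddir v w x + e" by linarith
    qed
  qed
  show ?thesis
  proof (rule tendstoI)
    fix e :: real assume "e > 0"
    from up[OF this, of v] up[OF this, of "- v"]
    show "eventually (\<lambda>n. dist (g n \<bullet> v) (ddir v w x) < e) sequentially"
      by eventually_elim (use two in \<open>auto simp: dist_real_def abs_less_iff\<close>)
  qed
qed

section \<open>Mollification\<close>

text \<open>The partial derivatives appear as named functions, so that iterated derivatives of a
  mollification can be followed as convolutions with other kernels.\<close>

definition C1_with :: "(real^2 \<Rightarrow> real) \<Rightarrow> (real^2 \<Rightarrow> real) \<Rightarrow> (real^2 \<Rightarrow> real) \<Rightarrow> bool" where
  "C1_with f f1 f2 \<longleftrightarrow> continuous_on UNIV f1 \<and> continuous_on UNIV f2 \<and>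
     (\<forall>x. (f has_derivative (\<lambda>d. f1 x * d $ 1 + f2 x * d $ 2)) (at x))"

lemma C1_with_continuous: "C1_with f f1 f2 \<Longrightarrow> continuous_on UNIV f"
  unfolding C1_with_def by (meson continuous_at_imp_continuous_on has_derivative_continuous)

lemma C1_with_line:
  assumes "C1_with f f1 f2"
  shows "((\<lambda>t. f (x + t *\<^sub>R d)) has_real_derivative (f1 (x + t *\<^sub>R d) * d $ 1 + f2 (x + t *\<^sub>R d) * d $ 2)) (at t)"
proof -
  have D: "(f has_derivative (\<lambda>h. f1 (x + t *\<^sub>R d) * h $ 1 + f2 (x + t *\<^sub>R d) * h $ 2)) (at (x + t *\<^sub>R d))"
    using assms by (simp add: C1_with_def)
  have "((\<lambda>t. x + t *\<^sub>R d) has_derivative (\<lambda>h. h *\<^sub>R d)) (at t)"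
    by (auto intro!: derivative_eq_intros)
  from has_derivative_compose[OF this D] show ?thesis
    unfolding has_field_derivative_def
    by (rule has_derivative_eq_rhs) (auto simp: fun_eq_iff algebra_simps)
qed

lemma C1_with_vanish:
  assumes "C1_with f f1 f2" and f0: "\<And>x. norm x > R \<Longrightarrow> f x = 0" and x: "norm x > R"
  shows "f1 x = 0" "f2 x = 0"
proof -
  have "((\<lambda>x. 0) has_derivative (\<lambda>h. 0)) (at x)" by simp
  then have "(f has_derivative (\<lambda>h. 0)) (at x)"
    by (rule has_derivative_transform_within_open[of _ _ _ _ "{x. norm x > R}"])
      (use x f0 in \<open>auto intro!: open_Collect_less continuous_intros\<close>)
  moreover have "(f has_derivative (\<lambda>d. f1 x * d $ 1 + f2 x * d $ 2)) (at x)"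
    using assms by (simp add: C1_with_def)
  ultimately have "(\<lambda>d::real^2. f1 x * d $ 1 + f2 x * d $ 2) = (\<lambda>h. 0)"
    by (rule has_derivative_unique[rotated])
  from fun_cong[OF this, of "axis 1 1"] fun_cong[OF this, of "axis 2 1"]
  show "f1 x = 0" "f2 x = 0" by (auto simp: axis_def)
qed

section \<open>Convolution with compactly supported kernels\<close>

definition conv :: "(real^2 \<Rightarrow> real) \<Rightarrow> (real^2 \<Rightarrow> real) \<Rightarrow> real^2 \<Rightarrow> real" where
  "conv k w x = (LINT z|lborel. w z * k (x - z))"

lemma integrable_conv:
  fixes k w :: "real^2 \<Rightarrow> real"
  assumes "continuous_on UNIV k" "\<And>y. norm y > R \<Longrightarrow> k y = 0" "continuous_on UNIV w"
  shows "integrable lborel (\<lambda>z. w z * k (x - z))"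
proof (rule integrable_continuous_vanishing[where R="norm x + R"])
  fix z :: "real^2" assume "norm x + R < norm z"
  moreover have "norm z - norm x \<le> norm (x - z)" using norm_triangle_ineq2[of z x] by (simp add: norm_minus_commute)
  ultimately show "w z * k (x - z) = 0" using assms(2)[of "x - z"] by simp
qed (auto intro!: continuous_intros continuous_on_compose2[OF assms(1)] assms(3))

lemma conv_commute:
  fixes k w :: "real^2 \<Rightarrow> real"
  assumes "continuous_on UNIV k" "continuous_on UNIV w"
  shows "conv k w x = (LINT y|lborel. w (x - y) * k y)"
proof -
  have [measurable]: "k \<in> borel_measurable borel" "w \<in> borel_measurable borel"
    using assms by (auto intro: borel_measurable_continuous_onI)
  have L: "(lborel :: (real^2) measure) = density (distr lborel borel (\<lambda>y. x + (-1) *\<^sub>R y)) (\<lambda>_. 1)"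
    using lborel_affine[of "-1" x] by simp
  have "conv k w x = (LINT z|distr lborel borel (\<lambda>y. x + (-1) *\<^sub>R y). w z * k (x - z))"
    unfolding conv_def by (subst L) (simp add: density_1)
  also have "\<dots> = (LINT y|lborel. w (x + (-1) *\<^sub>R y) * k (x - (x + (-1) *\<^sub>R y)))"
    by (intro integral_distr) measurable
  finally show ?thesis by simp
qed

text \<open>Meant for increments and Taylor remainders of a kernel: these are uniformly small and
  vanish outside a fixed ball, which makes a convolution continuous and differentiable while w is
  merely continuous.\<close>

lemma conv_increment:
  fixes k w :: "real^2 \<Rightarrow> real"
  assumes c: "continuous_on UNIV k'" and w: "continuous_on UNIV w"
    and van: "\<And>y. norm y > R \<Longrightarrow> k' y = 0" and b: "\<And>y. \<bar>k' y\<bar> \<le> B"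
  shows "\<bar>conv k' w x\<bar> \<le> B * (LINT z|lborel. indicator (cball x R) z *\<^sub>R \<bar>w z\<bar>)"
proof -
  have i: "integrable lborel (\<lambda>z. indicator (cball x R) z *\<^sub>R \<bar>w z\<bar>)"
    by (intro borel_integrable_compact) (auto intro!: continuous_intros continuous_on_subset[OF w])
  have "norm (conv k' w x) \<le> (LINT z|lborel. norm (w z * k' (x - z)))"
    unfolding conv_def by (rule integral_norm_bound)
  also have "\<dots> \<le> (LINT z|lborel. B * (indicator (cball x R) z *\<^sub>R \<bar>w z\<bar>))"
  proof (rule integral_mono)
    show "integrable lborel (\<lambda>z. norm (w z * k' (x - z)))"
      using integrable_conv[OF c van w] by (rule integrable_norm)
    show "integrable lborel (\<lambda>z. B * (indicator (cball x R) z *\<^sub>R \<bar>w z\<bar>))" using i by simp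
    fix z
    show "norm (w z * k' (x - z)) \<le> B * (indicator (cball x R) z *\<^sub>R \<bar>w z\<bar>)"
      using mult_left_mono[OF b[of "x - z"] abs_ge_zero[of "w z"]] van[of "x - z"]
      by (cases "z \<in> cball x R") (auto simp: abs_mult dist_norm mult.commute)
  qed
  finally show ?thesis using i by simp
qed

text \<open>Compactness applies on the ball of radius \<open>R + 1\<close>; two points at distance
  below 1 lie either both in it or both outside the ball of radius \<open>R\<close>, where k
  vanishes.\<close>

lemma uniformly_continuous_vanishing:
  fixes k :: "real^2 \<Rightarrow> real"
  assumes c: "continuous_on UNIV k" and van: "\<And>y. norm y > R \<Longrightarrow> k y = 0" and "e > 0"
  obtains d where "d > 0" "\<And>y z. norm (y - z) < d \<Longrightarrow> \<bar>k y - k z\<bar> < e"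
proof -
  have "uniformly_continuous_on (cball 0 (R + 1)) k"
    by (rule compact_uniformly_continuous[OF continuous_on_subset[OF c]]) auto
  then obtain d where d: "d > 0" "\<And>y z. y \<in> cball 0 (R+1) \<Longrightarrow> z \<in> cball 0 (R+1) \<Longrightarrow> dist z y < d \<Longrightarrow> dist (k z) (k y) < e"
    unfolding uniformly_continuous_on_def using \<open>e > 0\<close> by metis
  show ?thesis
  proof (rule that[of "min d 1"])
    fix y z :: "real^2" assume yz: "norm (y - z) < min d 1"
    have "norm y \<le> norm z + norm (y - z)" "norm z \<le> norm y + norm (y - z)"
      using norm_triangle_sub[of y z] norm_triangle_sub[of z y] by (auto simp: norm_minus_commute)
    then consider "norm y \<le> R + 1" "norm z \<le> R + 1" | "norm y > R" "norm z > R"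
      using yz by linarith
    then show "\<bar>k y - k z\<bar> < e"
    proof cases
      case 1
      then show ?thesis using d(2)[of y z] yz by (auto simp: dist_norm norm_minus_commute abs_minus_commute)
    qed (use van \<open>e > 0\<close> in auto)
  qed (use d in auto)
qed

lemma conv_continuous:
  fixes k w :: "real^2 \<Rightarrow> real"
  assumes c: "continuous_on UNIV k" and van: "\<And>y. norm y > R \<Longrightarrow> k y = 0" and w: "continuous_on UNIV w"
  shows "continuous_on UNIV (conv k w)"
proof (rule continuous_at_imp_continuous_on, intro ballI)
  fix x :: "real^2"
  define M where "M = (LINT z|lborel. indicator (cball x (R+1)) z *\<^sub>R \<bar>w z\<bar>)"
  have M: "M \<ge> 0" unfolding M_def by (intro Bochner_Integration.integral_nonneg) auto
  show "isCont (conv k w) x"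
    unfolding continuous_at_eps_delta
  proof (intro allI impI)
    fix e :: real assume "e > 0"
    define e' where "e' = e / (M + 1)"
    have e': "e' > 0" using M \<open>e > 0\<close> by (simp add: e'_def)
    obtain d where d: "d > 0" "\<And>y z. norm (y - z) < d \<Longrightarrow> \<bar>k y - k z\<bar> < e'"
      using uniformly_continuous_vanishing[OF c van e'] by metis
    show "\<exists>d>0. \<forall>x'. dist x' x < d \<longrightarrow> dist (conv k w x') (conv k w x) < e"
    proof (intro exI[of _ "min d 1"] conjI allI impI)
      fix x' assume x': "dist x' x < min d 1"
      define \<delta> where "\<delta> = x' - x"
      have \<delta>: "norm \<delta> < d" "norm \<delta> < 1" using x' by (auto simp: \<delta>_def dist_norm)
      let ?k = "\<lambda>y. k (y + \<delta>) - k y"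
      have cs: "continuous_on UNIV (\<lambda>y. k (y + \<delta>))"
        by (intro continuous_on_compose2[OF c] continuous_intros) auto
      have vs: "k (y + \<delta>) = 0" if "norm y > R + 1" for y
      proof (rule van)
        have "norm y - norm \<delta> \<le> norm (y + \<delta>)" by (rule norm_diff_ineq)
        then show "norm (y + \<delta>) > R" using that \<delta> by linarith
      qed
      have "conv k w x' - conv k w x = conv ?k w x"
        unfolding conv_def
        using integrable_conv[OF cs vs w, where x=x] integrable_conv[OF c van w, where x=x]
        by (simp add: right_diff_distrib \<delta>_def algebra_simps)
      moreover have "\<bar>conv ?k w x\<bar> \<le> e' * M"
        unfolding M_def
      proof (rule conv_increment[OF _ w])
        show "continuous_on UNIV ?k" by (intro continuous_intros cs c)
        show "?k y = 0" if "norm y > R + 1" for y using vs[OF that] van[of y] that by simp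
        show "\<bar>?k y\<bar> \<le> e'" for y using d(2)[of "y + \<delta>" y] \<delta> by simp
      qed
      moreover have "e' * M < e" using M \<open>e > 0\<close> by (simp add: e'_def field_simps)
      ultimately show "dist (conv k w x') (conv k w x) < e" by (simp add: dist_real_def)
    qed (use d in auto)
  qed
qed

text \<open>The first-order remainder of the kernel is at most 2 e' |\<delta>| by the mean value
  inequality along the segment, so all derivatives fall on the kernel.\<close>

lemma C1_conv:
  fixes k w :: "real^2 \<Rightarrow> real"
  assumes C: "C1_with k k1 k2" and van: "\<And>y. norm y > R \<Longrightarrow> k y = 0" and w: "continuous_on UNIV w"
  shows "C1_with (conv k w) (conv k1 w) (conv k2 w)"
proof -
  have c: "continuous_on UNIV k" "continuous_on UNIV k1" "continuous_on UNIV k2"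
    using C C1_with_continuous[OF C] by (auto simp: C1_with_def)
  have van12: "k1 y = 0" "k2 y = 0" if "norm y > R" for y
    using C1_with_vanish[OF C _ that] van by auto
  have "(conv k w has_derivative (\<lambda>d. conv k1 w x * d $ 1 + conv k2 w x * d $ 2)) (at x)" for x
  proof -
    define M where "M = (LINT z|lborel. indicator (cball x (R+1)) z *\<^sub>R \<bar>w z\<bar>)"
    have M: "M \<ge> 0" unfolding M_def by (intro Bochner_Integration.integral_nonneg) auto
    have bl: "bounded_linear (\<lambda>d::real^2. conv k1 w x * d $ 1 + conv k2 w x * d $ 2)"
      by (intro bounded_linear_add bounded_linear_mult_const bounded_linear_const_mult bounded_linear_vec_nth)
    show ?thesis
      unfolding has_derivative_at_alt
    proof (intro conjI bl allI impI)
      fix e :: real assume "e > 0"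
      \<comment> \<open>The 2 accounts for the two partial derivatives; \<open>M + 1\<close> in
        place of \<open>M\<close> avoids a zero denominator.\<close>
      define e' where "e' = e / (2 * (M + 1))"
      have e': "e' > 0" using M \<open>e > 0\<close> by (simp add: e'_def)
      obtain d1 where d1: "d1 > 0" "\<And>y z. norm (y - z) < d1 \<Longrightarrow> \<bar>k1 y - k1 z\<bar> < e'"
        using uniformly_continuous_vanishing[OF c(2) van12(1) e'] by metis
      obtain d2 where d2: "d2 > 0" "\<And>y z. norm (y - z) < d2 \<Longrightarrow> \<bar>k2 y - k2 z\<bar> < e'"
        using uniformly_continuous_vanishing[OF c(3) van12(2) e'] by metis
      show "\<exists>d>0. \<forall>y. norm (y - x) < d \<longrightarrow>
         norm (conv k w y - conv k w x - (conv k1 w x * (y - x) $ 1 + conv k2 w x * (y - x) $ 2)) \<le> e * norm (y - x)"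
      proof (intro exI[of _ "min (min d1 d2) 1"] conjI allI impI)
        fix x' assume x': "norm (x' - x) < min (min d1 d2) 1"
        define \<delta> where "\<delta> = x' - x"
        have \<delta>: "norm \<delta> < d1" "norm \<delta> < d2" "norm \<delta> < 1" using x' by (auto simp: \<delta>_def)
        let ?k = "\<lambda>y. k (y + \<delta>) - k y - (k1 y * \<delta> $ 1 + k2 y * \<delta> $ 2)"
        have cs: "continuous_on UNIV (\<lambda>y. k (y + \<delta>))"
          by (intro continuous_on_compose2[OF c(1)] continuous_intros) auto
        have vs: "k (y + \<delta>) = 0" if "norm y > R + 1" for y
        proof (rule van)
          have "norm y - norm \<delta> \<le> norm (y + \<delta>)" by (rule norm_diff_ineq)
          then show "norm (y + \<delta>) > R" using that \<delta> by linarith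
        qed
        have xx: "x' - z = x - z + \<delta>" for z by (simp add: \<delta>_def)
        have "conv ?k w x = (LINT z|lborel. w z * k (x' - z) - w z * k (x - z)
             - (w z * k1 (x - z) * \<delta> $ 1 + w z * k2 (x - z) * \<delta> $ 2))"
          unfolding conv_def xx by (simp add: algebra_simps)
        also have "\<dots> = conv k w x' - conv k w x - (conv k1 w x * \<delta> $ 1 + conv k2 w x * \<delta> $ 2)"
          unfolding conv_def
          using integrable_conv[OF c(1) van w, where x=x'] integrable_conv[OF c(1) van w, where x=x]
            integrable_conv[OF c(2) van12(1) w, where x=x] integrable_conv[OF c(3) van12(2) w, where x=x]
          by simp
        finally have eq: "conv k w x' - conv k w x - (conv k1 w x * \<delta> $ 1 + conv k2 w x * \<delta> $ 2) = conv ?k w x" ..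
        have "\<bar>conv ?k w x\<bar> \<le> (e' * (2 * norm \<delta>)) * M"
          unfolding M_def
        proof (rule conv_increment[OF _ w])
          show "continuous_on UNIV ?k" by (intro continuous_intros cs c)
          show "?k y = 0" if "norm y > R + 1" for y
            using vs[OF that] van[of y] van12[of y] that by simp
          show "\<bar>?k y\<bar> \<le> e' * (2 * norm \<delta>)" for y
          proof -
            let ?g = "\<lambda>t. k (y + t *\<^sub>R \<delta>) - t * (k1 y * \<delta> $ 1 + k2 y * \<delta> $ 2)"
            let ?g' = "\<lambda>t. k1 (y + t *\<^sub>R \<delta>) * \<delta> $ 1 + k2 (y + t *\<^sub>R \<delta>) * \<delta> $ 2 - (k1 y * \<delta> $ 1 + k2 y * \<delta> $ 2)"
            have "norm (?g 1 - ?g 0) \<le> (e' * (2 * norm \<delta>)) * norm (1 - 0 :: real)"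
            proof (rule field_differentiable_bound[where S="{0..1}" and f'="?g'"])
              fix t :: real assume t: "t \<in> {0..1}"
              show "(?g has_field_derivative ?g' t) (at t within {0..1})"
                by (rule has_field_derivative_at_within)
                  (auto intro!: derivative_eq_intros C1_with_line[OF C])
              have nt: "norm (t *\<^sub>R \<delta>) \<le> norm \<delta>" using t by (simp add: mult_left_le_one_le)
              have "\<bar>k1 (y + t *\<^sub>R \<delta>) - k1 y\<bar> \<le> e'" "\<bar>k2 (y + t *\<^sub>R \<delta>) - k2 y\<bar> \<le> e'"
                using d1(2)[of "y + t *\<^sub>R \<delta>" y] d2(2)[of "y + t *\<^sub>R \<delta>" y] \<delta> nt by auto
              then have "\<bar>k1 (y + t *\<^sub>R \<delta>) - k1 y\<bar> * \<bar>\<delta> $ 1\<bar> \<le> e' * norm \<delta>"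
                "\<bar>k2 (y + t *\<^sub>R \<delta>) - k2 y\<bar> * \<bar>\<delta> $ 2\<bar> \<le> e' * norm \<delta>"
                using component_le_norm_cart[of \<delta>] by (auto intro!: mult_mono)
              moreover have "?g' t = (k1 (y + t *\<^sub>R \<delta>) - k1 y) * \<delta> $ 1 + (k2 (y + t *\<^sub>R \<delta>) - k2 y) * \<delta> $ 2"
                by (simp add: algebra_simps)
              ultimately show "norm (?g' t) \<le> e' * (2 * norm \<delta>)"
                using abs_triangle_ineq[of "(k1 (y + t *\<^sub>R \<delta>) - k1 y) * \<delta> $ 1" "(k2 (y + t *\<^sub>R \<delta>) - k2 y) * \<delta> $ 2"]
                by (simp add: abs_mult)
            qed auto
            then show ?thesis by (simp add: algebra_simps)
          qed
        qed
        also have "\<dots> = (e * (M / (M + 1))) * norm \<delta>" using M by (simp add: e'_def field_simps)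
        also have "\<dots> \<le> (e * 1) * norm \<delta>"
          using M \<open>e > 0\<close> by (intro mult_right_mono mult_left_mono) auto
        finally show "norm (conv k w x' - conv k w x - (conv k1 w x * (x' - x) $ 1 + conv k2 w x * (x' - x) $ 2)) \<le> e * norm (x' - x)"
          using eq by (simp add: \<delta>_def)
      qed (use d1 d2 in auto)
    qed
  qed
  then show ?thesis using conv_continuous[OF c(2) van12(1) w] conv_continuous[OF c(3) van12(2) w]
    by (simp add: C1_with_def)
qed

text \<open>The slope from x towards y is monotone in the step, so its limit at 0 is at most its
  value at step 1.\<close>

lemma convex_C1_subgradient:
  assumes W: "convex_on UNIV W" and C: "C1_with W P Q"
  shows "W y \<ge> W x + (P x * (y - x) $ 1 + Q x * (y - x) $ 2)"
proof -
  have "((\<lambda>t. (W (x + t *\<^sub>R (y - x)) - W (x + 0 *\<^sub>R (y - x))) / (t - 0)) \<longlongrightarrow> P x * (y - x) $ 1 + Q x * (y - x) $ 2) (at 0)"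
    using C1_with_line[OF C, of x "y - x" 0] by (simp add: has_field_derivative_iff)
  then have lim: "((\<lambda>t. (W (x + t *\<^sub>R (y - x)) - W x) / t) \<longlongrightarrow> P x * (y - x) $ 1 + Q x * (y - x) $ 2) (at_right 0)"
    by (simp add: filterlim_at_split)
  have ev: "eventually (\<lambda>t::real. t \<in> {0<..<1}) (at_right 0)"
    by (rule eventually_at_right_real) simp
  have "eventually (\<lambda>t. (W (x + t *\<^sub>R (y - x)) - W x) / t \<le> W y - W x) (at_right 0)"
    using ev
  proof (rule eventually_mono)
    fix t :: real assume "t \<in> {0<..<1}"
    then show "(W (x + t *\<^sub>R (y - x)) - W x) / t \<le> W y - W x"
      using convex_slope_mono[OF W, of t 1 x "y - x"] by simp
  qed
  from tendsto_upperbound[OF lim this] show ?thesis by simp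
qed

section \<open>The product kernels and their scaling\<close>

definition bump :: "real \<Rightarrow> real" where
  "bump t = flat_exp 1 (1 + t) * flat_exp 1 (1 - t)"

definition dbump :: "nat \<Rightarrow> real \<Rightarrow> real" where
  "dbump m = (deriv ^^ m) bump"

lemma Cr_dbump: "Cr k (dbump m)"
proof (induction m arbitrary: k)
  case 0
  have "Cr k (\<lambda>t. flat_exp 1 (1 * t + 1) * flat_exp 1 ((-1) * t + 1))"
    by (intro Cr_mult Cr_affine Cr_flat_exp)
  moreover have "(\<lambda>t. flat_exp 1 (1 * t + 1) * flat_exp 1 ((-1) * t + 1)) = bump"
    by (auto simp: bump_def fun_eq_iff add.commute)
  ultimately show ?case by (simp add: dbump_def)
next
  case (Suc m)
  then show ?case using Cr_deriv(2)[of "dbump m"] by (simp add: dbump_def)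
qed

lemma dbump_deriv: "(dbump m has_real_derivative dbump (Suc m) t) (at t)"
  using Cr_deriv(1)[of "dbump m" t] Cr_dbump by (simp add: dbump_def)

lemma dbump_continuous: "continuous_on UNIV (dbump m)"
  using Cr_dbump[of 0 m] by simp

lemma dbump_vanish: "\<bar>t\<bar> > 1 \<Longrightarrow> dbump m t = 0"
proof (induction m arbitrary: t)
  case 0
  then show ?case by (auto simp: dbump_def bump_def flat_exp_def abs_if split: if_splits)
next
  case (Suc m)
  have "((\<lambda>t. 0) has_real_derivative 0) (at t)" by simp
  then have "(dbump m has_real_derivative 0) (at t)"
    by (rule has_field_derivative_transform_within_open[of _ _ _ "{t. \<bar>t\<bar> > 1}"])
      (use Suc in \<open>auto intro!: open_Collect_less continuous_intros\<close>)
  then show ?case using dbump_deriv DERIV_unique by blast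
qed

definition bump_mass :: real where
  "bump_mass = (LINT y|lborel. dbump 0 ((y::real^2) $ 1) * dbump 0 (y $ 2))"

text \<open>In the exponent \<open>2 + m + n\<close> the 2 normalises the mass in the plane and each
  differentiation contributes one factor by the chain rule. Thus \<open>kern m n h\<close> is the
  partial derivative of \<open>kern 0 0 h\<close> of orders m and n.\<close>

definition kern :: "nat \<Rightarrow> nat \<Rightarrow> real \<Rightarrow> real^2 \<Rightarrow> real" where
  "kern m n h y = dbump m (y $ 1 / h) * dbump n (y $ 2 / h) / (bump_mass * h ^ (2 + m + n))"

lemma norm_le_components2: "norm (y::real^2) \<le> \<bar>y $ 1\<bar> + \<bar>y $ 2\<bar>"
  using norm_le_l1_cart[of y] by (simp add: sum_2)

lemma dbump_prod_continuous:
  "continuous_on UNIV (\<lambda>y::real^2. dbump m (y $ 1 / h) * dbump n (y $ 2 / h))" if "h \<noteq> 0"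
  using that by (intro continuous_intros continuous_on_compose2[OF dbump_continuous]) auto

lemma dbump_prod_vanish:
  assumes "h > 0" "norm (y::real^2) > 2 * h"
  shows "dbump m (y $ 1 / h) * dbump n (y $ 2 / h) = 0"
proof -
  have "\<bar>y $ 1\<bar> > h \<or> \<bar>y $ 2\<bar> > h" using assms norm_le_components2[of y] by linarith
  then have "\<bar>y $ 1 / h\<bar> > 1 \<or> \<bar>y $ 2 / h\<bar> > 1" using assms by (simp add: abs_divide)
  then show ?thesis using dbump_vanish by auto
qed

text \<open>A nonnegative continuous function with integral 0 vanishes almost everywhere, hence
  everywhere because its zero set is closed; the product of bumps is positive at 0.\<close>

lemma bump_mass_pos: "bump_mass > 0"
proof -
  let ?k = "\<lambda>y::real^2. dbump 0 (y $ 1) * dbump 0 (y $ 2)"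
  have c: "continuous_on UNIV ?k" using dbump_prod_continuous[of 1 0 0] by simp
  have i: "integrable lborel ?k"
    using dbump_prod_vanish[of 1 _ 0 0] by (intro integrable_continuous_vanishing[OF c, where R=2]) simp
  have nn: "0 \<le> ?k y" for y by (simp add: dbump_def bump_def flat_exp_bounds)
  have "bump_mass \<noteq> 0"
  proof
    assume "bump_mass = 0"
    then have "AE y in lborel. ?k y = 0"
      using nn i by (subst (asm) bump_mass_def, subst (asm) integral_nonneg_eq_0_iff_AE) auto
    then have "AE y in lebesgue. y \<in> {y. ?k y = 0}" by (simp add: AE_completion)
    moreover have "closed {y. ?k y = 0}" using c by (intro closed_Collect_eq) auto
    ultimately have "0 \<in> {y. ?k y = 0}" by (rule mem_closed_if_AE_lebesgue[rotated])
    then show False by (simp add: dbump_def bump_def flat_exp_def)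
  qed
  moreover have "bump_mass \<ge> 0" unfolding bump_mass_def using nn by (intro Bochner_Integration.integral_nonneg) auto
  ultimately show ?thesis by linarith
qed

lemma C1_kern:
  assumes "h > 0"
  shows "C1_with (kern m n h) (kern (Suc m) n h) (kern m (Suc n) h)"
proof -
  have c: "continuous_on UNIV (kern m n h)" for m n
    unfolding kern_def divide_inverse[of _ "bump_mass * _"]
    by (intro continuous_on_mult_right dbump_prod_continuous) (use assms in auto)
  have sc: "((\<lambda>t. dbump m (t / h)) has_real_derivative dbump (Suc m) (t / h) / h) (at t)" for m t
  proof -
    have "((\<lambda>t. t / h) has_real_derivative 1 / h) (at t)" using assms by (auto intro!: derivative_eq_intros)
    from DERIV_chain2[OF dbump_deriv this] show ?thesis by simp
  qed
  have "(kern m n h has_derivative (\<lambda>d. kern (Suc m) n h x * d $ 1 + kern m (Suc n) h x * d $ 2)) (at x)" for x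
  proof -
    have "((\<lambda>y. dbump m (y $ 1 / h) * dbump n (y $ 2 / h) * inverse (bump_mass * h ^ (2 + m + n))) has_derivative
      (\<lambda>d. (dbump m (x $ 1 / h) * (dbump (Suc n) (x $ 2 / h) / h * d $ 2) + (dbump (Suc m) (x $ 1 / h) / h * d $ 1) * dbump n (x $ 2 / h))
        * inverse (bump_mass * h ^ (2 + m + n)))) (at x)"
      by (intro has_derivative_mult_left has_derivative_mult has_derivative_nth sc)
    moreover have "(\<lambda>d. (dbump m (x $ 1 / h) * (dbump (Suc n) (x $ 2 / h) / h * d $ 2) + (dbump (Suc m) (x $ 1 / h) / h * d $ 1) * dbump n (x $ 2 / h))
        * inverse (bump_mass * h ^ (2 + m + n))) = (\<lambda>d::real^2. kern (Suc m) n h x * d $ 1 + kern m (Suc n) h x * d $ 2)"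
    proof (rule ext)
      fix d :: "real^2"
      define H where "H = h ^ (2 + m + n)"
      have p: "h ^ (2 + Suc m + n) = h * H" "h ^ (2 + m + Suc n) = h * H" "h ^ (2 + m + n) = H"
        by (simp_all add: H_def)
      show "(dbump m (x $ 1 / h) * (dbump (Suc n) (x $ 2 / h) / h * d $ 2) + (dbump (Suc m) (x $ 1 / h) / h * d $ 1) * dbump n (x $ 2 / h))
        * inverse (bump_mass * h ^ (2 + m + n)) = kern (Suc m) n h x * d $ 1 + kern m (Suc n) h x * d $ 2"
        unfolding kern_def p by (simp add: divide_inverse algebra_simps)
    qed
    moreover have "(\<lambda>y. dbump m (y $ 1 / h) * dbump n (y $ 2 / h) * inverse (bump_mass * h ^ (2 + m + n))) = kern m n h"
      by (simp add: fun_eq_iff kern_def divide_inverse)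
    ultimately show ?thesis by simp
  qed
  then show ?thesis using c by (simp add: C1_with_def)
qed

lemma kern_vanish: "h > 0 \<Longrightarrow> norm y > 2 * h \<Longrightarrow> kern m n h y = 0"
  using dbump_prod_vanish by (simp add: kern_def)

lemma kern_nonneg: "h > 0 \<Longrightarrow> kern 0 0 h y \<ge> 0"
  using bump_mass_pos by (simp add: kern_def dbump_def bump_def flat_exp_bounds)

lemma kern_continuous: "h > 0 \<Longrightarrow> continuous_on UNIV (kern m n h)"
  using C1_with_continuous[OF C1_kern] .

lemma integrable_kern: "h > 0 \<Longrightarrow> integrable lborel (kern m n h)"
  using kern_continuous kern_vanish by (intro integrable_continuous_vanishing[where R="2 * h"])

lemma LINT_scale2:
  fixes F :: "real^2 \<Rightarrow> real"
  assumes "h > 0" and [measurable]: "F \<in> borel_measurable borel"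
  shows "(LINT y|lborel. F ((1 / h) *\<^sub>R y)) = h^2 * (LINT y|lborel. F y)"
proof -
  have "(LINT y|lborel. F ((1 / h) *\<^sub>R y)) = (LINT y|density (distr lborel borel (\<lambda>x. 0 + h *\<^sub>R x)) (\<lambda>_. \<bar>h\<bar> ^ DIM(real^2)). F ((1 / h) *\<^sub>R y))"
    using lborel_affine[of h "0::real^2"] assms(1) by simp
  also have "\<dots> = (LINT y|distr lborel borel (\<lambda>x. 0 + h *\<^sub>R x). h^2 * F ((1 / h) *\<^sub>R y))"
    using assms(1) by (subst integral_density) (auto simp: power2_eq_square)
  also have "\<dots> = (LINT x|lborel. h^2 * F ((1 / h) *\<^sub>R (0 + h *\<^sub>R x)))"
    by (intro integral_distr) measurable
  finally show ?thesis using assms(1) by simp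
qed

definition kern_mass :: "nat \<Rightarrow> nat \<Rightarrow> real" where
  "kern_mass m n = (LINT y|lborel. \<bar>kern m n 1 y\<bar>)"

lemma kern_mass_nonneg: "kern_mass m n \<ge> 0"
  unfolding kern_mass_def by (intro Bochner_Integration.integral_nonneg) auto

text \<open>Each derivative of the kernel costs a factor 1/h in the L1 norm; this is what keeps h
  times the mollified Hessian bounded near an atom.\<close>

lemma LINT_abs_kern:
  assumes "h > 0"
  shows "(LINT y|lborel. \<bar>kern m n h y\<bar>) = kern_mass m n / h ^ (m + n)"
proof -
  have "kern m n h y = (1 / h ^ (2 + m + n)) * kern m n 1 ((1 / h) *\<^sub>R y)" for y
    using assms by (simp add: kern_def)
  then have "(LINT y|lborel. \<bar>kern m n h y\<bar>) = (LINT y|lborel. (1 / h ^ (2 + m + n)) * \<bar>kern m n 1 ((1 / h) *\<^sub>R y)\<bar>)"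
    using assms by (simp add: abs_mult)
  also have "\<dots> = (1 / h ^ (2 + m + n)) * (h^2 * kern_mass m n)"
    unfolding kern_mass_def using assms kern_continuous[of 1 m n]
    by (subst LINT_scale2[symmetric]) (auto intro!: borel_measurable_continuous_onI continuous_intros)
  finally show ?thesis using assms by (simp add: power_add power2_eq_square field_simps)
qed

lemma LINT_kern: assumes "h > 0" shows "(LINT y|lborel. kern 0 0 h y) = 1"
proof -
  have "(LINT y|lborel. kern 0 0 h y) = (LINT y|lborel. kern 0 0 1 y)"
    using LINT_abs_kern[OF assms, of 0 0] kern_nonneg[OF assms] kern_nonneg[of 1] by (simp add: kern_mass_def)
  also have "\<dots> = 1" using bump_mass_pos by (simp add: kern_def[abs_def] bump_mass_def[symmetric])
  finally show ?thesis .
qed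

section \<open>Mollified convex and Lipschitz functions\<close>

definition moll :: "nat \<Rightarrow> nat \<Rightarrow> real \<Rightarrow> (real^2 \<Rightarrow> real) \<Rightarrow> real^2 \<Rightarrow> real" where
  "moll m n h w = conv (kern m n h) w"

lemma C1_moll:
  "h > 0 \<Longrightarrow> continuous_on UNIV w \<Longrightarrow> C1_with (moll m n h w) (moll (Suc m) n h w) (moll m (Suc n) h w)"
  unfolding moll_def by (rule C1_conv[OF C1_kern kern_vanish])

lemma moll_eq:
  "h > 0 \<Longrightarrow> continuous_on UNIV w \<Longrightarrow> moll m n h w x = (LINT y|lborel. w (x - y) * kern m n h y)"
  unfolding moll_def by (rule conv_commute[OF kern_continuous])

lemma integrable_moll:
  assumes "h > 0" "continuous_on UNIV w"
  shows "integrable lborel (\<lambda>y. w (x - y) * kern m n h y)"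
  using kern_vanish[OF assms(1)]
  by (intro integrable_continuous_vanishing[where R="2 * h"] continuous_intros continuous_on_compose2[OF assms(2)]
      kern_continuous[OF assms(1)]) auto

text \<open>A mollification averages translates of a convex function with the nonnegative weights of
  the kernel.\<close>

lemma moll_convex:
  assumes h: "h > 0" and w: "convex_on UNIV w" "K-lipschitz_on UNIV w"
  shows "convex_on UNIV (moll 0 0 h w)"
proof (rule convex_onI)
  have c: "continuous_on UNIV w" using w(2) by (rule lipschitz_on_continuous_on)
  fix t x y assume t: "0 < t" "t < (1::real)"
  have "(LINT z|lborel. w ((1 - t) *\<^sub>R x + t *\<^sub>R y - z) * kern 0 0 h z)
     \<le> (LINT z|lborel. (1 - t) * (w (x - z) * kern 0 0 h z) + t * (w (y - z) * kern 0 0 h z))"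
  proof (rule integral_mono)
    fix z
    have "(1 - t) *\<^sub>R x + t *\<^sub>R y - z = (1 - t) *\<^sub>R (x - z) + t *\<^sub>R (y - z)"
      by (simp add: algebra_simps)
    then have "w ((1 - t) *\<^sub>R x + t *\<^sub>R y - z) \<le> (1 - t) * w (x - z) + t * w (y - z)"
      using convex_onD[OF w(1), of t "x - z" "y - z"] t by simp
    from mult_right_mono[OF this kern_nonneg[OF h, of z]]
    show "w ((1 - t) *\<^sub>R x + t *\<^sub>R y - z) * kern 0 0 h z \<le> (1 - t) * (w (x - z) * kern 0 0 h z) + t * (w (y - z) * kern 0 0 h z)"
      by (simp add: algebra_simps)
  qed (use integrable_moll[OF h c] in auto)
  then show "moll 0 0 h w ((1 - t) *\<^sub>R x + t *\<^sub>R y) \<le> (1 - t) * moll 0 0 h w x + t * moll 0 0 h w y"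
    using integrable_moll[OF h c] by (simp add: moll_eq[OF h c])
qed simp

text \<open>The kernel lives in a square of half side h, which the ball of radius 2 h contains; only
  the values of g in that ball enter.\<close>

lemma LINT_kern_bound:
  assumes h: "h > 0" and g: "integrable lborel (\<lambda>y. g y * kern m n h y)"
    and b: "\<And>y. norm y \<le> 2 * h \<Longrightarrow> \<bar>g y\<bar> \<le> B"
  shows "\<bar>LINT y|lborel. g y * kern m n h y\<bar> \<le> B * (kern_mass m n / h ^ (m + n))"
proof -
  have "norm (LINT y|lborel. g y * kern m n h y) \<le> (LINT y|lborel. norm (g y * kern m n h y))"
    by (rule integral_norm_bound)
  also have "\<dots> \<le> (LINT y|lborel. B * \<bar>kern m n h y\<bar>)"
  proof (rule integral_mono)
    fix y show "norm (g y * kern m n h y) \<le> B * \<bar>kern m n h y\<bar>"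
      using mult_right_mono[OF b[of y] abs_ge_zero] kern_vanish[OF h, of y m n]
      by (cases "norm y \<le> 2 * h") (auto simp: abs_mult)
  qed (use g integrable_kern[OF h] in auto)
  finally show ?thesis using LINT_abs_kern[OF h] by simp
qed

lemma moll_close:
  assumes h: "h > 0" and K: "K-lipschitz_on UNIV w"
  shows "\<bar>moll 0 0 h w x - w x\<bar> \<le> 2 * K * h"
proof -
  have c: "continuous_on UNIV w" using K by (rule lipschitz_on_continuous_on)
  have m1: "kern_mass 0 0 = 1"
    using LINT_abs_kern[OF h, of 0 0] LINT_kern[OF h] kern_nonneg[OF h] by simp
  have i: "integrable lborel (\<lambda>y. (w (x - y) - w x) * kern 0 0 h y)"
    using integrable_moll[OF h c, of x 0 0] integrable_kern[OF h, of 0 0] by (simp add: left_diff_distrib)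
  have "moll 0 0 h w x - w x = (LINT y|lborel. (w (x - y) - w x) * kern 0 0 h y)"
    using integrable_moll[OF h c, of x 0 0] integrable_kern[OF h, of 0 0] LINT_kern[OF h]
    by (simp add: left_diff_distrib moll_eq[OF h c])
  moreover have "\<bar>w (x - y) - w x\<bar> \<le> 2 * K * h" if "norm y \<le> 2 * h" for y
    using lipschitz_onD[OF K, of "x - y" x] mult_left_mono[OF that lipschitz_on_nonneg[OF K]]
    by (simp add: dist_norm mult_ac)
  ultimately show ?thesis using LINT_kern_bound[OF h i] m1 by simp
qed

lemma moll_lipschitz:
  assumes h: "h > 0" and K: "K-lipschitz_on UNIV w"
  shows "\<bar>moll m n h w x - moll m n h w x'\<bar> \<le> K * norm (x - x') * (kern_mass m n / h ^ (m + n))"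
proof -
  have c: "continuous_on UNIV w" using K by (rule lipschitz_on_continuous_on)
  note i = integrable_moll[OF h c, of _ m n]
  have "moll m n h w x - moll m n h w x' = (LINT y|lborel. (w (x - y) - w (x' - y)) * kern m n h y)"
    using i[of x] i[of x'] by (simp add: left_diff_distrib moll_eq[OF h c])
  moreover have "integrable lborel (\<lambda>y. (w (x - y) - w (x' - y)) * kern m n h y)"
    using i[of x] i[of x'] by (simp add: left_diff_distrib)
  moreover have "\<bar>w (x - y) - w (x' - y)\<bar> \<le> K * norm (x - x')" for y
    using lipschitz_onD[OF K, of "x - y" "x' - y"] by (simp add: dist_norm)
  ultimately show ?thesis using LINT_kern_bound[OF h, of "\<lambda>y. w (x - y) - w (x' - y)" m n] by simp
qed

text \<open>Turns a local Lipschitz estimate for an averaged quantity into a bound for its partial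
  derivatives.\<close>

lemma C1_with_lipschitz_bound:
  assumes C: "C1_with f f1 f2" and r: "r > 0" and L: "\<And>y. norm (y - x) < r \<Longrightarrow> \<bar>f y - f x\<bar> \<le> L * norm (y - x)"
  shows "\<bar>f1 x\<bar> \<le> L" "\<bar>f2 x\<bar> \<le> L"
proof -
  have *: "\<bar>f1 x * d $ 1 + f2 x * d $ 2\<bar> \<le> L" if d: "norm d = 1" for d :: "real^2"
  proof -
    have "((\<lambda>t. \<bar>(f (x + t *\<^sub>R d) - f (x + 0 *\<^sub>R d)) / (t - 0)\<bar>) \<longlongrightarrow> \<bar>f1 x * d $ 1 + f2 x * d $ 2\<bar>) (at 0)"
      using C1_with_line[OF C, of x d 0] by (intro tendsto_rabs) (simp add: has_field_derivative_iff)
    moreover have "eventually (\<lambda>t. \<bar>(f (x + t *\<^sub>R d) - f (x + 0 *\<^sub>R d)) / (t - 0)\<bar> \<le> L) (at 0)"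
      unfolding eventually_at
    proof (intro exI[of _ r] conjI ballI impI)
      fix t :: real assume t: "t \<noteq> 0 \<and> dist t 0 < r"
      then show "\<bar>(f (x + t *\<^sub>R d) - f (x + 0 *\<^sub>R d)) / (t - 0)\<bar> \<le> L"
        using L[of "x + t *\<^sub>R d"] d by (simp add: abs_divide divide_le_eq)
    qed (rule r)
    ultimately show ?thesis by (rule tendsto_upperbound) simp
  qed
  have a: "(axis 1 1 :: real^2) $ 1 = 1" "(axis 1 1 :: real^2) $ 2 = 0"
    "(axis 2 1 :: real^2) $ 1 = 0" "(axis 2 1 :: real^2) $ 2 = 1" by (simp_all add: axis_def)
  show "\<bar>f1 x\<bar> \<le> L" "\<bar>f2 x\<bar> \<le> L" using *[of "axis 1 1"] *[of "axis 2 1"] by (simp_all add: a norm_axis_1)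
qed

text \<open>One derivative is absorbed by the Lipschitz constant of w, the remaining m + n by the
  kernel. For m + n = 0 this bounds the gradient by \<open>K\<close>, for m + n = 1 the Hessian by a
  multiple of K/h.\<close>

lemma moll_deriv_bound:
  assumes h: "h > 0" and K: "K-lipschitz_on UNIV w"
  shows "\<bar>moll (Suc m) n h w x\<bar> \<le> K * (kern_mass m n / h ^ (m + n))"
    and "\<bar>moll m (Suc n) h w x\<bar> \<le> K * (kern_mass m n / h ^ (m + n))"
  using C1_with_lipschitz_bound[OF C1_moll[OF h lipschitz_on_continuous_on[OF K], of m n], where r=1 and x=x and L="K * (kern_mass m n / h ^ (m + n))"]
    moll_lipschitz[OF h K, where m=m and n=n and x'=x] by (auto simp: mult_ac)

lemma kern_mass_0: "kern_mass 0 0 = 1"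
  using LINT_abs_kern[of 1 0 0] LINT_kern[of 1] kern_nonneg[of 1] by simp

text \<open>Difference quotients of w are dominated by its Lipschitz constant, so they may pass to
  the limit under the average. The gradient becomes an average of \<open>ddir\<close>, a form that
  can be compared with the gradient at a single point.\<close>

lemma moll_grad_eq:
  assumes h: "h > 0" and w: "convex_on UNIV w" "K-lipschitz_on UNIV w"
  shows "moll (Suc 0) 0 h w x = (LINT y|lborel. ddir (axis 1 1) w (x - y) * kern 0 0 h y)"
    and "moll 0 (Suc 0) h w x = (LINT y|lborel. ddir (axis 2 1) w (x - y) * kern 0 0 h y)"
    and "integrable lborel (\<lambda>y. ddir v w (x - y) * kern 0 0 h y)"
proof -
  have c: "continuous_on UNIV w" using w(2) by (rule lipschitz_on_continuous_on)
  have [measurable]: "w \<in> borel_measurable borel" "kern 0 0 h \<in> borel_measurable borel"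
    using c kern_continuous[OF h] by (auto intro: borel_measurable_continuous_onI)
  have [measurable]: "ddir v w \<in> borel_measurable borel" for v by (rule ddir_borel_measurable[OF w])
  have t0: "filterlim (\<lambda>n. 1 / real (Suc n)) (at 0) sequentially"
    using LIMSEQ_inverse_real_of_nat by (auto simp: filterlim_at inverse_eq_divide)
  have ik: "integrable lborel (\<lambda>y. (K * norm v) * kern 0 0 h y)" for v :: "real^2"
    using integrable_kern[OF h] by simp
  have pb: "norm (a * kern 0 0 h y) \<le> (K * norm v) * kern 0 0 h y" if "\<bar>a\<bar> \<le> K * norm v" for a y and v :: "real^2"
    using mult_right_mono[OF that kern_nonneg[OF h, of y]] kern_nonneg[OF h, of y] by (simp add: abs_mult)
  show "integrable lborel (\<lambda>y. ddir v w (x - y) * kern 0 0 h y)" for v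
  proof (rule Bochner_Integration.integrable_bound[OF ik[of v]])
    show "AE y in lborel. norm (ddir v w (x - y) * kern 0 0 h y) \<le> norm ((K * norm v) * kern 0 0 h y)"
    proof (rule AE_I2)
      fix y
      show "norm (ddir v w (x - y) * kern 0 0 h y) \<le> norm ((K * norm v) * kern 0 0 h y)"
        using pb[OF ddir_bound[OF w, of v "x - y"], of y] by simp
    qed
  qed measurable
  have *: "(\<lambda>n. (moll 0 0 h w (x + (1 / real (Suc n)) *\<^sub>R v) - moll 0 0 h w x) / (1 / real (Suc n)))
     \<longlonglongrightarrow> (LINT y|lborel. ddir v w (x - y) * kern 0 0 h y)" for v
  proof -
    let ?q = "\<lambda>n z. (w (z + (1 / real (Suc n)) *\<^sub>R v) - w z) / (1 / real (Suc n))"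
    have eq: "(moll 0 0 h w (x + (1 / real (Suc n)) *\<^sub>R v) - moll 0 0 h w x) / (1 / real (Suc n))
      = (LINT y|lborel. ?q n (x - y) * kern 0 0 h y)" for n
    proof -
      have s: "x - y + t *\<^sub>R v = x + t *\<^sub>R v - y" for y and t :: real by simp
      have "(LINT y|lborel. ?q n (x - y) * kern 0 0 h y) =
        (LINT y|lborel. (w (x + (1 / real (Suc n)) *\<^sub>R v - y) * kern 0 0 h y - w (x - y) * kern 0 0 h y) / (1 / real (Suc n)))"
        unfolding s by (intro Bochner_Integration.integral_cong) (simp_all add: left_diff_distrib right_diff_distrib mult_ac)
      also have "\<dots> = ((LINT y|lborel. w (x + (1 / real (Suc n)) *\<^sub>R v - y) * kern 0 0 h y) - (LINT y|lborel. w (x - y) * kern 0 0 h y)) / (1 / real (Suc n))"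
        using integrable_moll[OF h c, of "x + (1 / real (Suc n)) *\<^sub>R v" 0 0] integrable_moll[OF h c, of x 0 0]
        by simp
      finally show ?thesis by (simp add: moll_eq[OF h c])
    qed
    show ?thesis
      unfolding eq
    proof (rule integral_dominated_convergence[OF _ _ ik[of v]])
      show "AE y in lborel. (\<lambda>n. ?q n (x - y) * kern 0 0 h y) \<longlonglongrightarrow> ddir v w (x - y) * kern 0 0 h y"
        by (intro AE_I2 tendsto_mult ddir_tendsto[OF w] tendsto_const)
      show "AE y in lborel. norm (?q n (x - y) * kern 0 0 h y) \<le> (K * norm v) * kern 0 0 h y" for n
      proof (intro AE_I2 pb)
        fix y
        show "\<bar>?q n (x - y)\<bar> \<le> K * norm v"
          using lipschitz_dq[OF w(2), of "x - y" "1 / real (Suc n)" v] by (simp add: abs_mult pos_le_divide_eq)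
      qed
    qed measurable
  qed
  note L = C1_with_line[OF C1_moll[OF h c, of 0 0], of x _ 0, unfolded has_field_derivative_iff]
  have **: "(\<lambda>n. (moll 0 0 h w (x + (1 / real (Suc n)) *\<^sub>R v) - moll 0 0 h w x) / (1 / real (Suc n)))
     \<longlonglongrightarrow> moll (Suc 0) 0 h w x * v $ 1 + moll 0 (Suc 0) h w x * v $ 2" for v
    using filterlim_compose[OF L[of v] t0] by simp
  show "moll (Suc 0) 0 h w x = (LINT y|lborel. ddir (axis 1 1) w (x - y) * kern 0 0 h y)"
    using LIMSEQ_unique[OF ** *, of "axis 1 1"] by (simp add: axis_def)
  show "moll 0 (Suc 0) h w x = (LINT y|lborel. ddir (axis 2 1) w (x - y) * kern 0 0 h y)"
    using LIMSEQ_unique[OF ** *, of "axis 2 1"] by (simp add: axis_def)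
qed

section \<open>Smooth strictly convex approximation\<close>

text \<open>\<open>P\<close>, \<open>Q\<close> are the first and \<open>A\<close>, \<open>B\<close>,
  \<open>C\<close> the second derivatives of \<open>W\<close>. \<open>T\<close> is the third
  derivative shared by \<open>A\<close> in the second and \<open>B\<close> in the first variable; it
  cancels when the strain residual is differentiated. The strict supporting inequality makes the
  gradient injective.\<close>

definition sconv where
  "sconv W P Q A B C T \<longleftrightarrow> C1_with W P Q \<and> C1_with P A B \<and> C1_with Q B C \<and>
     (\<exists>S. C1_with A S T) \<and> (\<exists>S. C1_with B T S) \<and>
     (\<forall>x y. x \<noteq> y \<longrightarrow> W y > W x + (P x * (y - x) $ 1 + Q x * (y - x) $ 2)) \<and>
     (\<forall>x. A x * C x - (B x)\<^sup>2 \<ge> 0)"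

text \<open>Monotonicity of the gradient makes the Hessian form nonnegative in every direction; the
  sign of the determinant is read off from the direction (-B, A).\<close>

lemma convex_hessian_det:
  assumes W: "convex_on UNIV W" and C: "C1_with W P Q" "C1_with P A B" "C1_with Q B C"
  shows "A x * C x - (B x)\<^sup>2 \<ge> 0" "A x \<ge> 0" "C x \<ge> 0"
proof -
  have q: "A x * (d $ 1)\<^sup>2 + 2 * B x * d $ 1 * d $ 2 + C x * (d $ 2)\<^sup>2 \<ge> 0" for d :: "real^2"
  proof -
    let ?m = "\<lambda>t. P (x + t *\<^sub>R d) * d $ 1 + Q (x + t *\<^sub>R d) * d $ 2"
    have D: "(?m has_real_derivative ((A x * d $ 1 + B x * d $ 2) * d $ 1 + (B x * d $ 1 + C x * d $ 2) * d $ 2)) (at 0)"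
      using C1_with_line[OF C(2), of x d 0] C1_with_line[OF C(3), of x d 0]
      by (auto intro!: derivative_eq_intros)
    then have "((\<lambda>t. (?m t - ?m 0) / (t - 0)) \<longlongrightarrow> ((A x * d $ 1 + B x * d $ 2) * d $ 1 + (B x * d $ 1 + C x * d $ 2) * d $ 2)) (at 0)"
      unfolding has_field_derivative_iff .
    moreover have "eventually (\<lambda>t. 0 \<le> (?m t - ?m 0) / (t - 0)) (at 0)"
    proof (rule eventuallyI)
      fix t :: real
      have "W (x + t *\<^sub>R d) \<ge> W x + t * ?m 0" "W x \<ge> W (x + t *\<^sub>R d) - t * ?m t"
        using convex_C1_subgradient[OF W C(1), of x "x + t *\<^sub>R d"] convex_C1_subgradient[OF W C(1), of "x + t *\<^sub>R d" x]
        by (simp_all add: algebra_simps)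
      then have "t * (?m t - ?m 0) \<ge> 0" by (simp add: right_diff_distrib)
      then show "0 \<le> (?m t - ?m 0) / (t - 0)" by (auto simp: zero_le_divide_iff zero_le_mult_iff)
    qed
    ultimately have "0 \<le> (A x * d $ 1 + B x * d $ 2) * d $ 1 + (B x * d $ 1 + C x * d $ 2) * d $ 2"
      by (rule tendsto_lowerbound) simp
    then show ?thesis by (simp add: algebra_simps power2_eq_square)
  qed
  show A: "A x \<ge> 0" and "C x \<ge> 0" using q[of "vector [1, 0]"] q[of "vector [0, 1]"] by auto
  show "A x * C x - (B x)\<^sup>2 \<ge> 0"
  proof (cases "A x = 0")
    case True
    have "B x = 0"
    proof (rule ccontr)
      assume "B x \<noteq> 0"
      \<comment> \<open>In this direction the form takes the value -1.\<close>
      then show False using q[of "vector [- (C x + 1) / (2 * B x), 1]"] True by simp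
    qed
    then show ?thesis using True by simp
  next
    case False
    have "A x * (A x * C x - (B x)\<^sup>2) \<ge> 0"
      using q[of "vector [- B x, A x]"] by (simp add: algebra_simps power2_eq_square)
    then show ?thesis using A False by (simp add: zero_le_mult_iff)
  qed
qed

text \<open>The small paraboloid makes the mollification strictly convex, so that its gradient is
  injective and the area formula gives the exact measure of a set of slopes.\<close>

definition apx :: "(real^2 \<Rightarrow> real) \<Rightarrow> nat \<Rightarrow> real^2 \<Rightarrow> real" where
  "apx w n x = moll 0 0 (1 / real (Suc n)) w x + (1 / real (Suc n)) * ((x $ 1)\<^sup>2 + (x $ 2)\<^sup>2) / 2"
definition apx1 where
  "apx1 w n x = moll (Suc 0) 0 (1 / real (Suc n)) w x + (1 / real (Suc n)) * x $ 1"
definition apx2 where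
  "apx2 w n x = moll 0 (Suc 0) (1 / real (Suc n)) w x + (1 / real (Suc n)) * x $ 2"
definition apx11 where
  "apx11 w n x = moll (Suc (Suc 0)) 0 (1 / real (Suc n)) w x + 1 / real (Suc n)"
definition apx12 where
  "apx12 w n = moll (Suc 0) (Suc 0) (1 / real (Suc n)) w"
definition apx22 where
  "apx22 w n x = moll 0 (Suc (Suc 0)) (1 / real (Suc n)) w x + 1 / real (Suc n)"
definition apx112 where
  "apx112 w n = moll (Suc (Suc 0)) (Suc 0) (1 / real (Suc n)) w"

lemma C1_with_add:
  assumes "C1_with f f1 f2" "C1_with g g1 g2"
  shows "C1_with (\<lambda>x. f x + g x) (\<lambda>x. f1 x + g1 x) (\<lambda>x. f2 x + g2 x)"
  unfolding C1_with_def
proof (intro conjI allI)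
  fix x
  have "((\<lambda>x. f x + g x) has_derivative (\<lambda>d. (f1 x * d $ 1 + f2 x * d $ 2) + (g1 x * d $ 1 + g2 x * d $ 2))) (at x)"
    using assms by (intro has_derivative_add) (auto simp: C1_with_def)
  then show "((\<lambda>x. f x + g x) has_derivative (\<lambda>d. (f1 x + g1 x) * d $ 1 + (f2 x + g2 x) * d $ 2)) (at x)"
    by (simp add: algebra_simps)
qed (use assms in \<open>auto simp: C1_with_def intro!: continuous_intros\<close>)

lemma C1_with_poly:
  "C1_with (\<lambda>x. c * ((x $ 1)\<^sup>2 + (x $ 2)\<^sup>2) / 2) (\<lambda>x. c * x $ 1) (\<lambda>x. c * x $ 2)"
  "C1_with (\<lambda>x. c * x $ 1) (\<lambda>x. c) (\<lambda>x. 0)"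
  "C1_with (\<lambda>x. c * x $ 2) (\<lambda>x. 0) (\<lambda>x. c)"
  "C1_with (\<lambda>x. c) (\<lambda>x. 0) (\<lambda>x. 0)"
  by (auto simp: C1_with_def bounded_linear_vec_nth power2_eq_square
      intro!: continuous_intros derivative_eq_intros bounded_linear.has_derivative[OF bounded_linear_vec_nth])
    (auto simp: algebra_simps)

lemma apx_sconv:
  assumes w: "convex_on UNIV w" "K-lipschitz_on UNIV w"
  shows "sconv (apx w n) (apx1 w n) (apx2 w n) (apx11 w n) (apx12 w n) (apx22 w n) (apx112 w n)"
proof -
  define h where "h = 1 / real (Suc n)"
  have h: "h > 0" by (simp add: h_def)
  have c: "continuous_on UNIV w" using w(2) by (rule lipschitz_on_continuous_on)
  note M = C1_moll[OF h c]
  have 1: "C1_with (apx w n) (apx1 w n) (apx2 w n)"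
    unfolding apx_def[abs_def] apx1_def[abs_def] apx2_def[abs_def] h_def[symmetric]
    by (intro C1_with_add M C1_with_poly)
  have 2: "C1_with (apx1 w n) (apx11 w n) (apx12 w n)"
    using C1_with_add[OF M C1_with_poly(2), of "Suc 0" 0 h]
    unfolding apx1_def[abs_def] apx11_def[abs_def] apx12_def[abs_def] h_def[symmetric] by simp
  have 3: "C1_with (apx2 w n) (apx12 w n) (apx22 w n)"
    using C1_with_add[OF M C1_with_poly(3), of 0 "Suc 0" h]
    unfolding apx2_def[abs_def] apx12_def[abs_def] apx22_def[abs_def] h_def[symmetric] by simp
  have 4: "C1_with (apx11 w n) (moll (Suc (Suc (Suc 0))) 0 h w) (apx112 w n)"
    using C1_with_add[OF M C1_with_poly(4), of "Suc (Suc 0)" 0 h]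
    unfolding apx112_def[abs_def] apx11_def[abs_def] h_def[symmetric] by simp
  have 5: "C1_with (apx12 w n) (apx112 w n) (moll (Suc 0) (Suc (Suc 0)) h w)"
    using M[of "Suc 0" "Suc 0"]
    unfolding apx112_def[abs_def] apx12_def[abs_def] h_def[symmetric] by simp
  have 6: "apx w n y > apx w n x + (apx1 w n x * (y - x) $ 1 + apx2 w n x * (y - x) $ 2)" if "x \<noteq> y" for x y
  proof -
    have "moll 0 0 h w y \<ge> moll 0 0 h w x + (moll (Suc 0) 0 h w x * (y - x) $ 1 + moll 0 (Suc 0) h w x * (y - x) $ 2)"
      by (rule convex_C1_subgradient[OF moll_convex[OF h w] M])
    moreover have "y $ 1 \<noteq> x $ 1 \<or> y $ 2 \<noteq> x $ 2" using that by (auto simp: vec_eq_iff forall_2)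
    then have "h * ((y $ 1 - x $ 1)\<^sup>2 + (y $ 2 - x $ 2)\<^sup>2) / 2 > 0"
      using h by (auto intro!: mult_pos_pos simp: sum_power2_gt_zero_iff)
    ultimately show ?thesis
      unfolding apx_def apx1_def apx2_def h_def[symmetric]
      by (simp add: algebra_simps power2_eq_square add_divide_distrib)
  qed
  have 7: "apx11 w n x * apx22 w n x - (apx12 w n x)\<^sup>2 \<ge> 0" for x
  proof (rule convex_hessian_det[OF _ 1 2 3])
    show "convex_on UNIV (apx w n)"
    proof (rule convex_onI)
      fix t :: real and x y :: "real^2" assume t: "0 < t" "t < 1"
      let ?z = "(1 - t) *\<^sub>R x + t *\<^sub>R y"
      let ?g = "\<lambda>y. apx1 w n ?z * (y - ?z) $ 1 + apx2 w n ?z * (y - ?z) $ 2"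
      have s: "apx w n y \<ge> apx w n ?z + ?g y" for y
        using 6[of ?z y] by (cases "?z = y") auto
      have "(1 - t) * (apx w n ?z + ?g x) + t * (apx w n ?z + ?g y) \<le> (1 - t) * apx w n x + t * apx w n y"
        using s[of x] s[of y] t by (intro add_mono mult_left_mono) auto
      moreover have "(1 - t) * (apx w n ?z + ?g x) + t * (apx w n ?z + ?g y) = apx w n ?z"
        by (simp add: algebra_simps)
      ultimately show "apx w n ?z \<le> (1 - t) * apx w n x + t * apx w n y" by simp
    qed simp
  qed
  show ?thesis unfolding sconv_def using 1 2 3 4 5 6 7 by blast
qed

lemma apx_bounds:
  assumes w: "convex_on UNIV w" "K-lipschitz_on UNIV w"
  shows "\<bar>apx w n x - w x\<bar> \<le> (2 * K + (norm x)\<^sup>2) * (1 / real (Suc n))"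
    and "\<bar>apx1 w n x\<bar> \<le> K + norm x" "\<bar>apx2 w n x\<bar> \<le> K + norm x"
proof -
  define h where "h = 1 / real (Suc n)"
  have h: "h > 0" "h \<le> 1" by (simp_all add: h_def)
  have nx: "(x $ 1)\<^sup>2 + (x $ 2)\<^sup>2 = (norm x)\<^sup>2" by (simp add: norm_vec_def L2_set_def sum_2)
  have "\<bar>apx w n x - w x\<bar> \<le> \<bar>moll 0 0 h w x - w x\<bar> + \<bar>h * (norm x)\<^sup>2 / 2\<bar>"
    unfolding apx_def h_def[symmetric] nx by linarith
  also have "\<dots> \<le> 2 * K * h + h * (norm x)\<^sup>2"
    using moll_close[OF h(1) w(2), of x] h by (intro add_mono) auto
  finally show "\<bar>apx w n x - w x\<bar> \<le> (2 * K + (norm x)\<^sup>2) * (1 / real (Suc n))"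
    unfolding h_def[symmetric] by (simp add: algebra_simps)
  have b: "\<bar>h * x $ i\<bar> \<le> norm x" for i
    using mult_mono[OF h(2) component_le_norm_cart[of x i]] h by (simp add: abs_mult)
  show "\<bar>apx1 w n x\<bar> \<le> K + norm x" "\<bar>apx2 w n x\<bar> \<le> K + norm x"
    using moll_deriv_bound[OF h(1) w(2), of 0 0 x] b[of 1] b[of 2]
    unfolding apx1_def apx2_def h_def[symmetric] by (auto simp: kern_mass_0)
qed

section \<open>The Monge-Ampere measures of the approximations\<close>

lemma inner_vec2: "(x::real^2) \<bullet> y = x $ 1 * y $ 1 + x $ 2 * y $ 2"
  by (simp add: inner_vec_def sum_2)

definition gmap :: "(real^2 \<Rightarrow> real) \<Rightarrow> (real^2 \<Rightarrow> real) \<Rightarrow> real^2 \<Rightarrow> real^2" where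
  "gmap P Q x = vector [P x, Q x]"

lemma gmap_nth [simp]: "gmap P Q x $ 1 = P x" "gmap P Q x $ 2 = Q x"
  by (simp_all add: gmap_def)

text \<open>At two points with equal gradient the strict supporting inequalities would add up to a
  contradiction. The area formula therefore applies to the gradient map, whose Jacobian is the
  Hessian determinant.\<close>

lemma sconv_gradient_image:
  assumes s: "sconv W P Q A B C T" and S: "compact S"
  shows "compact (gmap P Q ` S)"
    and "measure lebesgue (gmap P Q ` S) = (LINT x:S|lborel. A x * C x - (B x)\<^sup>2)"
proof -
  have C: "C1_with W P Q" "C1_with P A B" "C1_with Q B C" and pos: "A x * C x - (B x)\<^sup>2 \<ge> 0" for x
    using s by (auto simp: sconv_def)
  have c: "continuous_on UNIV P" "continuous_on UNIV Q" "continuous_on UNIV A" "continuous_on UNIV B" "continuous_on UNIV C"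
    using C C1_with_continuous[OF C(2)] C1_with_continuous[OF C(3)] by (auto simp: C1_with_def)
  let ?g' = "\<lambda>x (d::real^2). vector [A x * d $ 1 + B x * d $ 2, B x * d $ 1 + C x * d $ 2] :: real^2"
  have der: "(gmap P Q has_derivative ?g' x) (at x)" for x
  proof -
    have "((\<lambda>x. P x *\<^sub>R (axis 1 1) + Q x *\<^sub>R axis 2 1 :: real^2) has_derivative
       (\<lambda>d::real^2. (A x * d $ 1 + B x * d $ 2) *\<^sub>R axis 1 1 + (B x * d $ 1 + C x * d $ 2) *\<^sub>R axis 2 1)) (at x)"
      using C by (intro has_derivative_add has_derivative_scaleR_left) (auto simp: C1_with_def)
    moreover have "(\<lambda>x. P x *\<^sub>R (axis 1 1) + Q x *\<^sub>R axis 2 1 :: real^2) = gmap P Q"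
      "(\<lambda>d::real^2. (A x * d $ 1 + B x * d $ 2) *\<^sub>R axis 1 1 + (B x * d $ 1 + C x * d $ 2) *\<^sub>R axis 2 1) = ?g' x"
      by (auto simp: fun_eq_iff vec_eq_iff forall_2 axis_def)
    ultimately show ?thesis by simp
  qed
  then have cg: "continuous_on S (gmap P Q)"
    by (meson continuous_at_imp_continuous_on has_derivative_continuous)
  then show cpt: "compact (gmap P Q ` S)" using S by (rule compact_continuous_image)
  have inj: "inj_on (gmap P Q) S"
  proof (rule inj_onI, rule ccontr)
    fix x y assume "gmap P Q x = gmap P Q y" and ne: "x \<noteq> y"
    then have "P x = P y" "Q x = Q y" by (metis gmap_nth)+
    moreover have "W y > W x + (P x * (y - x) $ 1 + Q x * (y - x) $ 2)"
      "W x > W y + (P y * (x - y) $ 1 + Q y * (x - y) $ 2)"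
      using s ne by (auto simp: sconv_def)
    ultimately show False by (simp add: algebra_simps)
  qed
  have det: "\<bar>det (matrix (?g' x))\<bar> = A x * C x - (B x)\<^sup>2" for x
    using pos[of x] by (simp add: det_2 matrix_def axis_def power2_eq_square)
  have set: "set_integrable lborel S (\<lambda>x. A x * C x - (B x)\<^sup>2)"
    unfolding set_integrable_def
    by (intro borel_integrable_compact S continuous_intros) (auto intro: continuous_on_subset[OF c(3)] continuous_on_subset[OF c(4)] continuous_on_subset[OF c(5)])
  have "measure lebesgue (gmap P Q ` S) = integral S (\<lambda>x. \<bar>det (matrix (?g' x))\<bar>)"
    using S der inj set_borel_integral_eq_integral(1)[OF set]
    by (intro measure_differentiable_image_eq) (auto simp: det compact_imp_closed intro: has_derivative_at_withinI)
  then show "measure lebesgue (gmap P Q ` S) = (LINT x:S|lborel. A x * C x - (B x)\<^sup>2)"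
    using set_borel_integral_eq_integral(2)[OF set] by (simp add: det)
qed

text \<open>If slopes converge, then a subsequence of their base points converges in
  \<open>E\<close>, and the supporting inequalities pass to the limit. Closedness supplies
  measurability of these sets of slopes.\<close>

lemma closed_subdiff_compact:
  fixes w :: "real^2 \<Rightarrow> real"
  assumes E: "compact E" and c: "continuous_on E w"
  shows "closed (\<Union>x\<in>E. subdiff \<Omega> w x)"
  unfolding closed_sequential_limits
proof (intro allI impI, elim conjE)
  fix p l assume p: "\<forall>n. p n \<in> (\<Union>x\<in>E. subdiff \<Omega> w x)" and l: "p \<longlonglongrightarrow> l"
  then have "\<forall>n. \<exists>x. x \<in> E \<and> p n \<in> subdiff \<Omega> w x" by blast
  then obtain x where x: "\<And>n. x n \<in> E" "\<And>n. p n \<in> subdiff \<Omega> w (x n)" unfolding choice_iff by blast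
  obtain z r where z: "z \<in> E" and r: "strict_mono (r::nat \<Rightarrow> nat)" and lim: "(x \<circ> r) \<longlonglongrightarrow> z"
    using E x(1) unfolding compact_def by metis
  have wl: "(\<lambda>n. w (x (r n))) \<longlonglongrightarrow> w z"
    using continuous_on_tendsto_compose[OF c lim z] x(1) by (simp add: o_def)
  have pl: "(\<lambda>n. p (r n)) \<longlonglongrightarrow> l" using LIMSEQ_subseq_LIMSEQ[OF l r] by (simp add: o_def)
  have "l \<bullet> (y - z) + w z \<le> w y" if "y \<in> \<Omega>" for y
  proof (rule LIMSEQ_le_const2)
    show "(\<lambda>n. p (r n) \<bullet> (y - x (r n)) + w (x (r n))) \<longlonglongrightarrow> l \<bullet> (y - z) + w z"
      using lim by (intro tendsto_intros pl wl) (simp add: o_def)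
    show "\<exists>N. \<forall>n\<ge>N. p (r n) \<bullet> (y - x (r n)) + w (x (r n)) \<le> w y"
      using x(2) that by (auto simp: subdiff_def)
  qed
  then show "l \<in> (\<Union>x\<in>E. subdiff \<Omega> w x)" using z by (auto simp: subdiff_def)
qed

text \<open>A slope attained in \<open>E\<close> by infinitely many approximations supports w at
  some point of \<open>E\<close>. Hence the decreasing tails of the gradient images shrink to a set
  of measure at most m; the bound \<open>R\<close> makes continuity from above applicable.\<close>

lemma MA_upper:
  fixes w :: "real^2 \<Rightarrow> real"
  assumes s: "\<And>n. sconv (W n) (P n) (Q n) (A n) (B n) (C n) (T n)"
    and c: "continuous_on UNIV w"
    and close: "\<And>n x. x \<in> \<Omega> \<Longrightarrow> \<bar>W n x - w x\<bar> \<le> e n" and e: "e \<longlonglongrightarrow> 0"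
    and gb: "\<And>n x. x \<in> \<Omega> \<Longrightarrow> norm (gmap (P n) (Q n) x) \<le> R"
    and E: "compact E" "E \<subseteq> \<Omega>"
    and m: "emeasure lebesgue (\<Union>x\<in>E. subdiff \<Omega> w x) = ennreal m" "m \<ge> 0" and "\<eta> > 0"
  shows "eventually (\<lambda>n. (LINT x:E|lborel. A n x * C n x - (B n x)\<^sup>2) < m + \<eta>) sequentially"
proof -
  define G where "G n = gmap (P n) (Q n) ` E" for n
  define U where "U k = (\<Union>n\<in>{k..}. G n)" for k
  define D where "D = (\<Union>x\<in>E. subdiff \<Omega> w x)"
  have Gc: "compact (G n)" for n unfolding G_def by (rule sconv_gradient_image(1)[OF s E(1)])
  have Gm: "measure lebesgue (G n) = (LINT x:E|lborel. A n x * C n x - (B n x)\<^sup>2)" for n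
    unfolding G_def by (rule sconv_gradient_image(2)[OF s E(1)])
  have Um: "U k \<in> sets lebesgue" for k
    unfolding U_def using Gc by (intro sets.countable_UN') (auto simp: compact_imp_closed)
  have Ub: "U k \<subseteq> cball 0 R" for k
    using gb E by (auto simp: U_def G_def)
  have Ulm: "U k \<in> lmeasurable" for k
    by (rule bounded_set_imp_lmeasurable[OF bounded_subset[OF bounded_cball Ub] Um])
  have "U l \<subseteq> U k" if "k \<le> l" for k l using that unfolding U_def by (intro UN_mono) auto
  then have dec: "decseq U" by (auto simp: antimono_def)
  have lU: "(\<lambda>k. measure lebesgue (U k)) \<longlonglongrightarrow> measure lebesgue (\<Inter>k. U k)"
  proof (rule Lim_measure_decseq[OF _ dec])
    show "range U \<subseteq> sets lebesgue" using Um by blast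
    show "emeasure lebesgue (U k) \<noteq> \<infinity>" for k
      unfolding infinity_ennreal_def by (rule fmeasurableD2[OF Ulm])
  qed
  have "(\<Inter>k. U k) \<subseteq> D"
  proof
    fix p assume "p \<in> (\<Inter>k. U k)"
    then have "\<forall>k. \<exists>n x. n \<ge> k \<and> x \<in> E \<and> gmap (P n) (Q n) x = p"
      by (fastforce simp: U_def G_def)
    then obtain N x where N: "\<And>k::nat. N k \<ge> k" and x: "\<And>k. x k \<in> E" and p: "\<And>k. gmap (P (N k)) (Q (N k)) (x k) = p"
      unfolding choice_iff by blast
    obtain z r where z: "z \<in> E" and r: "strict_mono (r::nat \<Rightarrow> nat)" and lim: "(x \<circ> r) \<longlonglongrightarrow> z"
      using E x unfolding compact_def by metis
    have zl: "(\<lambda>k. x (r k)) \<longlonglongrightarrow> z" using lim by (simp add: o_def)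
    have wl: "(\<lambda>k. w (x (r k))) \<longlonglongrightarrow> w z"
      using continuous_on_tendsto_compose[OF c zl] by simp
    have "filterlim (\<lambda>k. N (r k)) sequentially sequentially"
    proof (rule filterlim_at_top_mono[OF filterlim_ident])
      have "N (r k) \<ge> k" for k using N[of "r k"] seq_suble[OF r, of k] by linarith
      then show "eventually (\<lambda>k. k \<le> N (r k)) sequentially" by auto
    qed
    then have el: "(\<lambda>k. e (N (r k))) \<longlonglongrightarrow> 0" using filterlim_compose[OF e] by blast
    have "p \<bullet> (y - z) + w z \<le> w y" if y: "y \<in> \<Omega>" for y
    proof -
      \<comment> \<open>Replacing \<open>W\<close> by w at y and at the base point costs one
        \<open>e\<close> each.\<close>
      have "(\<lambda>k. p \<bullet> (y - x (r k)) + w (x (r k)) - 2 * e (N (r k))) \<longlonglongrightarrow> p \<bullet> (y - z) + w z - 2 * 0"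
        by (intro tendsto_intros zl wl el)
      moreover have "p \<bullet> (y - x (r k)) + w (x (r k)) - 2 * e (N (r k)) \<le> w y" for k
      proof -
        let ?n = "N (r k)" and ?x = "x (r k)"
        have pe: "p $ 1 = P ?n ?x" "p $ 2 = Q ?n ?x" using p[of "r k"] by (auto simp: vec_eq_iff forall_2)
        have "W ?n y \<ge> W ?n ?x + (P ?n ?x * (y - ?x) $ 1 + Q ?n ?x * (y - ?x) $ 2)"
          using s[of ?n] unfolding sconv_def by (cases "?x = y") (auto intro: less_imp_le)
        moreover have "\<bar>W ?n y - w y\<bar> \<le> e ?n" "\<bar>W ?n ?x - w ?x\<bar> \<le> e ?n"
          using close y x E by auto
        ultimately show ?thesis using pe by (simp add: inner_vec2 abs_le_iff)
      qed
      ultimately show ?thesis using LIMSEQ_le_const2 by fastforce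
    qed
    then show "p \<in> D" using z by (auto simp: D_def subdiff_def)
  qed
  then have mU: "measure lebesgue (\<Inter>k. U k) \<le> m"
  proof -
    have "closed D" unfolding D_def by (rule closed_subdiff_compact[OF E(1) continuous_on_subset[OF c]]) simp
    then have "D \<in> lmeasurable" using m by (intro fmeasurableI) (auto simp: D_def)
    moreover have "measure lebesgue D = m" using m by (simp add: measure_def D_def)
    ultimately show ?thesis
      using measure_mono_fmeasurable[OF \<open>(\<Inter>k. U k) \<subseteq> D\<close>, of lebesgue] Um by auto
  qed
  from \<open>\<eta> > 0\<close> mU have "eventually (\<lambda>k. measure lebesgue (U k) < m + \<eta>) sequentially"
    by (intro order_tendstoD(2)[OF lU]) linarith
  then show ?thesis
  proof (rule eventually_mono)
    fix k assume "measure lebesgue (U k) < m + \<eta>"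
    moreover have "measure lebesgue (G k) \<le> measure lebesgue (U k)"
      using Gc Ulm by (intro measure_mono_fmeasurable) (auto simp: U_def compact_imp_closed)
    ultimately show "(LINT x:E|lborel. A k x * C k x - (B k x)\<^sup>2) < m + \<eta>" using Gm by simp
  qed
qed

lemma convex_subdiff: "convex (subdiff \<Omega> w x)"
proof (rule convexI)
  fix p q u v assume *: "p \<in> subdiff \<Omega> w x" "q \<in> subdiff \<Omega> w x" "(0::real) \<le> u" "0 \<le> v" "u + v = 1"
  show "u *\<^sub>R p + v *\<^sub>R q \<in> subdiff \<Omega> w x"
    unfolding subdiff_def
  proof (intro CollectI ballI)
    fix y assume "y \<in> \<Omega>"
    then have "u * (p \<bullet> (y - x) + w x) + v * (q \<bullet> (y - x) + w x) \<le> u * w y + v * w y"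
      using * by (intro add_mono mult_left_mono) (auto simp: subdiff_def)
    moreover have "u * w y + v * w y = w y" "u * w x + v * w x = w x"
      using *(5) by (metis distrib_right mult_1_left)+
    ultimately show "(u *\<^sub>R p + v *\<^sub>R q) \<bullet> (y - x) + w x \<le> w y"
      by (simp add: inner_add_left algebra_simps)
  qed
qed

text \<open>A slope p interior to the subdifferential at a is attained by all late approximations: w
  exceeds its supporting plane by a cone with vertex a, so the minimum of \<open>W n\<close> minus
  the linear function p over a small ball is not on the sphere. Continuity from below concludes,
  since the boundary of a convex set is null.\<close>

lemma MA_lower:
  fixes w :: "real^2 \<Rightarrow> real"
  assumes s: "\<And>n. sconv (W n) (P n) (Q n) (A n) (B n) (C n) (T n)"
    and close: "\<And>n x. x \<in> \<Omega> \<Longrightarrow> \<bar>W n x - w x\<bar> \<le> e n" and e: "e \<longlonglongrightarrow> 0"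
    and E: "compact E" "E \<subseteq> \<Omega>" and a: "a \<in> interior E"
    and m: "emeasure lebesgue (subdiff \<Omega> w a) = ennreal m" "m \<ge> 0" and "\<eta> > 0"
  shows "eventually (\<lambda>n. (LINT x:E|lborel. A n x * C n x - (B n x)\<^sup>2) > m - \<eta>) sequentially"
proof -
  define G where "G n = gmap (P n) (Q n) ` E" for n
  define I where "I = interior (subdiff \<Omega> w a)"
  define V where "V k = I \<inter> (\<Inter>n\<in>{k..}. G n)" for k
  have Gc: "compact (G n)" for n unfolding G_def by (rule sconv_gradient_image(1)[OF s E(1)])
  have Gm: "measure lebesgue (G n) = (LINT x:E|lborel. A n x * C n x - (B n x)\<^sup>2)" for n
    unfolding G_def by (rule sconv_gradient_image(2)[OF s E(1)])
  have cl: "closed (subdiff \<Omega> w a)"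
    using closed_subdiff_compact[of "{a}" w \<Omega>] by simp
  have Ilm: "I \<in> lmeasurable"
  proof -
    have "subdiff \<Omega> w a \<in> lmeasurable"
    proof (rule fmeasurableI)
      show "subdiff \<Omega> w a \<in> sets lebesgue" using cl by simp
      show "emeasure lebesgue (subdiff \<Omega> w a) < \<infinity>" unfolding m(1) by simp
    qed
    then show ?thesis unfolding I_def by (rule fmeasurableI2[OF _ interior_subset]) auto
  qed
  have Im: "measure lebesgue I = m"
  proof -
    have "frontier (subdiff \<Omega> w a) \<in> null_sets lebesgue"
      using negligible_convex_frontier[OF convex_subdiff] by (simp add: negligible_iff_null_sets)
    moreover have "subdiff \<Omega> w a = I \<union> frontier (subdiff \<Omega> w a)"
      using cl interior_subset[of "subdiff \<Omega> w a"] by (auto simp: I_def frontier_def)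
    ultimately have "emeasure lebesgue (subdiff \<Omega> w a) = emeasure lebesgue I"
      using emeasure_Un_null_set[of I lebesgue "frontier (subdiff \<Omega> w a)"] Ilm by simp
    then have "emeasure lebesgue I = ennreal m" unfolding m(1) by (rule sym)
    then show ?thesis unfolding measure_def using m(2) by (simp only: enn2real_ennreal)
  qed
  have Vm: "V k \<in> sets lebesgue" for k
    unfolding V_def using Gc by (intro sets.Int sets.countable_INT'') (auto simp: compact_imp_closed I_def)
  have "V k \<subseteq> V l" if "k \<le> l" for k l using that unfolding V_def by auto
  then have inc: "incseq V" by (auto simp: mono_def)
  have "(\<Union>k. V k) = I"
  proof
    show "(\<Union>k. V k) \<subseteq> I" by (auto simp: V_def)
    show "I \<subseteq> (\<Union>k. V k)"
    proof
      fix p assume p: "p \<in> I"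
      then obtain r where r: "r > 0" "cball p r \<subseteq> subdiff \<Omega> w a"
        unfolding I_def mem_interior_cball by blast
      have cone: "w y \<ge> w a + p \<bullet> (y - a) + r * norm (y - a)" if "y \<in> \<Omega>" for y
      proof (cases "y = a")
        case False
        \<comment> \<open>Moving p by r in the direction of y - a stays in the subdifferential and
          gains r |y - a|.\<close>
        define p' where "p' = p + (r / norm (y - a)) *\<^sub>R (y - a)"
        have "p' \<in> cball p r" using r False by (simp add: p'_def dist_norm)
        then have "p' \<bullet> (y - a) + w a \<le> w y" using r that by (auto simp: subdiff_def)
        then show ?thesis using False by (simp add: p'_def inner_add_left dot_square_norm power2_eq_square)
      qed simp
      obtain \<rho> where \<rho>: "\<rho> > 0" "cball a \<rho> \<subseteq> E" using a unfolding mem_interior_cball by blast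
      \<comment> \<open>On the sphere the cone gains r \<rho>, while the approximation loses at most
        twice \<open>e n\<close>.\<close>
      have "eventually (\<lambda>n. e n < r * \<rho> / 2) sequentially"
        using r \<rho> by (intro order_tendstoD(2)[OF e]) auto
      then obtain k where k: "\<And>n. n \<ge> k \<Longrightarrow> e n < r * \<rho> / 2" by (auto simp: eventually_sequentially)
      have "p \<in> G n" if n: "n \<ge> k" for n
      proof -
        let ?f = "\<lambda>y. W n y - p \<bullet> y"
        have CW: "C1_with (W n) (P n) (Q n)" using s by (auto simp: sconv_def)
        have "continuous_on (cball a \<rho>) ?f"
          by (intro continuous_intros continuous_on_subset[OF C1_with_continuous[OF CW]]) auto
        then obtain z where z: "z \<in> cball a \<rho>" "\<And>y. y \<in> cball a \<rho> \<Longrightarrow> ?f z \<le> ?f y"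
          using continuous_attains_inf[of "cball a \<rho>" ?f] \<rho> by auto
        have "a \<in> cball a \<rho>" using \<rho> by simp
        then have zO: "z \<in> \<Omega>" "a \<in> \<Omega>" using z(1) \<rho>(2) E(2) by blast+
        have "norm (z - a) < \<rho>"
        proof (rule ccontr)
          assume "\<not> norm (z - a) < \<rho>"
          then have "r * norm (z - a) \<ge> r * \<rho>" using r by (intro mult_left_mono) auto
          moreover have "?f z \<le> ?f a" using z \<rho> by simp
          ultimately show False
            using cone[OF zO(1)] close[OF zO(1), of n] close[OF zO(2), of n] k[OF n]
            by (simp add: abs_le_iff inner_diff_right)
        qed
        then have zb: "z \<in> ball a \<rho>" by (simp add: dist_norm norm_minus_commute)
        have "(?f has_derivative (\<lambda>d. (P n z * d $ 1 + Q n z * d $ 2) - p \<bullet> d)) (at z)"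
          using CW by (intro has_derivative_diff bounded_linear.has_derivative[OF bounded_linear_inner_right] has_derivative_ident)
            (auto simp: C1_with_def)
        then have "(\<lambda>d. (P n z * d $ 1 + Q n z * d $ 2) - p \<bullet> d) = (\<lambda>d. 0)"
          by (rule differential_zero_maxmin[OF zb open_ball]) (use z in auto)
        from fun_cong[OF this, of "axis 1 1"] fun_cong[OF this, of "axis 2 1"]
        have "gmap (P n) (Q n) z = p" by (simp add: inner_vec2 vec_eq_iff forall_2 axis_def)
        then show ?thesis using z \<rho> by (auto simp: G_def)
      qed
      then have "p \<in> V k" using p by (auto simp: V_def)
      then show "p \<in> (\<Union>k. V k)" by blast
    qed
  qed
  then have UV: "(\<Union>k. V k) = I" .
  have "(\<lambda>k. measure lebesgue (V k)) \<longlonglongrightarrow> measure lebesgue (\<Union>k. V k)"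
  proof (rule Lim_measure_incseq[OF _ inc])
    show "range V \<subseteq> sets lebesgue" using Vm by blast
    show "emeasure lebesgue (\<Union>k. V k) \<noteq> \<infinity>"
      unfolding infinity_ennreal_def UV by (rule fmeasurableD2[OF Ilm])
  qed
  then have "(\<lambda>k. measure lebesgue (V k)) \<longlonglongrightarrow> m" unfolding UV Im .
  from order_tendstoD(1)[OF this, of "m - \<eta>"]
  obtain k where k: "measure lebesgue (V k) > m - \<eta>" using \<open>\<eta> > 0\<close> by (auto simp: eventually_sequentially)
  have "(LINT x:E|lborel. A n x * C n x - (B n x)\<^sup>2) > m - \<eta>" if "n \<ge> k" for n
  proof -
    have "measure lebesgue (V k) \<le> measure lebesgue (G n)"
      using Vm Gc that by (intro measure_mono_fmeasurable) (auto simp: V_def lmeasurable_compact)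
    then show ?thesis using k Gm by simp
  qed
  then show ?thesis by (auto simp: eventually_sequentially)
qed

text \<open>If all the mass of \<open>E\<close> sits at one interior point, the upper bound for
  \<open>E\<close> and the lower bound for that point coincide.\<close>

lemma MA_point_limits:
  fixes w :: "real^2 \<Rightarrow> real"
  assumes s: "\<And>n. sconv (W n) (P n) (Q n) (A n) (B n) (C n) (T n)"
    and c: "continuous_on UNIV w"
    and close: "\<And>n x. x \<in> \<Omega> \<Longrightarrow> \<bar>W n x - w x\<bar> \<le> e n" and e: "e \<longlonglongrightarrow> 0"
    and gb: "\<And>n x. x \<in> \<Omega> \<Longrightarrow> norm (gmap (P n) (Q n) x) \<le> R"
    and E: "compact E" "E \<subseteq> \<Omega>"
  shows "emeasure lebesgue (\<Union>x\<in>E. subdiff \<Omega> w x) = 0 \<Longrightarrow>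
      (\<lambda>n. LINT x:E|lborel. A n x * C n x - (B n x)\<^sup>2) \<longlonglongrightarrow> 0"
    and "a \<in> interior E \<Longrightarrow> m \<ge> 0 \<Longrightarrow> emeasure lebesgue (\<Union>x\<in>E. subdiff \<Omega> w x) = ennreal m \<Longrightarrow>
      emeasure lebesgue (subdiff \<Omega> w a) = ennreal m \<Longrightarrow>
      (\<lambda>n. LINT x:E|lborel. A n x * C n x - (B n x)\<^sup>2) \<longlonglongrightarrow> m"
proof -
  let ?I = "\<lambda>n. LINT x:E|lborel. A n x * C n x - (B n x)\<^sup>2"
  have pos: "?I n \<ge> 0" for n
    using s[of n] by (auto simp: set_lebesgue_integral_def sconv_def intro!: Bochner_Integration.integral_nonneg)
  show "?I \<longlonglongrightarrow> 0" if "emeasure lebesgue (\<Union>x\<in>E. subdiff \<Omega> w x) = 0"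
  proof (rule order_tendstoI)
    fix y :: real
    show "eventually (\<lambda>n. y < ?I n) sequentially" if "y < 0"
      by (intro always_eventually allI less_le_trans[OF that pos])
    show "eventually (\<lambda>n. ?I n < y) sequentially" if "0 < y"
      using MA_upper[OF s c close e gb E, of 0 y] \<open>emeasure _ _ = 0\<close> that by simp
  qed
  show "?I \<longlonglongrightarrow> m" if a: "a \<in> interior E" and m: "m \<ge> 0"
    "emeasure lebesgue (\<Union>x\<in>E. subdiff \<Omega> w x) = ennreal m" "emeasure lebesgue (subdiff \<Omega> w a) = ennreal m"
  proof (rule order_tendstoI)
    fix y :: real
    show "eventually (\<lambda>n. y < ?I n) sequentially" if "y < m"
      using MA_lower[OF s close e E a m(3,1), of "m - y"] that by simp
    show "eventually (\<lambda>n. ?I n < y) sequentially" if "m < y"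
      using MA_upper[OF s c close e gb E m(2,1), of "y - m"] that by simp
  qed
qed

text \<open>The kernel may jump: it is constant on small disjoint balls about the atoms, and off
  these balls it is bounded by 1 while the mass of the densities tends to 0.\<close>

lemma concentrating_limit:
  fixes d :: "nat \<Rightarrow> real^2 \<Rightarrow> real"
  assumes d: "\<And>n. continuous_on UNIV (d n)" "\<And>n x. d n x \<ge> 0"
    and \<Omega>: "open \<Omega>" and A: "finite A" "A \<subseteq> \<Omega>"
    and away: "\<And>E. compact E \<Longrightarrow> E \<subseteq> \<Omega> \<Longrightarrow> E \<inter> A = {} \<Longrightarrow> (\<lambda>n. LINT x:E|lborel. d n x) \<longlonglongrightarrow> 0"
    and at: "\<And>E a. compact E \<Longrightarrow> E \<subseteq> \<Omega> \<Longrightarrow> a \<in> interior E \<Longrightarrow> E \<inter> A = {a} \<Longrightarrow> (\<lambda>n. LINT x:E|lborel. d n x) \<longlonglongrightarrow> \<sigma> a"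
    and k: "k \<in> borel_measurable borel" "\<And>x. \<bar>k x\<bar> \<le> 1" "\<And>x. x \<notin> E \<Longrightarrow> k x = 0"
    and E: "compact E" "E \<subseteq> \<Omega>"
    and kc: "\<And>a. a \<in> A \<Longrightarrow> eventually (\<lambda>x. k x = k a) (nhds a)"
  shows "(\<lambda>n. LINT x|lborel. k x * d n x) \<longlonglongrightarrow> (\<Sum>a\<in>A. k a * \<sigma> a)"
proof -
  have "\<exists>r>0. cball a r \<subseteq> \<Omega> \<and> (\<forall>x\<in>cball a r. k x = k a) \<and> (\<forall>b\<in>A. b \<noteq> a \<longrightarrow> 2 * r < dist a b)" if a: "a \<in> A" for a
  proof -
    obtain r1 where r1: "r1 > 0" "cball a r1 \<subseteq> \<Omega>" using \<Omega> A a open_contains_cball by blast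
    obtain r2 where r2: "r2 > 0" "\<And>x. dist x a < r2 \<Longrightarrow> k x = k a"
      using kc[OF a] unfolding eventually_nhds_metric by blast
    obtain r3 where r3: "r3 > 0" "\<And>b. b \<in> A \<Longrightarrow> b \<noteq> a \<Longrightarrow> r3 \<le> dist a b"
      using finite_set_avoid[OF A(1), of a] by blast
    show ?thesis
    proof (intro exI[of _ "min r1 (min (r2 / 2) (r3 / 3))"] conjI ballI impI)
      show "cball a (min r1 (min (r2 / 2) (r3 / 3))) \<subseteq> \<Omega>" using r1 by auto
      show "k x = k a" if "x \<in> cball a (min r1 (min (r2 / 2) (r3 / 3)))" for x
        using that r2 by (intro r2(2)) (auto simp: dist_commute)
      show "2 * min r1 (min (r2 / 2) (r3 / 3)) < dist a b" if "b \<in> A" "b \<noteq> a" for b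
        using r3(1) r3(2)[OF that] by linarith
    qed (use r1 r2 r3 in auto)
  qed
  then obtain r where r: "\<And>a. a \<in> A \<Longrightarrow> r a > 0" "\<And>a. a \<in> A \<Longrightarrow> cball a (r a) \<subseteq> \<Omega>"
    "\<And>a x. a \<in> A \<Longrightarrow> x \<in> cball a (r a) \<Longrightarrow> k x = k a" "\<And>a b. a \<in> A \<Longrightarrow> b \<in> A \<Longrightarrow> b \<noteq> a \<Longrightarrow> 2 * r a < dist a b"
    by metis
  have disj: "a = b" if "a \<in> A" "b \<in> A" "x \<in> cball a (r a)" "x \<in> cball b (r b)" for a b x
  proof (rule ccontr)
    assume "a \<noteq> b"
    then have "2 * r a < dist a b" "2 * r b < dist a b"
      using r(4)[of a b] r(4)[of b a] that by (auto simp: dist_commute)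
    moreover have "dist a b \<le> r a + r b" using that dist_triangle[of a b x] by (auto simp: dist_commute)
    ultimately show False by linarith
  qed
  \<comment> \<open>\<open>E'\<close> omits open balls and is compact, so its mass is known to
    vanish in the limit; \<open>F\<close> omits closed balls, so that the pieces of the
    decomposition are disjoint.\<close>
  define E' where "E' = E - (\<Union>a\<in>A. ball a (r a))"
  define F where "F = E - (\<Union>a\<in>A. cball a (r a))"
  have E': "compact E'" "E' \<subseteq> \<Omega>" "E' \<inter> A = {}"
    using E r(1) by (auto simp: E'_def intro!: compact_diff)
  note k(1) [measurable]
  have Fb [measurable]: "F \<in> sets borel" using E A(1) by (auto simp: F_def compact_imp_closed intro!: sets.Diff sets.finite_UN)
  have FE: "F \<subseteq> E'" by (auto simp: F_def E'_def)
  have dm [measurable]: "d n \<in> borel_measurable borel" for n using d(1) by (rule borel_measurable_continuous_onI)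
  have si: "integrable lborel (\<lambda>x. indicator K x * d n x)" if "compact K" for K n
    using borel_integrable_compact[OF that continuous_on_subset[OF d(1)]] by simp
  have iF: "integrable lborel (\<lambda>x. k x * (indicator F x * d n x))" for n
  proof (rule Bochner_Integration.integrable_bound[OF si[OF E'(1), of n]])
    show "AE x in lborel. norm (k x * (indicat_real F x * d n x)) \<le> norm (indicat_real E' x * d n x)"
    proof (rule AE_I2)
      fix x
      have "\<bar>k x\<bar> * \<bar>d n x\<bar> \<le> \<bar>d n x\<bar>"
        using mult_right_mono[OF k(2)[of x] abs_ge_zero[of "d n x"]] by simp
      then show "norm (k x * (indicat_real F x * d n x)) \<le> norm (indicat_real E' x * d n x)"
        using FE by (cases "x \<in> F") (auto simp: abs_mult)
    qed
    show "(\<lambda>x. k x * (indicat_real F x * d n x)) \<in> borel_measurable lborel" by measurable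
  qed
  have split: "k x * d n x = (\<Sum>a\<in>A. k a * (indicator (cball a (r a)) x * d n x)) + k x * (indicator F x * d n x)" for n x
  proof (cases "\<exists>a\<in>A. x \<in> cball a (r a)")
    case True
    then obtain a where a: "a \<in> A" "x \<in> cball a (r a)" by blast
    have "(\<Sum>b\<in>A. k b * (indicator (cball b (r b)) x * d n x)) = (\<Sum>b\<in>A. if b = a then k a * d n x else 0)"
    proof (rule sum.cong[OF refl])
      fix b assume b: "b \<in> A"
      show "k b * (indicator (cball b (r b)) x * d n x) = (if b = a then k a * d n x else 0)"
      proof (cases "b = a")
        case False
        then have "x \<notin> cball b (r b)" using disj[OF a(1) b a(2)] by blast
        then show ?thesis using False by simp
      qed (use a in simp)
    qed
    moreover have "\<dots> = k x * d n x" using a A(1) r(3)[OF a] by simp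
    moreover have "x \<notin> F" using a by (auto simp: F_def)
    ultimately show ?thesis by simp
  next
    case False
    then have "(\<Sum>b\<in>A. k b * (indicator (cball b (r b)) x * d n x)) = 0" by (intro sum.neutral) auto
    then show ?thesis using False k(3)[of x] by (auto simp: F_def indicator_def)
  qed
  have "(\<lambda>n. LINT x|lborel. k x * (indicator F x * d n x)) \<longlonglongrightarrow> 0"
  proof (rule Lim_null_comparison)
    show "(\<lambda>n. LINT x:E'|lborel. d n x) \<longlonglongrightarrow> 0" using away E' by blast
    show "eventually (\<lambda>n. norm (LINT x|lborel. k x * (indicator F x * d n x)) \<le> (LINT x:E'|lborel. d n x)) sequentially"
    proof (rule always_eventually, intro allI)
      fix n
      have "norm (LINT x|lborel. k x * (indicator F x * d n x)) \<le> (LINT x|lborel. norm (k x * (indicator F x * d n x)))"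
        by (rule integral_norm_bound)
      also have "\<dots> \<le> (LINT x|lborel. indicator E' x * d n x)"
        using FE k(2) d(2) by (intro integral_mono integrable_norm iF si E') (auto simp: indicator_def abs_mult mult_left_le_one_le)
      finally show "norm (LINT x|lborel. k x * (indicator F x * d n x)) \<le> (LINT x:E'|lborel. d n x)"
        by (simp add: set_lebesgue_integral_def)
    qed
  qed
  moreover have "(\<lambda>n. LINT x|lborel. indicator (cball a (r a)) x * d n x) \<longlonglongrightarrow> \<sigma> a" if a: "a \<in> A" for a
  proof -
    have "(\<lambda>n. LINT x:cball a (r a)|lborel. d n x) \<longlonglongrightarrow> \<sigma> a"
    proof (rule at)
      show "a \<in> interior (cball a (r a))" using r(1)[OF a] by simp
      show "cball a (r a) \<inter> A = {a}" using disj[OF a] r(1) a by (fastforce intro: less_imp_le)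
    qed (use r a in auto)
    then show ?thesis by (simp add: set_lebesgue_integral_def)
  qed
  ultimately have "(\<lambda>n. (\<Sum>a\<in>A. k a * (LINT x|lborel. indicator (cball a (r a)) x * d n x)) + (LINT x|lborel. k x * (indicator F x * d n x)))
     \<longlonglongrightarrow> (\<Sum>a\<in>A. k a * \<sigma> a) + 0"
    by (intro tendsto_intros)
  moreover have "(LINT x|lborel. k x * d n x) = (\<Sum>a\<in>A. k a * (LINT x|lborel. indicator (cball a (r a)) x * d n x)) + (LINT x|lborel. k x * (indicator F x * d n x))" for n
    unfolding split using iF si by simp
  ultimately show ?thesis by simp
qed

section \<open>Solving the strain equation up to a curvature integral\<close>

text \<open>A derivative along one axis only, without joint differentiability: the antiderivatives
  that occur are differentiated separately in each variable.\<close>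

definition has_pd :: "'n \<Rightarrow> (real^'n::finite \<Rightarrow> real) \<Rightarrow> (real^'n \<Rightarrow> real) \<Rightarrow> bool" where
  "has_pd i f g \<longleftrightarrow> (\<forall>x. ((\<lambda>t. f (x + t *\<^sub>R axis i 1)) has_real_derivative g x) (at 0))"

lemma has_pd_line:
  assumes "has_pd i f g"
  shows "((\<lambda>t. f (x + t *\<^sub>R axis i 1)) has_real_derivative g (x + t *\<^sub>R axis i 1)) (at t)"
proof -
  have "((\<lambda>s. f ((x + t *\<^sub>R axis i 1) + s *\<^sub>R axis i 1)) has_real_derivative g (x + t *\<^sub>R axis i 1)) (at 0)"
    using assms by (simp add: has_pd_def)
  then have "((\<lambda>s. f (x + (s + t) *\<^sub>R axis i 1)) has_real_derivative g (x + t *\<^sub>R axis i 1)) (at 0)"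
    by (simp add: algebra_simps)
  then show ?thesis
    using DERIV_shift[of "\<lambda>t. f (x + t *\<^sub>R axis i 1)" "g (x + t *\<^sub>R axis i 1)" 0 t] by simp
qed

lemma has_pd_weak:
  fixes f g :: "real^'n::finite \<Rightarrow> real"
  assumes "open \<Omega>" and f: "continuous_on UNIV f" and g: "continuous_on UNIV g" and pd: "has_pd i f g"
  shows "has_weak_partial \<Omega> i f g"
proof (rule has_weak_partialI[OF assms(1) f borel_measurable_continuous_onI[OF g]])
  show t: "(\<lambda>n. 1 / real (Suc n)) \<longlonglongrightarrow> 0"
    using LIMSEQ_inverse_real_of_nat by (simp add: inverse_eq_divide)
  have t0: "filterlim (\<lambda>n. 1 / real (Suc n)) (at 0) sequentially"
    using LIMSEQ_inverse_real_of_nat by (auto simp: filterlim_at inverse_eq_divide)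
  show "(\<lambda>n. (f (x + (1 / real (Suc n)) *\<^sub>R axis i 1) - f x) / (1 / real (Suc n))) \<longlonglongrightarrow> g x" for x
  proof -
    have "((\<lambda>t. (f (x + t *\<^sub>R axis i 1) - f (x + 0 *\<^sub>R axis i 1)) / (t - 0)) \<longlongrightarrow> g x) (at 0)"
      using pd unfolding has_pd_def has_field_derivative_iff by blast
    from filterlim_compose[OF this t0] show ?thesis by simp
  qed
  show "\<exists>L. \<forall>x n. norm x \<le> R \<longrightarrow> \<bar>f (x + (1 / real (Suc n)) *\<^sub>R axis i 1) - f x\<bar> \<le> L * \<bar>1 / real (Suc n)\<bar>" for R
  proof -
    have "bounded (g ` cball 0 (R + 1))"
      by (intro compact_imp_bounded compact_continuous_image continuous_on_subset[OF g]) auto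
    then obtain L where "\<forall>y\<in>g ` cball 0 (R + 1). norm y \<le> L" unfolding bounded_iff by blast
    then have L: "\<And>y. norm y \<le> R + 1 \<Longrightarrow> \<bar>g y\<bar> \<le> L" by auto
    have "\<bar>f (x + (1 / real (Suc n)) *\<^sub>R axis i 1) - f x\<bar> \<le> L * \<bar>1 / real (Suc n)\<bar>" if x: "norm x \<le> R" for x n
    proof -
      let ?h = "1 / real (Suc n)"
      have "norm (f (x + ?h *\<^sub>R axis i 1) - f (x + 0 *\<^sub>R axis i 1)) \<le> L * norm (?h - 0)"
      proof (rule field_differentiable_bound[where S="{0..?h}"])
        fix s assume s: "s \<in> {0..?h}"
        show "((\<lambda>t. f (x + t *\<^sub>R axis i 1)) has_field_derivative g (x + s *\<^sub>R axis i 1)) (at s within {0..?h})"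
          by (rule has_field_derivative_at_within[OF has_pd_line[OF pd]])
        have "?h \<le> 1" by simp
        moreover have "0 \<le> s" "s \<le> ?h" using s by auto
        ultimately have "\<bar>s\<bar> \<le> 1" by linarith
        then have "norm (x + s *\<^sub>R axis i 1) \<le> R + 1"
          using norm_triangle_ineq[of x "s *\<^sub>R axis i 1"] x by (simp add: norm_axis_1)
        then show "norm (g (x + s *\<^sub>R axis i 1)) \<le> L" using L by simp
      qed auto
      then show ?thesis by simp
    qed
    then show ?thesis by blast
  qed
qed auto

lemma C1_with_pd: "C1_with f f1 f2 \<Longrightarrow> has_pd 1 f f1" "C1_with f f1 f2 \<Longrightarrow> has_pd 2 f f2"
  using C1_with_line[of f f1 f2 _ "axis 1 1" 0] C1_with_line[of f f1 f2 _ "axis 2 1" 0]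
  by (auto simp: has_pd_def axis_def)

lemma has_pd_add: "has_pd i f f' \<Longrightarrow> has_pd i g g' \<Longrightarrow> has_pd i (\<lambda>x. f x + g x) (\<lambda>x. f' x + g' x)"
  by (auto simp: has_pd_def intro!: DERIV_add)
lemma has_pd_diff: "has_pd i f f' \<Longrightarrow> has_pd i g g' \<Longrightarrow> has_pd i (\<lambda>x. f x - g x) (\<lambda>x. f' x - g' x)"
  by (auto simp: has_pd_def intro!: DERIV_diff)
lemma has_pd_mult:
  assumes "has_pd i f f'" "has_pd i g g'"
  shows "has_pd i (\<lambda>x. f x * g x) (\<lambda>x. f' x * g x + g' x * f x)"
  unfolding has_pd_def
proof
  fix x
  show "((\<lambda>t. f (x + t *\<^sub>R axis i 1) * g (x + t *\<^sub>R axis i 1)) has_real_derivative f' x * g x + g' x * f x) (at 0)"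
    using DERIV_mult[of "\<lambda>t. f (x + t *\<^sub>R axis i 1)" "f' x" 0 UNIV "\<lambda>t. g (x + t *\<^sub>R axis i 1)" "g' x"] assms
    by (simp add: has_pd_def)
qed

text \<open>The i-th coordinate of the result is \<tau> times that of x; as \<tau> runs from 0 to 1,
  the point runs from the coordinate hyperplane to x.\<close>

definition shr :: "'n \<Rightarrow> real \<Rightarrow> real^'n::finite \<Rightarrow> real^'n" where
  "shr i \<tau> x = x + ((\<tau> - 1) * x $ i) *\<^sub>R axis i 1"

text \<open>The antiderivative in direction i that vanishes on the hyperplane where the i-th
  coordinate is 0, scaled to the fixed interval from 0 to 1.\<close>

definition prim :: "'n \<Rightarrow> (real^'n::finite \<Rightarrow> real) \<Rightarrow> real^'n \<Rightarrow> real" where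
  "prim i g x = x $ i * integral {0..1} (\<lambda>\<tau>. g (shr i \<tau> x))"

lemma prim_continuous:
  fixes g :: "real^'n::finite \<Rightarrow> real"
  assumes g: "continuous_on UNIV g"
  shows "continuous_on UNIV (prim i g)"
proof -
  have "continuous_on (UNIV \<times> cbox 0 1) (\<lambda>(x, \<tau>). g (shr i \<tau> x))"
    unfolding shr_def case_prod_unfold
    by (intro continuous_on_compose2[OF g] continuous_intros) auto
  then have "continuous_on UNIV (\<lambda>x. integral (cbox 0 1) (\<lambda>\<tau>. g (shr i \<tau> x)))"
    by (rule integral_continuous_on_param)
  then show ?thesis unfolding prim_def by (intro continuous_intros) simp
qed

lemma antiderivative_UNIV:
  fixes h :: "real \<Rightarrow> real"
  assumes "continuous_on UNIV h"
  obtains H where "\<And>t. (H has_real_derivative h t) (at t)"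
proof -
  have "\<exists>F. \<forall>x. -\<infinity> < ereal x \<longrightarrow> ereal x < \<infinity> \<longrightarrow> (F has_vector_derivative h x) (at x)"
    using assms by (intro einterval_antiderivative) (auto simp: continuous_on_eq_continuous_at)
  then show ?thesis using that by (auto simp: has_real_derivative_iff_has_vector_derivative)
qed

text \<open>On a line in direction i the substitution t = \<tau> \<open>x $ i\<close> turns the
  scaled integral into an ordinary one from 0 to \<open>x $ i\<close>.\<close>

lemma prim_pd_same:
  fixes g :: "real^'n::finite \<Rightarrow> real"
  assumes g: "continuous_on UNIV g"
  shows "has_pd i (prim i g) g"
  unfolding has_pd_def
proof
  fix x :: "real^'n"
  define x0 where "x0 = x - (x $ i) *\<^sub>R axis i 1"
  define h where "h t = g (x0 + t *\<^sub>R axis i 1)" for t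
  have hc: "continuous_on UNIV h"
    unfolding h_def by (intro continuous_on_compose2[OF g] continuous_intros) auto
  obtain H where H: "\<And>t. (H has_real_derivative h t) (at t)" using antiderivative_UNIV[OF hc] by blast
  have eq: "prim i g (x + t *\<^sub>R axis i 1) = H (x $ i + t) - H 0" for t
  proof -
    let ?y = "x + t *\<^sub>R axis i (1::real)"
    have yi: "?y $ i = x $ i + t" by (simp add: axis_def)
    have sh: "shr i \<tau> ?y = x0 + (\<tau> * (x $ i + t)) *\<^sub>R axis i 1" for \<tau>
      unfolding shr_def yi x0_def by (simp add: algebra_simps)
    have "((\<lambda>\<tau>. (x $ i + t) * h (\<tau> * (x $ i + t))) has_integral (H (1 * (x $ i + t)) - H (0 * (x $ i + t)))) {0..1}"
    proof (rule fundamental_theorem_of_calculus)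
      fix \<tau> :: real assume "\<tau> \<in> {0..1}"
      have "((\<lambda>\<tau>. \<tau> * (x $ i + t)) has_real_derivative (x $ i + t)) (at \<tau>)"
        by (auto intro!: derivative_eq_intros)
      from DERIV_chain2[OF H this]
      show "((\<lambda>\<tau>. H (\<tau> * (x $ i + t))) has_vector_derivative (x $ i + t) * h (\<tau> * (x $ i + t))) (at \<tau> within {0..1})"
        by (auto simp: has_real_derivative_iff_has_vector_derivative[symmetric] mult.commute intro: has_field_derivative_at_within)
    qed simp
    from integral_unique[OF this]
    have "integral {0..1} (\<lambda>\<tau>. (x $ i + t) * h (\<tau> * (x $ i + t))) = H (x $ i + t) - H 0"
      unfolding mult_1_left mult_zero_left .
    then show ?thesis unfolding prim_def sh yi h_def by simp
  qed
  have "((\<lambda>t. H (x $ i + t) - H 0) has_real_derivative h (x $ i + 0)) (at 0)"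
  proof -
    have "((\<lambda>t. x $ i + t) has_real_derivative 1) (at 0)" by (auto intro!: derivative_eq_intros)
    from DERIV_chain2[OF H this] show ?thesis by (auto intro!: derivative_eq_intros)
  qed
  then show "((\<lambda>t. prim i g (x + t *\<^sub>R axis i 1)) has_real_derivative g x) (at 0)"
    unfolding eq by (simp add: h_def x0_def)
qed

text \<open>Along direction j the factor \<open>x $ i\<close> and the interval stay fixed, so the
  derivative passes under the integral.\<close>

lemma prim_pd_other:
  fixes g :: "real^'n::finite \<Rightarrow> real"
  assumes g: "continuous_on UNIV g" and g': "continuous_on UNIV g'" and pd: "has_pd j g g'" and ij: "i \<noteq> j"
  shows "has_pd j (prim i g) (prim i g')"
  unfolding has_pd_def
proof
  fix x :: "real^'n"
  have sh: "shr i \<tau> (x + t *\<^sub>R axis j 1) = shr i \<tau> x + t *\<^sub>R axis j 1" for \<tau> t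
    using ij by (simp add: shr_def axis_def vec_eq_iff)
  have "((\<lambda>t. integral (cbox 0 1) (\<lambda>\<tau>. g (shr i \<tau> x + t *\<^sub>R axis j 1))) has_real_derivative
     integral (cbox 0 1) (\<lambda>\<tau>. g' (shr i \<tau> x + 0 *\<^sub>R axis j 1))) (at 0 within UNIV)"
  proof (rule leibniz_rule_field_derivative)
    show "((\<lambda>t. g (shr i \<tau> x + t *\<^sub>R axis j 1)) has_field_derivative g' (shr i \<tau> x + t *\<^sub>R axis j 1)) (at t within UNIV)" for t \<tau>
      by (rule has_pd_line[OF pd])
    show "(\<lambda>\<tau>. g (shr i \<tau> x + t *\<^sub>R axis j 1)) integrable_on cbox 0 1" for t
      unfolding shr_def by (intro integrable_continuous continuous_on_compose2[OF g] continuous_intros) auto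
    show "continuous_on (UNIV \<times> cbox 0 1) (\<lambda>(t, \<tau>). g' (shr i \<tau> x + t *\<^sub>R axis j 1))"
      unfolding shr_def case_prod_unfold by (intro continuous_on_compose2[OF g'] continuous_intros) auto
  qed auto
  from DERIV_cmult[OF this, of "x $ i"]
  show "((\<lambda>t. prim i g (x + t *\<^sub>R axis j 1)) has_real_derivative prim i g' x) (at 0)"
    using ij unfolding prim_def sh by (simp add: axis_def)
qed

section \<open>Signed integration along the axes\<close>

definition oin :: "real \<Rightarrow> real \<Rightarrow> real \<Rightarrow> real" where
  "oin a b t = indicator {a..b} t - indicator {b..a} t"

text \<open>The sign built into \<open>oin\<close> makes the formula independent of the order of a
  and b, so points on either side of a transversal are treated alike.\<close>

lemma oriented_FTC:
  assumes H: "\<And>t. (H has_real_derivative h t) (at t)" and h: "continuous_on UNIV h"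
  shows "(LINT t|lborel. oin a b t * h t) = H b - H a" and "integrable lborel (\<lambda>t. oin a b t * h t)"
proof -
  have hi: "integrable lborel (\<lambda>t. indicator {a..b} t * h t)" for a b
    using borel_integrable_compact[of "{a..b}" h] continuous_on_subset[OF h] by simp
  have 1: "(LINT t|lborel. indicator {a..b} t * h t) = H b - H a" if "a \<le> b" for a b
    using integral_FTC_Icc_real[OF that, of H h] H h
    by (simp add: continuous_on_eq_continuous_at mult.commute)
  have eq: "(\<lambda>t. oin a b t * h t) = (\<lambda>t. indicator {a..b} t * h t - indicator {b..a} t * h t)" for a b
    by (simp add: oin_def left_diff_distrib fun_eq_iff)
  show "integrable lborel (\<lambda>t. oin a b t * h t)" unfolding eq using hi by simp
  have le: "(LINT t|lborel. oin a b t * h t) = H b - H a" if "a \<le> b" for a b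
  proof (cases "a = b")
    case True
    then show ?thesis by (simp add: oin_def)
  next
    case False
    then have "{b..a} = {}" using that by auto
    then show ?thesis using 1[OF that] by (simp add: oin_def)
  qed
  show "(LINT t|lborel. oin a b t * h t) = H b - H a"
  proof (cases "a \<le> b")
    case False
    have "oin a b t * h t = - (oin b a t * h t)" for t by (simp add: oin_def algebra_simps)
    then show ?thesis using le[of b a] False by simp
  qed (rule le)
qed

lemma vector2_measurable: "(\<lambda>(t, s). vector [t, s] :: real^2) \<in> borel_measurable (lborel \<Otimes>\<^sub>M lborel)"
proof -
  have c: "continuous_on UNIV (\<lambda>p::real\<times>real. fst p *\<^sub>R axis 1 1 + snd p *\<^sub>R axis 2 1 :: real^2)"
    by (intro continuous_intros)
  have eq: "(\<lambda>p::real\<times>real. fst p *\<^sub>R axis 1 1 + snd p *\<^sub>R axis 2 1 :: real^2) = (\<lambda>(t, s). vector [t, s])"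
    by (auto simp: fun_eq_iff vec_eq_iff forall_2 axis_def)
  have "sets (lborel \<Otimes>\<^sub>M lborel) = sets (borel :: (real \<times> real) measure)"
    unfolding lborel_prod by simp
  then show ?thesis
    using borel_measurable_continuous_onI[OF c] unfolding eq by (simp cong: measurable_cong_sets)
qed

lemma lborel_real2: "lborel = distr (lborel \<Otimes>\<^sub>M lborel) borel (\<lambda>(t, s). vector [t, s] :: real^2)"
proof (rule lborel_eqI)
  fix l u :: "real^2" assume le: "\<And>b. b \<in> Basis \<Longrightarrow> l \<bullet> b \<le> u \<bullet> b"
  have le1: "l $ 1 \<le> u $ 1" "l $ 2 \<le> u $ 2"
    using le[of "axis 1 1"] le[of "axis 2 1"] by (auto simp: inner_axis axis_in_Basis_iff)
  have pre: "(\<lambda>(t, s). vector [t, s] :: real^2) -` box l u \<inter> space (lborel \<Otimes>\<^sub>M lborel) = {l $ 1<..<u $ 1} \<times> {l $ 2<..<u $ 2}"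
    by (auto simp: box2 space_pair_measure)
  have "emeasure (distr (lborel \<Otimes>\<^sub>M lborel) borel (\<lambda>(t, s). vector [t, s] :: real^2)) (box l u)
     = emeasure (lborel \<Otimes>\<^sub>M lborel) ({l $ 1<..<u $ 1} \<times> {l $ 2<..<u $ 2})"
    using vector2_measurable pre by (subst emeasure_distr) auto
  also have "\<dots> = emeasure lborel {l $ 1<..<u $ 1} * emeasure lborel {l $ 2<..<u $ 2}"
    by (intro lborel.emeasure_pair_measure_Times) auto
  also have "\<dots> = ennreal ((u $ 1 - l $ 1) * (u $ 2 - l $ 2))"
    using le1 by (simp add: ennreal_mult)
  also have "(u $ 1 - l $ 1) * (u $ 2 - l $ 2) = (\<Prod>b\<in>Basis. (u - l) \<bullet> b)"
  proof -
    have B: "(Basis :: (real^2) set) = {axis 1 1, axis 2 1}"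
      unfolding Basis_vec_def by (auto simp: UNIV_2)
    have "axis 1 1 \<noteq> (axis 2 1 :: real^2)" by (simp add: axis_eq_axis)
    then show ?thesis unfolding B by (simp add: inner_axis)
  qed
  finally show "emeasure (distr (lborel \<Otimes>\<^sub>M lborel) borel (\<lambda>(t, s). vector [t, s] :: real^2)) (box l u)
     = ennreal (\<Prod>b\<in>Basis. (u - l) \<bullet> b)" .
qed simp

lemma LINT_real2:
  fixes F :: "real^2 \<Rightarrow> real"
  assumes F: "integrable lborel F"
  shows "(LINT t|lborel. LINT s|lborel. F (vector [t, s])) = (LINT z|lborel. F z)"
proof -
  have Fm: "F \<in> borel_measurable borel" using borel_measurable_integrable[OF F] by simp
  note mV = vector2_measurable
  have "integrable (distr (lborel \<Otimes>\<^sub>M lborel) borel (\<lambda>(t, s). vector [t, s] :: real^2)) F"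
    using F lborel_real2 by simp
  then have i: "integrable (lborel \<Otimes>\<^sub>M lborel) (\<lambda>p. F (case p of (t, s) \<Rightarrow> vector [t, s]))"
    using integrable_distr_eq[OF mV Fm] by simp
  have "(LINT z|lborel. F z) = (LINT p|(lborel \<Otimes>\<^sub>M lborel). F (case p of (t, s) \<Rightarrow> vector [t, s]))"
    by (subst lborel_real2, rule integral_distr[OF mV Fm])
  also have "\<dots> = (LINT t|lborel. LINT s|lborel. F (case (t, s) of (t, s) \<Rightarrow> vector [t, s]))"
    by (rule lborel_pair.integral_fst'[OF i, symmetric])
  finally show ?thesis by simp
qed

lemma vector2_eq: "vector [a, b] = a *\<^sub>R axis 1 1 + b *\<^sub>R (axis 2 1 :: real^2)"
  by (auto simp: vec_eq_iff forall_2 axis_def)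

lemma vector2_nth: "vector [x $ 1, x $ 2] = (x::real^2)"
  by (auto simp: vec_eq_iff forall_2)

lemma has_pd_vector2:
  fixes f g :: "real^2 \<Rightarrow> real"
  shows "has_pd 1 f g \<Longrightarrow> ((\<lambda>t. f (vector [t, s])) has_real_derivative g (vector [t, s])) (at t)"
    "has_pd 2 f g \<Longrightarrow> ((\<lambda>t. f (vector [s, t])) has_real_derivative g (vector [s, t])) (at t)"
proof -
  have e: "vector [0, s] + t *\<^sub>R axis 1 1 = (vector [t, s] :: real^2)"
    "vector [s, 0] + t *\<^sub>R axis 2 1 = (vector [s, t] :: real^2)" for t s
    by (auto simp: vec_eq_iff forall_2 axis_def)
  show "has_pd 1 f g \<Longrightarrow> ((\<lambda>t. f (vector [t, s])) has_real_derivative g (vector [t, s])) (at t)"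
    using has_pd_line[of 1 f g "vector [0, s]" t] unfolding e .
  show "has_pd 2 f g \<Longrightarrow> ((\<lambda>t. f (vector [s, t])) has_real_derivative g (vector [s, t])) (at t)"
    using has_pd_line[of 2 f g "vector [s, 0]" t] unfolding e .
qed

lemma has_pd_coord:
  fixes F :: "real \<Rightarrow> real"
  assumes "\<And>t. (F has_real_derivative f t) (at t)"
  shows "has_pd i (\<lambda>x::real^'n::finite. F (x $ i)) (\<lambda>x. f (x $ i))"
    and "j \<noteq> i \<Longrightarrow> has_pd j (\<lambda>x::real^'n::finite. F (x $ i)) (\<lambda>x. 0)"
proof -
  show "has_pd i (\<lambda>x::real^'n. F (x $ i)) (\<lambda>x. f (x $ i))"
    unfolding has_pd_def
  proof
    fix x :: "real^'n"
    have "((\<lambda>t. x $ i + t) has_real_derivative 1) (at 0)" by (auto intro!: derivative_eq_intros)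
    from DERIV_chain2[OF assms this]
    show "((\<lambda>t. F ((x + t *\<^sub>R axis i 1) $ i)) has_real_derivative f (x $ i)) (at 0)" by (simp add: axis_def)
  qed
  show "j \<noteq> i \<Longrightarrow> has_pd j (\<lambda>x::real^'n. F (x $ i)) (\<lambda>x. 0)"
    by (simp add: has_pd_def axis_def)
qed

lemma has_pd_half_square:
  assumes "has_pd i f f'"
  shows "has_pd i (\<lambda>x. (f x)\<^sup>2 / 2) (\<lambda>x. f x * f' x)"
  unfolding has_pd_def
proof
  fix x
  have "((\<lambda>t. f (x + t *\<^sub>R axis i 1)) has_real_derivative f' x) (at 0)" using assms by (simp add: has_pd_def)
  then show "((\<lambda>t. (f (x + t *\<^sub>R axis i 1))\<^sup>2 / 2) has_real_derivative f x * f' x) (at 0)"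
    by (auto intro!: derivative_eq_intros)
qed

text \<open>The signed indicator of the region swept when a density is integrated vertically from
  the graph of \<open>c\<close> to the height of x, and the result horizontally from the curve
  \<open>xh\<close> to x.\<close>

definition rect_kernel :: "(real \<Rightarrow> real) \<Rightarrow> (real \<Rightarrow> real) \<Rightarrow> real^2 \<Rightarrow> real^2 \<Rightarrow> real" where
  "rect_kernel xh c x z = oin (xh (x $ 2)) (x $ 1) (z $ 1) * oin (c (z $ 1)) (x $ 2) (z $ 2)"

lemma oin_bound: "\<bar>oin a b t\<bar> \<le> 1"
  by (auto simp: oin_def indicator_def)

lemma oin_nonzero: "oin a b t \<noteq> 0 \<Longrightarrow> t \<in> closed_segment a b"
proof (rule ccontr)
  assume n: "oin a b t \<noteq> 0" "t \<notin> closed_segment a b"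
  then have "t \<notin> {a..b}" "t \<notin> {b..a}" by (auto simp: closed_segment_eq_real_ivl split: if_splits)
  then show False using n by (simp add: oin_def)
qed

lemma rect_kernel_bound: "\<bar>rect_kernel xh c x z\<bar> \<le> 1"
  using mult_mono[OF oin_bound oin_bound] by (simp add: rect_kernel_def abs_mult)

lemma rect_kernel_measurable:
  assumes "continuous_on UNIV c"
  shows "rect_kernel xh c x \<in> borel_measurable borel"
proof -
  have [measurable]: "c \<in> borel_measurable borel" using assms by (rule borel_measurable_continuous_onI)
  have [measurable]: "(\<lambda>z::real^2. z $ i) \<in> borel_measurable borel" for i
    by (intro borel_measurable_continuous_onI continuous_intros)
  show ?thesis unfolding rect_kernel_def[abs_def] oin_def indicator_def atLeastAtMost_iff by measurable
qed

text \<open>Given as the continuous image of a square, so that compactness is immediate and the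
  horizontal and vertical segments from the curves remain visible.\<close>

definition rect_region :: "(real \<Rightarrow> real) \<Rightarrow> (real \<Rightarrow> real) \<Rightarrow> real^2 \<Rightarrow> (real^2) set" where
  "rect_region xh c x = (\<lambda>(l, m). let t = (1 - l) * xh (x $ 2) + l * x $ 1 in
      vector [t, (1 - m) * c t + m * x $ 2]) ` ({0..1} \<times> {0..1})"

lemma compact_rect_region:
  assumes c: "continuous_on UNIV c"
  shows "compact (rect_region xh c x)"
  unfolding rect_region_def Let_def vector2_eq case_prod_unfold
  by (intro compact_continuous_image continuous_intros continuous_on_compose2[OF c] compact_Times) auto

lemma rect_kernel_nonzero:
  assumes "rect_kernel xh c x z \<noteq> 0"
  shows "z \<in> rect_region xh c x"
proof -
  have "z $ 1 \<in> closed_segment (xh (x $ 2)) (x $ 1)" "z $ 2 \<in> closed_segment (c (z $ 1)) (x $ 2)"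
    using assms by (auto simp: rect_kernel_def intro: oin_nonzero)
  then obtain l m where l: "0 \<le> l" "l \<le> 1" "z $ 1 = (1 - l) * xh (x $ 2) + l * x $ 1"
    and m: "0 \<le> m" "m \<le> 1" "z $ 2 = (1 - m) * c (z $ 1) + m * x $ 2"
    by (auto simp: in_segment)
  have "z = vector [z $ 1, (1 - m) * c (z $ 1) + m * x $ 2]" using m by (auto simp: vec_eq_iff forall_2)
  then have "z = vector [(1 - l) * xh (x $ 2) + l * x $ 1, (1 - m) * c ((1 - l) * xh (x $ 2) + l * x $ 1) + m * x $ 2]"
    unfolding l(3) .
  then show ?thesis unfolding rect_region_def Let_def using l m by (auto intro!: image_eqI[of _ _ "(l, m)"])
qed

lemma rect_kernel_integrable:
  assumes c: "continuous_on UNIV c" and d: "continuous_on UNIV d"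
  shows "integrable lborel (\<lambda>z. rect_kernel xh c x z * d z)"
proof (rule Bochner_Integration.integrable_bound)
  show "integrable lborel (\<lambda>z. indicator (rect_region xh c x) z *\<^sub>R d z)"
    by (intro borel_integrable_compact compact_rect_region c continuous_on_subset[OF d]) auto
  have [measurable]: "d \<in> borel_measurable borel" using d by (rule borel_measurable_continuous_onI)
  note rect_kernel_measurable[OF c, measurable]
  show "(\<lambda>z. rect_kernel xh c x z * d z) \<in> borel_measurable lborel" by measurable
  show "AE z in lborel. norm (rect_kernel xh c x z * d z) \<le> norm (indicator (rect_region xh c x) z *\<^sub>R d z)"
  proof (rule AE_I2)
    fix z
    show "norm (rect_kernel xh c x z * d z) \<le> norm (indicator (rect_region xh c x) z *\<^sub>R d z)"
    proof (cases "z \<in> rect_region xh c x")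
      case True
      then show ?thesis
        using mult_right_mono[OF rect_kernel_bound[of xh c x z] abs_ge_zero[of "d z"]] by (simp add: abs_mult)
    next
      case False
      then have "rect_kernel xh c x z = 0" using rect_kernel_nonzero by blast
      then show ?thesis by simp
    qed
  qed
qed

text \<open>Integrating the diagonal components of the symmetrised gradient leaves an off-diagonal
  residual whose mixed second derivative is the Hessian determinant; the remaining freedom of adding
  functions of one variable normalises it to vanish along the two given curves.\<close>

lemma strain_residual:
  assumes W: "C1_with W P Q" "C1_with P A B" "C1_with Q B C" "C1_with A SA T" "C1_with B T SB"
    and c: "continuous_on UNIV c" and xh: "continuous_on UNIV xh"
  shows "\<exists>u1 u2 g k. continuous_on UNIV u1 \<and> continuous_on UNIV u2 \<and> continuous_on UNIV g \<and> continuous_on UNIV k \<and>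
     has_pd 1 u1 (\<lambda>x. (P x)\<^sup>2 / 2) \<and> has_pd 2 u1 g \<and> has_pd 1 u2 k \<and> has_pd 2 u2 (\<lambda>x. (Q x)\<^sup>2 / 2) \<and>
     (\<forall>x. g x + k x = P x * Q x - (LINT z|lborel. rect_kernel xh c x z * (A z * C z - (B z)\<^sup>2)))"
proof -
  have cn: "continuous_on UNIV P" "continuous_on UNIV Q" "continuous_on UNIV A" "continuous_on UNIV B"
    "continuous_on UNIV C" "continuous_on UNIV T"
    using W by (auto simp: C1_with_def)
  note pd = C1_with_pd[OF W(2)] C1_with_pd[OF W(3)] C1_with_pd[OF W(4)] C1_with_pd[OF W(5)]
  \<comment> \<open>\<open>G\<close> is the derivative of \<open>Q x * B x\<close> in the first
    variable. It will turn out that \<open>N\<close> is the derivative of the residual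
    \<open>S0\<close> in the first variable and the determinant \<open>dt\<close> that of
    \<open>N\<close> in the second; the terms with \<open>T\<close> cancel.\<close>
  define G where "G x = B x * B x + T x * Q x" for x
  define N where "N x = A x * Q x - prim 2 G x" for x
  define S0 where "S0 x = P x * Q x - prim 1 (\<lambda>x. P x * B x) x - prim 2 (\<lambda>x. Q x * B x) x" for x
  define dt where "dt x = A x * C x - (B x)\<^sup>2" for x
  have cPB: "continuous_on UNIV (\<lambda>x. P x * B x)" "continuous_on UNIV (\<lambda>x. Q x * B x)" "continuous_on UNIV G"
    "continuous_on UNIV dt"
    unfolding G_def[abs_def] dt_def[abs_def] by (intro continuous_intros cn)+
  have cN: "continuous_on UNIV N" unfolding N_def[abs_def] by (intro continuous_intros cn prim_continuous cPB)
  have cS: "continuous_on UNIV S0" unfolding S0_def[abs_def] by (intro continuous_intros cn prim_continuous cPB)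
  have pQB: "has_pd 1 (\<lambda>x. Q x * B x) G"
    using has_pd_mult[OF pd(3) pd(7)] by (simp add: G_def[abs_def])
  have "has_pd 1 S0 (\<lambda>x. A x * Q x + B x * P x - P x * B x - prim 2 G x)"
    unfolding S0_def[abs_def]
    by (intro has_pd_diff has_pd_mult pd prim_pd_same prim_pd_other cPB pQB) simp
  then have pS: "has_pd 1 S0 N" by (simp add: N_def[abs_def] mult.commute)
  have "has_pd 2 N (\<lambda>x. T x * Q x + C x * A x - G x)"
    unfolding N_def[abs_def] by (intro has_pd_diff has_pd_mult pd prim_pd_same cPB)
  moreover have "(\<lambda>x. T x * Q x + C x * A x - G x) = dt"
    by (auto simp: dt_def G_def power2_eq_square algebra_simps)
  ultimately have pN: "has_pd 2 N dt" by simp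
  have cv: "continuous_on UNIV (\<lambda>t. f (vector [t, r t]))" "continuous_on UNIV (\<lambda>t. f (vector [r t, t]))"
    if "continuous_on UNIV f" "continuous_on UNIV r" for f :: "real^2 \<Rightarrow> real" and r :: "real \<Rightarrow> real"
    unfolding vector2_eq by (intro continuous_on_compose2[OF that(1)] continuous_intros that(2), simp)+
  \<comment> \<open>With \<open>b\<close> having derivative \<open>N\<close> along the graph of
    \<open>c\<close>, the first derivative of \<open>S0 - b\<close> vanishes there; \<alpha> then
    removes the value of \<open>S0 - b\<close> along the curve \<open>xh\<close>. What remains of
    the residual is the determinant integrated twice, starting from the two curves.\<close>
  obtain b where b: "\<And>t. (b has_real_derivative N (vector [t, c t])) (at t)"
    using antiderivative_UNIV[OF cv(1)[OF cN c]] by blast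
  have cb: "continuous_on UNIV b" using b by (auto simp: continuous_on_eq_continuous_at intro: DERIV_isCont)
  define \<alpha> where "\<alpha> y = S0 (vector [xh y, y]) - b (xh y)" for y
  have ca: "continuous_on UNIV \<alpha>"
    unfolding \<alpha>_def[abs_def] by (intro continuous_on_diff cv(2)[OF cS xh] continuous_on_compose2[OF cb xh]) simp
  obtain AA where AA: "\<And>t. (AA has_real_derivative \<alpha> t) (at t)" using antiderivative_UNIV[OF ca] by blast
  obtain BB where BB: "\<And>t. (BB has_real_derivative b t) (at t)" using antiderivative_UNIV[OF cb] by blast
  have cAA: "continuous_on UNIV AA" "continuous_on UNIV BB"
    using AA BB by (auto simp: continuous_on_eq_continuous_at intro: DERIV_isCont)
  define u1 where "u1 x = prim 1 (\<lambda>x. (P x)\<^sup>2 / 2) x + AA (x $ 2)" for x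
  define u2 where "u2 x = prim 2 (\<lambda>x. (Q x)\<^sup>2 / 2) x + BB (x $ 1)" for x
  define g where "g x = prim 1 (\<lambda>x. P x * B x) x + \<alpha> (x $ 2)" for x
  define k where "k x = prim 2 (\<lambda>x. Q x * B x) x + b (x $ 1)" for x
  have half: "has_pd 2 (\<lambda>x. (P x)\<^sup>2 / 2) (\<lambda>x. P x * B x)" "has_pd 1 (\<lambda>x. (Q x)\<^sup>2 / 2) (\<lambda>x. Q x * B x)"
    by (intro has_pd_half_square pd)+
  have c2: "continuous_on UNIV (\<lambda>x. (P x)\<^sup>2 / 2)" "continuous_on UNIV (\<lambda>x. (Q x)\<^sup>2 / 2)"
    by (intro continuous_intros cn; simp)+
  have "has_pd 1 u1 (\<lambda>x. (P x)\<^sup>2 / 2 + 0)"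
    unfolding u1_def[abs_def] by (intro has_pd_add prim_pd_same c2 has_pd_coord(2)[OF AA]) simp
  moreover have "has_pd 2 u1 g"
    unfolding u1_def[abs_def] g_def[abs_def]
    by (intro has_pd_add prim_pd_other c2 half cPB has_pd_coord(1)[OF AA]) simp
  moreover have "has_pd 1 u2 k"
    unfolding u2_def[abs_def] k_def[abs_def]
    by (intro has_pd_add prim_pd_other c2 half cPB has_pd_coord(1)[OF BB]) simp
  moreover have "has_pd 2 u2 (\<lambda>x. (Q x)\<^sup>2 / 2 + 0)"
    unfolding u2_def[abs_def] by (intro has_pd_add prim_pd_same c2 has_pd_coord(2)[OF BB]) simp
  moreover have "continuous_on UNIV u1" "continuous_on UNIV u2" "continuous_on UNIV g" "continuous_on UNIV k"
    unfolding u1_def[abs_def] u2_def[abs_def] g_def[abs_def] k_def[abs_def]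
    by (intro continuous_on_add prim_continuous c2 cPB continuous_on_compose2[OF cAA(1)] continuous_on_compose2[OF cAA(2)]
      continuous_on_compose2[OF ca] continuous_on_compose2[OF cb] continuous_intros; simp)+
  moreover have "g x + k x = P x * Q x - (LINT z|lborel. rect_kernel xh c x z * dt z)" for x
  proof -
    let ?y = "x $ 2" and ?a = "xh (x $ 2)"
    let ?H = "\<lambda>t. S0 (vector [t, ?y]) - b t"
    have "(LINT z|lborel. rect_kernel xh c x z * dt z)
      = (LINT t|lborel. LINT s|lborel. rect_kernel xh c x (vector [t, s]) * dt (vector [t, s]))"
      by (rule LINT_real2[OF rect_kernel_integrable[OF c cPB(4)], symmetric])
    also have "\<dots> = (LINT t|lborel. oin ?a (x $ 1) t * (N (vector [t, ?y]) - N (vector [t, c t])))"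
    proof (rule Bochner_Integration.integral_cong[OF refl])
      fix t
      have "(LINT s|lborel. oin (c t) ?y s * dt (vector [t, s])) = N (vector [t, ?y]) - N (vector [t, c t])"
        using oriented_FTC(1)[of "\<lambda>s. N (vector [t, s])" "\<lambda>s. dt (vector [t, s])", OF has_pd_vector2(2)[OF pN]]
          cv(2)[OF cPB(4), of "\<lambda>_. t"] by simp
      then show "(LINT s|lborel. rect_kernel xh c x (vector [t, s]) * dt (vector [t, s])) = oin ?a (x $ 1) t * (N (vector [t, ?y]) - N (vector [t, c t]))"
        by (simp add: rect_kernel_def mult.assoc)
    qed
    also have "\<dots> = ?H (x $ 1) - ?H ?a"
    proof (rule oriented_FTC(1))
      show "(?H has_real_derivative N (vector [t, ?y]) - N (vector [t, c t])) (at t)" for t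
        by (intro DERIV_diff has_pd_vector2(1)[OF pS] b)
      show "continuous_on UNIV (\<lambda>t. N (vector [t, ?y]) - N (vector [t, c t]))"
        by (intro continuous_on_diff cv(1)[OF cN c] cv(1)[OF cN]) simp
    qed
    finally show ?thesis
      by (simp add: vector2_nth g_def k_def \<alpha>_def S0_def)
  qed
  ultimately show ?thesis
    unfolding dt_def by (intro exI[of _ u1] exI[of _ u2] exI[of _ g] exI[of _ k]) simp
qed

text \<open>A piecewise affine transversal through a generic point.\<close>

lemma transversal_curve:
  fixes \<Omega> :: "(real^2) set"
  assumes \<Omega>: "convex \<Omega>" "open \<Omega>" "bounded \<Omega>" "\<Omega> \<noteq> {}" and A: "finite A" "A \<subseteq> \<Omega>" and ij: "i \<noteq> j"
  obtains c where "continuous_on UNIV c" "\<And>z. z \<in> \<Omega> \<Longrightarrow> \<exists>z'\<in>\<Omega>. z' $ i = z $ i \<and> z' $ j = c (z $ i)"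
    "\<And>a. a \<in> A \<Longrightarrow> c (a $ i) \<noteq> a $ j" "\<And>y. finite {t. c t = y}"
proof -
  have cc: "compact (closure \<Omega>)" "closure \<Omega> \<noteq> {}" using \<Omega> by (auto simp: compact_closure)
  have ci: "continuous_on (closure \<Omega>) (\<lambda>z. z $ i)" by (intro continuous_intros)
  obtain p where p: "p \<in> closure \<Omega>" "\<And>z. z \<in> closure \<Omega> \<Longrightarrow> p $ i \<le> z $ i"
    using continuous_attains_inf[OF cc ci] by blast
  obtain q where q: "q \<in> closure \<Omega>" "\<And>z. z \<in> closure \<Omega> \<Longrightarrow> z $ i \<le> q $ i"
    using continuous_attains_sup[OF cc ci] by blast
  have strict: "p $ i < z $ i" "z $ i < q $ i" if z: "z \<in> \<Omega>" for z
  proof -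
    obtain e where e: "e > 0" "cball z e \<subseteq> \<Omega>" using \<Omega> z open_contains_cball by blast
    then have "z + e *\<^sub>R axis i 1 \<in> closure \<Omega>" "z - e *\<^sub>R axis i 1 \<in> closure \<Omega>"
      using closure_subset[of \<Omega>] by (auto simp: dist_norm norm_axis_1 subset_iff)
    from p(2)[OF this(2)] q(2)[OF this(1)] show "p $ i < z $ i" "z $ i < q $ i"
      using e by (auto simp: axis_def)
  qed
  have two: "v = w" if "v $ i = w $ i" "v $ j = w $ j" for v w :: "real^2"
    using that ij exhaust_2[of i] exhaust_2[of j] by (auto simp: vec_eq_iff forall_2)
  \<comment> \<open>A normal of the line through a and r.\<close>
  define nrm where "nrm a r = (a $ j - r $ j) *\<^sub>R axis i 1 - (a $ i - r $ i) *\<^sub>R (axis j 1 :: real^2)" for a r :: "real^2"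
  have nrm0: "nrm a r \<noteq> 0" if "a $ i \<noteq> r $ i" for a r
  proof
    assume "nrm a r = 0"
    then have "nrm a r $ j = 0" by simp
    then show False using that ij by (simp add: nrm_def axis_def)
  qed
  have nrm_in: "nrm a r \<bullet> z = (a $ j - r $ j) * z $ i - (a $ i - r $ i) * z $ j" for a r z
    by (simp add: nrm_def inner_diff_left inner_axis')
  \<comment> \<open>Excluded for the corner \<open>z0\<close> are the lines through an atom and an
    extreme point, on which a piece of the curve could hit the atom, and the points level with
    \<open>p\<close> or \<open>q\<close>, for which a piece would be constant and have an infinite
    level set.\<close>
  define bad where "bad = (\<Union>a\<in>A. {z. nrm a p \<bullet> z = nrm a p \<bullet> p} \<union> {z. nrm a q \<bullet> z = nrm a q \<bullet> q})
     \<union> {z. axis j 1 \<bullet> z = p $ j} \<union> {z. axis j 1 \<bullet> z = q $ j}"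
  have "negligible bad"
    unfolding bad_def
  proof (intro negligible_Un negligible_hyperplane negligible_Union)
    show "finite ((\<lambda>a. {z. nrm a p \<bullet> z = nrm a p \<bullet> p} \<union> {z. nrm a q \<bullet> z = nrm a q \<bullet> q}) ` A)" using A by simp
    fix t assume "t \<in> (\<lambda>a. {z. nrm a p \<bullet> z = nrm a p \<bullet> p} \<union> {z. nrm a q \<bullet> z = nrm a q \<bullet> q}) ` A"
    then obtain a where a: "a \<in> A" "t = {z. nrm a p \<bullet> z = nrm a p \<bullet> p} \<union> {z. nrm a q \<bullet> z = nrm a q \<bullet> q}" by blast
    then have "a $ i \<noteq> p $ i" "a $ i \<noteq> q $ i" using strict[of a] A by auto
    then show "negligible t" unfolding a(2) using nrm0 by (intro negligible_Un negligible_hyperplane) auto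
  qed (auto simp: axis_eq_0_iff)
  moreover have "\<not> negligible \<Omega>" using \<Omega> open_not_negligible by blast
  ultimately obtain z0 where z0: "z0 \<in> \<Omega>" "z0 \<notin> bad" using negligible_subset by blast
  define m where "m = z0 $ i"
  have pm: "p $ i < m" "m < q $ i" using strict[OF z0(1)] by (auto simp: m_def)
  define s1 where "s1 = (z0 $ j - p $ j) / (m - p $ i)"
  define s2 where "s2 = (q $ j - z0 $ j) / (q $ i - m)"
  have s0: "s1 \<noteq> 0" "s2 \<noteq> 0" using z0(2) pm by (auto simp: bad_def s1_def s2_def inner_axis')
  \<comment> \<open>The broken line from \<open>p\<close> via \<open>z0\<close> to \<open>q\<close>
    as a graph over the i-th coordinate; beyond \<open>p\<close> and \<open>q\<close> it continues
    with the same slopes.\<close>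
  define c where "c t = z0 $ j + (min t m - m) * s1 + (max t m - m) * s2" for t
  \<comment> \<open>The extreme points may lie on the boundary, but by convexity the segment from
    \<open>z0\<close> stays in the domain until it reaches them.\<close>
  have inO: "(1 - l) *\<^sub>R z0 + l *\<^sub>R r \<in> \<Omega>" if "r \<in> closure \<Omega>" "0 \<le> l" "l < 1" for r l
  proof (cases "l = 0 \<or> z0 = r")
    case True
    then show ?thesis using z0 by (auto simp: algebra_simps)
  next
    case False
    then have "(1 - l) *\<^sub>R z0 + l *\<^sub>R r \<in> open_segment z0 r"
      using that by (auto simp: in_segment intro!: exI[of _ l])
    moreover have "open_segment z0 r \<subseteq> interior \<Omega>"
      using \<Omega> z0 that by (intro in_interior_closure_convex_segment) (auto simp: interior_open)
    ultimately show ?thesis using interior_subset by blast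
  qed
  show thesis
  proof (rule that[of c])
    show "continuous_on UNIV c" unfolding c_def by (intro continuous_intros)
    show "\<exists>z'\<in>\<Omega>. z' $ i = z $ i \<and> z' $ j = c (z $ i)" if z: "z \<in> \<Omega>" for z
    proof (cases "z $ i \<le> m")
      case True
      define l where "l = (m - z $ i) / (m - p $ i)"
      have l: "0 \<le> l" "l < 1" using True pm strict[OF z] by (auto simp: l_def)
      have lm: "l * (m - p $ i) = m - z $ i" using pm by (simp add: l_def)
      have "s1 * (m - p $ i) = z0 $ j - p $ j" using pm by (simp add: s1_def)
      then have "l * (z0 $ j - p $ j) = (m - z $ i) * s1" using lm by (metis mult.assoc mult.commute)
      then show ?thesis using inO[OF p(1) l] lm True
        by (intro bexI[of _ "(1 - l) *\<^sub>R z0 + l *\<^sub>R p"]) (auto simp: c_def m_def[symmetric] algebra_simps)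
    next
      case False
      define l where "l = (z $ i - m) / (q $ i - m)"
      have l: "0 \<le> l" "l < 1" using False pm strict[OF z] by (auto simp: l_def)
      have lm: "l * (q $ i - m) = z $ i - m" using pm by (simp add: l_def)
      have "s2 * (q $ i - m) = q $ j - z0 $ j" using pm by (simp add: s2_def)
      then have "l * (q $ j - z0 $ j) = (z $ i - m) * s2" using lm by (metis mult.assoc mult.commute)
      then show ?thesis using inO[OF q(1) l] lm False
        by (intro bexI[of _ "(1 - l) *\<^sub>R z0 + l *\<^sub>R q"]) (auto simp: c_def m_def[symmetric] algebra_simps)
    qed
    show "c (a $ i) \<noteq> a $ j" if a: "a \<in> A" for a
    proof
      assume eq: "c (a $ i) = a $ j"
      have b: "nrm a p \<bullet> z0 \<noteq> nrm a p \<bullet> p" "nrm a q \<bullet> z0 \<noteq> nrm a q \<bullet> q"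
        using z0(2) a by (auto simp: bad_def)
      show False
      proof (cases "a $ i \<le> m")
        case True
        have "s1 * (m - p $ i) = z0 $ j - p $ j" using pm by (simp add: s1_def)
        moreover have "a $ j = z0 $ j + (a $ i - m) * s1" using eq True by (simp add: c_def)
        ultimately have "(a $ j - p $ j) * (m - p $ i) = (a $ i - p $ i) * (z0 $ j - p $ j)" by algebra
        then show False using b(1) unfolding nrm_in m_def by (simp add: algebra_simps)
      next
        case False
        have "s2 * (q $ i - m) = q $ j - z0 $ j" using pm by (simp add: s2_def)
        moreover have "a $ j = z0 $ j + (a $ i - m) * s2" using eq False by (simp add: c_def)
        ultimately have "(a $ j - q $ j) * (m - q $ i) = (a $ i - q $ i) * (z0 $ j - q $ j)" by algebra
        then show False using b(2) unfolding nrm_in m_def by (simp add: algebra_simps)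
      qed
    qed
    show "finite {t. c t = y}" for y
    proof (rule finite_subset)
      show "{t. c t = y} \<subseteq> {m + (y - z0 $ j) / s1, m + (y - z0 $ j) / s2}"
        using s0 by (auto simp: c_def min_def max_def field_simps split: if_splits)
    qed simp
  qed
qed

section \<open>Compatibility of functions with the same Monge-Ampere measure\<close>

text \<open>Records the measure through compact sets with at most one atom, which suffice to compute
  limits against kernels that are constant near each atom. Slopes support w on the domain only, even
  where w lives on the whole plane.\<close>

definition point_MA :: "(real^2) set \<Rightarrow> (real^2) set \<Rightarrow> (real^2 \<Rightarrow> real) \<Rightarrow> (real^2 \<Rightarrow> real) \<Rightarrow> bool" where
  "point_MA \<Omega> A \<sigma> w \<longleftrightarrow> (\<forall>E. compact E \<longrightarrow> E \<subseteq> \<Omega> \<longrightarrow>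
     (E \<inter> A = {} \<longrightarrow> emeasure lebesgue (\<Union>x\<in>E. subdiff \<Omega> w x) = 0) \<and>
     (\<forall>a. E \<inter> A = {a} \<longrightarrow> emeasure lebesgue (\<Union>x\<in>E. subdiff \<Omega> w x) = ennreal (\<sigma> a) \<and>
        emeasure lebesgue (subdiff \<Omega> w a) = ennreal (\<sigma> a)))"

definition apxdet :: "(real^2 \<Rightarrow> real) \<Rightarrow> nat \<Rightarrow> real^2 \<Rightarrow> real" where
  "apxdet w n z = apx11 w n z * apx22 w n z - (apx12 w n z)\<^sup>2"

lemma apxdet_props:
  assumes w: "convex_on UNIV w" "K-lipschitz_on UNIV w"
  shows "continuous_on UNIV (apxdet w n)" "apxdet w n x \<ge> 0"
proof -
  have "C1_with (apx1 w n) (apx11 w n) (apx12 w n)" "C1_with (apx2 w n) (apx12 w n) (apx22 w n)"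
    using apx_sconv[OF w, of n] by (auto simp: sconv_def)
  then have "continuous_on UNIV (apx11 w n)" "continuous_on UNIV (apx12 w n)" "continuous_on UNIV (apx22 w n)"
    by (auto simp: C1_with_def)
  then show "continuous_on UNIV (apxdet w n)" unfolding apxdet_def[abs_def] by (intro continuous_intros)
  show "apxdet w n x \<ge> 0" using apx_sconv[OF w, of n] by (simp add: sconv_def apxdet_def)
qed

lemma gmap_apx_bound:
  assumes w: "convex_on UNIV w" "K-lipschitz_on UNIV w" and "norm x \<le> R"
  shows "norm (gmap (apx1 w n) (apx2 w n) x) \<le> 2 * (K + R)"
  using norm_le_components2[of "gmap (apx1 w n) (apx2 w n) x"] apx_bounds(2,3)[OF w, where n=n and x=x] assms(3) by simp

text \<open>Feeds the limits of the determinant masses, known for compact sets with at most one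
  atom, into \<open>concentrating_limit\<close>.\<close>

lemma kernel_limit:
  assumes w: "convex_on UNIV w" "K-lipschitz_on UNIV w"
    and \<Omega>: "open \<Omega>" "bounded \<Omega>" and A: "finite A" "A \<subseteq> \<Omega>" and \<sigma>: "\<And>a. a \<in> A \<Longrightarrow> \<sigma> a \<ge> 0"
    and MA: "point_MA \<Omega> A \<sigma> w"
    and k: "k \<in> borel_measurable borel" "\<And>x. \<bar>k x\<bar> \<le> 1" "\<And>x. x \<notin> E \<Longrightarrow> k x = 0"
    and E: "compact E" "E \<subseteq> \<Omega>"
    and kc: "\<And>a. a \<in> A \<Longrightarrow> eventually (\<lambda>x. k x = k a) (nhds a)"
  shows "(\<lambda>n. LINT z|lborel. k z * apxdet w n z) \<longlonglongrightarrow> (\<Sum>a\<in>A. k a * \<sigma> a)"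
proof (rule concentrating_limit[OF apxdet_props[OF w] \<Omega>(1) A _ _ k E kc])
  obtain R where R: "R > 0" "\<And>x. x \<in> \<Omega> \<Longrightarrow> norm x \<le> R" using \<Omega>(2) by (auto simp: bounded_pos)
  have c: "continuous_on UNIV w" using w(2) by (rule lipschitz_on_continuous_on)
  have K: "K \<ge> 0" using w(2) by (rule lipschitz_on_nonneg)
  define e where "e n = (2 * K + R\<^sup>2) * (1 / real (Suc n))" for n
  have close: "\<bar>apx w n x - w x\<bar> \<le> e n" if "x \<in> \<Omega>" for n x
  proof -
    have "(norm x)\<^sup>2 \<le> R\<^sup>2" using R(2)[OF that] by (intro power_mono) auto
    then have "(2 * K + (norm x)\<^sup>2) * (1 / real (Suc n)) \<le> e n"
      unfolding e_def by (intro mult_right_mono) auto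
    then show ?thesis using apx_bounds(1)[OF w, where n=n and x=x] by linarith
  qed
  have e: "e \<longlonglongrightarrow> 0"
    using tendsto_mult_right_zero[OF LIMSEQ_inverse_real_of_nat, of "2 * K + R\<^sup>2"]
    by (simp add: e_def[abs_def] inverse_eq_divide)
  have gb: "norm (gmap (apx1 w n) (apx2 w n) x) \<le> 2 * (K + R)" if "x \<in> \<Omega>" for n x
    using gmap_apx_bound[OF w R(2)[OF that]] .
  note lim = MA_point_limits[where \<Omega>=\<Omega>, OF apx_sconv[OF w] c close e gb]
  show "(\<lambda>n. LINT x:E|lborel. apxdet w n x) \<longlonglongrightarrow> 0"
    if "compact E" "E \<subseteq> \<Omega>" "E \<inter> A = {}" for E
  proof -
    have em: "emeasure lebesgue (\<Union>x\<in>E. subdiff \<Omega> w x) = 0" using MA that unfolding point_MA_def by blast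
    show ?thesis unfolding apxdet_def by (rule lim(1)[OF _ _ that(1,2) em])
  qed
  show "(\<lambda>n. LINT x:E|lborel. apxdet w n x) \<longlonglongrightarrow> \<sigma> a"
    if E: "compact E" "E \<subseteq> \<Omega>" "a \<in> interior E" "E \<inter> A = {a}" for E a
  proof -
    have "a \<in> A" using E by blast
    moreover have "emeasure lebesgue (\<Union>x\<in>E. subdiff \<Omega> w x) = ennreal (\<sigma> a)"
      "emeasure lebesgue (subdiff \<Omega> w a) = ennreal (\<sigma> a)"
      using MA E unfolding point_MA_def by blast+
    ultimately show ?thesis unfolding apxdet_def by (intro lim(2)[OF _ _ E(1-3) \<sigma>])
  qed
qed

text \<open>The integral of the determinant over a ball is the area of its gradient image, which
  lies in a ball whose radius depends on \<open>K\<close> and \<open>R\<close> but not on n. This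
  bound later dominates the residuals.\<close>

lemma kernel_bounded:
  assumes w: "convex_on UNIV w" "K-lipschitz_on UNIV w"
    and k: "k \<in> borel_measurable borel" "\<And>x. \<bar>k x\<bar> \<le> 1" "\<And>x. x \<notin> cball 0 R \<Longrightarrow> k x = 0"
  shows "\<bar>LINT z|lborel. k z * apxdet w n z\<bar> \<le> measure lebesgue (cball (0::real^2) (2 * (K + R)))"
proof -
  have dc: "continuous_on UNIV (apxdet w n)" by (rule apxdet_props[OF w])
  have [measurable]: "apxdet w n \<in> borel_measurable borel" "k \<in> borel_measurable borel"
    using dc k(1) by (auto intro: borel_measurable_continuous_onI)
  have i: "integrable lborel (\<lambda>z. indicator (cball 0 R) z * apxdet w n z)"
    using borel_integrable_compact[of "cball 0 R" "apxdet w n"] continuous_on_subset[OF dc] by simp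
  have b: "norm (k z * apxdet w n z) \<le> indicator (cball 0 R) z * apxdet w n z" for z
    using k(2)[of z] k(3)[of z] mult_right_mono[OF k(2)[of z] apxdet_props(2)[OF w, of n z]]
      apxdet_props(2)[OF w, of n z]
    by (cases "z \<in> cball 0 R") (simp_all add: abs_mult)
  have ki: "integrable lborel (\<lambda>z. k z * apxdet w n z)"
  proof (rule Bochner_Integration.integrable_bound[OF i])
    show "AE z in lborel. norm (k z * apxdet w n z) \<le> norm (indicator (cball 0 R) z * apxdet w n z)"
      using b by (intro AE_I2) (simp add: order_trans[OF _ abs_ge_self])
  qed measurable
  have "norm (LINT z|lborel. k z * apxdet w n z) \<le> (LINT z|lborel. norm (k z * apxdet w n z))"
    by (rule integral_norm_bound)
  also have "\<dots> \<le> (LINT z|lborel. indicator (cball 0 R) z * apxdet w n z)"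
    by (rule integral_mono[OF integrable_norm[OF ki] i b])
  also have "\<dots> = measure lebesgue (gmap (apx1 w n) (apx2 w n) ` cball 0 R)"
    using sconv_gradient_image(2)[OF apx_sconv[OF w, of n], of "cball 0 R"]
    by (simp add: set_lebesgue_integral_def apxdet_def)
  also have "\<dots> \<le> measure lebesgue (cball (0::real^2) (2 * (K + R)))"
  proof (rule measure_mono_fmeasurable)
    show "gmap (apx1 w n) (apx2 w n) ` cball 0 R \<subseteq> cball 0 (2 * (K + R))"
      using gmap_apx_bound[OF w] by auto
    show "gmap (apx1 w n) (apx2 w n) ` cball 0 R \<in> sets lebesgue"
      using sconv_gradient_image(1)[OF apx_sconv[OF w, of n], of "cball 0 R"] by (simp add: compact_imp_closed)
  qed simp
  finally show ?thesis by simp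
qed

lemma eventually_sign:
  fixes f :: "'a::topological_space \<Rightarrow> real"
  assumes "continuous_on UNIV f" "f a \<noteq> 0"
  shows "eventually (\<lambda>z. f z \<noteq> 0 \<and> (f z > 0 \<longleftrightarrow> f a > 0)) (nhds a)"
proof -
  have t: "(f \<longlongrightarrow> f a) (nhds a)"
    using assms(1) by (simp add: continuous_on_def flip: tendsto_at_iff_tendsto_nhds)
  show ?thesis
  proof (cases "f a > 0")
    case True
    from order_tendstoD(1)[OF t True] show ?thesis by (rule eventually_mono) (use True in auto)
  next
    case False
    then have "f a < 0" using assms(2) by simp
    from order_tendstoD(2)[OF t this] show ?thesis by (rule eventually_mono) (use False in auto)
  qed
qed

lemma oin_cong:
  assumes "t - p \<noteq> 0" "t - q \<noteq> 0" "t' - p' \<noteq> 0" "t' - q' \<noteq> 0" "t - p > 0 \<longleftrightarrow> t' - p' > 0" "t - q > 0 \<longleftrightarrow> t' - q' > 0"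
  shows "oin p q t = oin p' q' t'"
  using assms unfolding oin_def by (cases "t > p"; cases "t > q") (auto simp: indicator_def)

text \<open>The four conditions keep a off the boundary of the region, including its curved part,
  whose height varies continuously with the first coordinate of z.\<close>

lemma rect_kernel_locally_constant:
  fixes a x :: "real^2"
  assumes c: "continuous_on UNIV c"
    and a: "a $ 1 \<noteq> x $ 1" "a $ 1 \<noteq> xh (x $ 2)" "a $ 2 \<noteq> x $ 2" "a $ 2 \<noteq> c (a $ 1)"
  shows "eventually (\<lambda>z. rect_kernel xh c x z = rect_kernel xh c x a) (nhds a)"
proof -
  have ct: "continuous_on UNIV (\<lambda>z::real^2. z $ 1 - x $ 1)" "continuous_on UNIV (\<lambda>z::real^2. z $ 1 - xh (x $ 2))"
    "continuous_on UNIV (\<lambda>z::real^2. z $ 2 - x $ 2)" "continuous_on UNIV (\<lambda>z::real^2. z $ 2 - c (z $ 1))"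
    by (intro continuous_intros continuous_on_compose2[OF c]; simp)+
  have "eventually (\<lambda>z. z $ 1 - x $ 1 \<noteq> 0 \<and> (z $ 1 - x $ 1 > 0 \<longleftrightarrow> a $ 1 - x $ 1 > 0)) (nhds a)"
    "eventually (\<lambda>z. z $ 1 - xh (x $ 2) \<noteq> 0 \<and> (z $ 1 - xh (x $ 2) > 0 \<longleftrightarrow> a $ 1 - xh (x $ 2) > 0)) (nhds a)"
    "eventually (\<lambda>z. z $ 2 - x $ 2 \<noteq> 0 \<and> (z $ 2 - x $ 2 > 0 \<longleftrightarrow> a $ 2 - x $ 2 > 0)) (nhds a)"
    "eventually (\<lambda>z. z $ 2 - c (z $ 1) \<noteq> 0 \<and> (z $ 2 - c (z $ 1) > 0 \<longleftrightarrow> a $ 2 - c (a $ 1) > 0)) (nhds a)"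
    using eventually_sign[OF ct(1), of a] eventually_sign[OF ct(2), of a] eventually_sign[OF ct(3), of a]
      eventually_sign[OF ct(4), of a] a by auto
  then show ?thesis
  proof eventually_elim
    case (elim z)
    have "oin (xh (x $ 2)) (x $ 1) (z $ 1) = oin (xh (x $ 2)) (x $ 1) (a $ 1)"
      by (rule oin_cong) (use elim a in auto)
    moreover have "oin (c (z $ 1)) (x $ 2) (z $ 2) = oin (c (a $ 1)) (x $ 2) (a $ 2)"
      by (rule oin_cong) (use elim a in auto)
    ultimately show ?case by (simp add: rect_kernel_def)
  qed
qed

text \<open>By convexity the domain contains the horizontal segment from one transversal to x, and
  then the vertical segments from the other transversal to the points of that segment.\<close>

lemma rect_region_subset:
  assumes \<Omega>: "convex \<Omega>" and x: "x \<in> \<Omega>"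
    and c: "\<And>z. z \<in> \<Omega> \<Longrightarrow> \<exists>z'\<in>\<Omega>. z' $ 1 = z $ 1 \<and> z' $ 2 = c (z $ 1)"
    and xh: "\<And>z. z \<in> \<Omega> \<Longrightarrow> \<exists>z'\<in>\<Omega>. z' $ 2 = z $ 2 \<and> z' $ 1 = xh (z $ 2)"
  shows "rect_region xh c x \<subseteq> \<Omega>"
proof
  fix z assume "z \<in> rect_region xh c x"
  then obtain l m t where l: "0 \<le> l" "l \<le> 1" and m: "0 \<le> m" "m \<le> 1"
    and t: "t = (1 - l) * xh (x $ 2) + l * x $ 1" and z: "z = vector [t, (1 - m) * c t + m * x $ 2]"
    by (auto simp: rect_region_def Let_def)
  obtain y where y: "y \<in> \<Omega>" "y $ 2 = x $ 2" "y $ 1 = xh (x $ 2)" using xh[OF x] by blast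
  define q where "q = (1 - l) *\<^sub>R y + l *\<^sub>R x"
  have q: "q \<in> \<Omega>" unfolding q_def using \<Omega> x y l by (intro convexD) auto
  have q12: "q $ 1 = t" "q $ 2 = x $ 2" using y by (simp_all add: q_def t algebra_simps)
  obtain y' where y': "y' \<in> \<Omega>" "y' $ 1 = t" "y' $ 2 = c t" using c[OF q] q12 by auto
  have "(1 - m) *\<^sub>R y' + m *\<^sub>R q \<in> \<Omega>" by (rule convexD[OF \<Omega> y'(1) q]) (use m in auto)
  moreover have "(1 - m) *\<^sub>R y' + m *\<^sub>R q = z"
    unfolding z using q12 y' by (simp add: vec_eq_iff forall_2 algebra_simps)
  ultimately show "z \<in> \<Omega>" by simp
qed

text \<open>Gradients of the smooth convex approximations are subgradients, so they converge
  wherever the one-sided derivatives of w match, hence almost everywhere.\<close>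

lemma apx_grad_tendsto:
  assumes w: "convex_on UNIV w" "K-lipschitz_on UNIV w"
    and two: "\<And>i. ddir (axis i 1) w x = - ddir (- axis i 1) w x"
  shows "(\<lambda>n. apx1 w n x) \<longlonglongrightarrow> ddir (axis 1 1) w x" "(\<lambda>n. apx2 w n x) \<longlonglongrightarrow> ddir (axis 2 1) w x"
proof -
  have sub: "apx w n y \<ge> apx w n x + gmap (apx1 w n) (apx2 w n) x \<bullet> (y - x)" for n y
    using apx_sconv[OF w, of n] unfolding sconv_def
    by (cases "x = y") (auto simp: inner_vec2 intro: less_imp_le)
  have lim: "(\<lambda>n. apx w n y) \<longlonglongrightarrow> w y" for y
  proof (rule LIM_zero_cancel, rule Lim_null_comparison)
    show "eventually (\<lambda>n. norm (apx w n y - w y) \<le> (2 * K + (norm y)\<^sup>2) * inverse (real (Suc n))) sequentially"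
      using apx_bounds(1)[OF w, where x=y] by (auto simp: inverse_eq_divide)
    show "(\<lambda>n. (2 * K + (norm y)\<^sup>2) * inverse (real (Suc n))) \<longlonglongrightarrow> 0"
      by (rule tendsto_mult_right_zero[OF LIMSEQ_inverse_real_of_nat])
  qed
  note S = subgradients_tendsto_ddir[OF w two sub lim]
  show "(\<lambda>n. apx1 w n x) \<longlonglongrightarrow> ddir (axis 1 1) w x" "(\<lambda>n. apx2 w n x) \<longlonglongrightarrow> ddir (axis 2 1) w x"
    using S[of 1] S[of 2] by (simp_all add: inner_axis)
qed

definition strain_defect where
  "strain_defect w1 w2 i j x = ddir (axis i 1) w1 x * ddir (axis j 1) w1 x - ddir (axis i 1) w2 x * ddir (axis j 1) w2 (x::real^2)"

text \<open>The displacements that solve the approximate equations for the two functions are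
  subtracted. Their residuals have a common limit, a sum over the atoms, so the defect tends to 0
  almost everywhere; uniform bounds on gradients and residuals turn this into convergence in
  L2.\<close>

lemma compatible_strain:
  fixes \<Omega> A :: "(real^2) set"
  assumes \<Omega>: "convex \<Omega>" "open \<Omega>" "bounded \<Omega>" "\<Omega> \<noteq> {}" and A: "finite A" "A \<subseteq> \<Omega>"
    and \<sigma>: "\<And>a. a \<in> A \<Longrightarrow> \<sigma> a \<ge> 0"
    and w1: "convex_on UNIV w1" "K-lipschitz_on UNIV w1" "point_MA \<Omega> A \<sigma> w1"
    and w2: "convex_on UNIV w2" "K-lipschitz_on UNIV w2" "point_MA \<Omega> A \<sigma> w2"
    and "\<eta> > 0"
  shows "\<exists>u1 u2 a11 a12 a21 a22.
     continuous_on UNIV u1 \<and> continuous_on UNIV u2 \<and> continuous_on UNIV a11 \<and> continuous_on UNIV a12 \<and>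
     continuous_on UNIV a21 \<and> continuous_on UNIV a22 \<and>
     has_pd 1 u1 a11 \<and> has_pd 2 u1 a12 \<and> has_pd 1 u2 a21 \<and> has_pd 2 u2 a22 \<and>
     (\<integral>\<^sup>+x. ennreal (indicator \<Omega> x * ((2 * a11 x - strain_defect w1 w2 1 1 x)\<^sup>2 + 2 * (a12 x + a21 x - strain_defect w1 w2 1 2 x)\<^sup>2
        + (2 * a22 x - strain_defect w1 w2 2 2 x)\<^sup>2)) \<partial>lborel) \<le> ennreal \<eta>"
proof -
  obtain R where R: "R > 0" "\<And>x. x \<in> \<Omega> \<Longrightarrow> norm x \<le> R" using \<Omega>(3) by (auto simp: bounded_pos)
  have K: "K \<ge> 0" using w1(2) by (rule lipschitz_on_nonneg)
  have n12: "(1::2) \<noteq> 2" by simp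
  have "\<exists>c. continuous_on UNIV c \<and> (\<forall>z\<in>\<Omega>. \<exists>z'\<in>\<Omega>. z' $ 1 = z $ 1 \<and> z' $ 2 = c (z $ 1)) \<and>
      (\<forall>a\<in>A. c (a $ 1) \<noteq> a $ 2)"
    by (rule transversal_curve[OF \<Omega> A n12]) blast
  then obtain c where c: "continuous_on UNIV c" "\<And>z. z \<in> \<Omega> \<Longrightarrow> \<exists>z'\<in>\<Omega>. z' $ 1 = z $ 1 \<and> z' $ 2 = c (z $ 1)"
    "\<And>a. a \<in> A \<Longrightarrow> c (a $ 1) \<noteq> a $ 2"
    by blast
  have "\<exists>c. continuous_on UNIV c \<and> (\<forall>z\<in>\<Omega>. \<exists>z'\<in>\<Omega>. z' $ 2 = z $ 2 \<and> z' $ 1 = c (z $ 2)) \<and>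
      (\<forall>y. finite {t. c t = y})"
    by (rule transversal_curve[OF \<Omega> A n12[symmetric]]) blast
  then obtain xh where xh: "continuous_on UNIV xh" "\<And>z. z \<in> \<Omega> \<Longrightarrow> \<exists>z'\<in>\<Omega>. z' $ 2 = z $ 2 \<and> z' $ 1 = xh (z $ 2)"
    "\<And>y. finite {t. xh t = y}"
    by blast
  define res where "res w n x = (LINT z|lborel. rect_kernel xh c x z * apxdet w n z)" for w n x
  define F where "F n x = (((apx1 w1 n x)\<^sup>2 - (apx1 w2 n x)\<^sup>2) - strain_defect w1 w2 1 1 x)\<^sup>2
     + 2 * (((apx1 w1 n x * apx2 w1 n x - res w1 n x) - (apx1 w2 n x * apx2 w2 n x - res w2 n x)) - strain_defect w1 w2 1 2 x)\<^sup>2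
     + (((apx2 w1 n x)\<^sup>2 - (apx2 w2 n x)\<^sup>2) - strain_defect w1 w2 2 2 x)\<^sup>2" for n x
  have strain: "\<exists>u1 u2 g k. continuous_on UNIV u1 \<and> continuous_on UNIV u2 \<and> continuous_on UNIV g \<and> continuous_on UNIV k \<and>
     has_pd 1 u1 (\<lambda>x. (apx1 w n x)\<^sup>2 / 2) \<and> has_pd 2 u1 g \<and> has_pd 1 u2 k \<and> has_pd 2 u2 (\<lambda>x. (apx2 w n x)\<^sup>2 / 2) \<and>
     (\<forall>x. g x + k x = apx1 w n x * apx2 w n x - res w n x)"
    if w: "convex_on UNIV w" "K-lipschitz_on UNIV w" for w n
  proof -
    have "C1_with (apx w n) (apx1 w n) (apx2 w n)" "C1_with (apx1 w n) (apx11 w n) (apx12 w n)" "C1_with (apx2 w n) (apx12 w n) (apx22 w n)"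
      and "\<exists>S. C1_with (apx11 w n) S (apx112 w n)" "\<exists>S. C1_with (apx12 w n) (apx112 w n) S"
      using apx_sconv[OF w, of n] unfolding sconv_def by blast+
    then show ?thesis
      using strain_residual[OF _ _ _ _ _ c(1) xh(1)] unfolding res_def apxdet_def by blast
  qed
  have cg: "continuous_on UNIV (apx1 w n)" "continuous_on UNIV (apx2 w n)" "continuous_on UNIV (res w n)"
    if w: "convex_on UNIV w" "K-lipschitz_on UNIV w" for w n
  proof -
    show c12: "continuous_on UNIV (apx1 w n)" "continuous_on UNIV (apx2 w n)"
      using apx_sconv[OF w, of n] by (auto simp: sconv_def C1_with_def)
    obtain g k where g: "continuous_on UNIV g" "continuous_on UNIV k" "\<And>x. g x + k x = apx1 w n x * apx2 w n x - res w n x"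
      using strain[OF w, of n] by blast
    have "res w n = (\<lambda>x. apx1 w n x * apx2 w n x - (g x + k x))" using g(3) by (auto simp: fun_eq_iff)
    then show "continuous_on UNIV (res w n)" by (simp only:) (intro continuous_intros c12 g)
  qed
  note cg1 = cg[OF w1(1,2)] and cg2 = cg[OF w2(1,2)]
  have dm: "strain_defect w1 w2 i j \<in> borel_measurable borel" for i j
    unfolding strain_defect_def[abs_def]
    using ddir_borel_measurable[OF w1(1,2)] ddir_borel_measurable[OF w2(1,2)]
    by (intro borel_measurable_diff borel_measurable_times)
  have Fm: "F n \<in> borel_measurable borel" for n
    unfolding F_def[abs_def]
    by (intro borel_measurable_add borel_measurable_diff borel_measurable_times borel_measurable_power borel_measurable_const
        dm borel_measurable_continuous_onI[OF cg1(1)] borel_measurable_continuous_onI[OF cg1(2)] borel_measurable_continuous_onI[OF cg1(3)]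
        borel_measurable_continuous_onI[OF cg2(1)] borel_measurable_continuous_onI[OF cg2(2)] borel_measurable_continuous_onI[OF cg2(3)])
  have reg: "rect_region xh c x \<subseteq> \<Omega>" if "x \<in> \<Omega>" for x
    by (rule rect_region_subset[OF \<Omega>(1) that c(2) xh(2)])
  define m where "m = measure lebesgue (cball (0::real^2) (2 * (K + R)))"
  have resb: "\<bar>res w n x\<bar> \<le> m" if w: "convex_on UNIV w" "K-lipschitz_on UNIV w" and x: "x \<in> \<Omega>" for w n x
    unfolding res_def m_def
  proof (rule kernel_bounded[OF w rect_kernel_measurable[OF c(1)] rect_kernel_bound])
    fix z :: "real^2" assume "z \<notin> cball 0 R"
    then have "z \<notin> rect_region xh c x" using reg[OF x] R(2) by auto
    then show "rect_kernel xh c x z = 0" using rect_kernel_nonzero by blast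
  qed
  define b where "b = K + R"
  have m0: "m \<ge> 0" "b \<ge> 0" using K R by (auto simp: m_def b_def)
  have gbd: "\<bar>apx1 w n x\<bar> \<le> b" "\<bar>apx2 w n x\<bar> \<le> b" if w: "convex_on UNIV w" "K-lipschitz_on UNIV w" and x: "x \<in> \<Omega>" for w n x
    using apx_bounds(2,3)[OF w, where n=n and x=x] R(2)[OF x] by (auto simp: b_def)
  have db: "\<bar>strain_defect w1 w2 i j x\<bar> \<le> 2 * b\<^sup>2" for i j x
  proof -
    have Kb: "K * norm (axis i 1 :: real^2) \<le> b" for i using K R by (simp add: b_def norm_axis_1)
    have "\<bar>ddir (axis i 1) w x\<bar> \<le> b" if w: "convex_on UNIV w" "K-lipschitz_on UNIV w" for w i
      by (rule order_trans[OF ddir_bound[OF w] Kb])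
    then have "\<bar>ddir (axis i 1) w x * ddir (axis j 1) w x\<bar> \<le> b * b" if w: "convex_on UNIV w" "K-lipschitz_on UNIV w" for w
      unfolding abs_mult using w m0 by (intro mult_mono) auto
    from this[OF w1(1,2)] this[OF w2(1,2)] show ?thesis unfolding strain_defect_def power2_eq_square by linarith
  qed
  define B where "B = (4 * b\<^sup>2)\<^sup>2 + 2 * (4 * b\<^sup>2 + 2 * m)\<^sup>2 + (4 * b\<^sup>2)\<^sup>2"
  have Fb: "\<bar>F n x\<bar> \<le> B" if x: "x \<in> \<Omega>" for n x
  proof -
    have sq: "(apx1 w n x)\<^sup>2 \<le> b\<^sup>2" "(apx2 w n x)\<^sup>2 \<le> b\<^sup>2" "\<bar>apx1 w n x * apx2 w n x\<bar> \<le> b\<^sup>2" if w: "convex_on UNIV w" "K-lipschitz_on UNIV w" for w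
    proof -
      note g = gbd[OF w x, of n]
      show "(apx1 w n x)\<^sup>2 \<le> b\<^sup>2" "(apx2 w n x)\<^sup>2 \<le> b\<^sup>2" using g m0 by (simp_all add: power2_le_iff_abs_le)
      have "\<bar>apx1 w n x\<bar> * \<bar>apx2 w n x\<bar> \<le> b * b" using g m0 by (intro mult_mono) auto
      then show "\<bar>apx1 w n x * apx2 w n x\<bar> \<le> b\<^sup>2" by (simp add: abs_mult power2_eq_square)
    qed
    have p: "X\<^sup>2 \<le> Y\<^sup>2" if "\<bar>X\<bar> \<le> Y" for X Y :: real using that power2_le_iff_abs_le[of Y X] abs_ge_zero[of X] by linarith
    note q = sq[OF w1(1,2)] sq[OF w2(1,2)] zero_le_power2[of "apx1 w1 n x"] zero_le_power2[of "apx1 w2 n x"]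
      zero_le_power2[of "apx2 w1 n x"] zero_le_power2[of "apx2 w2 n x"]
    have "(((apx1 w1 n x)\<^sup>2 - (apx1 w2 n x)\<^sup>2) - strain_defect w1 w2 1 1 x)\<^sup>2 \<le> (4 * b\<^sup>2)\<^sup>2"
      "(((apx2 w1 n x)\<^sup>2 - (apx2 w2 n x)\<^sup>2) - strain_defect w1 w2 2 2 x)\<^sup>2 \<le> (4 * b\<^sup>2)\<^sup>2"
      "(((apx1 w1 n x * apx2 w1 n x - res w1 n x) - (apx1 w2 n x * apx2 w2 n x - res w2 n x)) - strain_defect w1 w2 1 2 x)\<^sup>2 \<le> (4 * b\<^sup>2 + 2 * m)\<^sup>2"
      using q db[of 1 1 x] db[of 2 2 x] db[of 1 2 x] resb[OF w1(1,2) x, of n] resb[OF w2(1,2) x, of n]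
      by (intro p, linarith)+
    then have "F n x \<le> B" unfolding F_def B_def by linarith
    moreover have "F n x \<ge> 0" unfolding F_def by simp
    ultimately show ?thesis by simp
  qed
  have good: "AE x in lebesgue. x \<in> \<Omega> \<longrightarrow> (\<lambda>n. F n x) \<longlonglongrightarrow> 0"
  proof -
    \<comment> \<open>Values of \<open>x $ 2\<close> for which an atom could lie on the boundary of
      the region; finitely many, because \<open>xh\<close> takes each value finitely often.\<close>
    define Y where "Y = (\<Union>a\<in>A. {t. xh t = a $ 1} \<union> {a $ 2})"
    have "finite Y" unfolding Y_def using A(1) xh(3) by auto
    have "negligible ((\<Union>a\<in>A. {x::real^2. axis 1 1 \<bullet> x = a $ 1}) \<union> (\<Union>y\<in>Y. {x::real^2. axis 2 1 \<bullet> x = y}))"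
      using A(1) \<open>finite Y\<close> by (intro negligible_Un negligible_Union) (auto intro!: negligible_hyperplane simp: axis_eq_0_iff)
    then have "AE x in lebesgue. x \<notin> ((\<Union>a\<in>A. {x::real^2. axis 1 1 \<bullet> x = a $ 1}) \<union> (\<Union>y\<in>Y. {x::real^2. axis 2 1 \<bullet> x = y}))"
      unfolding negligible_iff_null_sets by (rule AE_not_in)
    moreover have "AE x in lebesgue. \<forall>i. ddir (axis i 1) w1 x = - ddir (- axis i 1) w1 x"
      using AE_ddir_two_sided[OF w1(1,2)] by (simp add: forall_2)
    moreover have "AE x in lebesgue. \<forall>i. ddir (axis i 1) w2 x = - ddir (- axis i 1) w2 x"
      using AE_ddir_two_sided[OF w2(1,2)] by (simp add: forall_2)
    ultimately show ?thesis
    proof eventually_elim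
      case (elim x)
      show ?case
      proof
        assume x: "x \<in> \<Omega>"
        have gen: "a $ 1 \<noteq> x $ 1" "a $ 1 \<noteq> xh (x $ 2)" "a $ 2 \<noteq> x $ 2" "a $ 2 \<noteq> c (a $ 1)" if "a \<in> A" for a
          using elim(1) that c(3)[OF that] by (auto simp: inner_axis' Y_def)
        define L where "L = (\<Sum>a\<in>A. rect_kernel xh c x a * \<sigma> a)"
        have "(\<lambda>n. res w n x) \<longlonglongrightarrow> L" if w: "convex_on UNIV w" "K-lipschitz_on UNIV w" "point_MA \<Omega> A \<sigma> w" for w
          unfolding res_def L_def
        proof (rule kernel_limit[OF w(1,2) \<Omega>(2,3) A \<sigma> w(3) rect_kernel_measurable[OF c(1)] rect_kernel_bound _ compact_rect_region[OF c(1)] reg[OF x]])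
          show "rect_kernel xh c x z = 0" if "z \<notin> rect_region xh c x" for z using rect_kernel_nonzero that by blast
          show "\<forall>\<^sub>F z in nhds a. rect_kernel xh c x z = rect_kernel xh c x a" if "a \<in> A" for a
            using rect_kernel_locally_constant[OF c(1)] gen[OF that] by blast
        qed
        from this[OF w1] this[OF w2]
        have "(\<lambda>n. F n x) \<longlonglongrightarrow> (((ddir (axis 1 1) w1 x)\<^sup>2 - (ddir (axis 1 1) w2 x)\<^sup>2) - strain_defect w1 w2 1 1 x)\<^sup>2
     + 2 * (((ddir (axis 1 1) w1 x * ddir (axis 2 1) w1 x - L) - (ddir (axis 1 1) w2 x * ddir (axis 2 1) w2 x - L)) - strain_defect w1 w2 1 2 x)\<^sup>2
     + (((ddir (axis 2 1) w1 x)\<^sup>2 - (ddir (axis 2 1) w2 x)\<^sup>2) - strain_defect w1 w2 2 2 x)\<^sup>2"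
          unfolding F_def
          by (intro tendsto_intros apx_grad_tendsto[OF w1(1,2)] apx_grad_tendsto[OF w2(1,2)]) (use elim in auto)
        then show "(\<lambda>n. F n x) \<longlonglongrightarrow> 0" by (simp add: strain_defect_def power2_eq_square)
      qed
    qed
  qed
  have Om: "\<Omega> \<in> sets borel" using \<Omega>(2) by auto
  have emO: "emeasure lborel \<Omega> < \<infinity>" using \<Omega>(3) by (rule emeasure_bounded_finite)
  have iB: "integrable lborel (\<lambda>x. indicator \<Omega> x * B)"
    using Om emO by (intro integrable_mult_left integrable_real_indicator) auto
  have "(\<lambda>n. LINT x|lborel. indicator \<Omega> x * F n x) \<longlonglongrightarrow> (LINT x|(lborel :: (real^2) measure). 0 :: real)"
  proof (rule integral_dominated_convergence[OF _ _ iB])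
    show "(\<lambda>x. indicator \<Omega> x * F n x) \<in> borel_measurable lborel" for n using Fm[of n] Om by simp
    show "AE x in lborel. (\<lambda>n. indicator \<Omega> x * F n x) \<longlonglongrightarrow> 0"
    proof -
      have "AE x in lborel. x \<in> \<Omega> \<longrightarrow> (\<lambda>n. F n x) \<longlonglongrightarrow> 0" using good by (simp only: AE_completion_iff)
      then show ?thesis by (rule eventually_mono) (auto simp: indicator_def)
    qed
    show "AE x in lborel. norm (indicator \<Omega> x * F n x) \<le> indicator \<Omega> x * B" for n
      using Fb by (intro AE_I2) (auto simp: indicator_def)
  qed simp
  then have "(\<lambda>n. LINT x|lborel. indicator \<Omega> x * F n x) \<longlonglongrightarrow> 0" by simp
  from order_tendstoD(2)[OF this \<open>\<eta> > 0\<close>]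
  \<comment> \<open>One late index is fixed; the displacement and its derivatives are those of this
    approximation.\<close>
  obtain n where n: "(LINT x|lborel. indicator \<Omega> x * F n x) < \<eta>" by (auto simp: eventually_sequentially)
  have F0: "F n x \<ge> 0" for x unfolding F_def by simp
  have iF: "integrable lborel (\<lambda>x. indicator \<Omega> x * F n x)"
  proof (rule Bochner_Integration.integrable_bound[OF iB])
    show "(\<lambda>x. indicator \<Omega> x * F n x) \<in> borel_measurable lborel" using Fm[of n] Om by simp
    show "AE x in lborel. norm (indicator \<Omega> x * F n x) \<le> norm (indicator \<Omega> x * B)"
    proof (rule AE_I2)
      fix x show "norm (indicator \<Omega> x * F n x) \<le> norm (indicator \<Omega> x * B)"
        using Fb[of x n] by (cases "x \<in> \<Omega>") auto
    qed
  qed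
  have nn: "(\<integral>\<^sup>+x. ennreal (indicator \<Omega> x * F n x) \<partial>lborel) \<le> ennreal \<eta>"
    using n F0 by (subst nn_integral_eq_integral[OF iF]) (auto intro!: AE_I2 ennreal_leI)
  obtain p1 p2 g k where 1: "continuous_on UNIV p1" "continuous_on UNIV p2" "continuous_on UNIV g" "continuous_on UNIV k"
     "has_pd 1 p1 (\<lambda>x. (apx1 w1 n x)\<^sup>2 / 2)" "has_pd 2 p1 g" "has_pd 1 p2 k" "has_pd 2 p2 (\<lambda>x. (apx2 w1 n x)\<^sup>2 / 2)"
     "\<And>x. g x + k x = apx1 w1 n x * apx2 w1 n x - res w1 n x"
    using strain[OF w1(1,2), of n] by blast
  obtain q1 q2 g' k' where 2: "continuous_on UNIV q1" "continuous_on UNIV q2" "continuous_on UNIV g'" "continuous_on UNIV k'"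
     "has_pd 1 q1 (\<lambda>x. (apx1 w2 n x)\<^sup>2 / 2)" "has_pd 2 q1 g'" "has_pd 1 q2 k'" "has_pd 2 q2 (\<lambda>x. (apx2 w2 n x)\<^sup>2 / 2)"
     "\<And>x. g' x + k' x = apx1 w2 n x * apx2 w2 n x - res w2 n x"
    using strain[OF w2(1,2), of n] by blast
  show ?thesis
  proof (intro exI conjI)
    show "has_pd 1 (\<lambda>x. p1 x - q1 x) (\<lambda>x. (apx1 w1 n x)\<^sup>2 / 2 - (apx1 w2 n x)\<^sup>2 / 2)"
      "has_pd 2 (\<lambda>x. p1 x - q1 x) (\<lambda>x. g x - g' x)"
      "has_pd 1 (\<lambda>x. p2 x - q2 x) (\<lambda>x. k x - k' x)"
      "has_pd 2 (\<lambda>x. p2 x - q2 x) (\<lambda>x. (apx2 w1 n x)\<^sup>2 / 2 - (apx2 w2 n x)\<^sup>2 / 2)"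
      by (intro has_pd_diff 1 2)+
    show "continuous_on UNIV (\<lambda>x. p1 x - q1 x)" "continuous_on UNIV (\<lambda>x. p2 x - q2 x)"
      "continuous_on UNIV (\<lambda>x. (apx1 w1 n x)\<^sup>2 / 2 - (apx1 w2 n x)\<^sup>2 / 2)" "continuous_on UNIV (\<lambda>x. g x - g' x)"
      "continuous_on UNIV (\<lambda>x. k x - k' x)" "continuous_on UNIV (\<lambda>x. (apx2 w1 n x)\<^sup>2 / 2 - (apx2 w2 n x)\<^sup>2 / 2)"
      by (intro continuous_intros 1 2 cg1 cg2; simp)+
    have "(g x - g' x) + (k x - k' x) = (apx1 w1 n x * apx2 w1 n x - res w1 n x) - (apx1 w2 n x * apx2 w2 n x - res w2 n x)" for x
      using 1(9)[of x] 2(9)[of x] by linarith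
    then show "(\<integral>\<^sup>+x. ennreal (indicator \<Omega> x * ((2 * ((apx1 w1 n x)\<^sup>2 / 2 - (apx1 w2 n x)\<^sup>2 / 2) - strain_defect w1 w2 1 1 x)\<^sup>2
       + 2 * ((g x - g' x) + (k x - k' x) - strain_defect w1 w2 1 2 x)\<^sup>2
        + (2 * ((apx2 w1 n x)\<^sup>2 / 2 - (apx2 w2 n x)\<^sup>2 / 2) - strain_defect w1 w2 2 2 x)\<^sup>2)) \<partial>lborel) \<le> ennreal \<eta>"
      using nn unfolding F_def by (simp add: right_diff_distrib)
  qed
qed

section \<open>Lipschitz continuity and extension of the solution\<close>

text \<open>Adding a small paraboloid to the barrier, a violation would produce a strictly supporting
  paraboloid away from the atoms, and hence a ball of slopes there, which the measure does not
  charge.\<close>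

lemma MA_affine_barrier:
  fixes \<Omega> :: "(real^2) set"
  assumes \<Omega>: "open \<Omega>" "bounded \<Omega>" and v: "continuous_on (closure \<Omega>) v" "\<And>x. x \<in> frontier \<Omega> \<Longrightarrow> v x = 0"
    and A: "finite A" and MA: "\<And>E. compact E \<Longrightarrow> E \<subseteq> \<Omega> \<Longrightarrow> E \<inter> A = {} \<Longrightarrow> emeasure lebesgue (\<Union>x\<in>E. subdiff \<Omega> v x) = 0"
    and bd: "\<And>x. x \<in> frontier \<Omega> \<Longrightarrow> q \<bullet> x + b \<le> 0" and at: "\<And>a. a \<in> A \<Longrightarrow> q \<bullet> a + b \<le> v a"
    and x1: "x1 \<in> \<Omega>"
  shows "q \<bullet> x1 + b \<le> v x1"
proof (rule ccontr)
  assume "\<not> q \<bullet> x1 + b \<le> v x1"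
  then have neg: "v x1 - (q \<bullet> x1 + b) < 0" by simp
  obtain R where "R > 0" "\<Omega> \<subseteq> ball x1 R"
    using bounded_subset_ballD[OF \<Omega>(2)] by blast
  then have R: "R > 0" "\<Omega> \<subseteq> cball x1 R" using ball_subset_cball by auto
  then have cR: "closure \<Omega> \<subseteq> cball x1 R" by (intro closure_minimal) auto
  \<comment> \<open>The paraboloid term raises \<open>g\<close> on the whole closure, by exactly
    half of the violation at \<open>x1\<close>. Hence \<open>g\<close> is still negative at
    \<open>x1\<close>, but nonnegative on the boundary and at the atoms.\<close>
  define \<epsilon> where "\<epsilon> = (q \<bullet> x1 + b - v x1) / (2 * R\<^sup>2)"
  have \<epsilon>: "\<epsilon> > 0" "\<epsilon> * R\<^sup>2 = (q \<bullet> x1 + b - v x1) / 2" using neg R by (auto simp: \<epsilon>_def)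
  define g where "g y = v y - (q \<bullet> y + b) - \<epsilon> * ((norm (y - x1))\<^sup>2 - R\<^sup>2)" for y
  have cl: "compact (closure \<Omega>)" "closure \<Omega> \<noteq> {}" using \<Omega>(2) x1 by (auto simp: compact_closure)
  have "continuous_on (closure \<Omega>) g" unfolding g_def by (intro continuous_intros v)
  then obtain z where z: "z \<in> closure \<Omega>" "\<And>y. y \<in> closure \<Omega> \<Longrightarrow> g z \<le> g y"
    using continuous_attains_inf[OF cl] by blast
  have sq: "\<epsilon> * ((norm (y - x1))\<^sup>2 - R\<^sup>2) \<le> 0" if "y \<in> closure \<Omega>" for y
  proof -
    have "norm (y - x1) \<le> R" using cR that by (auto simp: dist_norm norm_minus_commute)
    then have "(norm (y - x1))\<^sup>2 \<le> R\<^sup>2" by (intro power_mono) auto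
    then show ?thesis using \<epsilon> by (intro mult_nonneg_nonpos) auto
  qed
  have "g x1 < 0" using neg \<epsilon> by (simp add: g_def)
  then have gz: "g z < 0" using z(2)[of x1] x1 closure_subset[of \<Omega>] by auto
  have "z \<notin> frontier \<Omega>" using v(2)[of z] bd[of z] sq[OF z(1)] gz by (auto simp: g_def)
  then have zO: "z \<in> \<Omega>" using z(1) \<Omega>(1) by (auto simp: frontier_def interior_open)
  have zA: "z \<notin> A" using at[of z] sq[OF z(1)] gz by (auto simp: g_def)
  have "open (\<Omega> - A)" using \<Omega>(1) A by (simp add: finite_imp_closed open_Diff)
  then obtain r where r: "r > 0" "cball z r \<subseteq> \<Omega> - A" using zO zA open_contains_cball by blast
  \<comment> \<open>The slope of the touching paraboloid at \<open>z\<close>.\<close>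
  define p where "p = q + (2 * \<epsilon>) *\<^sub>R (z - x1)"
  have supp: "v y \<ge> v z + p \<bullet> (y - z) + \<epsilon> * (norm (y - z))\<^sup>2" if "y \<in> closure \<Omega>" for y
  proof -
    have "(norm (y - x1))\<^sup>2 - (norm (z - x1))\<^sup>2 = (norm (y - z))\<^sup>2 + 2 * ((z - x1) \<bullet> (y - z))"
      unfolding power2_norm_eq_inner by (simp add: algebra_simps inner_commute)
    then have "\<epsilon> * ((norm (y - x1))\<^sup>2 - (norm (z - x1))\<^sup>2) = \<epsilon> * ((norm (y - z))\<^sup>2 + 2 * ((z - x1) \<bullet> (y - z)))"
      by (rule arg_cong)
    then have "\<epsilon> * ((norm (y - x1))\<^sup>2 - R\<^sup>2) - \<epsilon> * ((norm (z - x1))\<^sup>2 - R\<^sup>2) = \<epsilon> * (norm (y - z))\<^sup>2 + 2 * \<epsilon> * ((z - x1) \<bullet> (y - z))"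
      by (simp add: right_diff_distrib distrib_left)
    moreover have "p \<bullet> (y - z) = q \<bullet> y - q \<bullet> z + 2 * \<epsilon> * ((z - x1) \<bullet> (y - z))"
      by (simp add: p_def inner_add_left inner_diff_right[of q])
    ultimately show ?thesis using z(2)[OF that] unfolding g_def by linarith
  qed
  \<comment> \<open>Tilting p by less than \<epsilon> r moves the minimiser by at most r, because v
    exceeds the plane of slope p through its value at z by \<epsilon> |y - z|^2.\<close>
  have "ball p (\<epsilon> * r) \<subseteq> (\<Union>x\<in>cball z r. subdiff \<Omega> v x)"
  proof
    fix p' assume p': "p' \<in> ball p (\<epsilon> * r)"
    have "continuous_on (closure \<Omega>) (\<lambda>y. v y - p' \<bullet> y)" by (intro continuous_intros v)
    then obtain y where y: "y \<in> closure \<Omega>" "\<And>x. x \<in> closure \<Omega> \<Longrightarrow> v y - p' \<bullet> y \<le> v x - p' \<bullet> x"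
      using continuous_attains_inf[OF cl] by blast
    have "norm (y - z) \<le> r"
    proof (rule ccontr)
      assume "\<not> norm (y - z) \<le> r"
      then have yz: "r < norm (y - z)" by simp
      have "\<epsilon> * (norm (y - z))\<^sup>2 \<le> (p' - p) \<bullet> (y - z)"
        using y(2)[OF z(1)] supp[OF y(1)] by (simp add: algebra_simps)
      also have "\<dots> \<le> norm (p' - p) * norm (y - z)" by (rule norm_cauchy_schwarz)
      finally have le: "(\<epsilon> * norm (y - z)) * norm (y - z) \<le> norm (p' - p) * norm (y - z)"
        by (simp add: power2_eq_square mult.assoc)
      have "norm (y - z) > 0" using yz r by linarith
      with le have "\<epsilon> * norm (y - z) \<le> norm (p' - p)" by (rule mult_right_le_imp_le)
      moreover have "\<epsilon> * r < \<epsilon> * norm (y - z)" using yz \<epsilon> by simp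
      ultimately show False using p' by (simp add: dist_norm norm_minus_commute)
    qed
    moreover have "p' \<in> subdiff \<Omega> v y"
      using y(2) closure_subset[of \<Omega>] by (fastforce simp: subdiff_def algebra_simps)
    ultimately show "p' \<in> (\<Union>x\<in>cball z r. subdiff \<Omega> v x)" by (auto simp: dist_norm norm_minus_commute)
  qed
  moreover have "closed (\<Union>x\<in>cball z r. subdiff \<Omega> v x)"
    using r closure_subset[of \<Omega>] by (intro closed_subdiff_compact continuous_on_subset[OF v(1)]) auto
  ultimately have "emeasure lebesgue (ball p (\<epsilon> * r)) \<le> emeasure lebesgue (\<Union>x\<in>cball z r. subdiff \<Omega> v x)"
    by (intro emeasure_mono) auto
  also have "\<dots> = 0" using r by (intro MA) auto
  finally have "negligible (ball p (\<epsilon> * r))" by (auto simp: negligible_iff_null_sets null_sets_def)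
  moreover have "\<epsilon> * r > 0" using \<epsilon>(1) r(1) by (rule mult_pos_pos)
  ultimately show False using open_not_negligible[of "ball p (\<epsilon> * r)"] by auto
qed

text \<open>An affine barrier vanishing on a supporting line at a boundary point b gives -v(x) \<le>
  K |x - b|. When the segment from x through y is prolonged to the boundary, where v = 0, convexity
  turns this estimate into a Lipschitz bound for the pair.\<close>

lemma MA_lipschitz:
  fixes \<Omega> :: "(real^2) set"
  assumes \<Omega>: "convex \<Omega>" "open \<Omega>" "bounded \<Omega>"
    and v: "convex_on \<Omega> v" "continuous_on (closure \<Omega>) v" "\<And>x. x \<in> frontier \<Omega> \<Longrightarrow> v x = 0"
    and A: "finite A" "A \<subseteq> \<Omega>" and MA: "\<And>E. compact E \<Longrightarrow> E \<subseteq> \<Omega> \<Longrightarrow> E \<inter> A = {} \<Longrightarrow> emeasure lebesgue (\<Union>x\<in>E. subdiff \<Omega> v x) = 0"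
  shows "\<exists>K. K-lipschitz_on \<Omega> v"
proof -
  \<comment> \<open>The ball of radius d about the atom lies in the domain, so every supporting line
    is at least d away; slope |v a| / d thus pushes the barrier below v at the atom.\<close>
  have "\<exists>k\<ge>0. \<forall>n. norm n = 1 \<longrightarrow> (\<forall>b. (\<forall>y\<in>\<Omega>. n \<bullet> y \<le> n \<bullet> b) \<longrightarrow> k * (n \<bullet> (a - b)) \<le> v a)" if a: "a \<in> A" for a
  proof -
    obtain d where d: "d > 0" "cball a d \<subseteq> \<Omega>" using \<Omega>(2) A a open_contains_cball by blast
    show ?thesis
    proof (intro exI[of _ "\<bar>v a\<bar> / d"] conjI allI impI)
      fix n b :: "real^2" assume n: "norm n = 1" "\<forall>y\<in>\<Omega>. n \<bullet> y \<le> n \<bullet> b"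
      have "a + d *\<^sub>R n \<in> \<Omega>" using d n by (auto simp: dist_norm subset_iff)
      then have "n \<bullet> (a + d *\<^sub>R n) \<le> n \<bullet> b" using n by blast
      then have "n \<bullet> (a - b) \<le> - d" using n by (simp add: algebra_simps dot_square_norm)
      then have "(\<bar>v a\<bar> / d) * (n \<bullet> (a - b)) \<le> (\<bar>v a\<bar> / d) * (- d)" using d by (intro mult_left_mono) auto
      also have "\<dots> = - \<bar>v a\<bar>" using d by simp
      finally show "\<bar>v a\<bar> / d * (n \<bullet> (a - b)) \<le> v a" by simp
    qed (use d in auto)
  qed
  then obtain k where k: "\<And>a. a \<in> A \<Longrightarrow> k a \<ge> 0"
    "\<And>a n b. a \<in> A \<Longrightarrow> norm n = 1 \<Longrightarrow> (\<forall>y\<in>\<Omega>. n \<bullet> y \<le> n \<bullet> b) \<Longrightarrow> k a * (n \<bullet> (a - b)) \<le> v a"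
    by metis
  define K where "K = (\<Sum>a\<in>A. k a)"
  have K: "K \<ge> 0" unfolding K_def using k by (intro sum_nonneg)
  have kK: "k a \<le> K" if "a \<in> A" for a unfolding K_def using k that A by (intro member_le_sum) auto
  have low: "- v x \<le> K * norm (x - b)" if x: "x \<in> \<Omega>" and b: "b \<in> frontier \<Omega>" for x b
  proof -
    have "b \<notin> \<Omega>" using b \<Omega>(2) by (simp add: frontier_def interior_open)
    then obtain m \<beta> where m: "m \<noteq> 0" "\<forall>y\<in>\<Omega>. m \<bullet> y \<le> \<beta>" "\<forall>y\<in>{b}. m \<bullet> y \<ge> \<beta>"
      using separating_hyperplane_sets[OF \<Omega>(1) convex_singleton, of b] x by blast
    define n where "n = (1 / norm m) *\<^sub>R m"
    have n1: "norm n = 1" using m by (simp add: n_def)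
    have n2: "\<forall>y\<in>\<Omega>. n \<bullet> y \<le> n \<bullet> b"
      using m by (auto simp: n_def divide_right_mono intro: order_trans)
    have "(K *\<^sub>R n) \<bullet> x + (- K * (n \<bullet> b)) \<le> v x"
    proof (rule MA_affine_barrier[OF \<Omega>(2,3) v(2,3) A(1) MA _ _ x])
      fix y assume "y \<in> frontier \<Omega>"
      then have "y \<in> closure \<Omega>" by (simp add: frontier_def)
      moreover have "closure \<Omega> \<subseteq> {y. n \<bullet> y \<le> n \<bullet> b}"
        using n2 by (intro closure_minimal closed_halfspace_le) auto
      ultimately have "n \<bullet> y \<le> n \<bullet> b" by auto
      then show "(K *\<^sub>R n) \<bullet> y + (- K * (n \<bullet> b)) \<le> 0" using K by (simp add: mult_left_mono)
    next
      fix a assume a: "a \<in> A"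
      have "n \<bullet> (a - b) \<le> 0" using n2 A a by (auto simp: inner_diff_right)
      then have "K * (n \<bullet> (a - b)) \<le> k a * (n \<bullet> (a - b))" using kK[OF a] by (rule mult_right_mono_neg[rotated])
      also have "\<dots> \<le> v a" using k(2)[OF a n1 n2] .
      finally show "(K *\<^sub>R n) \<bullet> a + (- K * (n \<bullet> b)) \<le> v a" by (simp add: inner_diff_right algebra_simps)
    qed auto
    then have "- v x \<le> K * (n \<bullet> (b - x))" by (simp add: inner_diff_right algebra_simps)
    also have "\<dots> \<le> K * norm (x - b)"
      using norm_cauchy_schwarz[of n "b - x"] n1 K by (intro mult_left_mono) (auto simp: norm_minus_commute)
    finally show ?thesis .
  qed
  have one: "v y - v x \<le> K * norm (y - x)" if x: "x \<in> \<Omega>" and y: "y \<in> \<Omega>" and ne: "x \<noteq> y" for x y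
  proof -
    have yi: "y \<in> interior \<Omega>" using y \<Omega>(2) by (simp add: interior_open)
    have "y - x \<noteq> 0" using ne by simp
    then obtain d where d: "0 < d" "y + d *\<^sub>R (y - x) \<in> frontier \<Omega>"
      "\<And>e. 0 \<le> e \<Longrightarrow> e < d \<Longrightarrow> y + e *\<^sub>R (y - x) \<in> interior \<Omega>"
      using ray_to_frontier[OF \<Omega>(3) yi] by metis
    have ineq: "(1 + e) * v y \<le> e * v x + v (y + e *\<^sub>R (y - x))" if e: "0 < e" "e < d" for e
    proof -
      let ?z = "y + e *\<^sub>R (y - x)"
      have zO: "?z \<in> \<Omega>" using d(3)[of e] e interior_subset by auto
      have "(1 - e / (1 + e)) *\<^sub>R ?z + (e / (1 + e)) *\<^sub>R x = (1 / (1 + e)) *\<^sub>R ((1 + e) *\<^sub>R y)"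
        using e by (simp add: vec_eq_iff field_simps)
      also have "\<dots> = y" using e by simp
      finally have "v y \<le> (1 - e / (1 + e)) * v ?z + (e / (1 + e)) * v x"
        using convex_onD[OF v(1), of "e / (1 + e)" ?z x] e zO x by simp
      then have "(1 + e) * v y \<le> (1 + e) * ((1 - e / (1 + e)) * v ?z + (e / (1 + e)) * v x)"
        using e by (intro mult_left_mono) auto
      also have "\<dots> = ((1 + e) * (1 - e / (1 + e))) * v ?z + ((1 + e) * (e / (1 + e))) * v x"
        by (simp only: distrib_left mult.assoc)
      also have "(1 + e) * (1 - e / (1 + e)) = 1" using e by (simp add: right_diff_distrib)
      also have "(1 + e) * (e / (1 + e)) = e" using e by simp
      finally show ?thesis by simp
    qed
    \<comment> \<open>Times approaching the exit time d from below, since convexity is available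
      only in the domain; the double successor keeps \<open>E 0\<close> positive.\<close>
    define E where "E n = d * (1 - inverse (real (Suc (Suc n))))" for n
    have E: "0 < E n" "E n < d" for n
    proof -
      have i: "0 < inverse (real (Suc (Suc n)))" "inverse (real (Suc (Suc n))) < 1" by (simp_all add: field_simps)
      show "0 < E n" unfolding E_def using d(1) i(2) by (intro mult_pos_pos) auto
      have "d * inverse (real (Suc (Suc n))) > 0" using d(1) i(1) by (rule mult_pos_pos)
      then show "E n < d" unfolding E_def right_diff_distrib by linarith
    qed
    have El: "E \<longlonglongrightarrow> d"
    proof -
      have "(\<lambda>n. d * (1 - inverse (real (Suc (Suc n))))) \<longlonglongrightarrow> d * (1 - 0)"
        by (intro tendsto_intros LIMSEQ_Suc[OF LIMSEQ_inverse_real_of_nat])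
      then show ?thesis by (simp add: E_def[abs_def])
    qed
    have ycl: "y + d *\<^sub>R (y - x) \<in> closure \<Omega>" using d(2) by (simp add: frontier_def)
    have "(\<lambda>n. v (y + E n *\<^sub>R (y - x))) \<longlonglongrightarrow> v (y + d *\<^sub>R (y - x))"
    proof (rule continuous_on_tendsto_compose[OF v(2) _ ycl])
      show "(\<lambda>n. y + E n *\<^sub>R (y - x)) \<longlonglongrightarrow> y + d *\<^sub>R (y - x)" by (intro tendsto_intros El)
      show "eventually (\<lambda>n. y + E n *\<^sub>R (y - x) \<in> closure \<Omega>) sequentially"
        using d(3) E interior_subset[of \<Omega>] closure_subset[of \<Omega>] by (intro always_eventually) (meson less_imp_le subsetD)
    qed
    then have "(\<lambda>n. E n * v x + v (y + E n *\<^sub>R (y - x))) \<longlonglongrightarrow> d * v x + 0"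
      using v(3)[OF d(2)] by (intro tendsto_intros El) simp
    moreover have "(\<lambda>n. (1 + E n) * v y) \<longlonglongrightarrow> (1 + d) * v y" by (intro tendsto_intros El)
    ultimately have "(1 + d) * v y \<le> d * v x + 0"
      using ineq E by (intro LIMSEQ_le) auto
    then have "d * (v y - v x) \<le> - v y" by (simp add: algebra_simps)
    also have "\<dots> \<le> K * norm (y - (y + d *\<^sub>R (y - x)))" by (rule low[OF y d(2)])
    also have "\<dots> = d * (K * norm (y - x))" using d(1) by simp
    finally show ?thesis using d(1) by simp
  qed
  have "K-lipschitz_on \<Omega> v"
  proof (rule lipschitz_onI[OF _ K])
    fix x y assume xy: "x \<in> \<Omega>" "y \<in> \<Omega>"
    show "dist (v x) (v y) \<le> K * dist x y"
      using one[OF xy] one[OF xy(2,1)] by (cases "x = y") (auto simp: dist_real_def dist_norm norm_minus_commute abs_le_iff)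
  qed
  then show ?thesis by blast
qed

text \<open>The infimal convolution with the cone of slope K.\<close>

lemma convex_lipschitz_extension:
  fixes v :: "'a::real_normed_vector \<Rightarrow> real"
  assumes \<Omega>: "convex \<Omega>" "\<Omega> \<noteq> {}" and v: "convex_on \<Omega> v" and K: "K-lipschitz_on \<Omega> v"
  obtains w where "convex_on UNIV w" "K-lipschitz_on UNIV w" "\<And>x. x \<in> \<Omega> \<Longrightarrow> w x = v x"
proof -
  have K0: "K \<ge> 0" using K by (rule lipschitz_on_nonneg)
  define f where "f x z = v z + K * norm (x - z)" for x z
  define w where "w x = (INF z\<in>\<Omega>. f x z)" for x
  obtain z0 where z0: "z0 \<in> \<Omega>" using \<Omega> by blast
  have lv: "v z \<ge> v y - K * norm (z - y)" if "y \<in> \<Omega>" "z \<in> \<Omega>" for y z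
    using lipschitz_onD[OF K, of z y] that by (auto simp: dist_real_def dist_norm)
  have bdd: "bdd_below (f x ` \<Omega>)" for x
  proof (rule bdd_belowI2)
    fix z assume "z \<in> \<Omega>"
    then have "v z \<ge> v z0 - K * norm (z - z0)" using lv z0 by blast
    moreover have "K * norm (z - z0) \<le> K * (norm (x - z) + norm (x - z0))"
      using K0 norm_triangle_ineq4[of "x - z0" "x - z"] by (intro mult_left_mono) (auto simp: algebra_simps)
    ultimately show "v z0 - K * norm (x - z0) \<le> f x z" by (simp add: f_def algebra_simps)
  qed
  have le: "w x \<le> f x z" if "z \<in> \<Omega>" for x z unfolding w_def using bdd that by (rule cINF_lower)
  show thesis
  proof (rule that[of w])
    show "w x = v x" if x: "x \<in> \<Omega>" for x
    proof (rule antisym)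
      show "w x \<le> v x" using le[OF x, of x] by (simp add: f_def)
      show "v x \<le> w x" unfolding w_def using \<Omega>(2) lv[OF x]
        by (intro cINF_greatest) (auto simp: f_def norm_minus_commute algebra_simps)
    qed
    have L: "w x \<le> w y + K * norm (x - y)" for x y
    proof -
      have "w x - K * norm (x - y) \<le> w y"
        unfolding w_def[of y]
      proof (rule cINF_greatest[OF \<Omega>(2)])
        fix z assume z: "z \<in> \<Omega>"
        have "K * norm (x - z) \<le> K * (norm (x - y) + norm (y - z))"
          using K0 norm_triangle_ineq[of "x - y" "y - z"] by (intro mult_left_mono) auto
        then show "w x - K * norm (x - y) \<le> f y z" using le[OF z, of x] by (simp add: f_def algebra_simps)
      qed
      then show ?thesis by simp
    qed
    show "K-lipschitz_on UNIV w"
    proof (rule lipschitz_onI[OF _ K0])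
      fix x y show "dist (w x) (w y) \<le> K * dist x y"
        using L[of x y] L[of y x] by (simp add: dist_real_def dist_norm abs_le_iff norm_minus_commute[of y x])
    qed
    show "convex_on UNIV w"
    proof (rule convex_onI)
      fix t x y assume t: "0 < t" "t < (1::real)"
      show "w ((1 - t) *\<^sub>R x + t *\<^sub>R y) \<le> (1 - t) * w x + t * w y"
      proof (rule field_le_epsilon)
        fix e :: real assume e: "e > 0"
        obtain z1 where z1: "z1 \<in> \<Omega>" "f x z1 < w x + e"
          using cINF_less_iff[OF \<Omega>(2) bdd, of x "w x + e"] e by (auto simp: w_def)
        obtain z2 where z2: "z2 \<in> \<Omega>" "f y z2 < w y + e"
          using cINF_less_iff[OF \<Omega>(2) bdd, of y "w y + e"] e by (auto simp: w_def)
        let ?z = "(1 - t) *\<^sub>R z1 + t *\<^sub>R z2"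
        have z: "?z \<in> \<Omega>" using \<Omega>(1) z1 z2 t by (intro convexD) auto
        have "(1 - t) *\<^sub>R x + t *\<^sub>R y - ?z = (1 - t) *\<^sub>R (x - z1) + t *\<^sub>R (y - z2)" by (simp add: algebra_simps)
        then have "norm ((1 - t) *\<^sub>R x + t *\<^sub>R y - ?z) \<le> (1 - t) * norm (x - z1) + t * norm (y - z2)"
          using norm_triangle_ineq[of "(1 - t) *\<^sub>R (x - z1)" "t *\<^sub>R (y - z2)"] t by simp
        from mult_left_mono[OF this K0]
        have "f ((1 - t) *\<^sub>R x + t *\<^sub>R y) ?z \<le> (1 - t) * f x z1 + t * f y z2"
          using convex_onD[OF v, of t z1 z2] t z1 z2 by (simp add: f_def algebra_simps)
        also have "\<dots> \<le> (1 - t) * (w x + e) + t * (w y + e)"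
          using t z1 z2 by (intro add_mono mult_left_mono) auto
        finally show "w ((1 - t) *\<^sub>R x + t *\<^sub>R y) \<le> (1 - t) * w x + t * w y + e"
          using le[OF z, of "(1 - t) *\<^sub>R x + t *\<^sub>R y"] by (simp add: algebra_simps)
      qed
    qed simp
  qed
qed

definition atom_mass :: "nat \<Rightarrow> (nat \<Rightarrow> real^2) \<Rightarrow> (nat \<Rightarrow> real) \<Rightarrow> real^2 \<Rightarrow> real" where
  "atom_mass N a \<sigma> x = (\<Sum>i=1..N. if a i = x then \<sigma> i else 0)"

text \<open>The extension leaves the values in the domain unchanged, hence also the slopes
  supporting there, and so the measure.\<close>

lemma MA_solution_extension:
  fixes \<Omega> :: "(real^2) set"
  assumes \<Omega>: "convex \<Omega>" "open \<Omega>" "bounded \<Omega>" "\<Omega> \<noteq> {}"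
    and a: "\<And>i. i \<in> {1..N} \<Longrightarrow> a i \<in> \<Omega>" and \<sigma>: "\<And>i. i \<in> {1..N} \<Longrightarrow> \<sigma> i > 0"
    and sol: "MA_solution \<Omega> (sum_dirac N a \<sigma>) v"
  obtains w K where "convex_on UNIV w" "K-lipschitz_on UNIV w" "\<And>x. x \<in> \<Omega> \<Longrightarrow> w x = v x"
    "point_MA \<Omega> (a ` {1..N}) (atom_mass N a \<sigma>) w"
proof -
  let ?A = "a ` {1..N}"
  have v: "convex_on \<Omega> v" "continuous_on (closure \<Omega>) v" "\<And>x. x \<in> frontier \<Omega> \<Longrightarrow> v x = 0"
    and MA: "\<And>E. E \<in> sets borel \<Longrightarrow> E \<subseteq> \<Omega> \<Longrightarrow> emeasure lebesgue (\<Union>x\<in>E. subdiff \<Omega> v x) = sum_dirac N a \<sigma> E"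
    using sol by (auto simp: MA_solution_def monge_ampere_def)
  have s0: "sum_dirac N a \<sigma> E = 0" if "E \<inter> ?A = {}" for E
    unfolding sum_dirac_def using that by (intro sum.neutral) (auto simp: indicator_def)
  have s1: "sum_dirac N a \<sigma> E = ennreal (atom_mass N a \<sigma> x)" if "E \<inter> ?A = {x}" for E x
  proof -
    have "ennreal (\<sigma> i) * indicator E (a i) = ennreal (if a i = x then \<sigma> i else 0)" if i: "i \<in> {1..N}" for i
      using i \<open>E \<inter> ?A = {x}\<close> by (cases "a i = x") (auto simp: indicator_def)
    then have "sum_dirac N a \<sigma> E = (\<Sum>i=1..N. ennreal (if a i = x then \<sigma> i else 0))"
      unfolding sum_dirac_def by (intro sum.cong refl) blast
    also have "\<dots> = ennreal (atom_mass N a \<sigma> x)"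
      unfolding atom_mass_def using \<sigma> by (intro sum_ennreal) (auto intro: less_imp_le)
    finally show ?thesis .
  qed
  have MA0: "emeasure lebesgue (\<Union>x\<in>E. subdiff \<Omega> v x) = 0" if "compact E" "E \<subseteq> \<Omega>" "E \<inter> ?A = {}" for E
    using MA[of E] s0[of E] that by (simp add: compact_imp_closed)
  have "\<exists>K. K-lipschitz_on \<Omega> v"
    using a by (intro MA_lipschitz[OF \<Omega>(1-3) v _ _ MA0, of ?A]) auto
  then obtain K where K: "K-lipschitz_on \<Omega> v" by blast
  obtain w where w: "convex_on UNIV w" "K-lipschitz_on UNIV w" "\<And>x. x \<in> \<Omega> \<Longrightarrow> w x = v x"
    using convex_lipschitz_extension[OF \<Omega>(1,4) v(1) K] by blast
  have sd: "subdiff \<Omega> w x = subdiff \<Omega> v x" if "x \<in> \<Omega>" for x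
    using w(3) that by (auto simp: subdiff_def)
  have "point_MA \<Omega> ?A (atom_mass N a \<sigma>) w"
    unfolding point_MA_def
  proof (intro allI impI conjI)
    fix E :: "(real^2) set" assume E: "compact E" "E \<subseteq> \<Omega>"
    have eq: "(\<Union>x\<in>E. subdiff \<Omega> w x) = (\<Union>x\<in>E. subdiff \<Omega> v x)" if "E \<subseteq> \<Omega>" for E using sd that by auto
    show "emeasure lebesgue (\<Union>x\<in>E. subdiff \<Omega> w x) = 0" if "E \<inter> ?A = {}"
      unfolding eq[OF E(2)] using MA0 E that by blast
    fix x assume x: "E \<inter> ?A = {x}"
    show "emeasure lebesgue (\<Union>x\<in>E. subdiff \<Omega> w x) = ennreal (atom_mass N a \<sigma> x)"
      unfolding eq[OF E(2)] using MA[of E] s1[OF x] E by (simp add: compact_imp_closed)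
    have "x \<in> \<Omega>" "{x} \<inter> ?A = {x}" using x E by auto
    then show "emeasure lebesgue (subdiff \<Omega> w x) = ennreal (atom_mass N a \<sigma> x)"
      using MA[of "{x}"] s1[of "{x}" x] sd[of x] by simp
  qed
  with w show thesis using that by blast
qed

section \<open>An explicit function with prescribed atoms\<close>

text \<open>The support function of the lens between two parabolas; its Hessian is supported in the double
  cone around the first axis, outside of which it is the absolute value of the second coordinate.\<close>

definition lens_slope :: "real^2 \<Rightarrow> real" where
  "lens_slope y = y $ 2 / max \<bar>y $ 1\<bar> \<bar>y $ 2\<bar>"

text \<open>A point of the lens maximising the inner product with y: on the arcs |p1| = (1 - p2^2) /
  2 stationarity gives p2 = y2 / |y1|, which the maximum in \<open>lens_slope\<close> truncates at
  the tips (0, 1) and (0, -1).\<close>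

definition lens_grad :: "real^2 \<Rightarrow> real^2" where
  "lens_grad y = vector [sgn (y $ 1) * (1 - (lens_slope y)\<^sup>2) / 2, lens_slope y]"

definition lens_fun :: "real^2 \<Rightarrow> real" where
  "lens_fun y = lens_grad y \<bullet> y"

definition lens :: "(real^2) set" where
  "lens = {p. \<bar>p $ 1\<bar> \<le> (1 - (p $ 2)\<^sup>2) / 2}"

lemma lens_slope_max: "lens_slope y * max \<bar>y $ 1\<bar> \<bar>y $ 2\<bar> = y $ 2"
  by (auto simp: lens_slope_def max_def)

lemma lens_slope_le_1: "\<bar>lens_slope y\<bar> \<le> 1"
  by (auto simp: lens_slope_def divide_le_eq_1)

lemma lens_grad_nth: "lens_grad y $ 1 = sgn (y $ 1) * (1 - (lens_slope y)\<^sup>2) / 2" "lens_grad y $ 2 = lens_slope y"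
  by (simp_all add: lens_grad_def)

lemma slope_sq: "(lens_slope y)\<^sup>2 \<le> 1"
  using lens_slope_le_1[of y] by (simp add: abs_square_le_1)

lemma lens_grad_in_lens: "lens_grad y \<in> lens"
  using slope_sq[of y] by (auto simp: lens_def lens_grad_nth abs_mult abs_sgn_eq)

text \<open>The slopes away from the vertex lie on the two arcs, which form a null set; this is what
  leaves no measure off the atoms.\<close>

lemma lens_grad_boundary:
  assumes "y \<noteq> 0"
  shows "\<bar>lens_grad y $ 1\<bar> = (1 - (lens_grad y $ 2)\<^sup>2) / 2"
proof (cases "y $ 1 = 0")
  case True
  then have "y $ 2 \<noteq> 0" using assms by (auto simp: vec_eq_iff forall_2)
  then have "(lens_slope y)\<^sup>2 = 1" using True by (simp add: lens_slope_def power_divide)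
  then show ?thesis by (simp add: lens_grad_nth)
next
  case False
  then show ?thesis using slope_sq[of y] by (simp add: lens_grad_nth abs_mult abs_sgn_eq)
qed

lemma lens_grad_outside:
  assumes "\<bar>y $ 1\<bar> \<le> \<bar>y $ 2\<bar>" "y $ 2 \<noteq> 0"
  shows "lens_grad y = vector [0, sgn (y $ 2)]"
proof -
  have "lens_slope y = sgn (y $ 2)" using assms by (simp add: lens_slope_def max_def sgn_if)
  moreover have "(sgn (y $ 2))\<^sup>2 = 1" using assms by (simp add: sgn_if)
  ultimately show ?thesis by (simp add: lens_grad_def)
qed

text \<open>Inside the double cone the deficit is at least \<open>(T - p $ 2)\<^sup>2 / 2\<close>
  times |y1|; outside it the inequality reduces to (1 - |p2|)^2 \<ge> 0.\<close>

lemma lens_fun_support: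
  assumes "p \<in> lens"
  shows "p \<bullet> y \<le> lens_fun y"
proof -
  have p1: "\<bar>p $ 1\<bar> \<le> (1 - (p $ 2)\<^sup>2) / 2" using assms by (simp add: lens_def)
  have p2: "\<bar>p $ 2\<bar> \<le> 1"
  proof -
    have "(p $ 2)\<^sup>2 \<le> 1" using order_trans[OF abs_ge_zero p1] by simp
    then show ?thesis by (simp add: abs_square_le_1)
  qed
  have "p \<bullet> y \<le> \<bar>p $ 1\<bar> * \<bar>y $ 1\<bar> + p $ 2 * y $ 2"
    using abs_ge_self[of "p $ 1 * y $ 1"] by (simp add: inner_vec2 abs_mult)
  also have "\<dots> \<le> (1 - (p $ 2)\<^sup>2) / 2 * \<bar>y $ 1\<bar> + p $ 2 * y $ 2"
    using mult_right_mono[OF p1 abs_ge_zero[of "y $ 1"]] by simp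
  also have "\<dots> \<le> lens_fun y"
  proof (cases "\<bar>y $ 1\<bar> \<le> \<bar>y $ 2\<bar>")
    case True
    show ?thesis
    proof (cases "y $ 2 = 0")
      case True
      then have "y = 0" using \<open>\<bar>y $ 1\<bar> \<le> \<bar>y $ 2\<bar>\<close> by (simp add: vec_eq_iff forall_2)
      then show ?thesis by (simp add: lens_fun_def)
    next
      case False
      have L: "lens_fun y = \<bar>y $ 2\<bar>"
        using False by (simp add: lens_fun_def lens_grad_outside[OF True False] inner_vec2 abs_sgn mult.commute)
      have nn: "(1 - (p $ 2)\<^sup>2) / 2 \<ge> 0" by (rule order_trans[OF abs_ge_zero p1])
      have "(1 - (p $ 2)\<^sup>2) / 2 * \<bar>y $ 1\<bar> + p $ 2 * y $ 2 \<le> (1 - \<bar>p $ 2\<bar>\<^sup>2) / 2 * \<bar>y $ 2\<bar> + \<bar>p $ 2\<bar> * \<bar>y $ 2\<bar>"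
        using mult_left_mono[OF True nn] abs_ge_self[of "p $ 2 * y $ 2"] by (simp add: abs_mult)
      also have "\<dots> = ((1 - \<bar>p $ 2\<bar>\<^sup>2) / 2 + \<bar>p $ 2\<bar>) * \<bar>y $ 2\<bar>" by (simp add: distrib_right)
      also have "\<dots> \<le> 1 * \<bar>y $ 2\<bar>"
      proof (rule mult_right_mono)
        have "(1 - \<bar>p $ 2\<bar>)\<^sup>2 \<ge> 0" by simp
        then show "(1 - \<bar>p $ 2\<bar>\<^sup>2) / 2 + \<bar>p $ 2\<bar> \<le> 1" by (simp add: power2_eq_square field_simps)
      qed simp
      finally show ?thesis using L by simp
    qed
  next
    case False
    then have y1: "\<bar>y $ 1\<bar> > 0" by linarith
    have sl: "lens_slope y = y $ 2 / \<bar>y $ 1\<bar>" using False by (simp add: lens_slope_def max_def)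
    define s where "s = \<bar>y $ 1\<bar>"
    define T where "T = lens_slope y"
    have s: "s > 0" using y1 by (simp add: s_def)
    have T: "y $ 2 = T * s" using s by (simp add: T_def sl s_def)
    have "sgn (y $ 1) * y $ 1 = s" by (simp add: s_def abs_sgn mult.commute)
    moreover have "lens_fun y = (sgn (y $ 1) * y $ 1) * ((1 - T\<^sup>2) / 2) + T * y $ 2"
      by (simp add: lens_fun_def inner_vec2 lens_grad_nth T_def)
    ultimately have "lens_fun y = (1 - T\<^sup>2) / 2 * s + T * (T * s)"
      using T by (simp add: mult.commute)
    moreover have "(1 - T\<^sup>2) / 2 * s + T * (T * s) - ((1 - (p $ 2)\<^sup>2) / 2 * s + p $ 2 * (T * s)) = (T - p $ 2)\<^sup>2 / 2 * s"
      by (simp add: power2_eq_square field_simps)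
    moreover have "(T - p $ 2)\<^sup>2 / 2 * s \<ge> 0" using s by simp
    ultimately show ?thesis unfolding T s_def[symmetric] by linarith
  qed
  finally show ?thesis .
qed

text \<open>The directions (0, 1) and (0, -1) bound p2; the directions (1, p2) and (-1, p2), normal
  to the arcs at height p2, then return the defining inequality.\<close>

lemma lens_fun_eq: "lens = {p. \<forall>y. p \<bullet> y \<le> lens_fun y}"
proof (intro equalityI subsetI CollectI allI)
  fix p assume p: "p \<in> {p. \<forall>y. p \<bullet> y \<le> lens_fun y}"
  have out: "lens_fun (vector [0, s]) = 1" if "\<bar>s\<bar> = 1" for s :: real
    using that by (cases "s > 0") (auto simp: lens_fun_def lens_grad_outside inner_vec2 sgn_if abs_if split: if_splits)
  have Q: "\<bar>p $ 2\<bar> \<le> 1"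
  proof -
    have "p \<bullet> vector [0, s] \<le> lens_fun (vector [0, s])" for s using p by blast
    from this[of 1] this[of "-1"] show ?thesis using out[of 1] out[of "-1"] by (simp add: inner_vec2 abs_le_iff)
  qed
  have v: "lens_fun (vector [s, p $ 2]) = (1 + (p $ 2)\<^sup>2) / 2" if "\<bar>s\<bar> = 1" for s :: real
  proof -
    have "lens_slope (vector [s, p $ 2]) = p $ 2" using that Q by (simp add: lens_slope_def max_def)
    then have "lens_grad (vector [s, p $ 2]) = vector [sgn s * (1 - (p $ 2)\<^sup>2) / 2, p $ 2]"
      by (simp add: lens_grad_def)
    then have "lens_fun (vector [s, p $ 2]) = (s * sgn s) * ((1 - (p $ 2)\<^sup>2) / 2) + p $ 2 * p $ 2"
      by (simp add: lens_fun_def inner_vec2)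
    moreover have "s * sgn s = 1" using that by (auto simp: sgn_if abs_if split: if_splits)
    ultimately have "lens_fun (vector [s, p $ 2]) = (1 - (p $ 2)\<^sup>2) / 2 + p $ 2 * p $ 2" by simp
    then show ?thesis by (simp add: power2_eq_square field_simps)
  qed
  have "s * p $ 1 + (p $ 2)\<^sup>2 \<le> (1 + (p $ 2)\<^sup>2) / 2" if "\<bar>s\<bar> = 1" for s
  proof -
    have "p \<bullet> vector [s, p $ 2] \<le> lens_fun (vector [s, p $ 2])" using p by blast
    then show ?thesis using v[OF that] by (simp add: inner_vec2 power2_eq_square mult.commute)
  qed
  from this[of 1] this[of "-1"] show "p \<in> lens" by (simp add: lens_def abs_le_iff field_simps)
qed (use lens_fun_support in auto)

lemma lens_convex: "convex lens"
proof -
  have "lens = (\<Inter>y. {p. p \<bullet> y \<le> lens_fun y})" unfolding lens_fun_eq by auto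
  moreover have "convex {p. p \<bullet> y \<le> lens_fun y}" for y
    using convex_halfspace_le[of y "lens_fun y"] by (simp add: inner_commute)
  ultimately show ?thesis using convex_INT[of UNIV "\<lambda>y. {p. p \<bullet> y \<le> lens_fun y}"] by simp
qed

lemma lens_compact: "compact lens"
  unfolding compact_eq_bounded_closed
proof
  have "closed {p::real^2. \<bar>p $ 1\<bar> \<le> (1 - (p $ 2)\<^sup>2) / 2}" by (intro closed_Collect_le continuous_intros) auto
  then show "closed lens" by (simp add: lens_def)
  have "norm p \<le> 2" if "p \<in> lens" for p
  proof -
    have p1: "\<bar>p $ 1\<bar> \<le> (1 - (p $ 2)\<^sup>2) / 2" using that by (simp add: lens_def)
    then have "(p $ 2)\<^sup>2 \<le> 1" using order_trans[OF abs_ge_zero p1] by simp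
    then have "\<bar>p $ 2\<bar> \<le> 1" by (simp add: abs_square_le_1)
    moreover have "\<bar>p $ 1\<bar> \<le> 1" by (rule order_trans[OF p1]) (simp add: field_simps)
    ultimately show ?thesis using norm_le_components2[of p] by linarith
  qed
  then show "bounded lens" by (auto simp: bounded_iff)
qed

lemma lens_grad_norm: "norm (lens_grad y) \<le> 2"
proof -
  have "\<bar>(1 - (lens_slope y)\<^sup>2) / 2\<bar> = (1 - (lens_slope y)\<^sup>2) / 2" using slope_sq[of y] by simp
  also have "\<dots> \<le> 1" by (simp add: field_simps add_nonneg_nonneg)
  finally have "\<bar>lens_grad y $ 1\<bar> \<le> 1 * 1"
    unfolding lens_grad_nth times_divide_eq_right[symmetric] abs_mult
    by (intro mult_mono) (auto simp: abs_sgn_eq)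
  then show ?thesis
    using norm_le_components2[of "lens_grad y"] lens_slope_le_1[of y] by (simp add: lens_grad_nth(2))
qed

lemma lens_measure_pos: "measure lebesgue lens > 0"
proof -
  have "ball 0 (1/4) \<subseteq> lens"
  proof
    fix p :: "real^2" assume "p \<in> ball 0 (1/4)"
    then have "\<bar>p $ 1\<bar> \<le> 1/4" "\<bar>p $ 2\<bar> \<le> 1/4" using component_le_norm_cart[of p 1] component_le_norm_cart[of p 2] by auto
    moreover from this(2) have "(p $ 2)\<^sup>2 \<le> (1/4)\<^sup>2" by (intro power2_le_iff_abs_le[THEN iffD2]) auto
    ultimately show "p \<in> lens" by (simp add: lens_def power2_eq_square)
  qed
  then have "measure lebesgue (ball 0 (1/4) :: (real^2) set) \<le> measure lebesgue lens"
    using lens_compact by (intro measure_mono_fmeasurable) (auto simp: lmeasurable_compact)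
  moreover have "measure lebesgue (ball 0 (1/4) :: (real^2) set) > 0" by (simp add: content_ball_gt_0_iff)
  ultimately show ?thesis by linarith
qed

text \<open>A horizontal push away from the second axis leaves the lens, so the arcs lie in the
  boundary of a convex set.\<close>

lemma lens_curve_negligible: "negligible {p::real^2. \<bar>p $ 1\<bar> = (1 - (p $ 2)\<^sup>2) / 2}"
proof (rule negligible_subset[OF negligible_convex_frontier[OF lens_convex]])
  show "{p::real^2. \<bar>p $ 1\<bar> = (1 - (p $ 2)\<^sup>2) / 2} \<subseteq> frontier lens"
  proof
    fix p :: "real^2" assume "p \<in> {p. \<bar>p $ 1\<bar> = (1 - (p $ 2)\<^sup>2) / 2}"
    then have p: "\<bar>p $ 1\<bar> = (1 - (p $ 2)\<^sup>2) / 2" by simp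
    have "p \<notin> interior lens"
    proof
      assume "p \<in> interior lens"
      then obtain e where e: "e > 0" "cball p e \<subseteq> lens" unfolding mem_interior_cball by blast
      define s where "s = (if p $ 1 \<ge> 0 then 1 else (-1::real))"
      have "p + (s * e) *\<^sub>R axis 1 1 \<in> cball p e" using e by (simp add: dist_norm norm_axis_1 s_def)
      then have "p + (s * e) *\<^sub>R axis 1 1 \<in> lens" using e by blast
      then show False using p e(1) by (auto simp: lens_def axis_def s_def split: if_splits)
    qed
    moreover have "p \<in> closure lens" using p closure_subset[of lens] by (auto simp: lens_def)
    ultimately show "p \<in> frontier lens" by (simp add: frontier_def)
  qed
qed

text \<open>By homogeneity the local Lipschitz constant is of order 1/|y|; only |y| is weighted, so
  z may be arbitrary, even 0. The change of sign across y1 = 0 does no harm, because (1 - X^2) / 2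
  \<le> 1 - |X| bounds the first component by |y1| over the maximum of |y1| and |y2|.\<close>

lemma lens_grad_lipschitz: "norm (lens_grad y - lens_grad z) * norm y \<le> 8 * norm (y - z)"
proof -
  define m where "m = max \<bar>y $ 1\<bar> \<bar>y $ 2\<bar>"
  define m' where "m' = max \<bar>z $ 1\<bar> \<bar>z $ 2\<bar>"
  define T where "T = lens_slope y"
  define T' where "T' = lens_slope z"
  define D where "D = norm (y - z)"
  have c: "\<bar>y $ 1 - z $ 1\<bar> \<le> D" "\<bar>y $ 2 - z $ 2\<bar> \<le> D"
    using component_le_norm_cart[of "y - z" 1] component_le_norm_cart[of "y - z" 2] by (auto simp: D_def)
  have mm: "\<bar>m - m'\<bar> \<le> D" using c unfolding m_def m'_def by linarith
  have m0: "m \<ge> 0" "m' \<ge> 0" by (auto simp: m_def m'_def)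
  have Tm: "T * m = y $ 2" "T' * m' = z $ 2" using lens_slope_max by (auto simp: T_def m_def T'_def m'_def)
  have T1: "\<bar>T\<bar> \<le> 1" "\<bar>T'\<bar> \<le> 1" using lens_slope_le_1 by (auto simp: T_def T'_def)
  have sqT: "T\<^sup>2 \<le> 1" "T'\<^sup>2 \<le> 1" using T1 by (simp_all add: abs_square_le_1)
  have "(T - T') * m = (y $ 2 - z $ 2) + T' * (m' - m)" using Tm by (simp add: algebra_simps)
  moreover have "\<bar>T' * (m' - m)\<bar> \<le> 1 * D" unfolding abs_mult using T1 mm m0 by (intro mult_mono) auto
  ultimately have dT: "\<bar>T - T'\<bar> * m \<le> 2 * D" using c m0 by (simp add: abs_mult[symmetric] abs_of_nonneg)
  define P where "P = lens_grad y $ 1"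
  define P' where "P' = lens_grad z $ 1"
  have Pe: "P = sgn (y $ 1) * ((1 - T\<^sup>2) / 2)" "P' = sgn (z $ 1) * ((1 - T'\<^sup>2) / 2)"
    by (simp_all add: P_def P'_def lens_grad_nth T_def T'_def)
  have half: "(1 - X\<^sup>2) / 2 \<le> 1 - \<bar>X\<bar>" for X :: real
    using zero_le_power2[of "1 - \<bar>X\<bar>"] by (simp add: power2_eq_square field_simps)
  have small: "\<bar>P\<bar> * m \<le> \<bar>y $ 1\<bar>" "\<bar>P'\<bar> * m' \<le> \<bar>z $ 1\<bar>"
  proof -
    have "\<bar>P\<bar> \<le> 1 - \<bar>T\<bar>" "\<bar>P'\<bar> \<le> 1 - \<bar>T'\<bar>"
      using half[of T] half[of T'] sqT T1 by (auto simp: Pe abs_mult abs_sgn_eq)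
    then have "\<bar>P\<bar> * m \<le> (1 - \<bar>T\<bar>) * m" "\<bar>P'\<bar> * m' \<le> (1 - \<bar>T'\<bar>) * m'" using m0 by (auto intro: mult_right_mono)
    moreover have "\<bar>T\<bar> * m = \<bar>y $ 2\<bar>" "\<bar>T'\<bar> * m' = \<bar>z $ 2\<bar>" using Tm m0 by (metis abs_mult abs_of_nonneg)+
    moreover have "m \<le> \<bar>y $ 1\<bar> + \<bar>y $ 2\<bar>" "m' \<le> \<bar>z $ 1\<bar> + \<bar>z $ 2\<bar>" by (auto simp: m_def m'_def)
    ultimately show "\<bar>P\<bar> * m \<le> \<bar>y $ 1\<bar>" "\<bar>P'\<bar> * m' \<le> \<bar>z $ 1\<bar>" by (auto simp: left_diff_distrib)
  qed
  have dP: "\<bar>P - P'\<bar> * m \<le> 2 * D"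
  proof (cases "sgn (y $ 1) = sgn (z $ 1)")
    case True
    then have "P - P' = sgn (y $ 1) * ((T' - T) * ((T' + T) / 2))"
      by (simp add: Pe power2_eq_square algebra_simps diff_divide_distrib add_divide_distrib)
    then have "\<bar>P - P'\<bar> = \<bar>sgn (y $ 1)\<bar> * (\<bar>T' - T\<bar> * \<bar>(T' + T) / 2\<bar>)" by (simp only: abs_mult)
    also have "\<dots> \<le> 1 * (\<bar>T' - T\<bar> * 1)"
      using T1 by (intro mult_mono) (auto simp: abs_sgn_eq)
    finally have "\<bar>P - P'\<bar> \<le> 1 * (\<bar>T' - T\<bar> * 1)" .
    then have "\<bar>P - P'\<bar> * m \<le> \<bar>T - T'\<bar> * m" using m0 by (intro mult_right_mono) auto
    then show ?thesis using dT by linarith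
  next
    case False
    then have s: "\<bar>y $ 1\<bar> + \<bar>z $ 1\<bar> \<le> D" using c(1) by (auto simp: sgn_if split: if_splits)
    have "\<bar>P'\<bar> \<le> 1 - \<bar>T'\<bar>" using half[of T'] sqT T1 by (auto simp: Pe abs_mult abs_sgn_eq)
    then have "\<bar>P'\<bar> \<le> 1" by linarith
    then have "\<bar>P'\<bar> * \<bar>m - m'\<bar> \<le> 1 * \<bar>m - m'\<bar>" by (rule mult_right_mono) simp
    moreover have "\<bar>P'\<bar> * (m - m') \<le> \<bar>P'\<bar> * \<bar>m - m'\<bar>" by (rule mult_left_mono[OF abs_ge_self]) simp
    ultimately have "\<bar>P'\<bar> * (m - m') \<le> 1 * \<bar>m - m'\<bar>" by linarith
    then have "\<bar>P'\<bar> * m \<le> \<bar>z $ 1\<bar> + D" using small mm by (simp add: right_diff_distrib)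
    moreover have "\<bar>P - P'\<bar> * m \<le> (\<bar>P\<bar> + \<bar>P'\<bar>) * m" using m0 by (intro mult_right_mono) auto
    ultimately show ?thesis using small s by (simp add: distrib_right)
  qed
  have "norm (lens_grad y - lens_grad z) \<le> \<bar>P - P'\<bar> + \<bar>T - T'\<bar>"
    using norm_le_components2[of "lens_grad y - lens_grad z"] by (simp add: P_def P'_def T_def T'_def lens_grad_nth(2))
  moreover have "norm y \<le> 2 * m" using norm_le_components2[of y] by (simp add: m_def)
  ultimately have "norm (lens_grad y - lens_grad z) * norm y \<le> (\<bar>P - P'\<bar> + \<bar>T - T'\<bar>) * (2 * m)"
    by (intro mult_mono) auto
  also have "\<dots> \<le> 8 * D" using dP dT by (simp add: algebra_simps)
  finally show ?thesis by (simp add: D_def)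
qed

section \<open>Sums of squeezed cones\<close>

locale lens_sum =
  fixes A :: "(real^2) set" and c :: "real^2 \<Rightarrow> real" and e :: "real^2" and \<delta> :: real
  assumes finA: "finite A" and cpos: "\<And>b. b \<in> A \<Longrightarrow> c b > 0" and e1: "norm e = 1"
    and dpos: "0 < \<delta>" and d1: "\<delta> \<le> 1"
begin

text \<open>\<open>f\<close> and \<open>e\<close> form an orthonormal frame. \<open>B\<close>
  squeezes the direction \<open>f\<close> by \<delta>, which narrows the double cone of z to |e z|
  \<le> \<delta> |f z|. \<open>Bt\<close> is the transpose, so \<open>Bt (lens_grad (B z))\<close>
  is the gradient of the squeezed cone off its vertex.\<close>

definition "f = (vector [- (e $ 2), e $ 1] :: real^2)"
definition B :: "real^2 \<Rightarrow> real^2" where "B z = vector [\<delta> * (f \<bullet> z), e \<bullet> z]"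
definition Bt :: "real^2 \<Rightarrow> real^2" where "Bt p = (\<delta> * p $ 1) *\<^sub>R f + p $ 2 *\<^sub>R e"
definition v :: "real^2 \<Rightarrow> real" where "v x = (\<Sum>b\<in>A. c b * lens_fun (B (x - b)))"
definition g :: "real^2 \<Rightarrow> real^2" where "g x = (\<Sum>b\<in>A. c b *\<^sub>R Bt (lens_grad (B (x - b))))"

lemma e_sq: "(e $ 1)\<^sup>2 + (e $ 2)\<^sup>2 = 1"
proof -
  have "(norm e)\<^sup>2 = e \<bullet> e" by (rule power2_norm_eq_inner)
  also have "\<dots> = (e $ 1)\<^sup>2 + (e $ 2)\<^sup>2" by (simp add: inner_vec2 power2_eq_square)
  finally have "(norm e)\<^sup>2 = (e $ 1)\<^sup>2 + (e $ 2)\<^sup>2" .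
  then show ?thesis using e1 by simp
qed

lemma B_nth [simp]: "B z $ 1 = \<delta> * (f \<bullet> z)" "B z $ 2 = e \<bullet> z"
  by (simp_all add: B_def)

lemma adj: "Bt p \<bullet> z = p \<bullet> B z"
  by (simp add: Bt_def inner_add_left inner_vec2[of p] algebra_simps)

lemma B_diff: "B (x - y) = B x - B y"
  by (simp add: vec_eq_iff forall_2 inner_diff_right right_diff_distrib)
lemma B_scale: "B (t *\<^sub>R x) = t *\<^sub>R B x"
  by (simp add: vec_eq_iff forall_2 )
lemma Bt_diff: "Bt (x - y) = Bt x - Bt y"
  by (simp add: Bt_def algebra_simps)
lemma norm_f: "norm f = 1"
proof -
  have "f \<bullet> f = 1" using e_sq by (simp add: inner_vec2 f_def power2_eq_square add.commute)
  then show ?thesis by (simp add: norm_eq_1)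
qed

lemma ef: "e \<bullet> e = 1" "f \<bullet> f = 1" "e \<bullet> f = 0" "f \<bullet> e = 0"
proof -
  show "e \<bullet> e = 1" "f \<bullet> f = 1" using e1 norm_f by (simp_all add: dot_square_norm)
  show "e \<bullet> f = 0" "f \<bullet> e = 0" by (simp_all add: inner_vec2 f_def)
qed

lemma expand: "z = (f \<bullet> z) *\<^sub>R f + (e \<bullet> z) *\<^sub>R e"
proof -
  have sq: "e $ 1 * e $ 1 + e $ 2 * e $ 2 = 1" using e_sq by (simp add: power2_eq_square)
  have "(f \<bullet> z) * f $ 1 + (e \<bullet> z) * e $ 1 = (e $ 1 * e $ 1 + e $ 2 * e $ 2) * z $ 1"
    "(f \<bullet> z) * f $ 2 + (e \<bullet> z) * e $ 2 = (e $ 1 * e $ 1 + e $ 2 * e $ 2) * z $ 2"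
    by (simp_all add: inner_vec2 f_def algebra_simps)
  then show ?thesis by (simp add: sq vec_eq_iff forall_2)
qed

lemma norm_Bt: "norm (Bt p) \<le> 2 * norm p"
proof -
  have "norm (Bt p) \<le> \<bar>\<delta> * p $ 1\<bar> * norm f + \<bar>p $ 2\<bar> * norm e"
    unfolding Bt_def by (rule order_trans[OF norm_triangle_ineq]) simp
  also have "\<dots> \<le> norm p + norm p"
  proof -
    have "\<bar>\<delta> * p $ 1\<bar> \<le> 1 * norm p" unfolding abs_mult using dpos d1 component_le_norm_cart[of p 1] by (intro mult_mono) auto
    then show ?thesis using component_le_norm_cart[of p 2] by (simp add: norm_f e1)
  qed
  finally show ?thesis by simp
qed

lemma norm_B: "norm (B z) \<le> 2 * norm z"
proof -
  have "\<bar>f \<bullet> z\<bar> \<le> norm z" "\<bar>e \<bullet> z\<bar> \<le> norm z"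
    using Cauchy_Schwarz_ineq2[of f z] Cauchy_Schwarz_ineq2[of e z] by (simp_all add: norm_f e1)
  moreover from this(1) have "\<bar>\<delta> * (f \<bullet> z)\<bar> \<le> 1 * norm z" unfolding abs_mult using dpos d1 by (intro mult_mono) auto
  ultimately show ?thesis using norm_le_components2[of "B z"] by simp
qed

lemma norm_B_lower: "\<delta> * norm z \<le> 2 * norm (B z)"
proof -
  have "norm z \<le> \<bar>f \<bullet> z\<bar> + \<bar>e \<bullet> z\<bar>"
    using norm_triangle_ineq[of "(f \<bullet> z) *\<^sub>R f" "(e \<bullet> z) *\<^sub>R e"] expand[of z] by (simp add: norm_f e1)
  then have "\<delta> * norm z \<le> \<delta> * \<bar>f \<bullet> z\<bar> + \<delta> * \<bar>e \<bullet> z\<bar>"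
    using dpos by (simp flip: distrib_left)
  also have "\<dots> \<le> \<bar>B z $ 1\<bar> + \<bar>B z $ 2\<bar>"
    using dpos d1 by (auto simp: abs_mult mult_left_le_one_le)
  also have "\<dots> \<le> 2 * norm (B z)" using component_le_norm_cart[of "B z" 1] component_le_norm_cart[of "B z" 2] by linarith
  finally show ?thesis .
qed

text \<open>The constant collects 2 from \<open>norm_Bt\<close>, 2/\<delta> from
  \<open>norm_B_lower\<close>, 8 from \<open>lens_grad_lipschitz\<close> and 2 from
  \<open>norm_B\<close>.\<close>

lemma term_lip: "norm (Bt (lens_grad (B z)) - Bt (lens_grad (B z'))) * norm z \<le> (64 / \<delta>) * norm (z - z')"
proof -
  let ?D = "lens_grad (B z) - lens_grad (B z')"
  have "norm (Bt ?D) * (\<delta> * norm z) \<le> (2 * norm ?D) * (2 * norm (B z))"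
    using dpos by (intro mult_mono norm_Bt norm_B_lower) auto
  also have "\<dots> = 4 * (norm ?D * norm (B z))" by simp
  also have "\<dots> \<le> 4 * (8 * norm (B z - B z'))" by (intro mult_left_mono lens_grad_lipschitz) simp
  also have "\<dots> \<le> 4 * (8 * (2 * norm (z - z')))" using norm_B[of "z - z'"] by (simp add: B_diff)
  finally have "\<delta> * (norm (Bt ?D) * norm z) \<le> 64 * norm (z - z')" by (simp add: mult_ac)
  then show ?thesis using dpos by (simp add: Bt_diff field_simps)
qed

definition "K = (\<Sum>b\<in>A. 4 * c b)"

lemma K_nonneg: "K \<ge> 0"
  unfolding K_def using cpos by (intro sum_nonneg) (auto intro: less_imp_le)

lemma g_bound: "norm (g x) \<le> K"
  unfolding g_def K_def
proof (rule order_trans[OF norm_sum sum_mono])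
  fix b assume b: "b \<in> A"
  have "norm (Bt (lens_grad (B (x - b)))) \<le> 4" using norm_Bt[of "lens_grad (B (x - b))"] lens_grad_norm[of "B (x - b)"] by linarith
  then show "norm (c b *\<^sub>R Bt (lens_grad (B (x - b)))) \<le> 4 * c b" using cpos[OF b] by simp
qed

text \<open>Sums the bounds of \<open>term_lip\<close>, each divided by the distance of x from its
  atom; y is unrestricted.\<close>

lemma g_lip:
  assumes "x \<notin> A"
  shows "norm (g x - g y) \<le> (\<Sum>b\<in>A. c b * (64 / \<delta>) / norm (x - b)) * norm (x - y)"
proof -
  have "norm (g x - g y) \<le> (\<Sum>b\<in>A. norm (c b *\<^sub>R (Bt (lens_grad (B (x - b))) - Bt (lens_grad (B (y - b))))))"
    unfolding g_def sum_subtractf[symmetric] scaleR_diff_right[symmetric] by (rule norm_sum)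
  also have "\<dots> \<le> (\<Sum>b\<in>A. c b * (64 / \<delta>) / norm (x - b) * norm (x - y))"
  proof (rule sum_mono)
    fix b assume b: "b \<in> A"
    then have nz: "norm (x - b) > 0" using assms by auto
    have "norm (Bt (lens_grad (B (x - b))) - Bt (lens_grad (B (y - b)))) \<le> (64 / \<delta>) * norm (x - y) / norm (x - b)"
      using iffD2[OF pos_le_divide_eq[OF nz] term_lip[of "x - b" "y - b"]] by simp
    then have "c b * norm (Bt (lens_grad (B (x - b))) - Bt (lens_grad (B (y - b)))) \<le> c b * ((64 / \<delta>) * norm (x - y) / norm (x - b))"
      using cpos[OF b] by (intro mult_left_mono) auto
    then show "norm (c b *\<^sub>R (Bt (lens_grad (B (x - b))) - Bt (lens_grad (B (y - b))))) \<le> c b * (64 / \<delta>) / norm (x - b) * norm (x - y)"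
      using cpos[OF b] by simp
  qed
  finally show ?thesis by (simp add: sum_distrib_right)
qed

text \<open>By homogeneity the tangent plane of each cone passes through the value 0 at its vertex,
  so the inequality is the support property of the lens, term by term. It holds at the atoms too,
  where \<open>g\<close> selects one of many subgradients.\<close>

lemma v_support: "v y \<ge> v x + g x \<bullet> (y - x)"
proof -
  have "v x + g x \<bullet> (y - x) = (\<Sum>b\<in>A. c b * (lens_fun (B (x - b)) + lens_grad (B (x - b)) \<bullet> B (y - x)))"
    unfolding v_def g_def inner_sum_left inner_scaleR_left adj by (simp add: sum.distrib distrib_left)
  also have "\<dots> \<le> v y"
    unfolding v_def
  proof (intro sum_mono mult_left_mono)
    fix b assume b: "b \<in> A"
    have "lens_fun (B (x - b)) + lens_grad (B (x - b)) \<bullet> B (y - x) = lens_grad (B (x - b)) \<bullet> B (y - b)"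
      unfolding lens_fun_def B_diff by (simp add: inner_diff_right)
    also have "\<dots> \<le> lens_fun (B (y - b))" by (rule lens_fun_support[OF lens_grad_in_lens])
    finally show "lens_fun (B (x - b)) + lens_grad (B (x - b)) \<bullet> B (y - x) \<le> lens_fun (B (y - b))" .
  qed (use cpos in \<open>auto intro: less_imp_le\<close>)
  finally show ?thesis .
qed

lemma v_convex: "convex_on UNIV v"
proof (rule convex_onI)
  fix t :: real and x y :: "real^2" assume t: "0 < t" "t < 1"
  let ?z = "(1 - t) *\<^sub>R x + t *\<^sub>R y"
  have "(1 - t) * (v ?z + g ?z \<bullet> (x - ?z)) + t * (v ?z + g ?z \<bullet> (y - ?z)) \<le> (1 - t) * v x + t * v y"
    using v_support[of ?z x] v_support[of ?z y] t by (intro add_mono mult_left_mono) auto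
  moreover have "(1 - t) * (g ?z \<bullet> (x - ?z)) + t * (g ?z \<bullet> (y - ?z)) = g ?z \<bullet> ((1 - t) *\<^sub>R (x - ?z) + t *\<^sub>R (y - ?z))"
    by (simp add: inner_add_right)
  moreover have "(1 - t) *\<^sub>R (x - ?z) + t *\<^sub>R (y - ?z) = 0" by (simp add: algebra_simps)
  ultimately show "v ?z \<le> (1 - t) * v x + t * v y" by (simp add: algebra_simps)
qed simp

lemma v_lipschitz: "K-lipschitz_on UNIV v"
proof (rule lipschitz_onI[OF _ K_nonneg])
  have *: "v x - v y \<le> K * norm (x - y)" for x y
  proof -
    have "v x - v y \<le> g x \<bullet> (x - y)" using v_support[of x y] by (simp add: inner_diff_right)
    also have "\<dots> \<le> norm (g x) * norm (x - y)" by (rule norm_cauchy_schwarz)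
    also have "\<dots> \<le> K * norm (x - y)" using g_bound by (rule mult_right_mono) simp
    finally show ?thesis .
  qed
  fix x y show "dist (v x) (v y) \<le> K * dist x y"
    using *[of x y] *[of y x] by (simp add: dist_real_def dist_norm abs_le_iff norm_minus_commute[of y x])
qed

text \<open>The difference quotient lies between g(x) w and g(x + t w) w, and the latter tends to
  the former by \<open>g_lip\<close>.\<close>

lemma v_ddir:
  assumes "x \<notin> A"
  shows "ddir w v x = g x \<bullet> w"
proof -
  define C where "C = (\<Sum>b\<in>A. c b * (64 / \<delta>) / norm (x - b))"
  have "(\<lambda>n. (v (x + (1 / real (Suc n)) *\<^sub>R w) - v x) / (1 / real (Suc n))) \<longlonglongrightarrow> g x \<bullet> w"
  proof (rule LIM_zero_cancel, rule Lim_null_comparison)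
    show "(\<lambda>n. (C * (norm w)\<^sup>2) * inverse (real (Suc n))) \<longlonglongrightarrow> 0"
      by (rule tendsto_mult_right_zero[OF LIMSEQ_inverse_real_of_nat])
    show "eventually (\<lambda>n. norm ((v (x + (1 / real (Suc n)) *\<^sub>R w) - v x) / (1 / real (Suc n)) - g x \<bullet> w) \<le> (C * (norm w)\<^sup>2) * inverse (real (Suc n))) sequentially"
    proof (rule always_eventually, rule allI)
      fix n
      define t where "t = 1 / real (Suc n)"
      have t: "t > 0" by (simp add: t_def)
      have lo: "v (x + t *\<^sub>R w) - v x \<ge> t * (g x \<bullet> w)" using v_support[of x "x + t *\<^sub>R w"] by simp
      have "v x \<ge> v (x + t *\<^sub>R w) + g (x + t *\<^sub>R w) \<bullet> (x - (x + t *\<^sub>R w))" by (rule v_support)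
      then have up: "v (x + t *\<^sub>R w) - v x \<le> t * (g (x + t *\<^sub>R w) \<bullet> w)" by simp
      have "(g (x + t *\<^sub>R w) - g x) \<bullet> w \<le> norm (g x - g (x + t *\<^sub>R w)) * norm w"
        using norm_cauchy_schwarz[of "g (x + t *\<^sub>R w) - g x" w] by (simp add: norm_minus_commute)
      also have "\<dots> \<le> (C * norm (x - (x + t *\<^sub>R w))) * norm w"
        using g_lip[OF assms] unfolding C_def by (rule mult_right_mono) simp
      also have "\<dots> = (C * (norm w)\<^sup>2) * t" using t by (simp add: power2_eq_square)
      finally have d: "g (x + t *\<^sub>R w) \<bullet> w \<le> g x \<bullet> w + (C * (norm w)\<^sup>2) * t" by (simp add: inner_diff_left)
      have "(v (x + t *\<^sub>R w) - v x) / t \<ge> g x \<bullet> w" "(v (x + t *\<^sub>R w) - v x) / t \<le> g (x + t *\<^sub>R w) \<bullet> w"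
        using lo up t by (simp_all add: pos_le_divide_eq pos_divide_le_eq mult.commute)
      then have "norm ((v (x + t *\<^sub>R w) - v x) / t - g x \<bullet> w) \<le> (C * (norm w)\<^sup>2) * t" using d by simp
      then show "norm ((v (x + (1 / real (Suc n)) *\<^sub>R w) - v x) / (1 / real (Suc n)) - g x \<bullet> w) \<le> (C * (norm w)\<^sup>2) * inverse (real (Suc n))"
        unfolding t_def inverse_eq_divide .
    qed
  qed
  with ddir_tendsto[OF v_convex v_lipschitz] show ?thesis by (rule LIMSEQ_unique)
qed

section \<open>Slopes of the sum and its Monge-Ampere measure\<close>

definition q :: "real^2 \<Rightarrow> real^2" where
  "q b = (\<Sum>b'\<in>A - {b}. c b' *\<^sub>R (sgn (e \<bullet> (b - b')) *\<^sub>R e))"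

text \<open>The first conclusion keeps the double cones of two atoms apart within the domain. The
  second puts the double cone of b, seen from b', on the side of b itself, so that the cone at b'
  has one constant gradient there, a tip of its lens.\<close>

definition slabs :: "(real^2) set \<Rightarrow> bool" where
  "slabs \<Omega> \<longleftrightarrow> (\<forall>x\<in>\<Omega>. \<forall>b\<in>A. \<forall>b'\<in>A. b \<noteq> b' \<longrightarrow> \<bar>e \<bullet> (x - b)\<bar> \<le> \<bar>\<delta> * (f \<bullet> (x - b))\<bar> \<longrightarrow>
     \<bar>\<delta> * (f \<bullet> (x - b'))\<bar> < \<bar>e \<bullet> (x - b')\<bar> \<and> sgn (e \<bullet> (x - b')) = sgn (e \<bullet> (b - b')))"

lemma slabsD:
  assumes "slabs \<Omega>" "x \<in> \<Omega>" "b \<in> A" "b' \<in> A - {b}" "\<bar>e \<bullet> (x - b)\<bar> \<le> \<bar>\<delta> * (f \<bullet> (x - b))\<bar>"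
  shows "\<bar>\<delta> * (f \<bullet> (x - b'))\<bar> < \<bar>e \<bullet> (x - b')\<bar>" "sgn (e \<bullet> (x - b')) = sgn (e \<bullet> (b - b'))"
proof -
  have "b' \<in> A" "b \<noteq> b'" using assms(4) by auto
  with assms(1)[unfolded slabs_def, rule_format, OF assms(2,3) this assms(5)]
  show "\<bar>\<delta> * (f \<bullet> (x - b'))\<bar> < \<bar>e \<bullet> (x - b')\<bar>" "sgn (e \<bullet> (x - b')) = sgn (e \<bullet> (b - b'))"
    by simp_all
qed

lemma Bt_outside:
  assumes "\<bar>\<delta> * (f \<bullet> z)\<bar> < \<bar>e \<bullet> z\<bar>"
  shows "Bt (lens_grad (B z)) = sgn (e \<bullet> z) *\<^sub>R e"
proof -
  have "lens_grad (B z) = vector [0, sgn (B z $ 2)]"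
    using assms by (intro lens_grad_outside) auto
  then show ?thesis by (simp add: Bt_def)
qed

text \<open>In the double cone of b all other terms keep the gradient that they have at b, and
  \<open>q b\<close> is their sum; the slopes are a translate of those of a single cone.\<close>

lemma g_slab:
  assumes s: "slabs \<Omega>" and x: "x \<in> \<Omega>" and b: "b \<in> A" and sl: "\<bar>e \<bullet> (x - b)\<bar> \<le> \<bar>\<delta> * (f \<bullet> (x - b))\<bar>"
  shows "g x = q b + c b *\<^sub>R Bt (lens_grad (B (x - b)))"
proof -
  have "g x = (\<Sum>b'\<in>A - {b}. c b' *\<^sub>R Bt (lens_grad (B (x - b')))) + c b *\<^sub>R Bt (lens_grad (B (x - b)))"
    unfolding g_def using b finA by (simp add: sum.remove add.commute)
  also have "(\<Sum>b'\<in>A - {b}. c b' *\<^sub>R Bt (lens_grad (B (x - b')))) = q b"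
    unfolding q_def
  proof (rule sum.cong[OF refl])
    fix b' assume b': "b' \<in> A - {b}"
    then have "\<bar>\<delta> * (f \<bullet> (x - b'))\<bar> < \<bar>e \<bullet> (x - b')\<bar>" "sgn (e \<bullet> (x - b')) = sgn (e \<bullet> (b - b'))"
      using slabsD[OF s x b _ sl] by simp_all
    then show "c b' *\<^sub>R Bt (lens_grad (B (x - b'))) = c b' *\<^sub>R (sgn (e \<bullet> (b - b')) *\<^sub>R e)"
      by (simp add: Bt_outside)
  qed
  finally show ?thesis .
qed

lemma g_no_slab:
  assumes "\<And>b. b \<in> A \<Longrightarrow> \<bar>\<delta> * (f \<bullet> (x - b))\<bar> < \<bar>e \<bullet> (x - b)\<bar>"
  shows "f \<bullet> g x = 0"
  unfolding g_def inner_sum_right using assms by (intro sum.neutral) (simp add: Bt_outside ef)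

text \<open>Monotonicity along w = p - g(x) bounds |w|^2 by the inner product of g(x + t w) - g(x)
  with w, which is at most C t |w|^2; a small t forces w = 0.\<close>

lemma subdiff_away:
  assumes \<Omega>: "open \<Omega>" and x: "x \<in> \<Omega>" "x \<notin> A" and p: "p \<in> subdiff \<Omega> v x"
  shows "p = g x"
proof (rule ccontr)
  assume ne: "p \<noteq> g x"
  define w where "w = p - g x"
  have w: "norm w > 0" using ne by (simp add: w_def)
  define C where "C = (\<Sum>b\<in>A. c b * (64 / \<delta>) / norm (x - b))"
  have C0: "C \<ge> 0" unfolding C_def
    by (intro sum_nonneg divide_nonneg_nonneg mult_nonneg_nonneg) (use cpos dpos in \<open>auto intro: less_imp_le\<close>)
  obtain r where r: "r > 0" "cball x r \<subseteq> \<Omega>" using \<Omega> x open_contains_cball by blast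
  \<comment> \<open>The first entry keeps the point in the domain, the second makes C t at most
    1/2.\<close>
  define t where "t = min (r / norm w) (1 / (2 * (C + 1)))"
  have t: "t > 0" using r w C0 by (simp add: t_def)
  have "t * norm w \<le> r" using w by (simp add: t_def min_def field_simps split: if_splits)
  then have "x + t *\<^sub>R w \<in> cball x r" using t by (simp add: dist_norm)
  then have "x + t *\<^sub>R w \<in> \<Omega>" using r(2) by blast
  then have "p \<bullet> (x + t *\<^sub>R w - x) + v x \<le> v (x + t *\<^sub>R w)" using p unfolding subdiff_def by blast
  then have "t * (p \<bullet> w) \<le> v (x + t *\<^sub>R w) - v x" by simp
  also have "\<dots> \<le> t * (g (x + t *\<^sub>R w) \<bullet> w)" using v_support[of "x + t *\<^sub>R w" x] by simp
  finally have "p \<bullet> w \<le> g (x + t *\<^sub>R w) \<bullet> w" using t by simp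
  then have "w \<bullet> w \<le> (g (x + t *\<^sub>R w) - g x) \<bullet> w" by (simp add: w_def inner_diff_left)
  also have "\<dots> \<le> norm (g x - g (x + t *\<^sub>R w)) * norm w"
    using norm_cauchy_schwarz[of "g (x + t *\<^sub>R w) - g x" w] by (simp add: norm_minus_commute)
  also have "\<dots> \<le> (C * norm (x - (x + t *\<^sub>R w))) * norm w"
    using g_lip[OF x(2)] unfolding C_def by (rule mult_right_mono) simp
  also have "\<dots> = (C * t) * (w \<bullet> w)" using t by (simp add: dot_square_norm power2_eq_square)
  also have "\<dots> \<le> (1 / 2) * (w \<bullet> w)"
  proof (rule mult_right_mono)
    have "C * t \<le> C * (1 / (2 * (C + 1)))" unfolding t_def using C0 by (intro mult_left_mono) auto
    also have "\<dots> \<le> 1 / 2" using C0 by (simp add: field_simps)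
    finally show "C * t \<le> 1 / 2" .
  qed simp
  finally have "w \<bullet> w \<le> 0" by simp
  moreover have "0 < w \<bullet> w" using w by simp
  ultimately show False by linarith
qed

lemma negligible_image: "negligible N \<Longrightarrow> negligible ((\<lambda>l. q b + k *\<^sub>R Bt l) ` N)"
proof -
  assume N: "negligible N"
  have lin: "linear (\<lambda>l. k *\<^sub>R Bt l)"
    by (rule linearI) (simp_all add: Bt_def algebra_simps)
  have "negligible ((+) (q b) ` ((\<lambda>l. k *\<^sub>R Bt l) ` N))"
    by (intro negligible_translation negligible_differentiable_image_negligible N linear_imp_differentiable_on lin) simp
  then show ?thesis by (simp add: image_image)
qed

text \<open>Slopes in the double cone of b lie on an affine image of the arcs, and outside all
  double cones every term is a multiple of \<open>e\<close>. So the slopes off the atoms lie on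
  finitely many curves and a line; overlapping double cones could instead produce sums of arcs, with
  positive area.\<close>

lemma subdiff_away_negligible:
  assumes "slabs \<Omega>" "open \<Omega>"
  shows "negligible (\<Union>x\<in>\<Omega> - A. subdiff \<Omega> v x)"
proof -
  let ?N = "{p::real^2. \<bar>p $ 1\<bar> = (1 - (p $ 2)\<^sup>2) / 2}"
  have "(\<Union>x\<in>\<Omega> - A. subdiff \<Omega> v x) \<subseteq> (\<Union>b\<in>A. (\<lambda>l. q b + c b *\<^sub>R Bt l) ` ?N) \<union> {p. f \<bullet> p = 0}"
  proof
    fix p assume "p \<in> (\<Union>x\<in>\<Omega> - A. subdiff \<Omega> v x)"
    then obtain x where x: "x \<in> \<Omega>" "x \<notin> A" "p \<in> subdiff \<Omega> v x" by blast
    have p: "p = g x" by (rule subdiff_away[OF assms(2) x])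
    show "p \<in> (\<Union>b\<in>A. (\<lambda>l. q b + c b *\<^sub>R Bt l) ` ?N) \<union> {p. f \<bullet> p = 0}"
    proof (cases "\<exists>b\<in>A. \<bar>e \<bullet> (x - b)\<bar> \<le> \<bar>\<delta> * (f \<bullet> (x - b))\<bar>")
      case True
      then obtain b where b: "b \<in> A" "\<bar>e \<bullet> (x - b)\<bar> \<le> \<bar>\<delta> * (f \<bullet> (x - b))\<bar>" by blast
      have "B (x - b) \<noteq> 0"
      proof
        assume "B (x - b) = 0"
        then have "\<delta> * norm (x - b) \<le> 0" using norm_B_lower[of "x - b"] by simp
        then show False using dpos b x by (simp add: mult_le_0_iff)
      qed
      then have "lens_grad (B (x - b)) \<in> ?N" using lens_grad_boundary by blast
      then show ?thesis using g_slab[OF assms(1) x(1) b] b p by blast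
    next
      case False
      then have "f \<bullet> g x = 0" by (intro g_no_slab) auto
      then show ?thesis using p by simp
    qed
  qed
  moreover have "negligible ((\<Union>b\<in>A. (\<lambda>l. q b + c b *\<^sub>R Bt l) ` ?N) \<union> {p. f \<bullet> p = 0})"
  proof (intro negligible_Un negligible_Union)
    have "f \<noteq> 0" using norm_f by auto
    then show "negligible {p. f \<bullet> p = 0}" by (intro negligible_hyperplane) simp
    show "finite ((\<lambda>b. (\<lambda>l. q b + c b *\<^sub>R Bt l) ` ?N) ` A)" using finA by simp
    fix t assume "t \<in> (\<lambda>b. (\<lambda>l. q b + c b *\<^sub>R Bt l) ` ?N) ` A"
    then show "negligible t" using negligible_image[OF lens_curve_negligible] by blast
  qed
  ultimately show ?thesis by (rule negligible_subset[rotated])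
qed

text \<open>The terms of the other atoms are differentiable at b with total gradient
  \<open>q b\<close>, and the cone at b contributes the image of the lens. For the inclusion from
  left to right, the supporting inequality is tested at b + t z, divided by t, and t tends to
  0.\<close>

lemma subdiff_atom:
  assumes s: "slabs \<Omega>" and \<Omega>: "open \<Omega>" and b: "b \<in> A" "b \<in> \<Omega>"
  shows "subdiff \<Omega> v b = (\<lambda>l. q b + c b *\<^sub>R Bt l) ` lens"
proof (intro equalityI subsetI)
  have B0: "B 0 = 0" using B_diff[of 0 0] by simp
  have out: "Bt (lens_grad (B (b - b'))) = sgn (e \<bullet> (b - b')) *\<^sub>R e" if b': "b' \<in> A - {b}" for b'
  proof -
    have "\<bar>e \<bullet> (b - b)\<bar> \<le> \<bar>\<delta> * (f \<bullet> (b - b))\<bar>" by simp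
    then have "\<bar>\<delta> * (f \<bullet> (b - b'))\<bar> < \<bar>e \<bullet> (b - b')\<bar>" by (rule slabsD(1)[OF s b(2,1) b'])
    then show ?thesis by (rule Bt_outside)
  qed
  have vb: "v y = (\<Sum>b'\<in>A - {b}. c b' * lens_fun (B (y - b'))) + c b * lens_fun (B (y - b))" for y
    unfolding v_def using b(1) finA by (simp add: sum.remove add.commute)
  have qe: "q b \<bullet> z = (\<Sum>b'\<in>A - {b}. c b' * (lens_grad (B (b - b')) \<bullet> B z))" for z
  proof -
    have "q b = (\<Sum>b'\<in>A - {b}. c b' *\<^sub>R Bt (lens_grad (B (b - b'))))"
      unfolding q_def using out by (intro sum.cong) auto
    then show ?thesis by (simp add: inner_sum_left adj)
  qed
  {
    fix p assume "p \<in> (\<lambda>l. q b + c b *\<^sub>R Bt l) ` lens"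
    then obtain l where l: "l \<in> lens" "p = q b + c b *\<^sub>R Bt l" by blast
    show "p \<in> subdiff \<Omega> v b"
      unfolding subdiff_def
    proof (intro CollectI ballI)
      fix y assume "y \<in> \<Omega>"
      have "(\<Sum>b'\<in>A - {b}. c b' * (lens_grad (B (b - b')) \<bullet> B (y - b))) + (\<Sum>b'\<in>A - {b}. c b' * lens_fun (B (b - b')))
          = (\<Sum>b'\<in>A - {b}. c b' * (lens_grad (B (b - b')) \<bullet> B (y - b')))"
        unfolding sum.distrib[symmetric] lens_fun_def B_diff
        by (intro sum.cong) (simp_all add: inner_diff_right algebra_simps)
      also have "\<dots> \<le> (\<Sum>b'\<in>A - {b}. c b' * lens_fun (B (y - b')))"
        using cpos by (intro sum_mono mult_left_mono lens_fun_support lens_grad_in_lens) (auto intro: less_imp_le)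
      finally have "q b \<bullet> (y - b) + (\<Sum>b'\<in>A - {b}. c b' * lens_fun (B (b - b'))) \<le> (\<Sum>b'\<in>A - {b}. c b' * lens_fun (B (y - b')))"
        unfolding qe .
      moreover have "c b * (l \<bullet> B (y - b)) \<le> c b * lens_fun (B (y - b))"
        using cpos[OF b(1)] lens_fun_support[OF l(1)] by (intro mult_left_mono) auto
      moreover have "p \<bullet> (y - b) = q b \<bullet> (y - b) + c b * (l \<bullet> B (y - b))"
        unfolding l(2) inner_add_left inner_scaleR_left adj ..
      moreover have "lens_fun (B (b - b)) = 0" by (simp add: B0 lens_fun_def)
      ultimately show "p \<bullet> (y - b) + v b \<le> v y" unfolding vb[of y] vb[of b] by simp
    qed
  }
  fix p assume p: "p \<in> subdiff \<Omega> v b"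
  define r where "r = (1 / c b) *\<^sub>R (p - q b)"
  \<comment> \<open>The preimage of \<open>r\<close> under \<open>Bt\<close>, read off in the
    frame.\<close>
  define l where "l = (vector [(f \<bullet> r) / \<delta>, e \<bullet> r] :: real^2)"
  have Btl: "Bt l = r" using dpos expand[of r] by (simp add: Bt_def l_def)
  have cb: "c b > 0" by (rule cpos[OF b(1)])
  have peq: "p = q b + c b *\<^sub>R Bt l" unfolding Btl r_def using cb by simp
  have "l \<bullet> y \<le> lens_fun y" for y
  proof -
    define z where "z = (y $ 1 / \<delta>) *\<^sub>R f + y $ 2 *\<^sub>R e"
    have Bz: "B z = y" using dpos by (simp add: vec_eq_iff forall_2 z_def inner_add_right ef)
    \<comment> \<open>Bounds the second-order error of the other terms, whose gradients are
      Lipschitz about b.\<close>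
    define D where "D = (\<Sum>b'\<in>A - {b}. c b' * (64 / \<delta>) / norm (b - b') * (norm z)\<^sup>2)"
    obtain \<rho> where \<rho>: "\<rho> > 0" "cball b \<rho> \<subseteq> \<Omega>" using \<Omega> b open_contains_cball by blast
    have main: "p \<bullet> z \<le> c b * lens_fun y + q b \<bullet> z + t * D" if t: "t > 0" "t * norm z \<le> \<rho>" for t
    proof -
      have "b + t *\<^sub>R z \<in> cball b \<rho>" using t by (simp add: dist_norm)
      then have "b + t *\<^sub>R z \<in> \<Omega>" using \<rho> by blast
      then have "p \<bullet> (b + t *\<^sub>R z - b) + v b \<le> v (b + t *\<^sub>R z)" using p unfolding subdiff_def by blast
      then have 1: "t * (p \<bullet> z) \<le> v (b + t *\<^sub>R z) - v b" by simp
      have lh: "lens_fun (B (b + t *\<^sub>R z - b)) \<le> t * lens_fun y"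
      proof -
        have "lens_fun (t *\<^sub>R y) = t * (lens_grad (t *\<^sub>R y) \<bullet> y)" by (simp add: lens_fun_def)
        also have "\<dots> \<le> t * lens_fun y" using t by (intro mult_left_mono lens_fun_support lens_grad_in_lens) auto
        finally show ?thesis by (simp add: B_scale Bz)
      qed
      have tm: "lens_fun (B (b + t *\<^sub>R z - b')) - lens_fun (B (b - b')) \<le> t * (lens_grad (B (b - b')) \<bullet> B z) + t * (t * ((64 / \<delta>) / norm (b - b') * (norm z)\<^sup>2))"
        if b': "b' \<in> A - {b}" for b'
      proof -
        let ?G = "lens_grad (B (b + t *\<^sub>R z - b'))" and ?H = "lens_grad (B (b - b'))"
        have ge: "lens_fun (B (b - b')) \<ge> ?G \<bullet> B (b - b')" by (rule lens_fun_support[OF lens_grad_in_lens])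
        have "b + t *\<^sub>R z - b' = (b - b') - (- t) *\<^sub>R z" by simp
        then have Be: "B (b + t *\<^sub>R z - b') = B (b - b') + t *\<^sub>R B z" by (simp only: B_diff B_scale) simp
        have "lens_fun (B (b + t *\<^sub>R z - b')) = ?G \<bullet> (B (b - b') + t *\<^sub>R B z)"
          by (simp only: lens_fun_def Be)
        also have "\<dots> = ?G \<bullet> B (b - b') + t * (?G \<bullet> B z)" by (simp only: inner_add_right inner_scaleR_right)
        finally have "lens_fun (B (b + t *\<^sub>R z - b')) - lens_fun (B (b - b')) \<le> t * (?G \<bullet> B z)"
          using ge by linarith
        also have "?G \<bullet> B z = ?H \<bullet> B z + (Bt ?G - Bt ?H) \<bullet> z" by (simp add: inner_diff_left adj)
        also have "(Bt ?G - Bt ?H) \<bullet> z \<le> norm (Bt ?H - Bt ?G) * norm z"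
          using norm_cauchy_schwarz[of "Bt ?G - Bt ?H" z] by (simp add: norm_minus_commute)
        also have "norm (Bt ?H - Bt ?G) \<le> (64 / \<delta>) * norm (t *\<^sub>R z) / norm (b - b')"
        proof -
          have nz: "norm (b - b') > 0" using b' by auto
          show ?thesis using iffD2[OF pos_le_divide_eq[OF nz] term_lip[of "b - b'" "b + t *\<^sub>R z - b'"]] by simp
        qed
        finally have "lens_fun (B (b + t *\<^sub>R z - b')) - lens_fun (B (b - b')) \<le> t * (?H \<bullet> B z + (64 / \<delta>) * norm (t *\<^sub>R z) / norm (b - b') * norm z)"
          using t by (simp add: mult_left_mono mult_right_mono)
        then show ?thesis using t by (simp add: algebra_simps power2_eq_square)
      qed
      have "v (b + t *\<^sub>R z) - v b \<le> t * (q b \<bullet> z) + t * (t * D) + c b * (t * lens_fun y)"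
      proof -
        have "(\<Sum>b'\<in>A - {b}. c b' * lens_fun (B (b + t *\<^sub>R z - b'))) - (\<Sum>b'\<in>A - {b}. c b' * lens_fun (B (b - b')))
           = (\<Sum>b'\<in>A - {b}. c b' * (lens_fun (B (b + t *\<^sub>R z - b')) - lens_fun (B (b - b'))))"
          by (simp add: sum_subtractf right_diff_distrib)
        also have "\<dots> \<le> (\<Sum>b'\<in>A - {b}. c b' * (t * (lens_grad (B (b - b')) \<bullet> B z) + t * (t * ((64 / \<delta>) / norm (b - b') * (norm z)\<^sup>2))))"
          using cpos tm by (intro sum_mono mult_left_mono) (auto intro: less_imp_le)
        also have "\<dots> = t * (q b \<bullet> z) + t * (t * D)"
          unfolding qe D_def sum_distrib_left sum.distrib[symmetric] by (intro sum.cong) (simp_all add: algebra_simps)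
        finally have S: "(\<Sum>b'\<in>A - {b}. c b' * lens_fun (B (b + t *\<^sub>R z - b'))) - (\<Sum>b'\<in>A - {b}. c b' * lens_fun (B (b - b')))
           \<le> t * (q b \<bullet> z) + t * (t * D)" .
        have "c b * lens_fun (B (b + t *\<^sub>R z - b)) \<le> c b * (t * lens_fun y)"
          using lh cb by (intro mult_left_mono) auto
        moreover have "c b * lens_fun (B (b - b)) = 0" by (simp add: B0 lens_fun_def)
        ultimately show ?thesis
          unfolding vb[of "b + t *\<^sub>R z"] vb[of b] using S by linarith
      qed
      with 1 have "t * (p \<bullet> z) \<le> t * (c b * lens_fun y + q b \<bullet> z + t * D)" by (simp add: algebra_simps)
      then show ?thesis using t by simp
    qed
    have D0: "D \<ge> 0" unfolding D_def
      by (intro sum_nonneg mult_nonneg_nonneg divide_nonneg_nonneg) (use cpos dpos in \<open>auto intro: less_imp_le\<close>)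
    have "p \<bullet> z \<le> c b * lens_fun y + q b \<bullet> z"
    proof (rule field_le_epsilon)
      fix \<epsilon> :: real assume \<epsilon>: "\<epsilon> > 0"
      define t where "t = min (\<rho> / (norm z + 1)) (\<epsilon> / (D + 1))"
      have t: "t > 0" using \<rho> \<epsilon> D0 by (simp add: t_def add_nonneg_pos)
      have "t * norm z \<le> \<rho> / (norm z + 1) * norm z" unfolding t_def by (intro mult_right_mono) auto
      also have "\<dots> \<le> \<rho>" using \<rho>(1) by (simp add: pos_divide_le_eq add_nonneg_pos)
      finally have tz: "t * norm z \<le> \<rho>" .
      have "t * D \<le> \<epsilon> / (D + 1) * D" unfolding t_def using D0 by (intro mult_right_mono) auto
      also have "\<dots> \<le> \<epsilon>" using D0 \<epsilon> by (simp add: pos_divide_le_eq)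
      finally show "p \<bullet> z \<le> c b * lens_fun y + q b \<bullet> z + \<epsilon>" using main[OF t tz] by linarith
    qed
    moreover have "p \<bullet> z = q b \<bullet> z + c b * (l \<bullet> y)"
      unfolding peq inner_add_left inner_scaleR_left adj Bz ..
    ultimately show ?thesis using cb by simp
  qed
  then have "l \<in> lens" unfolding lens_fun_eq by blast
  then show "p \<in> (\<lambda>l. q b + c b *\<^sub>R Bt l) ` lens" using peq by blast
qed

text \<open>The determinant of k times \<open>Bt\<close> is -k^2 \<delta> because the frame is
  orthonormal. The mass of an atom can therefore be adjusted by k after \<delta> has been
  fixed.\<close>

lemma atom_measure:
  "(\<lambda>l. q b + k *\<^sub>R Bt l) ` lens \<in> lmeasurable"
  "measure lebesgue ((\<lambda>l. q b + k *\<^sub>R Bt l) ` lens) = k\<^sup>2 * \<delta> * measure lebesgue lens"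
proof -
  have lin: "linear (\<lambda>l. k *\<^sub>R Bt l)"
    by (rule linearI) (simp_all add: Bt_def algebra_simps)
  have im: "(\<lambda>l. q b + k *\<^sub>R Bt l) ` lens = (+) (q b) ` ((\<lambda>l. k *\<^sub>R Bt l) ` lens)"
    by (simp add: image_image)
  have lm: "lens \<in> lmeasurable" using lens_compact by (rule lmeasurable_compact)
  have "matrix (\<lambda>l. k *\<^sub>R Bt l) $ 1 $ 1 = k * (\<delta> * f $ 1)" "matrix (\<lambda>l. k *\<^sub>R Bt l) $ 1 $ 2 = k * e $ 1"
    "matrix (\<lambda>l. k *\<^sub>R Bt l) $ 2 $ 1 = k * (\<delta> * f $ 2)" "matrix (\<lambda>l. k *\<^sub>R Bt l) $ 2 $ 2 = k * e $ 2"
    by (simp_all add: matrix_def Bt_def axis_def)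
  then have "det (matrix (\<lambda>l. k *\<^sub>R Bt l)) = - (k\<^sup>2 * \<delta> * ((e $ 1)\<^sup>2 + (e $ 2)\<^sup>2))"
    unfolding det_2 by (simp add: f_def power2_eq_square algebra_simps)
  then have "det (matrix (\<lambda>l. k *\<^sub>R Bt l)) = - (k\<^sup>2 * \<delta>)" by (simp add: e_sq)
  then have d: "\<bar>det (matrix (\<lambda>l. k *\<^sub>R Bt l))\<bar> = k\<^sup>2 * \<delta>" using dpos by (simp add: abs_mult)
  have li: "(\<lambda>l. k *\<^sub>R Bt l) ` lens \<in> lmeasurable" by (rule measurable_linear_image[OF lin lm])
  show "(\<lambda>l. q b + k *\<^sub>R Bt l) ` lens \<in> lmeasurable"
    unfolding im using li by (rule measurable_translation)
  show "measure lebesgue ((\<lambda>l. q b + k *\<^sub>R Bt l) ` lens) = k\<^sup>2 * \<delta> * measure lebesgue lens"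
    unfolding im measure_translation using measure_linear_image[OF lin lm] d by simp
qed

text \<open>Slopes at points of \<open>E\<close> other than atoms form a null set, so a set
  containing the single atom b carries exactly the measure of the image of the lens.\<close>

lemma v_point_MA:
  assumes s: "slabs \<Omega>" and \<Omega>: "open \<Omega>" "A \<subseteq> \<Omega>" and \<sigma>: "\<And>b. b \<in> A \<Longrightarrow> (c b)\<^sup>2 * \<delta> * measure lebesgue lens = \<sigma> b"
  shows "point_MA \<Omega> A \<sigma> v"
  unfolding point_MA_def
proof (intro allI impI conjI)
  fix E assume E: "compact E" "E \<subseteq> \<Omega>"
  have N: "(\<Union>x\<in>E - A. subdiff \<Omega> v x) \<in> null_sets lebesgue"
    using negligible_subset[OF subdiff_away_negligible[OF s \<Omega>(1)], of "\<Union>x\<in>E - A. subdiff \<Omega> v x"] E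
    unfolding negligible_iff_null_sets by blast
  show "emeasure lebesgue (\<Union>x\<in>E. subdiff \<Omega> v x) = 0" if "E \<inter> A = {}"
  proof -
    have "E - A = E" using that by blast
    then show ?thesis using N by (simp add: null_setsD1)
  qed
  fix b assume b: "E \<inter> A = {b}"
  then have bA: "b \<in> A" "b \<in> \<Omega>" using \<Omega> by auto
  let ?L = "(\<lambda>l. q b + c b *\<^sub>R Bt l) ` lens"
  have "emeasure lebesgue ?L = ennreal (measure lebesgue ?L)"
    using atom_measure(1) by (rule emeasure_eq_measure2)
  then have L: "emeasure lebesgue ?L = ennreal (\<sigma> b)" unfolding atom_measure(2) \<sigma>[OF bA(1)] .
  then show "emeasure lebesgue (subdiff \<Omega> v b) = ennreal (\<sigma> b)" unfolding subdiff_atom[OF s \<Omega>(1) bA] .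
  have "E = insert b (E - A)" using b by blast
  then have "(\<Union>x\<in>E. subdiff \<Omega> v x) = subdiff \<Omega> v b \<union> (\<Union>x\<in>E - A. subdiff \<Omega> v x)" by (metis UN_insert)
  also have "\<dots> = ?L \<union> (\<Union>x\<in>E - A. subdiff \<Omega> v x)" unfolding subdiff_atom[OF s \<Omega>(1) bA] ..
  finally have "emeasure lebesgue (\<Union>x\<in>E. subdiff \<Omega> v x) = emeasure lebesgue ?L"
    using emeasure_Un_null_set[OF fmeasurableD[OF atom_measure(1)] N] by simp
  then show "emeasure lebesgue (\<Union>x\<in>E. subdiff \<Omega> v x) = ennreal (\<sigma> b)" unfolding L .
qed

end

section \<open>Logarithmic integrals\<close>

text \<open>The smaller of 1 and h / |x - b|: the common profile of the mollification error of the
  gradient and of h times the mollified Hessian.\<close>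

definition wt :: "real \<Rightarrow> real^2 \<Rightarrow> real^2 \<Rightarrow> real" where
  "wt h b x = h / max h (norm (x - b))"

text \<open>Dyadic annuli: each of the roughly log(1/h) scales between h and D contributes equally.\<close>

lemma wt_dyadic:
  assumes h: "h > 0" and m: "norm (x - b) \<le> 2 ^ m * h"
  shows "(wt h b x)\<^sup>2 \<le> (\<Sum>k\<le>m. 4 * (1 / 4) ^ k * indicator (cball b (2 ^ k * h)) x)"
proof -
  let ?r = "norm (x - b)"
  \<comment> \<open>Selects the dyadic annulus of x: unless k = 0, the distance exceeds half of the
    radius 2^k h, which bounds the weight by 2 (1/2)^k.\<close>
  define k where "k = (LEAST k. ?r \<le> 2 ^ k * h)"
  have k: "?r \<le> 2 ^ k * h" unfolding k_def by (rule LeastI[of _ m]) (rule m)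
  have km: "k \<le> m" unfolding k_def by (rule Least_le) (rule m)
  have w0: "0 \<le> wt h b x" using h by (simp add: wt_def)
  have "wt h b x \<le> 2 * (1 / 2) ^ k"
  proof (cases k)
    case 0
    have "h / max h ?r \<le> 1" using h by (simp add: divide_le_eq_1 less_max_iff_disj)
    then show ?thesis using 0 by (simp add: wt_def)
  next
    case (Suc j)
    have "\<not> ?r \<le> 2 ^ j * h" using not_less_Least[of j "\<lambda>k. ?r \<le> 2 ^ k * h"] Suc by (simp add: k_def)
    then have "max h ?r \<ge> 2 ^ j * h" by simp
    then have "h / max h ?r \<le> h / (2 ^ j * h)" using h by (intro divide_left_mono) auto
    then show ?thesis using h Suc by (simp add: wt_def power_one_over)
  qed
  then have "(wt h b x)\<^sup>2 \<le> (2 * (1 / 2) ^ k)\<^sup>2" using w0 by (intro power_mono)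
  also have "\<dots> = 2\<^sup>2 * ((1 / 2)\<^sup>2) ^ k"
    by (simp only: power_mult_distrib power_mult[symmetric] mult.commute[of k])
  also have "\<dots> = 4 * (1 / 4) ^ k" by (simp add: power_divide)
  also have "\<dots> = 4 * (1 / 4) ^ k * indicator (cball b (2 ^ k * h)) x" using k by (simp add: dist_norm norm_minus_commute)
  also have "\<dots> \<le> (\<Sum>k\<le>m. 4 * (1 / 4) ^ k * indicator (cball b (2 ^ k * h)) x)"
    using km by (intro member_le_sum[where f="\<lambda>k. 4 * (1 / 4) ^ k * indicator (cball b (2 ^ k * h)) x"]) auto
  finally show ?thesis .
qed

lemma wt_integral:
  assumes D: "D > 0"
  obtains C where "C > 0" "\<And>h b. 0 < h \<Longrightarrow> h < 1 / 2 \<Longrightarrow>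
    (\<integral>\<^sup>+x. ennreal (indicator (cball b D) x * (wt h b x)\<^sup>2) \<partial>lborel) \<le> ennreal (C * h\<^sup>2 * ln (1 / h))"
proof -
  define U where "U = unit_ball_vol (real DIM(real^2))"
  have U: "U > 0" by (simp add: U_def)
  \<comment> \<open>There are m + 1 scales, with m at most 1 plus the positive part of log2 (D/h).
    The terms free of ln (1/h) are absorbed by the factor ln (1/h) / ln 2, which is at least 1 for h
    < 1/2; the outcome is m + 1 \<le> c ln (1/h).\<close>
  define c where "c = 2 / ln 2 + (\<bar>ln D\<bar> / ln 2 + 1) / ln (2::real)"
  have l2: "ln (2::real) > 0" by simp
  have c: "c > 0" unfolding c_def using l2 by (intro add_pos_nonneg divide_pos_pos) auto
  show thesis
  proof (rule that[of "4 * U * c"])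
    show "4 * U * c > 0" using U c by simp
    fix h :: real and b :: "real^2" assume h: "0 < h" "h < 1 / 2"
    define L where "L = ln (1 / h)"
    have "2 \<le> 1 / h" using h by (simp add: field_simps)
    then have L: "L \<ge> ln 2" unfolding L_def using h by (subst ln_le_cancel_iff) auto
    define lg where "lg = max 0 (log 2 (D / h))"
    define m where "m = nat \<lceil>lg\<rceil>"
    have m1: "lg \<le> real m" "real m \<le> lg + 1" unfolding m_def lg_def by linarith+
    have "D / h = 2 powr log 2 (D / h)" using D h by simp
    also have "\<dots> \<le> 2 powr real m" using m1 by (intro powr_mono) (auto simp: lg_def)
    also have "\<dots> = 2 ^ m" by (simp add: powr_realpow)
    finally have Dm: "D \<le> 2 ^ m * h" using h by (simp add: pos_divide_le_eq)
    have "log 2 (D / h) = (ln D + L) / ln 2" using D h by (simp add: log_def ln_div L_def)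
    also have "\<dots> \<le> (\<bar>ln D\<bar> + L) / ln 2" using l2 by (intro divide_right_mono) auto
    finally have "log 2 (D / h) \<le> (\<bar>ln D\<bar> + L) / ln 2" .
    moreover have "0 \<le> \<bar>ln D\<bar> + L" using L l2 by linarith
    then have "0 \<le> (\<bar>ln D\<bar> + L) / ln 2" using l2 by (rule divide_nonneg_pos)
    ultimately have lgb: "lg \<le> (\<bar>ln D\<bar> + L) / ln 2" unfolding lg_def by simp
    have one: "1 \<le> L / ln 2" using L l2 by (simp add: pos_le_divide_eq)
    have "real m + 1 \<le> 2 * 1 + (\<bar>ln D\<bar> / ln 2) * 1 + L / ln 2" using m1 lgb by (simp add: add_divide_distrib)
    also have "\<dots> \<le> 2 * (L / ln 2) + (\<bar>ln D\<bar> / ln 2) * (L / ln 2) + L / ln 2"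
      using one l2 by (intro add_mono mult_left_mono) auto
    also have "\<dots> = c * L" unfolding c_def by (simp add: field_simps)
    finally have mc: "real m + 1 \<le> c * L" .
    have "(\<integral>\<^sup>+x. ennreal (indicator (cball b D) x * (wt h b x)\<^sup>2) \<partial>lborel)
       \<le> (\<integral>\<^sup>+x. (\<Sum>k\<le>m. ennreal (4 * (1 / 4) ^ k) * indicator (cball b (2 ^ k * h)) x) \<partial>lborel)"
    proof (rule nn_integral_mono)
      fix x
      have s: "(\<Sum>k\<le>m. ennreal (4 * (1 / 4) ^ k) * indicator (cball b (2 ^ k * h)) x) = ennreal (\<Sum>k\<le>m. 4 * (1 / 4) ^ k * indicator (cball b (2 ^ k * h)) x)"
        by (subst sum_ennreal[symmetric]) (auto intro!: sum.cong simp: indicator_def)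
      show "ennreal (indicator (cball b D) x * (wt h b x)\<^sup>2) \<le> (\<Sum>k\<le>m. ennreal (4 * (1 / 4) ^ k) * indicator (cball b (2 ^ k * h)) x)"
      proof (cases "x \<in> cball b D")
        case True
        then have "norm (x - b) \<le> 2 ^ m * h" using Dm by (simp add: dist_norm norm_minus_commute)
        from wt_dyadic[OF h(1) this] show ?thesis unfolding s using True by (intro ennreal_leI) simp
      qed simp
    qed
    also have "\<dots> = (\<Sum>k\<le>m. ennreal (4 * (1 / 4) ^ k) * emeasure lborel (cball b (2 ^ k * h)))"
      by (subst nn_integral_sum) (auto simp: nn_integral_cmult_indicator intro!: borel_measurable_times_ennreal borel_measurable_indicator)
    \<comment> \<open>The area of the ball grows like 4^k and cancels the weight (1/4)^k.\<close>
    also have "\<dots> = (\<Sum>k\<le>m. ennreal (4 * U * h\<^sup>2))"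
    proof (rule sum.cong[OF refl])
      fix k
      have "emeasure lborel (cball b (2 ^ k * h)) = ennreal (U * (2 ^ k * h) ^ 2)"
        using h by (simp add: emeasure_cball U_def)
      then have "ennreal (4 * (1 / 4) ^ k) * emeasure lborel (cball b (2 ^ k * h)) = ennreal (4 * (1 / 4) ^ k * (U * (2 ^ k * h) ^ 2))"
        using U by (simp add: ennreal_mult)
      also have "4 * (1 / 4) ^ k * (U * (2 ^ k * h) ^ 2) = 4 * U * h\<^sup>2 * ((1 / 4) ^ k * (2 ^ k)\<^sup>2)"
        by (simp add: power_mult_distrib)
      also have "(1 / 4 :: real) ^ k * (2 ^ k)\<^sup>2 = 1"
        by (simp add: power_mult[symmetric] mult.commute[of k] power_one_over) (simp add: power_mult)
      finally show "ennreal (4 * (1 / 4) ^ k) * emeasure lborel (cball b (2 ^ k * h)) = ennreal (4 * U * h\<^sup>2)" by simp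
    qed
    also have "\<dots> = ennreal ((real m + 1) * (4 * U * h\<^sup>2))"
      using U by (simp add: ennreal_of_nat_eq_real_of_nat ennreal_mult[symmetric] ennreal_plus[symmetric] algebra_simps del: ennreal_plus)
    also have "\<dots> \<le> ennreal (4 * U * c * h\<^sup>2 * ln (1 / h))"
      using mult_right_mono[OF mc, of "4 * U * h\<^sup>2"] U by (intro ennreal_leI) (simp add: L_def mult_ac)
    finally show "(\<integral>\<^sup>+x. ennreal (indicator (cball b D) x * (wt h b x)\<^sup>2) \<partial>lborel) \<le> ennreal (4 * U * c * h\<^sup>2 * ln (1 / h))" .
  qed
qed

section \<open>Mollifying the explicit function\<close>

context lens_sum
begin

text \<open>The local Lipschitz constant of \<open>g\<close> at x supplied by
  \<open>g_lip\<close>.\<close>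

definition lipg :: "real^2 \<Rightarrow> real" where
  "lipg x = (\<Sum>b\<in>A. c b * (64 / \<delta>) / norm (x - b))"

lemma lipg_nonneg: "lipg x \<ge> 0"
  unfolding lipg_def
  by (intro sum_nonneg divide_nonneg_nonneg mult_nonneg_nonneg) (use cpos dpos in \<open>auto intro: less_imp_le\<close>)

text \<open>The directional derivative at z lies between g(z) w and g(z + t w) w for every t > 0.
  Only x has to avoid the atoms; z may be one of them, as happens when averaging over a ball that
  contains an atom.\<close>

lemma ddir_near:
  assumes x: "x \<notin> A" and w: "norm w = 1"
  shows "\<bar>ddir w v z - g x \<bullet> w\<bar> \<le> lipg x * norm (z - x)"
proof -
  have L: "norm (g x - g y) \<le> lipg x * norm (y - x)" for y
    using g_lip[OF x, of y] by (simp add: lipg_def norm_minus_commute)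
  have "\<bar>(g y - g x) \<bullet> w\<bar> \<le> lipg x * norm (y - x)" for y
    using Cauchy_Schwarz_ineq2[of "g y - g x" w] L[of y] w by (simp add: norm_minus_commute)
  then have "\<bar>g y \<bullet> w - g x \<bullet> w\<bar> \<le> lipg x * norm (y - x)" for y
    unfolding inner_diff_left .
  note gw0 = this
  have gw: "g y \<bullet> w \<le> g x \<bullet> w + lipg x * norm (y - x)" "g y \<bullet> w \<ge> g x \<bullet> w - lipg x * norm (y - x)" for y
    using gw0[of y] by linarith+
  have "ddir w v z \<le> g x \<bullet> w + lipg x * norm (z - x)"
  proof (rule field_le_epsilon)
    fix \<epsilon> :: real assume \<epsilon>: "\<epsilon> > 0"
    define t where "t = \<epsilon> / (lipg x + 1)"
    have t: "t > 0" using \<epsilon> lipg_nonneg[of x] by (simp add: t_def add_nonneg_pos)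
    have "ddir w v z \<le> (v (z + t *\<^sub>R w) - v z) / t" by (rule ddir_le[OF v_convex v_lipschitz t])
    also have "\<dots> \<le> g (z + t *\<^sub>R w) \<bullet> w"
      using v_support[of "z + t *\<^sub>R w" z] t by (simp add: pos_divide_le_eq mult.commute)
    also have "\<dots> \<le> g x \<bullet> w + lipg x * norm (z + t *\<^sub>R w - x)" by (rule gw)
    also have "\<dots> \<le> g x \<bullet> w + lipg x * (norm (z - x) + t)"
    proof -
      have "norm (z + t *\<^sub>R w - x) \<le> norm (z - x) + t"
        using norm_triangle_ineq[of "z - x" "t *\<^sub>R w"] t w by (simp add: algebra_simps)
      then show ?thesis using lipg_nonneg[of x] by (intro add_left_mono mult_left_mono)
    qed
    finally have z: "ddir w v z \<le> g x \<bullet> w + lipg x * (norm (z - x) + t)" .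
    have "lipg x * t \<le> \<epsilon>"
    proof -
      have "lipg x * t \<le> (lipg x + 1) * t" using t by (intro mult_right_mono) auto
      also have "\<dots> = \<epsilon>" using lipg_nonneg[of x] by (simp add: t_def)
      finally show ?thesis .
    qed
    with z show "ddir w v z \<le> g x \<bullet> w + lipg x * norm (z - x) + \<epsilon>" by (simp add: distrib_left)
  qed
  moreover have "ddir w v z \<ge> g z \<bullet> w"
  proof (rule LIMSEQ_le_const[OF ddir_tendsto[OF v_convex v_lipschitz]], intro exI allI impI)
    fix n :: nat
    define t where "t = 1 / real (Suc n)"
    have t: "t > 0" by (simp add: t_def)
    have "g z \<bullet> w \<le> (v (z + t *\<^sub>R w) - v z) / t"
      using v_support[of z "z + t *\<^sub>R w"] t by (simp add: pos_le_divide_eq mult.commute)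
    then show "g z \<bullet> w \<le> (v (z + (1 / real (Suc n)) *\<^sub>R w) - v z) / (1 / real (Suc n))" unfolding t_def .
  qed
  ultimately show ?thesis using gw(2)[of z] by (simp add: abs_le_iff)
qed

definition csum :: real where "csum = (\<Sum>b\<in>A. c b)"

definition wts :: "real \<Rightarrow> real^2 \<Rightarrow> real" where "wts h x = (\<Sum>b\<in>A. wt h b x)"

lemma csum_nonneg: "csum \<ge> 0" and c_le_csum: "b \<in> A \<Longrightarrow> c b \<le> csum"
  unfolding csum_def using cpos finA
  by (auto intro!: sum_nonneg member_le_sum intro: less_imp_le)

lemma wt_nonneg: "h > 0 \<Longrightarrow> wt h b x \<ge> 0"
  by (simp add: wt_def)

lemma wt_le_wts: "h > 0 \<Longrightarrow> b \<in> A \<Longrightarrow> wt h b x \<le> wts h x"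
  unfolding wts_def using finA wt_nonneg by (intro member_le_sum) auto

lemma wts_nonneg: "h > 0 \<Longrightarrow> wts h x \<ge> 0"
  unfolding wts_def using wt_nonneg by (intro sum_nonneg) auto

text \<open>At distance h or more the maximum in \<open>wt\<close> is the distance itself, so h / |x
  - b| is the weight.\<close>

lemma lipg_le_wts:
  assumes h: "h > 0" and far: "\<And>b. b \<in> A \<Longrightarrow> norm (x - b) \<ge> h"
  shows "h * lipg x \<le> (csum * (64 / \<delta>)) * wts h x"
proof -
  have "h * lipg x = (\<Sum>b\<in>A. c b * (64 / \<delta>) * wt h b x)"
    unfolding lipg_def sum_distrib_left
  proof (rule sum.cong[OF refl])
    fix b assume "b \<in> A"
    then have "max h (norm (x - b)) = norm (x - b)" using far by (simp add: max_def)
    then show "h * (c b * (64 / \<delta>) / norm (x - b)) = c b * (64 / \<delta>) * wt h b x" by (simp add: wt_def)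
  qed
  also have "\<dots> \<le> (\<Sum>b\<in>A. csum * (64 / \<delta>) * wt h b x)"
    using c_le_csum dpos wt_nonneg[OF h] by (intro sum_mono mult_right_mono) auto
  finally show ?thesis by (simp add: wts_def sum_distrib_left)
qed

definition C1 :: real where "C1 = 2 * K + 2 * (csum * (64 / \<delta>))"

text \<open>Within h of an atom its weight is 1 and both gradients are at most \<open>K\<close>,
  which gives the part 2 K of \<open>C1\<close>. Farther away \<open>ddir\<close> differs from g(x)
  by at most 2 h \<open>lipg x\<close> on the ball of radius 2 h, which gives the other
  part.\<close>

lemma moll_grad_close:
  assumes h: "h > 0" and x: "x \<notin> A"
  shows "\<bar>moll (Suc 0) 0 h v x - g x $ 1\<bar> \<le> C1 * wts h x"
    and "\<bar>moll 0 (Suc 0) h v x - g x $ 2\<bar> \<le> C1 * wts h x"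
proof -
  have gi: "\<bar>g x $ i\<bar> \<le> K" for i using component_le_norm_cart[of "g x" i] g_bound[of x] by linarith
  have near: "\<bar>m - g x $ i\<bar> \<le> C1 * wts h x" if b: "b \<in> A" "norm (x - b) < h" and m: "\<bar>m\<bar> \<le> K" for b m i
  proof -
    have "wt h b x = 1" using b h by (simp add: wt_def)
    then have "1 \<le> wts h x" using wt_le_wts[OF h b(1), of x] by simp
    then have "2 * K * 1 \<le> C1 * wts h x"
      unfolding C1_def using K_nonneg csum_nonneg dpos by (intro mult_mono) auto
    then show ?thesis using gi[of i] m by linarith
  qed
  have far: "\<bar>(LINT y|lborel. ddir (axis i 1) v (x - y) * kern 0 0 h y) - g x $ i\<bar> \<le> C1 * wts h x"
    if f: "\<And>b. b \<in> A \<Longrightarrow> norm (x - b) \<ge> h" for i :: 2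
  proof -
    note ig = moll_grad_eq(3)[OF h v_convex v_lipschitz, of "axis i 1" x]
    have i: "integrable lborel (\<lambda>y. (ddir (axis i 1) v (x - y) - g x $ i) * kern 0 0 h y)"
      using ig integrable_kern[OF h, of 0 0] by (simp add: left_diff_distrib)
    have "(LINT y|lborel. ddir (axis i 1) v (x - y) * kern 0 0 h y) - g x $ i
      = (LINT y|lborel. (ddir (axis i 1) v (x - y) - g x $ i) * kern 0 0 h y)"
      using ig integrable_kern[OF h, of 0 0] LINT_kern[OF h] by (simp add: left_diff_distrib)
    moreover have "\<bar>ddir (axis i 1) v (x - y) - g x $ i\<bar> \<le> lipg x * (2 * h)" if "norm y \<le> 2 * h" for y
    proof -
      have "\<bar>ddir (axis i 1) v (x - y) - g x \<bullet> axis i 1\<bar> \<le> lipg x * norm (x - y - x)"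
        by (rule ddir_near[OF x]) (simp add: norm_axis_1)
      also have "\<dots> \<le> lipg x * (2 * h)" using that lipg_nonneg by (intro mult_left_mono) auto
      finally show ?thesis by (simp add: inner_axis)
    qed
    ultimately have "\<bar>(LINT y|lborel. ddir (axis i 1) v (x - y) * kern 0 0 h y) - g x $ i\<bar> \<le> 2 * (h * lipg x)"
      using LINT_kern_bound[OF h i] kern_mass_0 by (simp add: mult_ac)
    also have "\<dots> \<le> (2 * (csum * (64 / \<delta>))) * wts h x" using lipg_le_wts[OF h f] by simp
    also have "\<dots> \<le> C1 * wts h x" unfolding C1_def using K_nonneg wts_nonneg[OF h] by (intro mult_right_mono) auto
    finally show ?thesis .
  qed
  have m: "\<bar>moll (Suc 0) 0 h v x\<bar> \<le> K" "\<bar>moll 0 (Suc 0) h v x\<bar> \<le> K"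
    using moll_deriv_bound[OF h v_lipschitz, of 0 0 x] by (simp_all add: kern_mass_0)
  show "\<bar>moll (Suc 0) 0 h v x - g x $ 1\<bar> \<le> C1 * wts h x" "\<bar>moll 0 (Suc 0) h v x - g x $ 2\<bar> \<le> C1 * wts h x"
  proof -
    have "\<bar>moll (Suc 0) 0 h v x - g x $ 1\<bar> \<le> C1 * wts h x \<and> \<bar>moll 0 (Suc 0) h v x - g x $ 2\<bar> \<le> C1 * wts h x"
    proof (cases "\<exists>b\<in>A. norm (x - b) < h")
      case True
      then show ?thesis using near m by blast
    next
      case False
      then have "\<And>b. b \<in> A \<Longrightarrow> norm (x - b) \<ge> h" by force
      then show ?thesis using far unfolding moll_grad_eq(1,2)[OF h v_convex v_lipschitz] by blast
    qed
    then show "\<bar>moll (Suc 0) 0 h v x - g x $ 1\<bar> \<le> C1 * wts h x" "\<bar>moll 0 (Suc 0) h v x - g x $ 2\<bar> \<le> C1 * wts h x" by blast+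
  qed
qed

definition C2 :: real where
  "C2 = 4 * (K * (kern_mass (Suc 0) 0 + kern_mass 0 (Suc 0))) + 2 * (csum * (64 / \<delta>))"

text \<open>Within 4 h of an atom the kernel bound of order K/h applies and the weight is at least
  1/4, whence the factor 4 in \<open>C2\<close>. Otherwise every point of the ball of radius 2 h
  about x keeps at least half the distance of x from each atom, so \<open>lipg\<close> at most
  doubles there and bounds the derivative of the averaged gradient.\<close>

lemma moll_hess_bound:
  assumes h: "h > 0"
  shows "h * \<bar>moll (Suc (Suc 0)) 0 h v x\<bar> \<le> C2 * wts h x"
    and "h * \<bar>moll (Suc 0) (Suc 0) h v x\<bar> \<le> C2 * wts h x"
    and "h * \<bar>moll 0 (Suc (Suc 0)) h v x\<bar> \<le> C2 * wts h x"
proof -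
  let ?M = "kern_mass (Suc 0) 0 + kern_mass 0 (Suc 0)"
  have M: "?M \<ge> 0" using kern_mass_nonneg by simp
  have vc: "continuous_on UNIV v" using v_lipschitz by (rule lipschitz_on_continuous_on)
  have near: "h * \<bar>m\<bar> \<le> C2 * wts h x" if b: "b \<in> A" "norm (x - b) < 4 * h" and m: "\<bar>m\<bar> \<le> K * (?M / h)" for b m
  proof -
    have "max h (norm (x - b)) \<le> 4 * h" using b h by simp
    then have "h / (4 * h) \<le> wt h b x" unfolding wt_def using h by (intro divide_left_mono) auto
    then have "1 / 4 \<le> wts h x" using wt_le_wts[OF h b(1), of x] h by simp
    have "h * \<bar>m\<bar> \<le> K * ?M" using mult_left_mono[OF m, of h] h by simp
    also have "\<dots> = 4 * (K * ?M) * (1 / 4)" by simp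
    also have "\<dots> \<le> 4 * (K * ?M) * wts h x"
      using \<open>1 / 4 \<le> wts h x\<close> M K_nonneg by (intro mult_left_mono) auto
    also have "\<dots> \<le> C2 * wts h x"
      unfolding C2_def using csum_nonneg dpos wts_nonneg[OF h] by (intro mult_right_mono) auto
    finally show ?thesis .
  qed
  have far: "h * \<bar>f1 x\<bar> \<le> C2 * wts h x" "h * \<bar>f2 x\<bar> \<le> C2 * wts h x"
    if fb: "\<And>b. b \<in> A \<Longrightarrow> norm (x - b) \<ge> 4 * h"
      and F: "C1_with F f1 f2" "\<And>x. F x = (LINT y|lborel. ddir (axis i 1) v (x - y) * kern 0 0 h y)" for F f1 f2 and i :: 2
  proof -
    note ig = moll_grad_eq(3)[OF h v_convex v_lipschitz, of "axis i 1"]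
    have "\<bar>F x' - F x\<bar> \<le> (2 * lipg x) * norm (x' - x)" for x'
    proof -
      have i: "integrable lborel (\<lambda>y. (ddir (axis i 1) v (x' - y) - ddir (axis i 1) v (x - y)) * kern 0 0 h y)"
        using ig[of x'] ig[of x] by (simp add: left_diff_distrib)
      have "F x' - F x = (LINT y|lborel. (ddir (axis i 1) v (x' - y) - ddir (axis i 1) v (x - y)) * kern 0 0 h y)"
        unfolding F(2) using ig[of x'] ig[of x] by (simp add: left_diff_distrib)
      moreover have "\<bar>ddir (axis i 1) v (x' - y) - ddir (axis i 1) v (x - y)\<bar> \<le> (2 * lipg x) * norm (x' - x)" if y: "norm y \<le> 2 * h" for y
      proof -
        have half: "norm (x - y - b) \<ge> norm (x - b) / 2" if "b \<in> A" for b
          using norm_triangle_ineq2[of "x - b" y] fb[OF that] y by (simp add: algebra_simps)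
        have nA: "x - y \<notin> A"
        proof
          assume "x - y \<in> A"
          then show False using half[of "x - y"] fb[of "x - y"] h by simp
        qed
        have xA: "norm (x - b) > 0" if "b \<in> A" for b using fb[OF that] h by linarith
        have "lipg (x - y) \<le> 2 * lipg x"
          unfolding lipg_def sum_distrib_left
        proof (rule sum_mono)
          fix b assume b: "b \<in> A"
          have "c b * (64 / \<delta>) / norm (x - y - b) \<le> c b * (64 / \<delta>) / (norm (x - b) / 2)"
            using half[OF b] xA[OF b] cpos[OF b] dpos by (intro divide_left_mono mult_pos_pos) auto
          then show "c b * (64 / \<delta>) / norm (x - y - b) \<le> 2 * (c b * (64 / \<delta>) / norm (x - b))" by simp
        qed
        moreover have "\<bar>ddir (axis i 1) v (x' - y) - ddir (axis i 1) v (x - y)\<bar> \<le> lipg (x - y) * norm (x' - x)"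
          using ddir_near[OF nA, of "axis i 1" "x' - y"] v_ddir[OF nA, of "axis i 1"] by (simp add: norm_axis_1)
        ultimately show ?thesis using mult_right_mono[of "lipg (x - y)" "2 * lipg x" "norm (x' - x)"] by simp
      qed
      ultimately show ?thesis using LINT_kern_bound[OF h i] kern_mass_0 by simp
    qed
    then have "\<bar>f1 x\<bar> \<le> 2 * lipg x" "\<bar>f2 x\<bar> \<le> 2 * lipg x"
      using C1_with_lipschitz_bound[OF F(1), of 1 x "2 * lipg x"] by simp_all
    then have "h * \<bar>f1 x\<bar> \<le> 2 * (h * lipg x)" "h * \<bar>f2 x\<bar> \<le> 2 * (h * lipg x)" using h by (simp_all add: mult_left_mono)
    moreover have "2 * (h * lipg x) \<le> (2 * (csum * (64 / \<delta>))) * wts h x"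
    proof -
      have "norm (x - b) \<ge> h" if "b \<in> A" for b using fb[OF that] h by linarith
      then show ?thesis using lipg_le_wts[OF h, of x] by simp
    qed
    moreover have "\<dots> \<le> C2 * wts h x"
      unfolding C2_def using M K_nonneg wts_nonneg[OF h] by (intro mult_right_mono) auto
    ultimately show "h * \<bar>f1 x\<bar> \<le> C2 * wts h x" "h * \<bar>f2 x\<bar> \<le> C2 * wts h x" by linarith+
  qed
  have le: "K * (kern_mass (Suc 0) 0 / h) \<le> K * (?M / h)" "K * (kern_mass 0 (Suc 0) / h) \<le> K * (?M / h)"
    using K_nonneg kern_mass_nonneg h by (auto intro!: mult_left_mono divide_right_mono)
  have b1: "\<bar>moll (Suc (Suc 0)) 0 h v x\<bar> \<le> K * (?M / h)" "\<bar>moll (Suc 0) (Suc 0) h v x\<bar> \<le> K * (?M / h)"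
    "\<bar>moll 0 (Suc (Suc 0)) h v x\<bar> \<le> K * (?M / h)"
    using moll_deriv_bound[OF h v_lipschitz, of "Suc 0" 0 x] moll_deriv_bound[OF h v_lipschitz, of 0 "Suc 0" x] le by auto
  note m1 = C1_moll[OF h vc, of "Suc 0" 0] and m2 = C1_moll[OF h vc, of 0 "Suc 0"]
  have "h * \<bar>moll (Suc (Suc 0)) 0 h v x\<bar> \<le> C2 * wts h x \<and> h * \<bar>moll (Suc 0) (Suc 0) h v x\<bar> \<le> C2 * wts h x \<and>
     h * \<bar>moll 0 (Suc (Suc 0)) h v x\<bar> \<le> C2 * wts h x"
  proof (cases "\<exists>b\<in>A. norm (x - b) < 4 * h")
    case True
    then show ?thesis using near b1 by blast
  next
    case False
    then have fb: "\<And>b. b \<in> A \<Longrightarrow> norm (x - b) \<ge> 4 * h" by force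
    show ?thesis
      using far[OF fb m1 moll_grad_eq(1)[OF h v_convex v_lipschitz]] far[OF fb m2 moll_grad_eq(2)[OF h v_convex v_lipschitz]] by blast
  qed
  then show "h * \<bar>moll (Suc (Suc 0)) 0 h v x\<bar> \<le> C2 * wts h x" "h * \<bar>moll (Suc 0) (Suc 0) h v x\<bar> \<le> C2 * wts h x"
    "h * \<bar>moll 0 (Suc (Suc 0)) h v x\<bar> \<le> C2 * wts h x" by blast+
qed

end

text \<open>Directions in which the atoms have distinct heights make the slabs disjoint in a bounded set.\<close>

lemma slabs_exist:
  fixes A \<Omega> :: "(real^2) set"
  assumes A: "finite A" and \<Omega>: "bounded \<Omega>"
  obtains e \<delta> where "norm e = 1" "0 < \<delta>" "\<delta> \<le> 1" "lens_sum.slabs A e \<delta> \<Omega>"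
proof -
  have "negligible ((\<Union>p\<in>{p\<in>A \<times> A. fst p \<noteq> snd p}. {x. (fst p - snd p) \<bullet> x = 0}) \<union> {0})"
  proof (intro negligible_Un negligible_Union)
    show "finite ((\<lambda>p. {x. (fst p - snd p) \<bullet> x = 0}) ` {p\<in>A \<times> A. fst p \<noteq> snd p})" using A by simp
    fix t assume "t \<in> (\<lambda>p. {x. (fst p - snd p) \<bullet> x = 0}) ` {p\<in>A \<times> A. fst p \<noteq> snd p}"
    then show "negligible t" by (auto intro!: negligible_hyperplane)
  qed simp
  moreover have "\<not> negligible (UNIV :: (real^2) set)" by simp
  ultimately obtain e0 where "e0 \<notin> (\<Union>p\<in>{p\<in>A \<times> A. fst p \<noteq> snd p}. {x. (fst p - snd p) \<bullet> x = 0}) \<union> {0}"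
    using negligible_subset by blast
  then have e0: "e0 \<noteq> 0" "\<And>b b'. b \<in> A \<Longrightarrow> b' \<in> A \<Longrightarrow> b \<noteq> b' \<Longrightarrow> (b - b') \<bullet> e0 \<noteq> 0"
    by fastforce+
  define e where "e = (1 / norm e0) *\<^sub>R e0"
  have e: "norm e = 1" "\<And>b b'. b \<in> A \<Longrightarrow> b' \<in> A \<Longrightarrow> b \<noteq> b' \<Longrightarrow> e \<bullet> (b - b') \<noteq> 0"
    using e0 by (auto simp: e_def inner_commute)
  \<comment> \<open>The 1 keeps the set nonempty when there are fewer than two atoms.\<close>
  define S where "S = insert 1 ((\<lambda>p. \<bar>e \<bullet> (fst p - snd p)\<bar>) ` {p\<in>A \<times> A. fst p \<noteq> snd p})"
  have S: "finite S" "S \<noteq> {}" "\<And>s. s \<in> S \<Longrightarrow> s > 0" using A e(2) by (auto simp: S_def)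
  define m where "m = Min S"
  have m: "m > 0" using S Min_in[OF S(1,2)] by (auto simp: m_def)
  have mle: "m \<le> \<bar>e \<bullet> (b - b')\<bar>" if "b \<in> A" "b' \<in> A" "b \<noteq> b'" for b b'
    unfolding m_def using that S(1) by (intro Min_le) (auto simp: S_def intro!: image_eqI[of _ _ "(b, b')"])
  have "bounded (\<Omega> \<union> A)" using \<Omega> A finite_imp_bounded by auto
  then obtain R where R: "R > 0" "\<And>x. x \<in> \<Omega> \<union> A \<Longrightarrow> norm x \<le> R" by (auto simp: bounded_pos)
  \<comment> \<open>With this choice the double cones have height at most m/4 within distance 2 R of
    their vertices, while the heights of distinct atoms differ by at least m.\<close>
  define \<delta> where "\<delta> = min 1 (m / (8 * R))"
  have \<delta>: "0 < \<delta>" "\<delta> \<le> 1" "\<delta> * (2 * R) \<le> m / 4"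
  proof -
    show "0 < \<delta>" "\<delta> \<le> 1" using m R by (auto simp: \<delta>_def)
    have "\<delta> * (2 * R) \<le> m / (8 * R) * (2 * R)" unfolding \<delta>_def using R by (intro mult_right_mono) auto
    then show "\<delta> * (2 * R) \<le> m / 4" using R by simp
  qed
  \<comment> \<open>\<open>slabs\<close> is determined by \<open>A\<close>, \<open>e\<close> and
    \<delta>, so weights 1 suffice to speak of it.\<close>
  interpret lens_sum A "\<lambda>_. 1" e \<delta>
    by unfold_locales (use A e \<delta> in auto)
  have fs: "\<bar>\<delta> * (f \<bullet> (x - b))\<bar> \<le> m / 4" if "x \<in> \<Omega>" "b \<in> A" for x b
  proof -
    have "\<bar>f \<bullet> (x - b)\<bar> \<le> norm (x - b)" using Cauchy_Schwarz_ineq2[of f "x - b"] by (simp add: norm_f)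
    also have "\<dots> \<le> 2 * R" using norm_triangle_ineq4[of x b] R(2)[of x] R(2)[of b] that by simp
    finally have "\<bar>f \<bullet> (x - b)\<bar> \<le> 2 * R" .
    then have "\<delta> * \<bar>f \<bullet> (x - b)\<bar> \<le> \<delta> * (2 * R)" by (rule mult_left_mono) (use \<delta>(1) in simp)
    moreover have "\<bar>\<delta> * (f \<bullet> (x - b))\<bar> = \<delta> * \<bar>f \<bullet> (x - b)\<bar>" using \<delta>(1) by (simp add: abs_mult)
    ultimately show ?thesis using \<delta>(3) by linarith
  qed
  have "slabs \<Omega>"
    unfolding slabs_def
  proof (intro ballI impI)
    fix x b b' assume x: "x \<in> \<Omega>" and b: "b \<in> A" "b' \<in> A" "b \<noteq> b'" and sl: "\<bar>e \<bullet> (x - b)\<bar> \<le> \<bar>\<delta> * (f \<bullet> (x - b))\<bar>"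
    have 1: "\<bar>e \<bullet> (x - b)\<bar> \<le> m / 4" using sl fs[OF x b(1)] by linarith
    have 2: "e \<bullet> (x - b') = e \<bullet> (x - b) + e \<bullet> (b - b')" by (simp add: inner_diff_right)
    have 3: "m \<le> \<bar>e \<bullet> (b - b')\<bar>" by (rule mle[OF b])
    have "\<bar>\<delta> * (f \<bullet> (x - b'))\<bar> < \<bar>e \<bullet> (x - b')\<bar>" using fs[OF x b(2)] 1 2 3 m by linarith
    moreover have "sgn (e \<bullet> (x - b')) = sgn (e \<bullet> (b - b'))"
    proof (cases "e \<bullet> (b - b') > 0")
      case True
      then have "e \<bullet> (x - b') > 0" using 1 2 3 m by linarith
      then show ?thesis using True by simp
    next
      case False
      then have "e \<bullet> (b - b') < 0" using 3 m by linarith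
      moreover from this have "e \<bullet> (x - b') < 0" using 1 2 3 m by linarith
      ultimately show ?thesis by simp
    qed
    ultimately show "\<bar>\<delta> * (f \<bullet> (x - b'))\<bar> < \<bar>e \<bullet> (x - b')\<bar> \<and> sgn (e \<bullet> (x - b')) = sgn (e \<bullet> (b - b'))" by blast
  qed
  with e(1) \<delta>(1,2) show thesis using that by blast
qed

section \<open>The recovery sequence\<close>

lemma weak_partial_AE:
  fixes f :: "real^2 \<Rightarrow> real"
  assumes "open \<Omega>" "has_weak_partial \<Omega> i f g"
  shows "has_weak_partial \<Omega> i f (weak_partial \<Omega> i f)"
    and "AE x in lebesgue_on \<Omega>. weak_partial \<Omega> i f x = g x"
proof -
  show w: "has_weak_partial \<Omega> i f (weak_partial \<Omega> i f)"
    unfolding weak_partial_def by (rule someI[of "has_weak_partial \<Omega> i f"]) (rule assms(2))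
  show "AE x in lebesgue_on \<Omega>. weak_partial \<Omega> i f x = g x"
    by (rule has_weak_partial_unique[OF assms(1) w assms(2)])
qed

lemma weak_partial2_AE:
  fixes f :: "real^2 \<Rightarrow> real"
  assumes \<Omega>: "open \<Omega>" and f: "has_weak_partial \<Omega> i f g" and g: "has_weak_partial \<Omega> j g k"
  shows "AE x in lebesgue_on \<Omega>. weak_partial \<Omega> j (weak_partial \<Omega> i f) x = k x"
proof (rule weak_partial_AE(2)[OF \<Omega>], rule has_weak_partial_cong_AE[OF \<Omega> _ _ g])
  show "loc_integrable \<Omega> (weak_partial \<Omega> i f)"
    using weak_partial_AE(1)[OF \<Omega> f] by (simp add: has_weak_partial_def)
  show "AE x in lebesgue_on \<Omega>. g x = weak_partial \<Omega> i f x"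
    using weak_partial_AE(2)[OF \<Omega> f] by (rule AE_mp) (intro AE_I2, simp)
qed

lemma L2_fun_continuous:
  fixes f :: "real^'n::finite \<Rightarrow> real"
  assumes \<Omega>: "open \<Omega>" "bounded \<Omega>" and f: "continuous_on UNIV f"
  shows "L2_fun \<Omega> f"
  unfolding L2_fun_def
proof
  have m: "f \<in> borel_measurable borel" using f by (rule borel_measurable_continuous_onI)
  have Om: "\<Omega> \<in> sets lebesgue" using \<Omega> by auto
  have fm: "f \<in> borel_measurable lebesgue" using m by (simp add: measurable_completion)
  then show fb: "f \<in> borel_measurable (lebesgue_on \<Omega>)" by (rule measurable_restrict_space1)
  have "compact (f ` closure \<Omega>)"
    using \<Omega>(2) by (intro compact_continuous_image continuous_on_subset[OF f]) auto
  then obtain M where M: "\<And>x. x \<in> closure \<Omega> \<Longrightarrow> \<bar>f x\<bar> \<le> M" using compact_imp_bounded by (force simp: bounded_iff)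
  have fin: "finite_measure (lebesgue_on \<Omega>)"
    by (rule finite_measureI)
      (use Om \<Omega>(1) emeasure_bounded_finite[OF \<Omega>(2)] in \<open>simp add: emeasure_restrict_space space_restrict_space less_top[symmetric]\<close>)
  show "integrable (lebesgue_on \<Omega>) (\<lambda>x. (f x)\<^sup>2)"
  proof (rule finite_measure.integrable_const_bound[OF fin, of _ "M\<^sup>2"])
    show "AE x in lebesgue_on \<Omega>. norm ((f x)\<^sup>2) \<le> M\<^sup>2"
    proof (rule AE_I2)
      fix x assume "x \<in> space (lebesgue_on \<Omega>)"
      then have "\<bar>f x\<bar> \<le> M" using M closure_subset[of \<Omega>] by auto
      then show "norm ((f x)\<^sup>2) \<le> M\<^sup>2" using power_mono[of "\<bar>f x\<bar>" M 2] by simp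
    qed
    show "(\<lambda>x. (f x)\<^sup>2) \<in> borel_measurable (lebesgue_on \<Omega>)" using fb by (rule borel_measurable_power)
  qed
qed

lemma norm_matrix2_sq:
  fixes M :: "real^2^2"
  shows "(norm M)\<^sup>2 = (M $ 1 $ 1)\<^sup>2 + (M $ 1 $ 2)\<^sup>2 + (M $ 2 $ 1)\<^sup>2 + (M $ 2 $ 2)\<^sup>2"
  by (simp add: norm_vec_def L2_set_def sum_2)

text \<open>Here s stands for the compatibility defect and d for the mollification error. The
  inequality (s + d)^2 \<le> 2 s^2 + 2 d^2 for four entries gives 8 T^2, and the four Hessian
  entries give 4 S^2.\<close>

lemma energy_density_bound:
  fixes T :: real
  assumes d: "\<bar>d11\<bar> \<le> T" "\<bar>d12\<bar> \<le> T" "\<bar>d22\<bar> \<le> T"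
    and H: "h * \<bar>H11\<bar> \<le> S" "h * \<bar>H12\<bar> \<le> S" "h * \<bar>H22\<bar> \<le> S" and h: "h > 0"
  shows "(s11 + d11)\<^sup>2 + (s12 + d12)\<^sup>2 + (s12 + d12)\<^sup>2 + (s22 + d22)\<^sup>2 + h\<^sup>2 * (H11\<^sup>2 + H12\<^sup>2 + H12\<^sup>2 + H22\<^sup>2)
    \<le> 2 * (s11\<^sup>2 + 2 * s12\<^sup>2 + s22\<^sup>2) + 8 * T\<^sup>2 + 4 * S\<^sup>2"
proof -
  have sq: "(s + d)\<^sup>2 \<le> 2 * s\<^sup>2 + 2 * T\<^sup>2" if "\<bar>d\<bar> \<le> T" for s d
  proof -
    have "0 \<le> (s - d)\<^sup>2" by simp
    then have "(s + d)\<^sup>2 \<le> 2 * s\<^sup>2 + 2 * d\<^sup>2" unfolding power2_sum power2_diff by simp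
    then show ?thesis using power_mono[OF that, of 2] by simp
  qed
  have hs: "h\<^sup>2 * x\<^sup>2 \<le> S\<^sup>2" if "h * \<bar>x\<bar> \<le> S" for x
    using power_mono[OF that, of 2] h by (simp add: power_mult_distrib)
  show ?thesis
    using sq[OF d(1), of s11] sq[OF d(2), of s12] sq[OF d(3), of s22] hs[OF H(1)] hs[OF H(2)] hs[OF H(3)]
    unfolding distrib_left by linarith
qed

lemma product_difference_bound:
  fixes K :: real
  assumes "\<bar>p\<bar> \<le> K" "\<bar>q'\<bar> \<le> K" "\<bar>p - p'\<bar> \<le> D" "\<bar>q - q'\<bar> \<le> D"
  shows "\<bar>p * q - p' * q'\<bar> \<le> 2 * K * D"
proof -
  have "p * q - p' * q' = p * (q - q') + q' * (p - p')" by (simp add: algebra_simps)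
  also have "\<bar>\<dots>\<bar> \<le> \<bar>p\<bar> * \<bar>q - q'\<bar> + \<bar>q'\<bar> * \<bar>p - p'\<bar>"
    using abs_triangle_ineq[of "p * (q - q')" "q' * (p - p')"] by (simp add: abs_mult)
  also have "\<dots> \<le> K * D + K * D" using assms by (intro add_mono mult_mono) auto
  finally show ?thesis by (simp add: mult_ac)
qed

lemma continuous_on_wt: "h > 0 \<Longrightarrow> continuous_on UNIV (wt h b)"
  unfolding wt_def by (intro continuous_intros) (auto simp: max_def)

context lens_sum
begin

text \<open>The displacement comes from \<open>compatible_strain\<close>, and \<open>V\<close> is
  \<open>v\<close> mollified at scale h. The constants belong to the cones; \<open>K'\<close> enters
  only through the application of the compatibility lemma.\<close>

lemma energy_bound:
  assumes \<Omega>: "convex \<Omega>" "open \<Omega>" "bounded \<Omega>" "\<Omega> \<noteq> {}" and A: "A \<subseteq> \<Omega>"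
    and \<sigma>: "\<And>b. b \<in> A \<Longrightarrow> \<sigma> b \<ge> 0" and vMA: "point_MA \<Omega> A \<sigma> v"
    and w: "convex_on UNIV w" "K'-lipschitz_on UNIV w" "point_MA \<Omega> A \<sigma> w"
    and v0: "\<And>x. x \<in> \<Omega> \<Longrightarrow> w x = v0 x"
    and h: "h > 0" and I: "0 \<le> I"
      "\<And>b. b \<in> A \<Longrightarrow> (\<integral>\<^sup>+x. ennreal (indicator \<Omega> x * (wt h b x)\<^sup>2) \<partial>lborel) \<le> ennreal I"
  shows "\<exists>u V. (\<forall>i. sobolev2 1 \<Omega> (\<lambda>x. (u x :: real^2) $ i)) \<and> sobolev2 2 \<Omega> V \<and>
     energy \<Omega> v0 h u V \<le> ennreal (2 * h\<^sup>2 + (8 * (2 * K * C1)\<^sup>2 + 4 * C2\<^sup>2) * (real (card A))\<^sup>2 * I)"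
proof -
  \<comment> \<open>Compatibility is stated with one Lipschitz constant for both functions.\<close>
  let ?K = "max K K'"
  have vL: "?K-lipschitz_on UNIV v" using v_lipschitz by (rule lipschitz_on_le) simp
  have wL: "?K-lipschitz_on UNIV w" using w(2) by (rule lipschitz_on_le) simp
  have "h\<^sup>2 > 0" using h by simp
  from compatible_strain[OF \<Omega> finA A \<sigma> w(1) wL w(3) v_convex vL vMA this]
  obtain u1 u2 a11 a12 a21 a22 where
    uc: "continuous_on UNIV u1" "continuous_on UNIV u2" "continuous_on UNIV a11" "continuous_on UNIV a12"
      "continuous_on UNIV a21" "continuous_on UNIV a22"
    and pd: "has_pd 1 u1 a11" "has_pd 2 u1 a12" "has_pd 1 u2 a21" "has_pd 2 u2 a22"
    and int: "(\<integral>\<^sup>+x. ennreal (indicator \<Omega> x * ((2 * a11 x - strain_defect w v 1 1 x)\<^sup>2 + 2 * (a12 x + a21 x - strain_defect w v 1 2 x)\<^sup>2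
        + (2 * a22 x - strain_defect w v 2 2 x)\<^sup>2)) \<partial>lborel) \<le> ennreal (h\<^sup>2)"
    by blast
  define F where "F x = (2 * a11 x - strain_defect w v 1 1 x)\<^sup>2 + 2 * (a12 x + a21 x - strain_defect w v 1 2 x)\<^sup>2
        + (2 * a22 x - strain_defect w v 2 2 x)\<^sup>2" for x
  define u where "u x = (vector [u1 x, u2 x] :: real^2)" for x
  define V where "V = moll 0 0 h v"
  let ?V1 = "moll (Suc 0) 0 h v" let ?V2 = "moll 0 (Suc 0) h v"
  let ?V11 = "moll (Suc (Suc 0)) 0 h v" let ?V12 = "moll (Suc 0) (Suc 0) h v" let ?V22 = "moll 0 (Suc (Suc 0)) h v"
  have u: "(\<lambda>x. u x $ 1) = u1" "(\<lambda>x. u x $ 2) = u2" by (auto simp: u_def)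
  have vc: "continuous_on UNIV v" using v_lipschitz by (rule lipschitz_on_continuous_on)
  note m = C1_moll[OF h vc]
  have mc: "continuous_on UNIV (moll i j h v)" for i j using m by (rule C1_with_continuous)
  note L2 = L2_fun_continuous[OF \<Omega>(2,3)]
  note hw = has_pd_weak[OF \<Omega>(2)]
  have uw: "has_weak_partial \<Omega> 1 u1 a11" "has_weak_partial \<Omega> 2 u1 a12" "has_weak_partial \<Omega> 1 u2 a21" "has_weak_partial \<Omega> 2 u2 a22"
    using uc pd by (auto intro: hw)
  have mw: "has_weak_partial \<Omega> 1 (moll i j h v) (moll (Suc i) j h v)" "has_weak_partial \<Omega> 2 (moll i j h v) (moll i (Suc j) h v)" for i j
    using mc C1_with_pd[OF m[of i j]] by (auto intro: hw)
  have "\<forall>i. sobolev2 (Suc 0) \<Omega> (\<lambda>x. u x $ i)"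
    unfolding forall_2 u sobolev2.simps using uw uc L2 by blast
  then have S1: "\<forall>i. sobolev2 1 \<Omega> (\<lambda>x. u x $ i)" by simp
  have "sobolev2 (Suc 0) \<Omega> (moll i j h v)" for i j
    unfolding forall_2 sobolev2.simps using mw[of i j] mc L2 by blast
  then have "sobolev2 (Suc (Suc 0)) \<Omega> V"
    unfolding sobolev2.simps(2)[of "Suc 0"] forall_2 V_def using mw[of 0 0] mc L2 by blast
  then have S2: "sobolev2 2 \<Omega> V" by (simp add: numeral_2_eq_2)
  have v0w: "has_weak_partial \<Omega> i v0 (ddir (axis i 1) w)" for i
    by (rule has_weak_partial_cong[OF \<Omega>(2) v0 convex_has_weak_partial(1)[OF w(1,2) \<Omega>(2)]])
  define c3 where "c3 = 8 * (2 * K * C1)\<^sup>2 + 4 * C2\<^sup>2"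
  have c3: "c3 \<ge> 0" by (simp add: c3_def)
  define n where "n = real (card A)"
  \<comment> \<open>A Borel majorant of the energy density, so that the integral passes to
    \<open>lborel\<close> and splits into its terms.\<close>
  define G where "G x = 2 * ennreal (indicator \<Omega> x * F x) + ennreal (c3 * n) * (\<Sum>b\<in>A. ennreal (indicator \<Omega> x * (wt h b x)\<^sup>2))" for x
  \<comment> \<open>Cauchy-Schwarz supplies one factor n; summing the n weight integrals supplies
    the second.\<close>
  have W2: "(wts h x)\<^sup>2 \<le> n * (\<Sum>b\<in>A. (wt h b x)\<^sup>2)" for x
    unfolding wts_def n_def using sum_squared_le_sum_of_squares[of "\<lambda>b. wt h b x" A] finA by (simp add: mult.commute)
  have "AE x in lebesgue. x \<notin> A" using finA by (intro AE_not_in) (simp add: negligible_finite negligible_iff_null_sets[symmetric])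
  then have nA: "AE x in lebesgue_on \<Omega>. x \<notin> A"
    using \<Omega>(2) by (subst AE_restrict_space_iff) auto
  have inO: "AE x in lebesgue_on \<Omega>. x \<in> \<Omega>" by (rule AE_I2) simp
  have bound: "AE x in lebesgue_on \<Omega>. ennreal (
        (norm (weak_jacobian \<Omega> u x + transpose (weak_jacobian \<Omega> u x)
               + tensor (weak_grad \<Omega> V x) (weak_grad \<Omega> V x)
               - tensor (weak_grad \<Omega> v0 x) (weak_grad \<Omega> v0 x)))\<^sup>2
        + h\<^sup>2 * (norm (weak_hessian \<Omega> V x))\<^sup>2) \<le> G x"
    using nA inO uw[THEN weak_partial_AE(2)[OF \<Omega>(2)]] mw[of 0 0, THEN weak_partial_AE(2)[OF \<Omega>(2)]]
      v0w[of 1, THEN weak_partial_AE(2)[OF \<Omega>(2)]] v0w[of 2, THEN weak_partial_AE(2)[OF \<Omega>(2)]]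
      weak_partial2_AE[OF \<Omega>(2) mw(1)[of 0 0] mw(1)] weak_partial2_AE[OF \<Omega>(2) mw(1)[of 0 0] mw(2)]
      weak_partial2_AE[OF \<Omega>(2) mw(2)[of 0 0] mw(1)] weak_partial2_AE[OF \<Omega>(2) mw(2)[of 0 0] mw(2)]
  proof eventually_elim
    case (elim x)
    note e = elim
    let ?v1 = "ddir (axis 1 1) v x" let ?v2 = "ddir (axis 2 1) v x"
    let ?w1 = "ddir (axis 1 1) w x" let ?w2 = "ddir (axis 2 1) w x"
    have vi: "ddir (axis i 1) v x = g x $ i" for i using v_ddir[OF e(1)] by (simp add: inner_axis)
    have vb: "\<bar>g x $ i\<bar> \<le> K" for i using component_le_norm_cart[of "g x" i] g_bound[of x] by linarith
    have Vb: "\<bar>?V1 x\<bar> \<le> K" "\<bar>?V2 x\<bar> \<le> K"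
      using moll_deriv_bound[OF h v_lipschitz, of 0 0 x] by (simp_all add: kern_mass_0)
    note cl = moll_grad_close[OF h e(1)]
    let ?T = "2 * K * (C1 * wts h x)"
    have d: "\<bar>?V1 x * ?V1 x - ?v1 * ?v1\<bar> \<le> ?T" "\<bar>?V1 x * ?V2 x - ?v1 * ?v2\<bar> \<le> ?T" "\<bar>?V2 x * ?V2 x - ?v2 * ?v2\<bar> \<le> ?T"
      unfolding vi using product_difference_bound vb Vb cl by blast+
    have J: "weak_jacobian \<Omega> u x $ 1 $ 1 = a11 x" "weak_jacobian \<Omega> u x $ 1 $ 2 = a12 x"
      "weak_jacobian \<Omega> u x $ 2 $ 1 = a21 x" "weak_jacobian \<Omega> u x $ 2 $ 2 = a22 x"
      using e by (simp_all add: weak_jacobian_def u)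
    have gV: "weak_grad \<Omega> V x $ 1 = ?V1 x" "weak_grad \<Omega> V x $ 2 = ?V2 x"
      and gv: "weak_grad \<Omega> v0 x $ 1 = ?w1" "weak_grad \<Omega> v0 x $ 2 = ?w2"
      using e by (simp_all add: weak_grad_def V_def)
    have H: "weak_hessian \<Omega> V x $ 1 $ 1 = ?V11 x" "weak_hessian \<Omega> V x $ 1 $ 2 = ?V12 x"
      "weak_hessian \<Omega> V x $ 2 $ 1 = ?V12 x" "weak_hessian \<Omega> V x $ 2 $ 2 = ?V22 x"
      using e by (simp_all add: weak_hessian_def V_def)
    let ?s11 = "2 * a11 x - strain_defect w v 1 1 x" let ?s12 = "a12 x + a21 x - strain_defect w v 1 2 x"
    let ?s22 = "2 * a22 x - strain_defect w v 2 2 x"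
    let ?E = "weak_jacobian \<Omega> u x + transpose (weak_jacobian \<Omega> u x)
               + tensor (weak_grad \<Omega> V x) (weak_grad \<Omega> V x) - tensor (weak_grad \<Omega> v0 x) (weak_grad \<Omega> v0 x)"
    \<comment> \<open>The tensor of the gradient of \<open>v\<close> is added and subtracted: the
      first summand is controlled in L2 by compatibility, the second pointwise by the
      weights.\<close>
    have E: "?E $ 1 $ 1 = ?s11 + (?V1 x * ?V1 x - ?v1 * ?v1)" "?E $ 1 $ 2 = ?s12 + (?V1 x * ?V2 x - ?v1 * ?v2)"
      "?E $ 2 $ 1 = ?s12 + (?V1 x * ?V2 x - ?v1 * ?v2)" "?E $ 2 $ 2 = ?s22 + (?V2 x * ?V2 x - ?v2 * ?v2)"
      by (simp_all add: transpose_def tensor_def J gV gv strain_defect_def)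
    have "(norm ?E)\<^sup>2 + h\<^sup>2 * (norm (weak_hessian \<Omega> V x))\<^sup>2 \<le> 2 * F x + 8 * ?T\<^sup>2 + 4 * (C2 * wts h x)\<^sup>2"
      unfolding norm_matrix2_sq E H F_def
      by (rule energy_density_bound[OF d moll_hess_bound[OF h] h])
    also have "8 * ?T\<^sup>2 + 4 * (C2 * wts h x)\<^sup>2 = c3 * (wts h x)\<^sup>2"
      by (simp add: c3_def power_mult_distrib algebra_simps)
    then have "2 * F x + 8 * ?T\<^sup>2 + 4 * (C2 * wts h x)\<^sup>2 = 2 * F x + c3 * (wts h x)\<^sup>2" by simp
    also have "\<dots> \<le> 2 * F x + c3 * (n * (\<Sum>b\<in>A. (wt h b x)\<^sup>2))"
      using W2 c3 by (intro add_left_mono mult_left_mono)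
    finally have le: "(norm ?E)\<^sup>2 + h\<^sup>2 * (norm (weak_hessian \<Omega> V x))\<^sup>2 \<le> 2 * F x + (c3 * n) * (\<Sum>b\<in>A. (wt h b x)\<^sup>2)"
      by (simp only: mult.assoc)
    have F0: "F x \<ge> 0" by (simp add: F_def)
    have "G x = ennreal (2 * F x + (c3 * n) * (\<Sum>b\<in>A. (wt h b x)\<^sup>2))"
      unfolding G_def using e(2) F0 c3
      by (simp add: sum_nonneg n_def ennreal_mult ennreal_plus)
    with ennreal_leI[OF le] show ?case by simp
  qed
  have Om: "\<Omega> \<in> sets borel" using \<Omega>(2) by simp
  have sdm: "strain_defect w v i j \<in> borel_measurable borel" for i j
    unfolding strain_defect_def[abs_def]
    using ddir_borel_measurable[OF w(1,2)] ddir_borel_measurable[OF v_convex v_lipschitz]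
    by (intro borel_measurable_diff borel_measurable_times)
  have am: "a11 \<in> borel_measurable borel" "a12 \<in> borel_measurable borel" "a21 \<in> borel_measurable borel" "a22 \<in> borel_measurable borel"
    using uc by (auto intro: borel_measurable_continuous_onI)
  have Fm: "F \<in> borel_measurable borel"
    unfolding F_def[abs_def] using sdm am
    by (intro borel_measurable_add borel_measurable_power borel_measurable_times borel_measurable_diff borel_measurable_const)
  have Fm': "(\<lambda>x. ennreal (indicator \<Omega> x * F x)) \<in> borel_measurable lborel"
    using Fm Om by simp
  have wm: "(\<lambda>x. ennreal (indicator \<Omega> x * (wt h b x)\<^sup>2)) \<in> borel_measurable lborel" for b
    using borel_measurable_continuous_onI[OF continuous_on_wt[OF h, of b]] Om by simp
  have "energy \<Omega> v0 h u V \<le> (\<integral>\<^sup>+x. G x \<partial>lebesgue_on \<Omega>)"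
    unfolding energy_def by (rule nn_integral_mono_AE[OF bound])
  also have "\<dots> = (\<integral>\<^sup>+x. G x * indicator \<Omega> x \<partial>lebesgue)"
    using Om by (subst nn_integral_restrict_space) auto
  also have "\<dots> \<le> (\<integral>\<^sup>+x. G x \<partial>lebesgue)"
    by (rule nn_integral_mono) (auto simp: indicator_def)
  also have "\<dots> = (\<integral>\<^sup>+x. G x \<partial>lborel)" by (rule nn_integral_completion)
  also have "\<dots> = 2 * (\<integral>\<^sup>+x. ennreal (indicator \<Omega> x * F x) \<partial>lborel)
      + ennreal (c3 * n) * (\<Sum>b\<in>A. \<integral>\<^sup>+x. ennreal (indicator \<Omega> x * (wt h b x)\<^sup>2) \<partial>lborel)"
    unfolding G_def using Fm' wm
    by (subst nn_integral_add nn_integral_cmult nn_integral_sum | intro borel_measurable_times_ennreal borel_measurable_sum borel_measurable_const | simp only:)+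
  also have "\<dots> \<le> 2 * ennreal (h\<^sup>2) + ennreal (c3 * n) * (\<Sum>b\<in>A. ennreal I)"
    using int I(2) unfolding F_def by (intro add_mono mult_left_mono sum_mono) auto
  also have "\<dots> = ennreal (2 * h\<^sup>2 + c3 * n\<^sup>2 * I)"
  proof -
    have "(\<Sum>b\<in>A. ennreal I) = ennreal (n * I)" using I(1) by (simp add: n_def ennreal_mult ennreal_of_nat_eq_real_of_nat)
    moreover have "2 * ennreal (h\<^sup>2) = ennreal (2 * h\<^sup>2)" by (simp add: ennreal_mult)
    moreover have "ennreal (c3 * n) * ennreal (n * I) = ennreal (c3 * n\<^sup>2 * I)"
      using c3 I(1) by (subst ennreal_mult[symmetric]) (auto simp: n_def power2_eq_square mult_ac)
    ultimately show ?thesis using c3 I(1) by (simp only:) (rule ennreal_plus[symmetric], auto)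
  qed
  finally show ?thesis using S1 S2 unfolding c3_def n_def by blast
qed

end


theorem mainTheorem5:
  fixes \<Omega> :: "(real^2) set" and N :: nat and a :: "nat \<Rightarrow> real^2" and \<sigma> :: "nat \<Rightarrow> real"
  assumes "convex \<Omega>" and "open \<Omega>" and "bounded \<Omega>" and "C11_boundary \<Omega>"
    and "\<And>i. i \<in> {1..N} \<Longrightarrow> a i \<in> \<Omega>" and "inj_on a {1..N}"
    and "\<And>i. i \<in> {1..N} \<Longrightarrow> \<sigma> i > 0"
  shows "\<exists>C > 0. \<exists>h0 > 0. \<forall>v0. MA_solution \<Omega> (sum_dirac N a \<sigma>) v0 \<longrightarrow>
           (\<forall>h. 0 < h \<and> h < h0 \<longrightarrow>
             (\<exists>(u :: real^2 \<Rightarrow> real^2) (v :: real^2 \<Rightarrow> real).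
                (\<forall>i. sobolev2 1 \<Omega> (\<lambda>x. u x $ i)) \<and> sobolev2 2 \<Omega> v \<and>
                energy \<Omega> v0 h u v \<le> ennreal (C * h\<^sup>2 * ln (1 / h))))"
proof (cases "\<Omega> = {}")
  \<comment> \<open>Extending \<open>v0\<close> requires a point of the domain; over the empty set
    the energy is 0.\<close>
  case True
  have z: "has_weak_partial {} i (\<lambda>x. 0) (\<lambda>x. 0)" for i :: 2
    by (simp add: has_weak_partial_def loc_integrable_def)
  have L: "L2_fun {} (\<lambda>x :: real^2. 0)" by (simp add: L2_fun_def)
  have s1: "sobolev2 (Suc 0) {} (\<lambda>x :: real^2. 0)" using z L by auto
  then have "sobolev2 (Suc (Suc 0)) {} (\<lambda>x :: real^2. 0)" using z L by auto
  then have s2: "sobolev2 2 {} (\<lambda>x :: real^2. 0)" by (simp add: numeral_2_eq_2)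
  have "energy \<Omega> v0 h (\<lambda>x. 0) (\<lambda>x. 0) = 0" for v0 h
    unfolding energy_def True by (rule nn_integral_empty) (simp add: space_restrict_space)
  then show ?thesis
    using s1 s2 unfolding True by (intro exI[of _ 1] conjI exI[of _ "\<lambda>x. 0"] allI impI) simp_all
next
  case False
  define A where "A = a ` {1..N}"
  have A: "finite A" "A \<subseteq> \<Omega>" using assms(5) by (auto simp: A_def)
  define m where "m = atom_mass N a \<sigma>"
  have m: "m b > 0" if bA: "b \<in> A" for b
  proof -
    obtain i where i: "i \<in> {1..N}" "a i = b" using bA unfolding A_def by blast
    have "\<sigma> i = (if a i = b then \<sigma> i else 0)" using i by simp
    also have "\<dots> \<le> m b" unfolding m_def atom_mass_def
      using assms(7) i by (intro member_le_sum[of i "{1..N}" "\<lambda>i. if a i = b then \<sigma> i else 0"]) (auto intro: less_imp_le)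
    finally show ?thesis using assms(7)[OF i(1)] by linarith
  qed
  \<comment> \<open>Direction and thinness come from the domain and the atoms and are fixed before
    \<open>v0\<close>; the same holds for all constants built from them.\<close>
  obtain e \<delta> where e: "norm e = 1" "0 < \<delta>" "\<delta> \<le> 1" and sl: "lens_sum.slabs A e \<delta> \<Omega>"
    using slabs_exist[OF A(1) assms(3)] by blast
  define M where "M = \<delta> * measure lebesgue lens"
  have M: "M > 0" using e lens_measure_pos by (simp add: M_def)
  \<comment> \<open>On \<open>A\<close> chosen so that c^2 \<delta> |lens| is the prescribed
    mass.\<close>
  define c where "c b = (if b \<in> A then sqrt (m b / M) else 1)" for b
  interpret lens_sum A c e \<delta>
    by unfold_locales (use A(1) e m M in \<open>auto simp: c_def\<close>)
  have "(c b)\<^sup>2 * \<delta> * measure lebesgue lens = m b" if "b \<in> A" for b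
  proof -
    have "(c b)\<^sup>2 = m b / M" using that m[OF that] M by (simp add: c_def)
    then have "(c b)\<^sup>2 * M = m b" using M by simp
    then show ?thesis by (simp add: M_def mult.assoc)
  qed
  with sl have vMA: "point_MA \<Omega> A m v" by (intro v_point_MA[OF _ assms(2) A(2)])
  obtain R where R: "R > 0" "\<And>x. x \<in> \<Omega> \<Longrightarrow> norm x \<le> R" using assms(3) by (auto simp: bounded_pos)
  have ball: "\<Omega> \<subseteq> cball b (2 * R)" if "b \<in> A" for b
  proof
    fix x assume "x \<in> \<Omega>"
    then show "x \<in> cball b (2 * R)"
      using norm_triangle_ineq4[of b x] R(2)[of x] R(2)[of b] that A(2) by (auto simp: dist_norm)
  qed
  have "2 * R > 0" using R by simp
  then obtain Cw where Cw: "Cw > 0" "\<And>h b. 0 < h \<Longrightarrow> h < 1 / 2 \<Longrightarrow>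
    (\<integral>\<^sup>+x. ennreal (indicator (cball b (2 * R)) x * (wt h b x)\<^sup>2) \<partial>lborel) \<le> ennreal (Cw * h\<^sup>2 * ln (1 / h))"
    by (rule wt_integral) blast
  \<comment> \<open>The summand 2 / ln 2 absorbs the compatibility tolerance 2 h^2, since ln (1/h)
    \<ge> ln 2 for h < 1/2.\<close>
  define C where "C = 2 / ln 2 + (8 * (2 * K * C1)\<^sup>2 + 4 * C2\<^sup>2) * (real (card A))\<^sup>2 * Cw"
  have "C > 0" unfolding C_def using Cw(1) by (intro add_pos_nonneg) auto
  moreover have "\<exists>u V. (\<forall>i. sobolev2 1 \<Omega> (\<lambda>x. (u x :: real^2) $ i)) \<and> sobolev2 2 \<Omega> V \<and>
      energy \<Omega> v0 h u V \<le> ennreal (C * h\<^sup>2 * ln (1 / h))"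
    if sol: "MA_solution \<Omega> (sum_dirac N a \<sigma>) v0" and h: "0 < h" "h < 1 / 2" for v0 h
  proof -
    obtain w K' where w: "convex_on UNIV w" "K'-lipschitz_on UNIV w" "\<And>x. x \<in> \<Omega> \<Longrightarrow> w x = v0 x" "point_MA \<Omega> A m w"
      using MA_solution_extension[OF assms(1-3) False assms(5,7) sol] unfolding A_def m_def by blast
    have "2 \<le> 1 / h" using h by (simp add: field_simps)
    then have l: "ln 2 \<le> ln (1 / h)" using h by (subst ln_le_cancel_iff) auto
    have l2: "ln (2::real) > 0" by simp
    have l0: "0 \<le> ln (1 / h)" using l l2 by linarith
    define I where "I = Cw * h\<^sup>2 * ln (1 / h)"
    have I: "0 \<le> I" unfolding I_def using Cw(1) l0 by simp
    have Ib: "(\<integral>\<^sup>+x. ennreal (indicator \<Omega> x * (wt h b x)\<^sup>2) \<partial>lborel) \<le> ennreal I" if "b \<in> A" for b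
    proof -
      have "(\<integral>\<^sup>+x. ennreal (indicator \<Omega> x * (wt h b x)\<^sup>2) \<partial>lborel)
        \<le> (\<integral>\<^sup>+x. ennreal (indicator (cball b (2 * R)) x * (wt h b x)\<^sup>2) \<partial>lborel)"
        using ball[OF that] by (intro nn_integral_mono ennreal_leI mult_right_mono) (auto simp: indicator_def)
      also have "\<dots> \<le> ennreal I" unfolding I_def by (rule Cw(2)[OF h])
      finally show ?thesis .
    qed
    have "1 \<le> ln (1 / h) / ln 2" using l l2 by (simp add: pos_le_divide_eq)
    then have "2 * h\<^sup>2 * 1 \<le> 2 * h\<^sup>2 * (ln (1 / h) / ln 2)" by (intro mult_left_mono) auto
    then have le: "2 * h\<^sup>2 + (8 * (2 * K * C1)\<^sup>2 + 4 * C2\<^sup>2) * (real (card A))\<^sup>2 * I \<le> C * h\<^sup>2 * ln (1 / h)"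
      unfolding C_def I_def by (simp add: algebra_simps)
    have m0: "m b \<ge> 0" if "b \<in> A" for b using m[OF that] by simp
    show ?thesis
      using energy_bound[OF assms(1-3) False A(2) m0 vMA w(1,2,4,3) h(1) I Ib] order_trans[OF _ ennreal_leI[OF le]] by blast
  qed
  ultimately show ?thesis by (intro exI[of _ C] conjI exI[of _ "1 / 2"]) auto
qed

end
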